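(* Let $\mathfrak g$ be a semisimple Lie algebra (over $\mathbb R$ or $\mathbb C$) with $n=\dim\mathfrak g<\infty$, and let $\mathfrak g_0\subset\mathfrak g$ be a Cartan subalgebra. Let $G$ be the smallest connected Lie group with Lie algebra $\mathfrak g$, let $H\subset G$ be the connected Lie subgroup with Lie algebra $\mathfrak g_0$, and let $\Gamma$ be the classical phase-space of $\mathfrak g$. Then $\Gamma\simeq G/H$, and $\Gamma$ is symplectic, i.e. the homogeneous manifold $G/H$ admits a symplectic form.
   Context: "Smallest connected Lie group with Lie algebra $\mathfrak g$" means the one that is a quotient of every other connected Lie group with Lie algebra $\mathfrak g$; for semisimple $\mathfrak g$ it is the adjoint group, i.e. the quotient of the simply connected group by its center. For instance, for $\mathfrak g=\mathfrak{su}_2$ one has $G=SO_3$, $H=SO_2$ and $\Gamma\simeq S^2$. The classical phase-space $\Gamma$ of $\mathfrak g$: write the root decomposition $\mathfrak g=\mathfrak g_0+\sum_{\alpha>0}(\mathfrak g_\alpha+\mathfrak g_{-\alpha})$ with root vectors $E_{\pm\alpha}$ and a basis $H_j$ of $\mathfrak g_0$, and consider the family of operators $$\Pi(u,v)=\exp\Big(i\sum_{\alpha>0}u^\alpha E_{\alpha}-i\sum_{\alpha>0}v^\alpha E_{-\alpha}+i\sum_j\lambda^j(u,v)H_j\Big),$$ in which the coefficients $\lambda^j$ of the Cartan elements are not independent parameters but functions of $(u,v)$. $\Gamma$ is the manifold, of dimension $\dim\mathfrak g-\dim\mathfrak g_0$, whose points are labelled locally by the parameters $(u,v)$. The group $G$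 acts transitively on $\Gamma$, the isotropy group being the connected subgroup $H$ generated by the Cartan directions; as a homogeneous space, $\Gamma$ is thereby determined by the pair $(G,H)$. *)

theory Defs
  imports
    "HOL-Analysis.Analysis"
    "HOL-Algebra.Group_Action"
    "HOL-Algebra.Generated_Groups"
begin

section \<open>The ground field\<close>

text \<open>The axioms make the type a subfield of the complex numbers that contains the reals, so up to
  isomorphism it is the field of real or the field of complex numbers.  The embedding
  \<open>to_complex\<close> serves to extend scalars to the complex numbers, where roots live; over the
  complex numbers nothing is extended.\<close>

class real_or_complex = real_normed_field + euclidean_space +
  fixes to_complex :: "'a \<Rightarrow> complex"
  assumes to_complex_add: "to_complex (x + y) = to_complex x + to_complex y"
    and to_complex_mult: "to_complex (x * y) = to_complex x * to_complex y"
    and to_complex_scaleR: "to_complex (r *\<^sub>R x) = r *\<^sub>R to_complex x"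
    and norm_to_complex: "norm (to_complex x) = norm x"

instantiation real :: real_or_complex
begin
definition to_complex_real :: "real \<Rightarrow> complex" where "to_complex_real = complex_of_real"
instance by standard (simp_all add: to_complex_real_def scaleR_conv_of_real)
end

instantiation complex :: real_or_complex
begin
definition to_complex_complex :: "complex \<Rightarrow> complex" where "to_complex_complex = (\<lambda>z. z)"
instance by standard (simp_all add: to_complex_complex_def)
end

section \<open>Lie algebras\<close>

text \<open>A Lie algebra of dimension \<open>n\<close> over \<open>K\<close> is a bracket on \<open>K\<^sup>n\<close>, \<open>n = CARD('n)\<close>.\<close>

type_synonym ('k, 'n) bracket = "'k ^ 'n \<Rightarrow> 'k ^ 'n \<Rightarrow> 'k ^ 'n"

definition lie_algebra :: "('k::field, 'n::finite) bracket \<Rightarrow> bool" where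
  "lie_algebra br \<longleftrightarrow>
     (\<forall>x. Vector_Spaces.linear (*s) (*s) (br x)) \<and>
     (\<forall>y. Vector_Spaces.linear (*s) (*s) (\<lambda>x. br x y)) \<and>
     (\<forall>x. br x x = 0) \<and>
     (\<forall>x y z. br x (br y z) + br y (br z x) + br z (br x y) = 0)"

definition bracket_span ::
    "('k::field, 'n::finite) bracket \<Rightarrow> ('k ^ 'n) set \<Rightarrow> ('k ^ 'n) set \<Rightarrow> ('k ^ 'n) set" where
  "bracket_span br S T = vec.span {br x y | x y. x \<in> S \<and> y \<in> T}"

definition lie_subalgebra :: "('k::field, 'n::finite) bracket \<Rightarrow> ('k ^ 'n) set \<Rightarrow> bool" where
  "lie_subalgebra br S \<longleftrightarrow> vec.subspace S \<and> (\<forall>x\<in>S. \<forall>y\<in>S. br x y \<in> S)"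

definition lie_ideal :: "('k::field, 'n::finite) bracket \<Rightarrow> ('k ^ 'n) set \<Rightarrow> bool" where
  "lie_ideal br I \<longleftrightarrow> vec.subspace I \<and> (\<forall>x. \<forall>y\<in>I. br x y \<in> I)"

primrec derived_series ::
    "('k::field, 'n::finite) bracket \<Rightarrow> ('k ^ 'n) set \<Rightarrow> nat \<Rightarrow> ('k ^ 'n) set" where
  "derived_series br S 0 = S"
| "derived_series br S (Suc j) = bracket_span br (derived_series br S j) (derived_series br S j)"

primrec lower_central_series ::
    "('k::field, 'n::finite) bracket \<Rightarrow> ('k ^ 'n) set \<Rightarrow> nat \<Rightarrow> ('k ^ 'n) set" where
  "lower_central_series br S 0 = S"
| "lower_central_series br S (Suc j) = bracket_span br S (lower_central_series br S j)"

definition solvable_lie :: "('k::field, 'n::finite) bracket \<Rightarrow> ('k ^ 'n) set \<Rightarrow> bool" where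
  "solvable_lie br S \<longleftrightarrow> (\<exists>j. derived_series br S j = {0})"

definition nilpotent_lie :: "('k::field, 'n::finite) bracket \<Rightarrow> ('k ^ 'n) set \<Rightarrow> bool" where
  "nilpotent_lie br S \<longleftrightarrow> (\<exists>j. lower_central_series br S j = {0})"

definition semisimple_lie :: "('k::field, 'n::finite) bracket \<Rightarrow> bool" where
  "semisimple_lie br \<longleftrightarrow> (\<forall>I. lie_ideal br I \<and> solvable_lie br I \<longrightarrow> I = {0})"

definition cartan_subalgebra :: "('k::field, 'n::finite) bracket \<Rightarrow> ('k ^ 'n) set \<Rightarrow> bool" where
  "cartan_subalgebra br h \<longleftrightarrow>
     lie_subalgebra br h \<and> nilpotent_lie br h \<and> {x. \<forall>y\<in>h. br x y \<in> h} = h"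

subsection \<open>Root decomposition\<close>

definition complexify :: "'k::real_or_complex ^ 'n \<Rightarrow> complex ^ 'n" where
  "complexify x = (\<chi> i. to_complex (x $ i))"

text \<open>The bracket on \<open>\<complex>\<^sup>n\<close> with the same structure constants.\<close>

definition complex_bracket :: "('k::real_or_complex, 'n::finite) bracket \<Rightarrow> (complex, 'n) bracket"
  where "complex_bracket br x y =
    (\<Sum>i\<in>UNIV. \<Sum>j\<in>UNIV. (x $ i * y $ j) *s complexify (br (axis i 1) (axis j 1)))"

definition complex_cartan :: "('k::real_or_complex ^ 'n::finite) set \<Rightarrow> (complex ^ 'n) set" where
  "complex_cartan h = vec.span (complexify ` h)"

type_synonym 'n functional = "complex ^ 'n \<Rightarrow> complex"

definition root_space ::
    "('k::real_or_complex, 'n::finite) bracket \<Rightarrow> ('k ^ 'n) set \<Rightarrow> 'n functional \<Rightarrow> (complex ^ 'n) set"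
  where "root_space br h \<alpha> =
    {x. \<forall>y\<in>complex_cartan h. complex_bracket br y x = \<alpha> y *s x}"

text \<open>A functional on the Cartan subalgebra is represented by the function extending it by 0
  off the Cartan subalgebra.\<close>

definition roots :: "('k::real_or_complex, 'n::finite) bracket \<Rightarrow> ('k ^ 'n) set \<Rightarrow> 'n functional set"
  where "roots br h = {\<alpha>.
    (\<forall>x\<in>complex_cartan h. \<forall>y\<in>complex_cartan h. \<alpha> (x + y) = \<alpha> x + \<alpha> y) \<and>
    (\<forall>x\<in>complex_cartan h. \<forall>c. \<alpha> (c *s x) = c * \<alpha> x) \<and>
    (\<forall>x. x \<notin> complex_cartan h \<longrightarrow> \<alpha> x = 0) \<and>
    \<alpha> \<noteq> (\<lambda>x. 0) \<and> root_space br h \<alpha> \<noteq> {0}}"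

definition positive_system ::
    "('k::real_or_complex, 'n::finite) bracket \<Rightarrow> ('k ^ 'n) set \<Rightarrow> 'n functional set \<Rightarrow> bool"
  where "positive_system br h P \<longleftrightarrow>
    P \<union> (\<lambda>\<alpha>. - \<alpha>) ` P = roots br h \<and> P \<inter> (\<lambda>\<alpha>. - \<alpha>) ` P = {} \<and>
    (\<forall>\<alpha>\<in>P. \<forall>\<beta>\<in>P. (\<lambda>x. \<alpha> x + \<beta> x) \<in> roots br h \<longrightarrow> (\<lambda>x. \<alpha> x + \<beta> x) \<in> P)"

definition root_basis ::
    "('k::real_or_complex, 'n::finite) bracket \<Rightarrow> ('k ^ 'n) set \<Rightarrow> 'n functional set \<Rightarrow>
     ('n functional \<Rightarrow> complex ^ 'n) \<Rightarrow> (complex ^ 'n) set \<Rightarrow> bool"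
  where "root_basis br h P E B \<longleftrightarrow>
    positive_system br h P \<and>
    (\<forall>\<alpha>\<in>roots br h. E \<alpha> \<in> root_space br h \<alpha> \<and> E \<alpha> \<noteq> 0) \<and>
    \<not> vec.dependent B \<and> vec.span B = complex_cartan h"

text \<open>The exponent of \<open>\<Pi>(u,v)\<close>, with Cartan coefficients \<open>l\<close>.\<close>

definition phase_exponent ::
    "'n functional set \<Rightarrow> ('n functional \<Rightarrow> complex ^ 'n) \<Rightarrow> (complex ^ 'n) set \<Rightarrow>
     ('n functional \<Rightarrow> complex) \<Rightarrow> ('n functional \<Rightarrow> complex) \<Rightarrow> (complex ^ 'n \<Rightarrow> complex) \<Rightarrow>
     complex ^ 'n::finite"
  where "phase_exponent P E B u v l =
    (\<Sum>\<alpha>\<in>P. (\<i> * u \<alpha>) *s E \<alpha>) - (\<Sum>\<alpha>\<in>P. (\<i> * v \<alpha>) *s E (- \<alpha>)) + (\<Sum>b\<in>B. (\<i> * l b) *s b)"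

text \<open>For a real Lie algebra the root vectors lie in the complexification only, so \<open>(u,v)\<close> is
  restricted to values for which the exponent can be made to lie in the Lie algebra itself (for
  \<open>su\<^sub>2\<close>: \<open>v\<close> is up to normalisation the conjugate of \<open>u\<close>).  Over the complex numbers this is no
  restriction.\<close>

definition phase_parameters ::
    "'k::real_or_complex itself \<Rightarrow> 'n functional set \<Rightarrow> ('n functional \<Rightarrow> complex ^ 'n) \<Rightarrow>
     (complex ^ 'n::finite) set \<Rightarrow> (('n functional \<Rightarrow> complex) \<times> ('n functional \<Rightarrow> complex)) set"
  where "phase_parameters _ P E B = {(u, v).
    (\<forall>\<alpha>. \<alpha> \<notin> P \<longrightarrow> u \<alpha> = 0 \<and> v \<alpha> = 0) \<and>
    (\<exists>l. phase_exponent P E B u v l \<in> range (complexify :: 'k ^ 'n \<Rightarrow> complex ^ 'n))}"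

section \<open>Smooth and holomorphic manifolds\<close>

primrec ck_on :: "nat \<Rightarrow> ('a::real_normed_vector \<Rightarrow> 'b::real_normed_vector) \<Rightarrow> 'a set \<Rightarrow> bool" where
  "ck_on 0 f S \<longleftrightarrow> continuous_on S f"
| "ck_on (Suc j) f S \<longleftrightarrow>
     (\<forall>x\<in>S. f differentiable (at x)) \<and> (\<forall>v. ck_on j (\<lambda>x. frechet_derivative f (at x) v) S)"

text \<open>Used for open sets only: infinitely differentiable over the reals, with differentials linear
  over the ground field.  Over the complex numbers this means holomorphic.\<close>

definition smooth_on :: "('k::real_or_complex ^ 'm::finite) set \<Rightarrow> ('k ^ 'm \<Rightarrow> 'k ^ 'l::finite) \<Rightarrow> bool"
  where "smooth_on S f \<longleftrightarrow>
    (\<forall>j. ck_on j f S) \<and>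
    (\<forall>x\<in>S. \<forall>c v. frechet_derivative f (at x) (c *s v) = c *s frechet_derivative f (at x) v)"

text \<open>A manifold modelled on \<open>K\<^sup>m\<close> is given by an atlas; its points are the union of the chart
  domains, and its topology is the one that makes all charts homeomorphisms onto open sets.\<close>

type_synonym ('p, 'k, 'm) chart = "'p set \<times> ('p \<Rightarrow> 'k ^ 'm)"
type_synonym ('p, 'k, 'm) atlas = "('p, 'k, 'm) chart set"

definition points :: "('p, 'k, 'm) atlas \<Rightarrow> 'p set" where
  "points A = (\<Union>(U, \<phi>)\<in>A. U)"

definition manifold_topology :: "('p, 'k::real_or_complex, 'm::finite) atlas \<Rightarrow> 'p topology" where
  "manifold_topology A = topology (\<lambda>W. W \<subseteq> points A \<and> (\<forall>(U, \<phi>)\<in>A. open (\<phi> ` (U \<inter> W))))"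

definition manifold :: "('p, 'k::real_or_complex, 'm::finite) atlas \<Rightarrow> bool" where
  "manifold A \<longleftrightarrow>
     (\<forall>(U, \<phi>)\<in>A. inj_on \<phi> U \<and> open (\<phi> ` U)) \<and>
     (\<forall>(U, \<phi>)\<in>A. \<forall>(V, \<psi>)\<in>A.
        open (\<phi> ` (U \<inter> V)) \<and> smooth_on (\<phi> ` (U \<inter> V)) (\<lambda>x. \<psi> (inv_into U \<phi> x))) \<and>
     Hausdorff_space (manifold_topology A) \<and> second_countable (manifold_topology A)"

lemma istopology_manifold:
  fixes A :: "('p, 'k::real_or_complex, 'm::finite) atlas"
  assumes "\<forall>(U, \<phi>)\<in>A. inj_on \<phi> U"
  shows "istopology (\<lambda>W. W \<subseteq> points A \<and> (\<forall>(U, \<phi>)\<in>A. open (\<phi> ` (U \<inter> W))))"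
  unfolding istopology_def
proof (intro conjI allI impI)
  fix S T
  assume S: "S \<subseteq> points A \<and> (\<forall>(U, \<phi>)\<in>A. open (\<phi> ` (U \<inter> S)))"
    and T: "T \<subseteq> points A \<and> (\<forall>(U, \<phi>)\<in>A. open (\<phi> ` (U \<inter> T)))"
  show "S \<inter> T \<subseteq> points A" using S by blast
  show "\<forall>(U, \<phi>)\<in>A. open (\<phi> ` (U \<inter> (S \<inter> T)))"
  proof (clarify)
    fix U \<phi> assume c: "(U, \<phi>) \<in> A"
    have "inj_on \<phi> U" using c assms by fastforce
    then have "\<phi> ` (U \<inter> (S \<inter> T)) = \<phi> ` (U \<inter> S) \<inter> \<phi> ` (U \<inter> T)"
      unfolding inj_on_def by blast
    moreover have "open (\<phi> ` (U \<inter> S))" "open (\<phi> ` (U \<inter> T))" using c S T by fastforce+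
    ultimately show "open (\<phi> ` (U \<inter> (S \<inter> T)))" by (simp add: open_Int)
  qed
next
  fix \<K>
  assume K: "\<forall>W\<in>\<K>. W \<subseteq> points A \<and> (\<forall>(U, \<phi>)\<in>A. open (\<phi> ` (U \<inter> W)))"
  show "\<Union>\<K> \<subseteq> points A" using K by blast
  show "\<forall>(U, \<phi>)\<in>A. open (\<phi> ` (U \<inter> \<Union>\<K>))"
  proof (clarify)
    fix U \<phi> assume c: "(U, \<phi>) \<in> A"
    have "\<phi> ` (U \<inter> \<Union>\<K>) = (\<Union>W\<in>\<K>. \<phi> ` (U \<inter> W))" by blast
    moreover have "\<forall>W\<in>\<K>. open (\<phi> ` (U \<inter> W))" using c K by fastforce
    ultimately show "open (\<phi> ` (U \<inter> \<Union>\<K>))" by auto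
  qed
qed

lemma openin_manifold_topology:
  fixes A :: "('p, 'k::real_or_complex, 'm::finite) atlas"
  assumes "\<forall>(U, \<phi>)\<in>A. inj_on \<phi> U"
  shows "openin (manifold_topology A) W \<longleftrightarrow>
    W \<subseteq> points A \<and> (\<forall>(U, \<phi>)\<in>A. open (\<phi> ` (U \<inter> W)))"
  unfolding manifold_topology_def using istopology_manifold[OF assms]
  by (simp add: topology_inverse')

definition smooth_map ::
    "('p, 'k::real_or_complex, 'm::finite) atlas \<Rightarrow> ('q, 'k, 'l::finite) atlas \<Rightarrow> ('p \<Rightarrow> 'q) \<Rightarrow> bool"
  where "smooth_map A B f \<longleftrightarrow>
    continuous_map (manifold_topology A) (manifold_topology B) f \<and>
    (\<forall>(U, \<phi>)\<in>A. \<forall>(V, \<psi>)\<in>B.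
       smooth_on (\<phi> ` (U \<inter> f -` V)) (\<lambda>x. \<psi> (f (inv_into U \<phi> x))))"

definition diffeomorphism ::
    "('p, 'k::real_or_complex, 'm::finite) atlas \<Rightarrow> ('q, 'k, 'l::finite) atlas \<Rightarrow> ('p \<Rightarrow> 'q) \<Rightarrow> bool"
  where "diffeomorphism A B f \<longleftrightarrow>
    bij_betw f (points A) (points B) \<and> smooth_map A B f \<and> smooth_map B A (inv_into (points A) f)"

definition prod_atlas ::
    "('p, 'k, 'm::finite) atlas \<Rightarrow> ('q, 'k, 'l::finite) atlas \<Rightarrow> ('p \<times> 'q, 'k, 'm + 'l) atlas"
  where "prod_atlas A B =
    {(U \<times> V, \<lambda>(p, q). \<chi> i. case i of Inl a \<Rightarrow> \<phi> p $ a | Inr b \<Rightarrow> \<psi> q $ b) | U \<phi> V \<psi>.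
       (U, \<phi>) \<in> A \<and> (V, \<psi>) \<in> B}"

definition open_atlas :: "('k ^ 'm) set \<Rightarrow> ('k ^ 'm, 'k, 'm) atlas" where
  "open_atlas W = {(W, \<lambda>x. x)}"

definition restrict_atlas :: "('p, 'k, 'm) atlas \<Rightarrow> 'p set \<Rightarrow> ('p, 'k, 'm) atlas" where
  "restrict_atlas A S = (\<lambda>(U, \<phi>). (U \<inter> S, \<phi>)) ` A"

section \<open>Symplectic forms\<close>

text \<open>A 2-form is given by its coordinate expression \<open>\<omega> c x u v\<close> in every chart \<open>c\<close>, at the
  coordinate \<open>x\<close> and on tangent vectors with coordinates \<open>u\<close>, \<open>v\<close>; the last condition is
  compatibility under change of charts.  The values are in the ground field: a real symplectic form
  on a real manifold, a holomorphic one on a complex manifold.  The type \<open>'k ^ 1\<close> only serves to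
  speak about smoothness of scalar functions.\<close>

definition symplectic_form ::
    "('p, 'k::real_or_complex, 'm::finite) atlas \<Rightarrow>
     (('p, 'k, 'm) chart \<Rightarrow> 'k ^ 'm \<Rightarrow> 'k ^ 'm \<Rightarrow> 'k ^ 'm \<Rightarrow> 'k) \<Rightarrow> bool"
  where "symplectic_form A \<omega> \<longleftrightarrow>
    (\<forall>(U, \<phi>)\<in>A.
       (\<forall>x\<in>\<phi> ` U.
          (\<forall>u. Vector_Spaces.linear (*s) (*) (\<lambda>v. \<omega> (U, \<phi>) x u v)) \<and>
          (\<forall>v. Vector_Spaces.linear (*s) (*) (\<lambda>u. \<omega> (U, \<phi>) x u v)) \<and>
          (\<forall>u. \<omega> (U, \<phi>) x u u = 0) \<and>
          (\<forall>u. (\<forall>v. \<omega> (U, \<phi>) x u v = 0) \<longrightarrow> u = 0) \<and>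
          (\<forall>u v w.
             frechet_derivative (\<lambda>y. \<omega> (U, \<phi>) y v w) (at x) u +
             frechet_derivative (\<lambda>y. \<omega> (U, \<phi>) y w u) (at x) v +
             frechet_derivative (\<lambda>y. \<omega> (U, \<phi>) y u v) (at x) w = 0)) \<and>
       (\<forall>u v. smooth_on (\<phi> ` U) (\<lambda>x. vec (\<omega> (U, \<phi>) x u v) :: 'k ^ 1))) \<and>
    (\<forall>(U, \<phi>)\<in>A. \<forall>(V, \<psi>)\<in>A. \<forall>x\<in>\<phi> ` (U \<inter> V). \<forall>u v.
       (let \<tau> = (\<lambda>y. \<psi> (inv_into U \<phi> y)); d\<tau> = frechet_derivative \<tau> (at x)
        in \<omega> (U, \<phi>) x u v = \<omega> (V, \<psi>) (\<tau> x) (d\<tau> u) (d\<tau> v)))"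

definition symplectic :: "('p, 'k::real_or_complex, 'm::finite) atlas \<Rightarrow> bool" where
  "symplectic A \<longleftrightarrow> (\<exists>\<omega>. symplectic_form A \<omega>)"

section \<open>Lie groups\<close>

definition lie_group :: "'g monoid \<Rightarrow> ('g, 'k::real_or_complex, 'n::finite) atlas \<Rightarrow> bool" where
  "lie_group G A \<longleftrightarrow>
     group G \<and> manifold A \<and> points A = carrier G \<and>
     smooth_map (prod_atlas A A) A (\<lambda>(x, y). x \<otimes>\<^bsub>G\<^esub> y) \<and>
     smooth_map A A (\<lambda>x. inv\<^bsub>G\<^esub> x)"

text \<open>Tangent vectors at the identity are described by their coordinates in a fixed chart \<open>(U,\<phi>)\<close>
  around it.  In these coordinates, \<open>left_field\<close> is the left invariant vector field with value \<open>v\<close>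
  at the identity, and \<open>tangent_bracket\<close> is the value at the identity of the commutator
  \<open>[X,Y] = DY(X) - DX(Y)\<close> of two such fields.\<close>

definition left_field ::
    "'g monoid \<Rightarrow> ('g, 'k::real_or_complex, 'n::finite) chart \<Rightarrow> 'k ^ 'n \<Rightarrow> 'k ^ 'n \<Rightarrow> 'k ^ 'n"
  where "left_field G = (\<lambda>(U, \<phi>) v x.
    frechet_derivative (\<lambda>y. \<phi> (inv_into U \<phi> x \<otimes>\<^bsub>G\<^esub> inv_into U \<phi> y)) (at (\<phi> \<one>\<^bsub>G\<^esub>)) v)"

definition tangent_bracket ::
    "'g monoid \<Rightarrow> ('g, 'k::real_or_complex, 'n::finite) chart \<Rightarrow> ('k, 'n) bracket"
  where "tangent_bracket G c u v =
    (let e = snd c \<one>\<^bsub>G\<^esub>; X = left_field G c u; Y = left_field G c v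
     in frechet_derivative Y (at e) (X e) - frechet_derivative X (at e) (Y e))"

definition lie_algebra_iso ::
    "'g monoid \<Rightarrow> ('g, 'k::real_or_complex, 'n::finite) atlas \<Rightarrow> ('k, 'n) bracket \<Rightarrow>
     ('g, 'k, 'n) chart \<Rightarrow> ('k ^ 'n \<Rightarrow> 'k ^ 'n) \<Rightarrow> bool"
  where "lie_algebra_iso G A br c \<theta> \<longleftrightarrow>
    c \<in> A \<and> \<one>\<^bsub>G\<^esub> \<in> fst c \<and> Vector_Spaces.linear (*s) (*s) \<theta> \<and> bij \<theta> \<and>
    (\<forall>x y. \<theta> (br x y) = tangent_bracket G c (\<theta> x) (\<theta> y))"

definition connected_lie_group_of ::
    "('k::real_or_complex, 'n::finite) bracket \<Rightarrow> 'g monoid \<Rightarrow> ('g, 'k, 'n) atlas \<Rightarrow> bool"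
  where "connected_lie_group_of br G A \<longleftrightarrow>
    lie_group G A \<and> connected_space (manifold_topology A) \<and> (\<exists>c \<theta>. lie_algebra_iso G A br c \<theta>)"

text \<open>Every connected Lie group of positive dimension has the cardinality of the continuum, so
  each one, up to isomorphism, has its elements in the type \<open>'g\<close> that carries \<open>G\<close>: quantifying
  over the Lie groups on subsets of that type loses nothing.  A smooth surjective homomorphism
  between connected Lie groups exhibits its target as the quotient Lie group by its kernel.\<close>

definition smallest_connected_lie_group ::
    "('k::real_or_complex, 'n::finite) bracket \<Rightarrow> 'g monoid \<Rightarrow> ('g, 'k, 'n) atlas \<Rightarrow> bool"
  where "smallest_connected_lie_group br G A \<longleftrightarrow>
    connected_lie_group_of br G A \<and>
    (\<forall>(G' :: 'g monoid) A'. connected_lie_group_of br G' A' \<longrightarrow>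
       (\<exists>\<pi>. \<pi> \<in> hom G' G \<and> smooth_map A' A \<pi> \<and> \<pi> ` carrier G' = carrier G))"

definition one_parameter_subgroup ::
    "'g monoid \<Rightarrow> ('g, 'k::real_or_complex, 'n::finite) atlas \<Rightarrow> (real \<Rightarrow> 'g) \<Rightarrow> bool"
  where "one_parameter_subgroup G A \<gamma> \<longleftrightarrow>
    (\<forall>t. \<gamma> t \<in> carrier G) \<and> (\<forall>s t. \<gamma> (s + t) = \<gamma> s \<otimes>\<^bsub>G\<^esub> \<gamma> t) \<and>
    continuous_map euclideanreal (manifold_topology A) \<gamma> \<and>
    (\<forall>(U, \<phi>)\<in>A. \<forall>j. ck_on j (\<lambda>t. \<phi> (\<gamma> t)) (\<gamma> -` U))"

definition lie_exp ::
    "'g monoid \<Rightarrow> ('g, 'k::real_or_complex, 'n::finite) atlas \<Rightarrow> ('g, 'k, 'n) chart \<Rightarrow>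
     ('k ^ 'n \<Rightarrow> 'k ^ 'n) \<Rightarrow> 'k ^ 'n \<Rightarrow> 'g"
  where "lie_exp G A c \<theta> X =
    (THE g. \<exists>\<gamma>. one_parameter_subgroup G A \<gamma> \<and>
       ((\<lambda>t. snd c (\<gamma> t)) has_vector_derivative \<theta> X) (at 0) \<and> g = \<gamma> 1)"

definition connected_lie_subgroup ::
    "'g monoid \<Rightarrow> ('g, 'k::real_or_complex, 'n::finite) atlas \<Rightarrow> ('g, 'k, 'n) chart \<Rightarrow>
     ('k ^ 'n \<Rightarrow> 'k ^ 'n) \<Rightarrow> ('k ^ 'n) set \<Rightarrow> 'g set"
  where "connected_lie_subgroup G A c \<theta> h = generate G (lie_exp G A c \<theta> ` h)"

section \<open>Homogeneous manifolds\<close>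

definition left_cosets :: "'g monoid \<Rightarrow> 'g set \<Rightarrow> 'g set set" where
  "left_cosets G H = (\<lambda>g. g <#\<^bsub>G\<^esub> H) ` carrier G"

text \<open>The manifold structure of \<open>G/H\<close>: the charts for which the projection \<open>G \<rightarrow> G/H\<close> is smooth
  and has smooth local sections (that is, is a submersion).  Two such charts are always
  compatible; that they cover \<open>G/H\<close> is not part of the definition.\<close>

definition quotient_atlas ::
    "'g monoid \<Rightarrow> ('g, 'k::real_or_complex, 'n::finite) atlas \<Rightarrow> 'g set \<Rightarrow>
     ('g set, 'k, 'm::finite) atlas"
  where "quotient_atlas G A H = {(U, \<phi>).
    U \<subseteq> left_cosets G H \<and> inj_on \<phi> U \<and> open (\<phi> ` U) \<and>
    (let S = {g \<in> carrier G. g <#\<^bsub>G\<^esub> H \<in> U}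
     in openin (manifold_topology A) S \<and>
        smooth_map (restrict_atlas A S) (open_atlas UNIV) (\<lambda>g. \<phi> (g <#\<^bsub>G\<^esub> H))) \<and>
    (\<forall>y\<in>\<phi> ` U. \<exists>W \<sigma>. open W \<and> y \<in> W \<and> W \<subseteq> \<phi> ` U \<and>
       smooth_map (open_atlas W) A \<sigma> \<and> (\<forall>x\<in>W. \<sigma> x <#\<^bsub>G\<^esub> H = inv_into U \<phi> x))}"

definition coset_action :: "'g monoid \<Rightarrow> 'g set \<Rightarrow> 'g \<Rightarrow> 'g set \<Rightarrow> 'g set" where
  "coset_action G H g = (\<lambda>C\<in>left_cosets G H. g <#\<^bsub>G\<^esub> C)"

definition homogeneous_manifold ::
    "'g monoid \<Rightarrow> ('g, 'k::real_or_complex, 'n::finite) atlas \<Rightarrow> ('p, 'k, 'm::finite) atlas \<Rightarrow>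
     ('g \<Rightarrow> 'p \<Rightarrow> 'p) \<Rightarrow> bool"
  where "homogeneous_manifold G A M act \<longleftrightarrow>
    manifold M \<and> transitive_action G (points M) act \<and>
    smooth_map (prod_atlas A M) M (\<lambda>(g, p). act g p)"

text \<open>The points near \<open>p\<close> are labelled by \<open>(u,v)\<close> through \<open>\<Pi>(u,v) p\<close>, where the Cartan
  coefficients are functions \<open>lam u v\<close>.  The labels form a vector space over the ground field; \<open>u\<close>,
  \<open>v\<close> coordinatise it linearly and bijectively by \<open>K\<^sup>m\<close>, and \<open>z \<mapsto> \<Pi>(u z, v z) p\<close> is required to be
  the inverse of a chart compatible with the atlas \<open>M\<close>.  Transitivity carries the labelling to
  every other point.\<close>

definition locally_labelled ::
    "('k::real_or_complex, 'n::finite) bracket \<Rightarrow> ('k ^ 'n) set \<Rightarrow> ('k ^ 'n \<Rightarrow> 'g) \<Rightarrow>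
     ('p, 'k, 'm::finite) atlas \<Rightarrow> ('g \<Rightarrow> 'p \<Rightarrow> 'p) \<Rightarrow> 'p \<Rightarrow> bool"
  where "locally_labelled br h ex M act p \<longleftrightarrow>
    (\<exists>P E B lam u v. \<exists>W :: ('k ^ 'm) set.
       root_basis br h P E B \<and>
       (\<forall>\<alpha>. (\<forall>x y. u (x + y) \<alpha> = u x \<alpha> + u y \<alpha>) \<and> (\<forall>c x. u (c *s x) \<alpha> = to_complex c * u x \<alpha>)) \<and>
       (\<forall>\<alpha>. (\<forall>x y. v (x + y) \<alpha> = v x \<alpha> + v y \<alpha>) \<and> (\<forall>c x. v (c *s x) \<alpha> = to_complex c * v x \<alpha>)) \<and>
       bij_betw (\<lambda>z. (u z, v z)) UNIV (phase_parameters TYPE('k) P E B) \<and>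
       open W \<and> 0 \<in> W \<and>
       (let \<Xi> = (\<lambda>z. phase_exponent P E B (u z) (v z) (lam (u z) (v z)));
            L = (\<lambda>z. act (ex (inv_into UNIV complexify (\<Xi> z))) p)
        in (\<forall>z\<in>W. \<Xi> z \<in> range (complexify :: 'k ^ 'n \<Rightarrow> complex ^ 'n)) \<and>
           inj_on L W \<and> L 0 = p \<and> L ` W \<subseteq> points M \<and> manifold (insert (L ` W, inv_into W L) M)))"

definition classical_phase_space ::
    "('k::real_or_complex, 'n::finite) bracket \<Rightarrow> ('k ^ 'n) set \<Rightarrow> 'g monoid \<Rightarrow> ('g, 'k, 'n) atlas \<Rightarrow>
     ('g, 'k, 'n) chart \<Rightarrow> ('k ^ 'n \<Rightarrow> 'k ^ 'n) \<Rightarrow>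
     ('p, 'k, 'm::finite) atlas \<Rightarrow> ('g \<Rightarrow> 'p \<Rightarrow> 'p) \<Rightarrow> 'p \<Rightarrow> bool"
  where "classical_phase_space br h G A c \<theta> M act p \<longleftrightarrow>
    CARD('m) = CARD('n) - vec.dim h \<and>
    homogeneous_manifold G A M act \<and> p \<in> points M \<and>
    stabilizer G act p = connected_lie_subgroup G A c \<theta> h \<and>
    locally_labelled br h (lie_exp G A c \<theta>) M act p"

end

theory Submission
  imports Defs "HOL-Computational_Algebra.Fundamental_Theorem_Algebra"
begin

text \<open>A Cartan subalgebra of a semisimple Lie algebra is the generalised null space of \<open>ad x\<close> for
  some \<open>x \<in> h\<close>.  The semisimple part \<open>D\<close> of \<open>ad x\<close> is a derivation with kernel \<open>h\<close>, and
  \<open>f y = tr (D \<circ> ad y)\<close> satisfies \<open>f [u,v] = \<kappa> (D u) v\<close>.  Since the Killing form \<open>\<kappa>\<close> is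
  nondegenerate, \<open>h\<close> is exactly the kernel of the 2-form \<open>f [u,v]\<close>, that is, the Lie algebra of
  the stabiliser of \<open>f\<close> under the coadjoint action.

  So \<open>H\<close> fixes \<open>f\<close>, and \<open>g \<mapsto> Ad\<^sup>* g f\<close> is constant on the cosets of \<open>H\<close> and has differential with
  kernel \<open>h\<close> at the identity.  Its components supply the charts of \<open>G/H\<close>, and \<open>H\<close> is closed
  because near the identity it is a level set of these charts.  The 2-form
  \<open>f [\<sigma>\<^sup>*\<Theta>, \<sigma>\<^sup>*\<Theta>]\<close>, with \<open>\<Theta>\<close> the Maurer-Cartan form and \<open>\<sigma>\<close> a local section, does not depend
  on \<open>\<sigma>\<close>, is closed by the Maurer-Cartan equation and nondegenerate because \<open>h\<close> is the whole
  kernel: it is the Kirillov-Kostant form.  A phase space \<open>\<Gamma>\<close> is the orbit of a point with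
  stabiliser \<open>H\<close>; its orbit map also is a submersion whose fibres are the cosets.\<close>

text \<open>The real and the complex case are treated at once: a smooth map is a real smooth one
  whose differentials commute with scalars, and the linear algebra rests on the generalised
  eigenspaces of a single \<open>ad x\<close>, whose semisimple part descends to the ground field.
  The functional is a trace against \<open>D\<close>, so that \<open>D\<close> need not be
  recognised as an inner derivation: f [u,v] = \<kappa> (D u) v uses only [D, ad u] = ad (D u) and
  cyclicity of the trace.

  The obstacle on the group side is that \<open>H\<close> is only given as the subgroup generated by
  exponentials; neither its closedness nor a manifold structure on it is at hand, and the stabiliser
  of f may have further components. The coordinates transverse to \<open>H\<close> therefore come
  from \<open>P \<circ> coad\<close>, which is smooth over the ground field. Exponentials, obtained
  from a real differential equation, enter only through real smoothness: the products of a slice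
  with exponentials cover a neighbourhood of the identity by an open mapping argument at one point,
  and no smooth factorisation is required.\<close>

declare vector_add_ldistrib[simp del] vector_ssub_ldistrib[simp del]
  vector_sadd_rdistrib[simp del] vector_sub_rdistrib[simp del]

section \<open>Generalised eigenspaces\<close>

definition klin :: "('k::field ^ 'n \<Rightarrow> 'k ^ 'm) \<Rightarrow> bool" where
  "klin f \<longleftrightarrow> (\<forall>x y. f (x + y) = f x + f y) \<and> (\<forall>c x. f (c *s x) = c *s f x)"

lemma klin_iff: "klin f \<longleftrightarrow> Vector_Spaces.linear (*s) (*s) f"
proof
  assume "klin f" then show "Vector_Spaces.linear (*s) (*s) f"
    unfolding klin_def by (unfold_locales) auto
next
  assume "Vector_Spaces.linear (*s) (*s) f"
  then interpret Vector_Spaces.linear "(*s)" "(*s)" f .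
  show "klin f" by (simp add: klin_def add scale)
qed

lemma klinI:
  assumes "\<And>x y. f (x + y) = f x + f y" "\<And>c x. f (c *s x) = c *s f x"
  shows "klin f"
  using assms by (simp add: klin_def)

lemma klin_add: "klin f \<Longrightarrow> f (x + y) = f x + f y"
  and klin_scale: "klin f \<Longrightarrow> f (c *s x) = c *s f x"
  by (auto simp: klin_def)

lemma klin_0: "klin f \<Longrightarrow> f 0 = 0"
  using klin_scale[of f 0 0] by simp

lemma klin_minus: "klin f \<Longrightarrow> f (- x) = - f x"
  using klin_scale[of f "- 1" x] by simp

lemma klin_diff: "klin f \<Longrightarrow> f (x - y) = f x - f y"
  using klin_add[of f x "- y"] by (simp add: klin_minus)

lemma klin_sum: "klin f \<Longrightarrow> f (sum g S) = (\<Sum>i\<in>S. f (g i))"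
  by (induction S rule: infinite_finite_induct) (auto simp: klin_0 klin_add)

lemma klin_compose: "klin f \<Longrightarrow> klin g \<Longrightarrow> klin (\<lambda>x. f (g x))"
  by (simp add: klin_def)

lemma klin_plus: "klin f \<Longrightarrow> klin g \<Longrightarrow> klin (\<lambda>x. f x + g x)"
  by (simp add: klin_def vector_add_ldistrib)

lemma klin_minus_fun: "klin f \<Longrightarrow> klin g \<Longrightarrow> klin (\<lambda>x. f x - g x)"
  by (simp add: klin_def algebra_simps vector_ssub_ldistrib)

lemma klin_mult: "klin f \<Longrightarrow> klin (\<lambda>x. c *s f x)"
  by (simp add: klin_def vector_add_ldistrib mult.commute)

lemma klin_id: "klin (\<lambda>x. x)" by (simp add: klin_def)

lemma klin_const0: "klin (\<lambda>x. 0)" by (simp add: klin_def)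

lemma klin_funpow:
  fixes f :: "'k::field ^ 'n \<Rightarrow> 'k ^ 'n"
  shows "klin f \<Longrightarrow> klin (f ^^ k)"
  by (induction k) (auto simp: klin_def)

lemma klin_matrix: "klin f \<Longrightarrow> matrix f *v x = f x"
  by (simp add: klin_iff matrix_works)

lemma matrix_compose_klin:
  fixes f :: "'k::field ^ 'n::finite \<Rightarrow> 'k ^ 'n"
  assumes "klin f" "klin g" shows "matrix (\<lambda>x. f (g x)) = matrix f ** matrix g"
  using matrix_compose_gen[of g f] assms by (simp add: klin_iff o_def)

lemma klin_eq_on_span:
  assumes "klin f" "klin g" "\<And>x. x \<in> S \<Longrightarrow> f x = g x" "x \<in> vec.span S"
  shows "f x = g x"
  using assms(4)
proof (induction rule: vec.span_induct_alt)
  case base then show ?case using assms by (simp add: klin_0)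
next
  case (step c x y) then show ?case using assms by (simp add: klin_add klin_scale)
qed

section \<open>Generalised eigenspaces over any field: independence and action of the shifts\<close>

definition klin_shift :: "('k::field ^ 'n \<Rightarrow> 'k ^ 'n) \<Rightarrow> 'k \<Rightarrow> 'k ^ 'n \<Rightarrow> 'k ^ 'n" where
  "klin_shift f a v = f v - a *s v"

lemma klin_shift_klin: "klin f \<Longrightarrow> klin (klin_shift f a)"
  unfolding klin_shift_def by (intro klin_minus_fun klin_mult klin_id)

definition gen_eigenspace :: "('k::field ^ 'n \<Rightarrow> 'k ^ 'n) \<Rightarrow> 'k \<Rightarrow> ('k ^ 'n) set" where
  "gen_eigenspace f a = {v. \<exists>k. (klin_shift f a ^^ k) v = 0}"

lemma klin_funpow_zero_mono:
  fixes f :: "'k::field ^ 'n \<Rightarrow> 'k ^ 'n"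
  assumes "klin f" "(f ^^ k) v = 0" "k \<le> l" shows "(f ^^ l) v = 0"
proof -
  have "l = (l - k) + k" using assms by simp
  then have "(f ^^ l) v = (f ^^ (l - k)) ((f ^^ k) v)" by (metis comp_apply funpow_add)
  then show ?thesis using assms by (simp add: klin_0[OF klin_funpow])
qed

lemma subspace_gen_eigenspace:
  assumes "klin f" shows "vec.subspace (gen_eigenspace f a)"
proof -
  let ?g = "klin_shift f a"
  have g: "klin ?g" using assms by (rule klin_shift_klin)
  show ?thesis
    unfolding vec.subspace_def
  proof (intro conjI ballI allI)
    show "0 \<in> gen_eigenspace f a" by (auto simp: gen_eigenspace_def intro!: exI[of _ 0])
  next
    fix x y assume "x \<in> gen_eigenspace f a" "y \<in> gen_eigenspace f a"
    then obtain k l where "(?g ^^ k) x = 0" "(?g ^^ l) y = 0" by (auto simp: gen_eigenspace_def)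
    then have "(?g ^^ (k + l)) x = 0" "(?g ^^ (k + l)) y = 0"
      using klin_funpow_zero_mono[OF g] by auto
    then have "(?g ^^ (k + l)) (x + y) = 0" by (simp add: klin_add[OF klin_funpow[OF g]])
    then show "x + y \<in> gen_eigenspace f a" by (auto simp: gen_eigenspace_def)
  next
    fix c x assume "x \<in> gen_eigenspace f a"
    then show "c *s x \<in> gen_eigenspace f a"
      by (auto simp: gen_eigenspace_def klin_scale[OF klin_funpow[OF g]])
  qed
qed

lemma gen_eigenspace_invariant:
  assumes "klin f" "v \<in> gen_eigenspace f a"
  shows "klin_shift f b v \<in> gen_eigenspace f a" "f v \<in> gen_eigenspace f a"
proof -
  let ?g = "klin_shift f a"
  have g: "klin ?g" using assms by (intro klin_shift_klin)
  obtain k where "(?g ^^ k) v = 0" using assms by (auto simp: gen_eigenspace_def)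
  then have "(?g ^^ k) (?g v) = 0" by (metis funpow_swap1 g klin_0)
  then have 1: "?g v \<in> gen_eigenspace f a" by (auto simp: gen_eigenspace_def)
  have "f v = ?g v + a *s v" by (simp add: klin_shift_def)
  then show 2: "f v \<in> gen_eigenspace f a"
    using vec.subspace_add[OF subspace_gen_eigenspace[OF assms(1)]] 1 assms(2)
      vec.subspace_scale[OF subspace_gen_eigenspace[OF assms(1)]] by metis
  show "klin_shift f b v \<in> gen_eigenspace f a"
    unfolding klin_shift_def using 2 assms(2) 
    by (intro vec.subspace_diff vec.subspace_scale subspace_gen_eigenspace assms)
qed

lemma gen_eigenspace_funpow_invariant:
  assumes "klin f" "v \<in> gen_eigenspace f a"
  shows "(klin_shift f b ^^ k) v \<in> gen_eigenspace f a"
  by (induction k) (auto intro: assms gen_eigenspace_invariant)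

text \<open>For one step: a vector killed by f - b is an eigenvector for b, so f - a multiplies it
  by the nonzero scalar b - a and no power of f - a can kill it. Powers reduce to one step because f
  - b preserves the generalised eigenspace of a.\<close>

lemma gen_eigenspace_shift_inj:
  assumes f: "klin f" and v: "v \<in> gen_eigenspace f a" and ab: "a \<noteq> b"
    and 0: "(klin_shift f b ^^ k) v = 0"
  shows "v = 0"
proof -
  have one: "v = 0" if v: "v \<in> gen_eigenspace f a" and 0: "klin_shift f b v = 0" for v
  proof -
    have fv: "f v = b *s v" using 0 by (simp add: klin_shift_def)
    then have "klin_shift f a v = (b - a) *s v" by (simp add: klin_shift_def vector_sub_rdistrib)
    then have "(klin_shift f a ^^ k) v = (b - a) ^ k *s v" for k
    proof (induction k)
      case (Suc k)
      have "(klin_shift f a ^^ Suc k) v = klin_shift f a ((b - a) ^ k *s v)" using Suc by simp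
      also have "\<dots> = (b - a) ^ k *s ((b - a) *s v)"
        unfolding klin_scale[OF klin_shift_klin[OF f]] using \<open>klin_shift f a v = _\<close> by simp
      finally show ?case by (simp only: vec.scale_scale power_Suc2)
    qed simp
    with v ab show ?thesis by (auto simp: gen_eigenspace_def)
  qed
  show ?thesis using 0
  proof (induction k)
    case (Suc k)
    then have "(klin_shift f b ^^ k) v = 0"
      using one[OF gen_eigenspace_funpow_invariant[OF f v]] by simp
    then show ?case by (rule Suc)
  qed simp
qed

text \<open>A power of f - a kills the summand of a and keeps the others in their generalised
  eigenspaces, so induction applies to a sum with one eigenvalue fewer; injectivity of f - a there
  brings the vanishing back to the original summands.\<close>

lemma gen_eigenspace_independent:
  assumes f: "klin f" and "finite M" "\<And>a. a \<in> M \<Longrightarrow> v a \<in> gen_eigenspace f a"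
    and "(\<Sum>a\<in>M. v a) = 0" "b \<in> M"
  shows "v b = 0"
  using assms(2-)
proof (induction M arbitrary: v b rule: finite_induct)
  case (insert a M)
  let ?g = "klin_shift f a"
  have g: "klin ?g" using f by (rule klin_shift_klin)
  obtain k where k: "(?g ^^ k) (v a) = 0" using insert.prems(1)[of a] by (auto simp: gen_eigenspace_def)
  have "(?g ^^ k) (\<Sum>c\<in>insert a M. v c) = 0" using insert.prems by (simp add: klin_0[OF klin_funpow[OF g]])
  then have "(\<Sum>c\<in>insert a M. (?g ^^ k) (v c)) = 0" by (simp add: klin_sum[OF klin_funpow[OF g]])
  then have s: "(\<Sum>c\<in>M. (?g ^^ k) (v c)) = 0" using insert.hyps k by simp
  have "(?g ^^ k) (v c) = 0" if "c \<in> M" for c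
    by (rule insert.IH[of "\<lambda>c. (?g ^^ k) (v c)"]) (auto intro!: gen_eigenspace_funpow_invariant f insert.prems s that)
  then have z: "v c = 0" if "c \<in> M" for c
    using that gen_eigenspace_shift_inj[OF f insert.prems(1)[of c]] insert.hyps by (metis insertCI)
  then have "v a = 0" using insert.prems insert.hyps by simp
  with z insert.prems show ?case by auto
qed auto

subsection \<open>Over the complex numbers the generalised eigenspaces span\<close>

text \<open>On the generalised eigenspace of a, f - b is the nonzero scalar a - b plus the nilpotent
  f - a. Recursion on the nilpotency exponent replaces a geometric series: if (f - b) u = (f - a) w,
  then (f - b) (w - u) = (a - b) w.\<close>

lemma gen_eigenspace_shift_surj:
  assumes f: "klin f" and w: "w \<in> gen_eigenspace f a" and ab: "a \<noteq> b"
  shows "\<exists>u\<in>gen_eigenspace f a. klin_shift f b u = w"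
proof -
  have "(klin_shift f a ^^ k) w = 0 \<Longrightarrow> w \<in> gen_eigenspace f a \<Longrightarrow>
     \<exists>u\<in>gen_eigenspace f a. klin_shift f b u = w" for k w
  proof (induction k arbitrary: w)
    case 0 then show ?case
      by (intro bexI[of _ 0]) (auto simp: klin_shift_def klin_0[OF f])
  next
    case (Suc k)
    have "\<exists>u\<in>gen_eigenspace f a. klin_shift f b u = klin_shift f a w"
      using Suc.prems by (intro Suc.IH gen_eigenspace_invariant(1)[OF f]) (simp_all add: funpow_swap1)
    then obtain u where u: "u \<in> gen_eigenspace f a" "klin_shift f b u = klin_shift f a w"
      by blast
    let ?u = "(1 / (a - b)) *s (w - u)"
    have "klin_shift f b (w - u) = (a - b) *s w"
      using u(2) by (simp add: klin_diff[OF klin_shift_klin[OF f]]) (simp add: klin_shift_def vector_sub_rdistrib)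
    then have "klin_shift f b ?u = (1 / (a - b)) *s ((a - b) *s w)"
      by (simp only: klin_scale[OF klin_shift_klin[OF f]])
    then have "klin_shift f b ?u = w" using ab by (simp add: vec.scale_scale)
    moreover have "?u \<in> gen_eigenspace f a"
      using u Suc.prems by (intro vec.subspace_scale vec.subspace_diff subspace_gen_eigenspace f)
    ultimately show ?case by blast
  qed
  then show ?thesis using w by (auto simp: gen_eigenspace_def)
qed

definition poly_apply :: "('k::field ^ 'n \<Rightarrow> 'k ^ 'n) \<Rightarrow> 'k poly \<Rightarrow> 'k ^ 'n \<Rightarrow> 'k ^ 'n" where
  "poly_apply f p v = (\<Sum>i\<le>degree p. coeff p i *s (f ^^ i) v)"

lemma poly_apply_le:
  assumes "degree p \<le> N" shows "poly_apply f p v = (\<Sum>i\<le>N. coeff p i *s (f ^^ i) v)"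
  unfolding poly_apply_def using assms
  by (intro sum.mono_neutral_left) (auto simp: coeff_eq_0)

lemma poly_apply_linear_factor:
  assumes f: "klin f"
  shows "poly_apply f ([:- a, 1:] * q) v = poly_apply f q (klin_shift f a v)"
proof -
  let ?N = "degree q"
  have d: "degree ([:- a, 1:] * q) \<le> Suc ?N"
    using degree_mult_le[of "[:- a, 1:]" q] by simp
  have pow: "(f ^^ i) (klin_shift f a v) = (f ^^ Suc i) v - a *s (f ^^ i) v" for i
    unfolding klin_shift_def klin_diff[OF klin_funpow[OF f]] klin_scale[OF klin_funpow[OF f]]
    by (simp add: funpow_swap1)
  have c: "coeff ([:- a, 1:] * q) i = coeff (pCons 0 q) i - a * coeff q i" for i
    by simp
  have "poly_apply f ([:- a, 1:] * q) v
    = (\<Sum>i\<le>Suc ?N. coeff (pCons 0 q) i *s (f ^^ i) v) - (\<Sum>i\<le>Suc ?N. (a * coeff q i) *s (f ^^ i) v)"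
    unfolding poly_apply_le[OF d] c vector_sub_rdistrib sum_subtractf ..
  also have "(\<Sum>i\<le>Suc ?N. coeff (pCons 0 q) i *s (f ^^ i) v) = (\<Sum>i\<le>?N. coeff q i *s (f ^^ Suc i) v)"
    by (subst sum.atMost_Suc_shift) simp
  also have "(\<Sum>i\<le>Suc ?N. (a * coeff q i) *s (f ^^ i) v) = (\<Sum>i\<le>?N. (a * coeff q i) *s (f ^^ i) v)"
    by (simp add: coeff_eq_0)
  also have "(\<Sum>i\<le>?N. coeff q i *s (f ^^ Suc i) v) - (\<Sum>i\<le>?N. (a * coeff q i) *s (f ^^ i) v)
     = poly_apply f q (klin_shift f a v)"
    unfolding poly_apply_def pow vector_ssub_ldistrib sum_subtractf
    by (simp add: mult.commute)
  finally show ?thesis .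
qed

text \<open>In dimension n the n + 1 iterates of v up to f^n v satisfy a linear relation. Dependence
  is a property of a set, so a repetition among the iterates is treated separately and yields a
  difference of two monomials.\<close>

lemma ex_poly_apply_zero:
  fixes f :: "'k::field ^ 'n::finite \<Rightarrow> 'k ^ 'n"
  shows "\<exists>p. p \<noteq> 0 \<and> poly_apply f p v = 0"
proof (cases "inj_on (\<lambda>i. (f ^^ i) v) {..CARD('n)}")
  case True
  let ?S = "(\<lambda>i. (f ^^ i) v) ` {..CARD('n)}"
  have "card ?S = Suc CARD('n)" using True by (simp add: card_image)
  then have "vec.dependent ?S"
    using vec.independent_card_le_dim[of ?S UNIV] by (auto simp: vec.dim_UNIV card_cart_basis)
  then obtain u where u: "\<exists>w\<in>?S. u w \<noteq> 0" "(\<Sum>w\<in>?S. u w *s w) = 0"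
    using vec.dependent_finite[of ?S] by auto
  define p where "p = Abs_poly (\<lambda>i. if i \<le> CARD('n) then u ((f ^^ i) v) else 0)"
  have cp: "coeff p = (\<lambda>i. if i \<le> CARD('n) then u ((f ^^ i) v) else 0)"
    unfolding p_def by (rule coeff_Abs_poly[of "CARD('n)"]) simp
  have "degree p \<le> CARD('n)" by (rule degree_le) (simp add: cp)
  then have "poly_apply f p v = (\<Sum>i\<le>CARD('n). u ((f ^^ i) v) *s (f ^^ i) v)"
    by (simp add: poly_apply_le cp)
  also have "\<dots> = 0" using u(2) True by (simp add: sum.reindex)
  moreover have "p \<noteq> 0" using u(1) cp by (auto simp: poly_eq_iff)
  ultimately show ?thesis by auto
next
  case False
  then obtain i j where ij: "i < j" "(f ^^ i) v = (f ^^ j) v"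
    unfolding inj_on_def by (metis nat_neq_iff)
  let ?p = "monom 1 i - monom 1 j :: 'k poly"
  have "degree ?p \<le> j" using ij by (intro degree_diff_le) (auto intro: order.trans[OF degree_monom_le])
  then have "poly_apply f ?p v = (\<Sum>k\<le>j. (if k = i then (f ^^ k) v else 0) - (if k = j then (f ^^ k) v else 0))"
    by (simp add: poly_apply_le, intro sum.cong) (auto simp: vector_sub_rdistrib)
  also have "\<dots> = 0" using ij by (simp add: sum_subtractf)
  finally have "poly_apply f ?p v = 0" .
  moreover have "coeff ?p i = 1" using ij by simp
  then have "?p \<noteq> 0" by (metis coeff_0 zero_neq_one)
  ultimately show ?thesis by blast
qed

text \<open>Roots are stripped off a polynomial that annihilates v. For a root b, induction puts (f
  - b) v into the span; correcting v by some u of the span leaves (f - b) (v - u) in the generalised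
  eigenspace of b, hence v - u as well.\<close>

lemma gen_eigenspaces_span:
  fixes f :: "complex ^ 'n::finite \<Rightarrow> complex ^ 'n"
  assumes f: "klin f"
  shows "v \<in> vec.span (\<Union>a. gen_eigenspace f a)"
proof -
  let ?G = "vec.span (\<Union>a. gen_eigenspace f a)"
  have sub: "gen_eigenspace f a \<subseteq> ?G" for a
    by (rule order_trans[OF UN_upper[OF UNIV_I] vec.span_superset])
  \<comment> \<open>Modulo the generalised eigenspace of b, f - b maps the span onto itself: it is
    onto on every other generalised eigenspace, and for a summand belonging to b itself the choice 0
    is good enough.\<close>
  have solve: "\<exists>u\<in>?G. w - klin_shift f b u \<in> gen_eigenspace f b" if "w \<in> ?G" for w b
    using that
  proof (induction rule: vec.span_induct_alt)
    case base show ?case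
      by (rule bexI[of _ 0]) (auto simp: klin_0[OF klin_shift_klin[OF f]] vec.span_zero
          vec.subspace_0[OF subspace_gen_eigenspace[OF f]])
  next
    case (step c x y)
    then obtain a u where a: "x \<in> gen_eigenspace f a" and u: "u \<in> ?G" "y - klin_shift f b u \<in> gen_eigenspace f b"
      by auto
    obtain t where t: "t \<in> ?G" "x - klin_shift f b t \<in> gen_eigenspace f b"
    proof (cases "a = b")
      case True
      with a show ?thesis
        by (intro that[of 0]) (auto simp: klin_0[OF klin_shift_klin[OF f]] vec.span_zero)
    next
      case False
      then obtain t where "t \<in> gen_eigenspace f a" "klin_shift f b t = x"
        using gen_eigenspace_shift_surj[OF f a] by auto
      then show ?thesis using sub
        by (intro that[of t]) (auto simp: vec.subspace_0[OF subspace_gen_eigenspace[OF f]])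
    qed
    have eq: "c *s x + y - klin_shift f b (c *s t + u)
      = c *s (x - klin_shift f b t) + (y - klin_shift f b u)"
      by (simp add: klin_add[OF klin_shift_klin[OF f]] klin_scale[OF klin_shift_klin[OF f]] vector_ssub_ldistrib)
    have "c *s t + u \<in> ?G" by (intro vec.span_add vec.span_scale t u)
    moreover have "c *s x + y - klin_shift f b (c *s t + u) \<in> gen_eigenspace f b"
      unfolding eq by (intro vec.subspace_add vec.subspace_scale subspace_gen_eigenspace f t u)
    ultimately show ?case by blast
  qed
  have "v \<in> ?G" if "p \<noteq> 0" "poly_apply f p v = 0" for p v
    using that
  proof (induction "degree p" arbitrary: p v)
    case 0
    then show ?case by (auto simp: poly_apply_def vec.span_zero elim!: degree_eq_zeroE)
  next
    case (Suc d)
    obtain b where "poly p b = 0"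
      using fundamental_theorem_of_algebra[of p] Suc.hyps(2) by (metis constant_degree Zero_not_Suc)
    then obtain q where p: "p = [:- b, 1:] * q" by (auto simp: poly_eq_0_iff_dvd)
    then have "q \<noteq> 0" "degree q = d"
      using Suc by (auto simp: degree_mult_eq simp del: mult_pCons_left)
    moreover have "poly_apply f q (klin_shift f b v) = 0"
      using Suc.prems(2) unfolding p poly_apply_linear_factor[OF f] .
    ultimately have "klin_shift f b v \<in> ?G" using Suc.hyps(1) by auto
    then obtain u where u: "u \<in> ?G" "klin_shift f b (v - u) \<in> gen_eigenspace f b"
      using solve[of "klin_shift f b v" b] by (auto simp: klin_diff[OF klin_shift_klin[OF f]])
    then obtain k where "(klin_shift f b ^^ k) (klin_shift f b (v - u)) = 0"
      unfolding gen_eigenspace_def by blast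
    then have "(klin_shift f b ^^ Suc k) (v - u) = 0" by (simp add: funpow_swap1)
    then have "v - u \<in> gen_eigenspace f b" unfolding gen_eigenspace_def by blast
    then have "v - u \<in> ?G" using sub by auto
    then show ?case using vec.span_add[OF u(1)] by fastforce
  qed
  then show ?thesis using ex_poly_apply_zero[of f v] by blast
qed

lemma klin_nilpotent_uniform:
  fixes f :: "'k::field ^ 'n::finite \<Rightarrow> 'k ^ 'n"
  assumes f: "klin f" and B: "finite B" "vec.span B = UNIV" and nil: "\<And>b. b \<in> B \<Longrightarrow> \<exists>k. (f ^^ k) b = 0"
  shows "\<exists>k. \<forall>v. (f ^^ k) v = 0"
proof -
  obtain k where k: "\<And>b. b \<in> B \<Longrightarrow> (f ^^ k b) b = 0" using nil by metis
  let ?K = "Max (insert 0 (k ` B))"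
  have "(f ^^ ?K) b = 0" if "b \<in> B" for b
    using klin_funpow_zero_mono[OF f k[OF that]] that B by simp
  then have "(f ^^ ?K) v = 0" for v
    using klin_eq_on_span[OF klin_funpow[OF f] klin_const0, of B ?K v] B by auto
  then show ?thesis by blast
qed

text \<open>The basis is extracted from the union of the generalised eigenspaces, so each of its
  vectors carries an eigenvalue \<open>ev b\<close>, and operators can be prescribed eigenvalue by
  eigenvalue.\<close>

lemma gen_eigenspace_basis:
  fixes f :: "complex ^ 'n::finite \<Rightarrow> complex ^ 'n"
  assumes f: "klin f"
  shows "\<exists>B ev. finite B \<and> \<not> vec.dependent B \<and> vec.span B = UNIV \<and> (\<forall>b\<in>B. b \<in> gen_eigenspace f (ev b))"
proof -
  obtain B where B: "B \<subseteq> (\<Union>a. gen_eigenspace f a)" "\<not> vec.dependent B"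
    "(\<Union>a. gen_eigenspace f a) \<subseteq> vec.span B"
    using vec.maximal_independent_subset by blast
  have "vec.span (\<Union>a. gen_eigenspace f a) \<subseteq> vec.span B"
    using B(3) by (metis vec.span_mono vec.span_span)
  then have span: "vec.span B = UNIV" using gen_eigenspaces_span[OF f] by auto
  have "\<forall>b\<in>B. \<exists>a. b \<in> gen_eigenspace f a" using B(1) by auto
  then obtain ev where "\<And>b. b \<in> B \<Longrightarrow> b \<in> gen_eigenspace f (ev b)" by metis
  with B span show ?thesis using vec.finiteI_independent[OF B(2)] by blast
qed

text \<open>\<open>\<phi> = id\<close> gives the semisimple part of \<open>f\<close>; \<open>\<phi> = cnj\<close> makes \<open>tr (T \<circ> f)\<close> the sum of the
  \<open>\<bar>a\<bar>\<^sup>2\<close> over the eigenvalues, which gives Cartan's criterion.\<close>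

definition eigen_operator ::
    "(complex \<Rightarrow> complex) \<Rightarrow> (complex ^ 'n \<Rightarrow> complex ^ 'n) \<Rightarrow> (complex ^ 'n \<Rightarrow> complex ^ 'n) \<Rightarrow> bool"
  where "eigen_operator \<phi> f T \<longleftrightarrow> klin T \<and> (\<forall>a. \<forall>v\<in>gen_eigenspace f a. T v = \<phi> a *s v)"

text \<open>T is prescribed on a basis of generalised eigenvectors. What needs an argument is that
  it acts as \<phi> a on the whole generalised eigenspace of a, also off the basis: when the
  expansion of such a vector is grouped by eigenvalue, independence leaves only the group of
  a.\<close>

lemma ex_eigen_operator:
  fixes f :: "complex ^ 'n::finite \<Rightarrow> complex ^ 'n"
  assumes f: "klin f"
  shows "\<exists>T. eigen_operator \<phi> f T"
proof -
  obtain B ev where B: "finite B" "\<not> vec.dependent B" "vec.span B = UNIV"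
    and ev: "\<And>b. b \<in> B \<Longrightarrow> b \<in> gen_eigenspace f (ev b)" using gen_eigenspace_basis[OF f] by blast
  let ?r = "vec.representation B"
  define T where "T v = (\<Sum>b\<in>B. (\<phi> (ev b) * ?r v b) *s b)" for v
  have "klin T"
    by (rule klinI) (simp_all add: T_def vec.representation_add vec.representation_scale B distrib_left
        vector_sadd_rdistrib sum.distrib vec.scale_sum_right mult.left_commute)
  moreover have "T v = \<phi> a *s v" if v: "v \<in> gen_eigenspace f a" for a v
  proof -
    define w where "w c = (\<Sum>b\<in>{b\<in>B. ev b = c}. ?r v b *s b)" for c
    define u where "u c = w c - (if c = a then v else 0)" for c
    \<comment> \<open>Inserting a covers the case that no basis vector has eigenvalue a;
      independence then forces v = 0.\<close>
    let ?M = "insert a (ev ` B)"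
    have w: "w c \<in> gen_eigenspace f c" for c
      unfolding w_def by (intro vec.subspace_sum vec.subspace_scale subspace_gen_eigenspace f) (use ev in auto)
    have "sum w ?M = (\<Sum>b\<in>B. ?r v b *s b)"
      unfolding w_def using B by (intro sum.group) auto
    also have "\<dots> = v" using B by (intro vec.sum_representation_eq) auto
    finally have "sum u ?M = 0" unfolding u_def by (simp add: sum_subtractf B)
    moreover have "u c \<in> gen_eigenspace f c" for c
      unfolding u_def using w v vec.subspace_0[OF subspace_gen_eigenspace[OF f]]
      by (auto intro!: vec.subspace_diff subspace_gen_eigenspace f)
    ultimately have u0: "u c = 0" if "c \<in> ?M" for c
      using gen_eigenspace_independent[OF f, of ?M u c] B that by blast
    have "T v = (\<Sum>c\<in>?M. \<Sum>b\<in>{b\<in>B. ev b = c}. (\<phi> (ev b) * ?r v b) *s b)"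
      unfolding T_def using B by (intro sum.group[symmetric]) auto
    also have "\<dots> = (\<Sum>c\<in>?M. \<phi> c *s w c)"
      unfolding w_def vec.scale_sum_right by (intro sum.cong) auto
    also have "\<dots> = (\<Sum>c\<in>?M. if c = a then \<phi> a *s v else 0)"
      using u0 unfolding u_def by (intro sum.cong) auto
    also have "\<dots> = \<phi> a *s v" using B by simp
    finally show ?thesis .
  qed
  ultimately show ?thesis unfolding eigen_operator_def by blast
qed

text \<open>T is diagonal in a basis of generalised eigenvectors, so a vector it kills has nonzero
  coordinates only at basis vectors with \<open>ev b\<close> = 0.\<close>

lemma eigen_operator_ker:
  fixes f :: "complex ^ 'n::finite \<Rightarrow> complex ^ 'n"
  assumes f: "klin f" and T: "eigen_operator (\<lambda>z. z) f T"
  shows "T v = 0 \<longleftrightarrow> v \<in> gen_eigenspace f 0"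
proof
  assume "v \<in> gen_eigenspace f 0" then show "T v = 0" using T by (auto simp: eigen_operator_def)
next
  assume T0: "T v = 0"
  obtain B ev where B: "finite B" "\<not> vec.dependent B" "vec.span B = UNIV"
    and ev: "\<And>b. b \<in> B \<Longrightarrow> b \<in> gen_eigenspace f (ev b)" using gen_eigenspace_basis[OF f] by blast
  let ?r = "vec.representation B v"
  have kT: "klin T" and Tb: "\<And>b. b \<in> B \<Longrightarrow> T b = ev b *s b"
    using T ev by (auto simp: eigen_operator_def)
  have v: "v = (\<Sum>b\<in>B. ?r b *s b)" using B by (intro vec.sum_representation_eq[symmetric]) auto
  have "0 = T (\<Sum>b\<in>B. ?r b *s b)" using T0 v by simp
  also have "\<dots> = (\<Sum>b\<in>B. (?r b * ev b) *s b)"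
    unfolding klin_sum[OF kT] using Tb by (intro sum.cong) (auto simp: klin_scale[OF kT])
  finally have "?r b * ev b = 0" if "b \<in> B" for b
    using that B vec.independentD[of B B "\<lambda>b. ?r b * ev b" b] by auto
  then have z: "?r b = 0 \<or> ev b = 0" if "b \<in> B" for b using that by auto
  have "?r b *s b \<in> gen_eigenspace f 0" if "b \<in> B" for b
    using z[OF that]
  proof
    assume "?r b = 0"
    then show ?thesis by (simp add: vec.subspace_0[OF subspace_gen_eigenspace[OF f]])
  next
    assume "ev b = 0"
    then show ?thesis using ev[OF that] by (intro vec.subspace_scale subspace_gen_eigenspace f) simp
  qed
  then show "v \<in> gen_eigenspace f 0"
    by (subst v) (intro vec.subspace_sum subspace_gen_eigenspace f)
qed

section \<open>Traces\<close>

text \<open>The coordinate vectors are expanded in B and two sums are swapped; no matrix of a change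
  of basis or its inverse occurs.\<close>

lemma trace_basis:
  fixes f :: "'k::field ^ 'n::finite \<Rightarrow> 'k ^ 'n"
  assumes f: "klin f" and B: "\<not> vec.dependent B" "vec.span B = UNIV"
  shows "trace (matrix f) = (\<Sum>b\<in>B. vec.representation B (f b) b)"
proof -
  let ?r = "vec.representation B"
  have fin: "finite B" using B vec.finiteI_independent by blast
  have ax: "f (axis i 1) = (\<Sum>b\<in>B. ?r (axis i 1) b *s f b)" for i :: 'n
  proof -
    have "f (axis i 1) = f (\<Sum>b\<in>B. ?r (axis i 1) b *s b)"
      using B fin by (subst vec.sum_representation_eq) auto
    then show ?thesis by (simp add: klin_sum[OF f] klin_scale[OF f])
  qed
  have rep: "?r v b = (\<Sum>i\<in>UNIV. v $ i * ?r (axis i 1) b)" for v :: "'k ^ 'n" and b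
  proof -
    have "v = (\<Sum>i\<in>UNIV. v $ i *s axis i 1)" by (simp add: basis_expansion)
    then have "?r v b = ?r (\<Sum>i\<in>UNIV. v $ i *s axis i 1) b" by simp
    also have "\<dots> = (\<Sum>i\<in>UNIV. v $ i * ?r (axis i 1) b)"
      using B by (simp add: vec.representation_sum vec.representation_scale)
    finally show ?thesis .
  qed
  have "trace (matrix f) = (\<Sum>i\<in>UNIV. f (axis i 1) $ i)" by (simp add: trace_def matrix_def)
  also have "\<dots> = (\<Sum>i\<in>UNIV. \<Sum>b\<in>B. f b $ i * ?r (axis i 1) b)"
    by (subst ax) (simp add: mult.commute)
  also have "\<dots> = (\<Sum>b\<in>B. ?r (f b) b)" by (subst sum.swap) (simp add: rep[symmetric])
  finally show ?thesis .
qed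

text \<open>The basis is built along the flag of the kernels of the powers of f. Since f sends each
  kernel into the span of the vectors chosen at the stage before, the image of a new vector has no
  component along it, and the diagonal entries of the old vectors do not change.\<close>

lemma trace_nilpotent:
  fixes f :: "'k::field ^ 'n::finite \<Rightarrow> 'k ^ 'n"
  assumes f: "klin f" and nil: "\<And>v. (f ^^ k) v = 0"
  shows "trace (matrix f) = 0"
proof -
  have "\<exists>B. \<not> vec.dependent B \<and> vec.span B = {v. (f ^^ j) v = 0} \<and> (\<forall>b\<in>B. vec.representation B (f b) b = 0)" for j
  proof (induction j)
    case 0 show ?case by (intro exI[of _ "{}"]) (auto simp: vec.dependent_def)
  next
    case (Suc j)
    then obtain B where B: "\<not> vec.dependent B" "vec.span B = {v. (f ^^ j) v = 0}"
      "\<And>b. b \<in> B \<Longrightarrow> vec.representation B (f b) b = 0" by blast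
    let ?V = "{v. (f ^^ Suc j) v = 0}"
    have sub: "vec.subspace ?V"
      unfolding vec.subspace_def
      by (auto simp: klin_0[OF f] klin_0[OF klin_funpow[OF f]] klin_add[OF f] klin_add[OF klin_funpow[OF f]]
          klin_scale[OF f] klin_scale[OF klin_funpow[OF f]])
    have fV: "f v \<in> vec.span B" if "v \<in> ?V" for v
      using that unfolding B(2) by (simp add: funpow_swap1)
    have "B \<subseteq> ?V" using B(2) vec.span_superset[of B] by (auto simp: klin_0[OF f])
    then obtain C where C: "B \<subseteq> C" "C \<subseteq> ?V" "\<not> vec.dependent C" "?V \<subseteq> vec.span C"
      using vec.maximal_independent_subset_extend[OF _ B(1)] by blast
    have "vec.span C = ?V" using C sub by (metis vec.span_minimal subset_antisym)
    moreover have "vec.representation C (f b) b = 0" if b: "b \<in> C" for b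
    proof -
      have "vec.representation C (f b) = vec.representation B (f b)"
        using C b fV by (intro vec.representation_extend) auto
      then show ?thesis using B(3) vec.representation_ne_zero[of B "f b" b] by (cases "b \<in> B") auto
    qed
    ultimately show ?case using C by blast
  qed
  from this[of k] obtain B where "\<not> vec.dependent B" "vec.span B = UNIV" 
      "\<And>b. b \<in> B \<Longrightarrow> vec.representation B (f b) b = 0" using nil by auto
  then show ?thesis using trace_basis[OF f] by simp
qed

text \<open>Compare f with its semisimple part S. On the generalised eigenspace of a, T (f - S) is
  cnj a times the nilpotent f - a, so it has trace 0, while T S is diagonal with entries cnj a a.
  Hence tr (T f) is a sum of squared moduli and vanishes only if all eigenvalues do.\<close>

lemma eigenvalues_zero_if_trace_zero:
  fixes f :: "complex ^ 'n::finite \<Rightarrow> complex ^ 'n"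
  assumes f: "klin f" and T: "eigen_operator cnj f T" and tr: "trace (matrix T ** matrix f) = 0"
  shows "v \<in> gen_eigenspace f 0"
proof -
  obtain B ev where B: "finite B" "\<not> vec.dependent B" "vec.span B = UNIV"
    and ev: "\<And>b. b \<in> B \<Longrightarrow> b \<in> gen_eigenspace f (ev b)" using gen_eigenspace_basis[OF f] by blast
  obtain S where S: "eigen_operator (\<lambda>z. z) f S" using ex_eigen_operator[OF f] by blast
  have kT: "klin T" and kS: "klin S" using S T by (auto simp: eigen_operator_def)
  define N where "N v = T (f v - S v)" for v
  have kN: "klin N" unfolding N_def by (intro klin_compose[OF kT] klin_minus_fun f kS)
  have N: "N v = cnj a *s klin_shift f a v" if "v \<in> gen_eigenspace f a" for v a
  proof -
    have "f v - S v = klin_shift f a v" using S that by (auto simp: eigen_operator_def klin_shift_def)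
    then show ?thesis using T gen_eigenspace_invariant(1)[OF f that, of a] by (auto simp: N_def eigen_operator_def)
  qed
  have "\<exists>k. (N ^^ k) b = 0" if "b \<in> B" for b
  proof -
    let ?a = "ev b"
    have "(N ^^ k) b = cnj ?a ^ k *s (klin_shift f ?a ^^ k) b" for k
    proof (induction k)
      case (Suc k)
      have "(N ^^ Suc k) b = cnj ?a ^ k *s N ((klin_shift f ?a ^^ k) b)"
        using Suc by (simp add: klin_scale[OF kN])
      also have "\<dots> = cnj ?a ^ k *s (cnj ?a *s (klin_shift f ?a ^^ Suc k) b)"
        by (subst N[OF gen_eigenspace_funpow_invariant[OF f ev[OF that]]]) simp
      finally show ?case by (simp only: vec.scale_scale power_Suc2)
    qed simp
    with ev[OF that] show ?thesis by (auto simp: gen_eigenspace_def) 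
  qed
  then obtain k where "\<And>v. (N ^^ k) v = 0"
    using klin_nilpotent_uniform[OF kN B(1,3)] by blast
  then have trN: "trace (matrix N) = 0" by (rule trace_nilpotent[OF kN])
  have kTS: "klin (\<lambda>v. T (S v))" by (rule klin_compose[OF kT kS])
  have TSb: "T (S b) = (cnj (ev b) * ev b) *s b" if "b \<in> B" for b
  proof -
    have "S b = ev b *s b" "T b = cnj (ev b) *s b"
      using S T ev[OF that] unfolding eigen_operator_def by blast+
    then show ?thesis by (simp add: klin_scale[OF kT] mult.commute)
  qed
  have "trace (matrix (\<lambda>v. T (S v))) = (\<Sum>b\<in>B. cnj (ev b) * ev b)"
    unfolding trace_basis[OF kTS B(2,3)]
    by (intro sum.cong refl) (simp add: TSb vec.representation_scale B vec.representation_basis)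
  also have "\<dots> = of_real (\<Sum>b\<in>B. (cmod (ev b))\<^sup>2)"
    by (simp only: of_real_sum complex_norm_square mult.commute)
  finally have trTS: "trace (matrix (\<lambda>v. T (S v))) = of_real (\<Sum>b\<in>B. (cmod (ev b))\<^sup>2)" .
  have "matrix T ** matrix f = matrix (\<lambda>v. T (f v))" by (rule matrix_compose_klin[OF kT f, symmetric])
  also have "\<dots> = matrix (\<lambda>v. N v + T (S v))" by (simp add: N_def klin_diff[OF kT])
  also have "\<dots> = matrix N + matrix (\<lambda>v. T (S v))" by (simp add: matrix_def vec_eq_iff)
  finally have "of_real (\<Sum>b\<in>B. (cmod (ev b))\<^sup>2) = (0 :: complex)"
    using tr trN trTS by (simp add: trace_add)
  then have "(\<Sum>b\<in>B. (cmod (ev b))\<^sup>2) = 0" by (simp only: of_real_eq_0_iff)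
  then have "ev b = 0" if "b \<in> B" for b using that B by (simp add: sum_nonneg_eq_0_iff)
  then have "B \<subseteq> gen_eigenspace f 0" using ev by fastforce
  then have "vec.span B \<subseteq> gen_eigenspace f 0" by (intro vec.span_minimal subspace_gen_eigenspace f)
  then show ?thesis using B by auto
qed

section \<open>Lie algebras\<close>

lemma matrix_mult_diff:
  fixes A :: "'k::comm_ring_1 ^ 'n::finite ^ 'm"
  shows "A ** (B - C) = A ** B - A ** C" "(B' - C') ** A = B' ** A - C' ** A"
  by (simp_all add: matrix_matrix_mult_def vec_eq_iff algebra_simps sum_subtractf)

locale lie_alg =
  fixes br :: "('k::field, 'n::finite) bracket"
  assumes lie: "lie_algebra br"
begin

lemma klin_br: "klin (br x)" and klin_br_left: "klin (\<lambda>x. br x y)"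
  using lie by (auto simp: lie_algebra_def klin_iff)

lemma br_self [simp]: "br x x = 0"
  using lie by (auto simp: lie_algebra_def)

lemma br_add: "br x (y + z) = br x y + br x z" and br_add_left: "br (x + y) z = br x z + br y z"
  and br_scale: "br x (c *s y) = c *s br x y" and br_scale_left: "br (c *s x) y = c *s br x y"
  and br_zero [simp]: "br x 0 = 0" "br 0 x = 0"
  and br_diff: "br x (y - z) = br x y - br x z" and br_diff_left: "br (x - y) z = br x z - br y z"
  and br_minus: "br x (- y) = - br x y" and br_minus_left: "br (- x) y = - br x y"
  by (rule klin_add[OF klin_br] klin_add[OF klin_br_left] klin_scale[OF klin_br] klin_scale[OF klin_br_left]
    klin_0[OF klin_br] klin_0[OF klin_br_left] klin_diff[OF klin_br] klin_diff[OF klin_br_left] 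
    klin_minus[OF klin_br] klin_minus[OF klin_br_left])+

lemma br_anti: "br x y = - br y x"
proof -
  have "0 = br (x + y) (x + y)" by simp
  also have "\<dots> = br x y + br y x" unfolding br_add br_add_left by simp
  finally show ?thesis by (simp add: eq_neg_iff_add_eq_0)
qed

lemma jacobi: "br x (br y z) = br (br x y) z + br y (br x z)"
proof -
  have "br x (br y z) + br y (br z x) + br z (br x y) = 0" using lie by (simp add: lie_algebra_def)
  moreover have "br z (br x y) = - br (br x y) z" by (rule br_anti)
  moreover have "br y (br z x) = - br y (br x z)" by (subst br_anti[of z x]) (rule br_minus)
  ultimately show ?thesis by (simp add: algebra_simps)
qed

text \<open>The shift by a + b obeys a Leibniz rule with the shifts by a and b on the two factors.
  Each application lowers one of the exponents k and l, so k + l applications kill every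
  term.\<close>

lemma gen_eigenspace_br:
  assumes u: "u \<in> gen_eigenspace (br x) a" and v: "v \<in> gen_eigenspace (br x) b"
  shows "br u v \<in> gen_eigenspace (br x) (a + b)"
proof -
  let ?s = "klin_shift (br x)"
  have ks: "klin (?s c)" for c by (intro klin_shift_klin klin_br)
  have step: "?s (a + b) (br u v) = br (?s a u) v + br u (?s b v)" for u v
    unfolding klin_shift_def jacobi[of x u v] by (simp add: br_diff br_diff_left br_scale br_scale_left vector_sadd_rdistrib)
  have "(?s a ^^ k) u = 0 \<Longrightarrow> (?s b ^^ l) v = 0 \<Longrightarrow> (?s (a + b) ^^ (k + l)) (br u v) = 0" for k l u v
  proof (induction "k + l" arbitrary: k l u v)
    case (Suc N)
    have red: "(?s (a + b) ^^ (k + l)) (br u v) = (?s (a + b) ^^ N) (br (?s a u) v) + (?s (a + b) ^^ N) (br u (?s b v))"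
      unfolding Suc.hyps(2)[symmetric] funpow_Suc_right comp_apply step klin_add[OF klin_funpow[OF ks]] ..
    show ?case
    proof (cases k; cases l)
      fix k' l' assume kl: "k = Suc k'" "l = Suc l'"
      have "(?s (a + b) ^^ (k' + l)) (br (?s a u) v) = 0"
        using Suc kl by (intro Suc.hyps(1)) (auto simp: funpow_swap1)
      moreover have "(?s (a + b) ^^ (k + l')) (br u (?s b v)) = 0"
        using Suc kl by (intro Suc.hyps(1)) (auto simp: funpow_swap1)
      ultimately show ?thesis unfolding red using Suc.hyps(2) kl by (simp del: funpow.simps)
    qed (use Suc.prems in \<open>auto simp: klin_0[OF klin_funpow[OF ks]] klin_0[OF ks]\<close>)
  qed simp
  then show ?thesis using u v unfolding gen_eigenspace_def by blast
qed

definition derivation :: "('k ^ 'n \<Rightarrow> 'k ^ 'n) \<Rightarrow> bool" where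
  "derivation T \<longleftrightarrow> klin T \<and> (\<forall>u v. T (br u v) = br (T u) v + br u (T v))"

abbreviation ad :: "'k ^ 'n \<Rightarrow> 'k ^ 'n ^ 'n" where "ad x \<equiv> matrix (br x)"

lemma ad_br: "ad (br x y) = ad x ** ad y - ad y ** ad x"
proof -
  have "(ad x ** ad y - ad y ** ad x) *v z = ad (br x y) *v z" for z
    by (simp add: klin_matrix[OF klin_br] matrix_vector_mult_diff_rdistrib matrix_vector_mul_assoc[symmetric] jacobi[of x y z])
  then show ?thesis by (simp add: matrix_eq)
qed

lemma derivation_ad:
  assumes "derivation T" shows "ad (T y) = matrix T ** ad y - ad y ** matrix T"
proof -
  have kT: "klin T" using assms by (simp add: derivation_def)
  have "(matrix T ** ad y - ad y ** matrix T) *v z = ad (T y) *v z" for z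
    using assms by (simp add: derivation_def klin_matrix[OF klin_br] klin_matrix[OF kT] matrix_vector_mult_diff_rdistrib matrix_vector_mul_assoc[symmetric])
  then show ?thesis by (simp add: matrix_eq)
qed

definition killing :: "'k ^ 'n \<Rightarrow> 'k ^ 'n \<Rightarrow> 'k" where
  "killing x y = trace (ad x ** ad y)"

text \<open>From [T, ad y] = ad (T y) and cyclicity of the trace. For the semisimple part of some
  \<open>ad x\<close> it turns the trace functional into the Killing form; for the operator with
  conjugate eigenvalues it drives Cartan's criterion.\<close>

lemma trace_derivation_br:
  assumes "derivation T" shows "trace (matrix T ** ad (br y w)) = killing (T y) w"
proof -
  have "trace (matrix T ** ad (br y w)) = trace (matrix T ** ad y ** ad w) - trace (matrix T ** ad w ** ad y)"
    by (simp add: ad_br matrix_mult_diff trace_sub matrix_mul_assoc)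
  also have "trace (matrix T ** ad w ** ad y) = trace (ad y ** matrix T ** ad w)"
    by (metis matrix_mul_assoc trace_mul_sym)
  finally show ?thesis
    by (simp add: killing_def derivation_ad[OF assms] matrix_mult_diff trace_sub)
qed

lemma killing_sym: "killing x y = killing y x" unfolding killing_def by (rule trace_mul_sym)

lemma ad_add: "ad (x + y) = ad x + ad y" and ad_scale: "ad (c *s x) = (\<chi> i j. c * ad x $ i $ j)"
  by (simp_all add: matrix_def vec_eq_iff br_add_left br_scale_left)

lemma killing_add: "killing x (y + z) = killing x y + killing x z"
  by (simp add: killing_def ad_add matrix_add_ldistrib trace_add)

lemma killing_scale: "killing x (c *s y) = c * killing x y"
  by (simp add: killing_def ad_scale trace_def matrix_matrix_mult_def sum_distrib_left mult.left_commute)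

lemma killing_add_left: "killing (y + z) x = killing y x + killing z x"
  and killing_scale_left: "killing (c *s y) x = c * killing y x"
  unfolding killing_sym[of _ x] by (rule killing_add killing_scale)+

lemma killing_invariant: "killing (br x y) z = killing x (br y z)"
proof -
  have "killing (br x y) z = trace (ad x ** ad y ** ad z) - trace (ad y ** ad x ** ad z)"
    by (simp add: killing_def ad_br matrix_mult_diff trace_sub)
  also have "trace (ad y ** ad x ** ad z) = trace (ad x ** ad z ** ad y)"
    by (metis matrix_mul_assoc trace_mul_sym)
  finally show ?thesis
    by (simp add: killing_def ad_br matrix_mult_diff trace_sub matrix_mul_assoc)
qed


end


text \<open>Additivity of \<phi> is exactly the Leibniz rule on generalised eigenvectors, because
  the bracket of vectors for a and b belongs to a + b; the identity and \<open>cnj\<close> both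
  qualify. The rule extends by linearity, one argument at a time.\<close>

lemma eigen_operator_derivation:
  fixes br :: "(complex, 'n::finite) bracket"
  assumes "lie_algebra br" and T: "eigen_operator \<phi> (br x) T"
    and \<phi>: "\<And>a b. \<phi> (a + b) = \<phi> a + \<phi> b"
  shows "lie_alg.derivation br T"
proof -
  interpret lie_alg br by (rule lie_alg.intro) fact
  let ?G = "\<Union>a. gen_eigenspace (br x) a"
  have kT: "klin T" using T by (simp add: eigen_operator_def)
  have span: "w \<in> vec.span ?G" for w by (rule gen_eigenspaces_span[OF klin_br])
  have 1: "T (br u v) = br (T u) v + br u (T v)" if uv: "u \<in> ?G" "v \<in> ?G" for u v
  proof -
    obtain a b where a: "u \<in> gen_eigenspace (br x) a" and b: "v \<in> gen_eigenspace (br x) b" using uv by blast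
    then have "T (br u v) = \<phi> (a + b) *s br u v" "T u = \<phi> a *s u" "T v = \<phi> b *s v"
      using T gen_eigenspace_br[OF a b] unfolding eigen_operator_def by blast+
    then show ?thesis by (simp add: \<phi> br_scale br_scale_left vector_sadd_rdistrib)
  qed
  have 2: "T (br u v) = br (T u) v + br u (T v)" if u: "u \<in> ?G" for u v
    by (rule klin_eq_on_span[where S = ?G, OF _ _ _ span])
      (auto intro!: klin_compose[OF kT] klin_compose[OF klin_br kT] klin_plus klin_br klin_compose[OF klin_br] kT 1 u)
  have "T (br u v) = br (T u) v + br u (T v)" for u v
    by (rule klin_eq_on_span[where S = ?G, OF _ _ _ span])
      (auto intro!: klin_compose[OF kT klin_br_left] klin_plus klin_br_left klin_compose[OF klin_br_left kT] 2)
  then show ?thesis using kT by (simp add: derivation_def)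
qed

section \<open>Engel's theorem\<close>

lemma vec_span_insert_subspace:
  assumes "vec.subspace W" "y \<in> vec.span (insert v W)"
  obtains c where "y - c *s v \<in> W"
  using assms vec.span_breakdown_eq[of y v W] by (metis vec.span_eq_iff)

lemma vec_ex_maximal_subspace:
  fixes P :: "('k::field ^ 'n::finite) set \<Rightarrow> bool"
  assumes "P W0"
  obtains W where "P W" "\<And>W'. P W' \<Longrightarrow> vec.dim W' \<le> vec.dim W"
proof -
  have "\<forall>W. P W \<longrightarrow> vec.dim W < Suc CARD('n)"
    using vec.dim_subset[OF subset_UNIV] vec_dim_card[where ?'a = 'k and ?'n = 'n] by (metis less_Suc_eq_le)
  then show ?thesis using ex_has_greatest_nat[of P W0 vec.dim "Suc CARD('n)"] assms that by blast
qed

context lie_alg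
begin

text \<open>Engel's theorem for the action of \<open>S\<close> on the quotient \<open>V/W\<close>: the induction applies it to
  the action of a maximal proper subalgebra on the quotient of \<open>S\<close> by that subalgebra.\<close>

lemma engel:
  assumes "lie_subalgebra br S" "vec.subspace V" "vec.subspace W" "W \<subset> V"
    and "\<And>x v. x \<in> S \<Longrightarrow> v \<in> V \<Longrightarrow> br x v \<in> V" "\<And>x v. x \<in> S \<Longrightarrow> v \<in> W \<Longrightarrow> br x v \<in> W"
    and "\<And>x v. x \<in> S \<Longrightarrow> v \<in> V \<Longrightarrow> \<exists>k. (br x ^^ k) v \<in> W"
    and "\<And>x y. x \<in> S \<Longrightarrow> y \<in> S \<Longrightarrow> \<exists>k. (br x ^^ k) y = 0"
  shows "\<exists>v\<in>V - W. \<forall>x\<in>S. br x v \<in> W"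
  using assms
proof (induction "vec.dim S" arbitrary: S V W rule: less_induct)
  case less
  note S = less.prems(1)
  have subS: "vec.subspace S" using S by (simp add: lie_subalgebra_def)
  show ?case
  proof (cases "S = {0}")
    case True
    then show ?thesis using less.prems(3,4) by (auto simp: vec.subspace_0)
  next
    case False
    let ?P = "\<lambda>K. lie_subalgebra br K \<and> K \<subset> S"
    have "?P {0}" using False subS vec.subspace_0[of S] by (auto simp: lie_subalgebra_def vec.subspace_single_0)
    then obtain K where K: "lie_subalgebra br K" "K \<subset> S" and max: "\<And>K'. ?P K' \<Longrightarrow> vec.dim K' \<le> vec.dim K"
      by (rule vec_ex_maximal_subspace[of ?P]) blast
    have subK: "vec.subspace K" using K by (simp add: lie_subalgebra_def)
    have dK: "vec.dim K < vec.dim S"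
      using K(2) vec.subspace_dim_equal[OF subK subS] vec.dim_subset[of K S] by fastforce
    have "\<exists>y\<in>S - K. \<forall>x\<in>K. br x y \<in> K"
    proof (rule less.hyps[OF dK K(1) subS subK K(2)])
      show "\<And>x v. x \<in> K \<Longrightarrow> v \<in> S \<Longrightarrow> br x v \<in> S" using S K(2) by (auto simp: lie_subalgebra_def)
      show "\<And>x v. x \<in> K \<Longrightarrow> v \<in> K \<Longrightarrow> br x v \<in> K" using K by (auto simp: lie_subalgebra_def)
      show "\<exists>k. (br x ^^ k) v \<in> K" if "x \<in> K" "v \<in> S" for x v
        using less.prems(8)[of x v] that K(2) vec.subspace_0[OF subK] by (metis psubsetD)
      show "\<exists>k. (br x ^^ k) v = 0" if "x \<in> K" "v \<in> K" for x v
        using less.prems(8)[of x v] that K(2) by blast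
    qed
    then obtain y where y: "y \<in> S" "y \<notin> K" "\<And>x. x \<in> K \<Longrightarrow> br x y \<in> K" by blast
    let ?K' = "vec.span (insert y K)"
    have K'S: "?K' \<subseteq> S" using y K(2) subS by (intro vec.span_minimal) auto
    have inK': "K \<subseteq> ?K'" "y \<in> ?K'" using vec.span_superset[of "insert y K"] by auto
    have "lie_subalgebra br ?K'"
      unfolding lie_subalgebra_def
    proof (intro conjI ballI vec.subspace_span)
      fix a b assume "a \<in> ?K'" "b \<in> ?K'"
      then obtain c d where cd: "a - c *s y \<in> K" "b - d *s y \<in> K"
        using vec_span_insert_subspace[OF subK] by metis
      define a' where "a' = a - c *s y"
      define b' where "b' = b - d *s y"
      have ab: "a = a' + c *s y" "b = b' + d *s y" by (auto simp: a'_def b'_def)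
      have "br a b = br a' b' + d *s br a' y - c *s br b' y"
        unfolding ab br_add br_add_left br_scale br_scale_left using br_anti[of y b']
        by (simp add: vec.scale_minus_right)
      moreover have "br a' b' \<in> K" "br a' y \<in> K" "br b' y \<in> K"
        using cd y K(1) by (auto simp: a'_def b'_def lie_subalgebra_def)
      ultimately have "br a b \<in> K" using subK
        by (auto intro!: vec.subspace_add vec.subspace_diff vec.subspace_scale)
      then show "br a b \<in> ?K'" using inK' by blast
    qed
    moreover have "vec.dim K < vec.dim ?K'"
    proof (rule ccontr)
      assume "\<not> vec.dim K < vec.dim ?K'"
      then have "K = ?K'" using vec.subspace_dim_equal[OF subK vec.subspace_span inK'(1)] by auto
      then show False using inK' y by blast
    qed
    \<comment> \<open>By maximality of \<open>K\<close>, the subalgebra enlarged by \<open>y\<close>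
      is everything: \<open>S\<close> is \<open>K\<close> plus the line through
      \<open>y\<close>.\<close>
    ultimately have K'eq: "?K' = S" using max[of ?K'] K'S by (metis leD psubsetI)
    have "\<exists>v\<in>V - W. \<forall>x\<in>K. br x v \<in> W"
    proof (rule less.hyps[OF dK K(1) less.prems(2,3,4)])
      fix x assume "x \<in> K"
      then have x: "x \<in> S" using K(2) by blast
      show "br x v \<in> V" if "v \<in> V" for v using less.prems(5)[OF x that] .
      show "br x v \<in> W" if "v \<in> W" for v using less.prems(6)[OF x that] .
      show "\<exists>k. (br x ^^ k) v \<in> W" if "v \<in> V" for v using less.prems(7)[OF x that] .
      show "\<exists>k. (br x ^^ k) z = 0" if "z \<in> K" for z using less.prems(8)[OF x] that K(2) by blast
    qed
    then obtain v0 where v0: "v0 \<in> V" "v0 \<notin> W" "\<And>x. x \<in> K \<Longrightarrow> br x v0 \<in> W" by blast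
    \<comment> \<open>The vectors of \<open>V\<close> that \<open>K\<close> sends into
      \<open>W\<close> are stable under \<open>y\<close>, because \<open>y\<close> normalises
      \<open>K\<close>; so all iterates of \<open>y\<close> on \<open>v0\<close> stay among
      them.\<close>
    have it: "(br y ^^ j) v0 \<in> V \<and> (\<forall>x\<in>K. br x ((br y ^^ j) v0) \<in> W)" for j
    proof (induction j)
      case (Suc j)
      let ?u = "(br y ^^ j) v0"
      have "br x (br y ?u) \<in> W" if "x \<in> K" for x
      proof -
        have "br (br x y) ?u \<in> W" using Suc y(3)[OF that] by blast
        moreover have "br y (br x ?u) \<in> W" using Suc that less.prems(6) y(1) by blast
        ultimately show ?thesis unfolding jacobi[of x y ?u] using less.prems(3) by (intro vec.subspace_add)
      qed
      then show ?case using Suc less.prems(5) y(1) by simp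
    qed (use v0 in auto)
    \<comment> \<open>The last iterate outside \<open>W\<close> is sent into \<open>W\<close> by
      \<open>y\<close> as well as by \<open>K\<close>, hence by all of \<open>S\<close>.\<close>
    define k where "k = (LEAST k. (br y ^^ k) v0 \<in> W)"
    have kW: "(br y ^^ k) v0 \<in> W"
      unfolding k_def using less.prems(7)[OF y(1) v0(1)] by (rule LeastI_ex)
    have "k \<noteq> 0" using kW v0 by (metis funpow_0)
    then obtain j where j: "k = Suc j" by (cases k) auto
    let ?v = "(br y ^^ j) v0"
    have "?v \<notin> W" using not_less_Least[of j "\<lambda>k. (br y ^^ k) v0 \<in> W"] j k_def by auto
    moreover have "br x ?v \<in> W" if x: "x \<in> S" for x
    proof -
      obtain c where c: "x - c *s y \<in> K" using vec_span_insert_subspace[OF subK] x K'eq by metis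
      have "br (x - c *s y) ?v + c *s br y ?v \<in> W"
        using it[of j] c kW j less.prems(3) by (intro vec.subspace_add vec.subspace_scale) auto
      then show ?thesis by (simp add: br_diff_left br_scale_left)
    qed
    ultimately show ?thesis using it[of j] by blast
  qed
qed

section \<open>Solvability of ideals by way of Engel's theorem\<close>

lemma lie_ideal_bracket_span:
  assumes "lie_ideal br I" "lie_ideal br J"
  shows "lie_ideal br (bracket_span br I J)" "bracket_span br I J \<subseteq> I"
proof -
  have subI: "vec.subspace I" using assms by (simp add: lie_ideal_def)
  have "{br x y |x y. x \<in> I \<and> y \<in> J} \<subseteq> I"
  proof clarify
    fix x y assume "x \<in> I"
    then have "- br y x \<in> I" using assms(1) by (intro vec.subspace_neg[OF subI]) (simp add: lie_ideal_def)
    then show "br x y \<in> I" by (subst br_anti)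
  qed
  then show "bracket_span br I J \<subseteq> I" unfolding bracket_span_def using subI by (rule vec.span_minimal)
  show "lie_ideal br (bracket_span br I J)"
    unfolding lie_ideal_def
  proof (intro conjI allI ballI)
    show sub: "vec.subspace (bracket_span br I J)" unfolding bracket_span_def by (rule vec.subspace_span)
    fix x z assume "z \<in> bracket_span br I J"
    then show "br x z \<in> bracket_span br I J"
      unfolding bracket_span_def
    proof (induction rule: vec.span_induct_alt)
      case base then show ?case by (simp add: vec.span_zero)
    next
      case (step c y z)
      then obtain a b where ab: "y = br a b" "a \<in> I" "b \<in> J" by blast
      have "br x a \<in> I" "br x b \<in> J" using ab assms by (auto simp: lie_ideal_def)
      then have "br (br x a) b \<in> vec.span {br x y |x y. x \<in> I \<and> y \<in> J}" "br a (br x b) \<in> vec.span {br x y |x y. x \<in> I \<and> y \<in> J}"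
        using ab by (intro vec.span_base; blast)+
      then have "br x y \<in> vec.span {br x y |x y. x \<in> I \<and> y \<in> J}"
        unfolding ab jacobi[of x a b] by (rule vec.span_add)
      then show ?case unfolding br_add br_scale using step by (intro vec.span_add vec.span_scale)
    qed
  qed
qed

lemma lie_ideal_derived_series: "lie_ideal br I \<Longrightarrow> lie_ideal br (derived_series br I k)"
  by (induction k) (auto intro: lie_ideal_bracket_span)

text \<open>For a maximal proper stable subspace W of D, Engel's theorem on D / W provides v outside
  W with [D, v] inside W. Then W and v span a stable subspace, which must be D, so [D, D] lies in W
  and D is not perfect.\<close>

lemma perfect_ad_nilpotent_trivial:
  assumes D: "lie_ideal br D" "bracket_span br D D = D"
    and nil: "\<And>x v. x \<in> D \<Longrightarrow> \<exists>k. (br x ^^ k) v = 0"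
  shows "D = {0}"
proof (rule ccontr)
  assume ne: "D \<noteq> {0}"
  have subD: "vec.subspace D" using D by (simp add: lie_ideal_def)
  have algD: "lie_subalgebra br D" using D by (auto simp: lie_ideal_def lie_subalgebra_def)
  let ?P = "\<lambda>W. vec.subspace W \<and> W \<subset> D \<and> (\<forall>x\<in>D. \<forall>w\<in>W. br x w \<in> W)"
  have "?P {0}" using ne subD vec.subspace_0[of D] by (auto simp: vec.subspace_single_0)
  then obtain W where W: "vec.subspace W" "W \<subset> D" "\<And>x w. x \<in> D \<Longrightarrow> w \<in> W \<Longrightarrow> br x w \<in> W"
    and max: "\<And>W'. ?P W' \<Longrightarrow> vec.dim W' \<le> vec.dim W"
    by (rule vec_ex_maximal_subspace[of ?P]) blast
  have "\<exists>v\<in>D - W. \<forall>x\<in>D. br x v \<in> W"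
  proof (rule engel[OF algD subD W(1,2) _ W(3)])
    show "\<exists>k. (br x ^^ k) v \<in> W" if "x \<in> D" for x v
      using nil[OF that, of v] vec.subspace_0[OF W(1)] by metis
    show "\<And>x v. x \<in> D \<Longrightarrow> v \<in> D \<Longrightarrow> br x v \<in> D" using algD by (auto simp: lie_subalgebra_def)
  qed (use nil in auto)
  then obtain v where v: "v \<in> D" "v \<notin> W" "\<And>x. x \<in> D \<Longrightarrow> br x v \<in> W" by blast
  let ?W' = "vec.span (insert v W)"
  have sup: "W \<subseteq> ?W'" "v \<in> ?W'" using vec.span_superset[of "insert v W"] by auto
  have inW: "br x w \<in> W" if x: "x \<in> D" and w: "w \<in> ?W'" for x w
  proof -
    obtain c where c: "w - c *s v \<in> W" using vec_span_insert_subspace[OF W(1) w] .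
    have "br x (w - c *s v) + c *s br x v \<in> W"
      using c v(3)[OF x] W(3)[OF x] W(1) by (intro vec.subspace_add vec.subspace_scale) auto
    then show ?thesis by (simp add: br_diff br_scale)
  qed
  have "?W' = D"
  proof (rule ccontr)
    assume "?W' \<noteq> D"
    moreover have "?W' \<subseteq> D" using v W(2) subD by (intro vec.span_minimal) auto
    ultimately have "?P ?W'" using inW sup by blast
    then have "vec.dim ?W' \<le> vec.dim W" by (rule max)
    then have "W = ?W'" using vec.subspace_dim_equal[OF W(1) vec.subspace_span sup(1)] by auto
    then show False using sup v by blast
  qed
  then have "{br x y |x y. x \<in> D \<and> y \<in> D} \<subseteq> W" using inW by auto
  then have "bracket_span br D D \<subseteq> W" unfolding bracket_span_def using W(1) by (rule vec.span_minimal)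
  then show False using D(2) W(2) by blast
qed

text \<open>The derived series stops decreasing in dimension at a perfect ideal. Being its own
  derived algebra, that ideal lies in [I, I] and consists of ad-nilpotent elements, so it is
  zero.\<close>

lemma solvable_if_commutators_ad_nilpotent:
  assumes I: "lie_ideal br I"
    and nil: "\<And>x v. x \<in> bracket_span br I I \<Longrightarrow> \<exists>k. (br x ^^ k) v = 0"
  shows "solvable_lie br I"
proof -
  obtain k where k: "\<And>j. vec.dim (derived_series br I k) \<le> vec.dim (derived_series br I j)"
    using ex_has_least_nat[of "\<lambda>_. True" 0 "\<lambda>k. vec.dim (derived_series br I k)"] by blast
  let ?D = "derived_series br I k"
  have D: "lie_ideal br ?D" "lie_ideal br (bracket_span br ?D ?D)"
    using I by (auto intro: lie_ideal_derived_series lie_ideal_bracket_span)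
  have perf: "bracket_span br ?D ?D = ?D"
    using k[of "Suc k"] D lie_ideal_bracket_span(2)[OF D(1) D(1)]
    by (intro vec.subspace_dim_equal) (auto simp: lie_ideal_def)
  have DI: "derived_series br I j \<subseteq> I" for j
    by (induction j) (use lie_ideal_bracket_span(2)[OF lie_ideal_derived_series[OF I] lie_ideal_derived_series[OF I]] in auto)
  have "?D \<subseteq> bracket_span br I I"
    using perf vec.span_mono[of "{br x y |x y. x \<in> ?D \<and> y \<in> ?D}" "{br x y |x y. x \<in> I \<and> y \<in> I}"] DI[of k]
    unfolding bracket_span_def by blast
  then have "?D = {0}" using nil by (intro perfect_ad_nilpotent_trivial[OF D(1) perf]) blast
  then show ?thesis unfolding solvable_lie_def by blast
qed

end

section \<open>Complexification\<close>

lemma to_complex_0 [simp]: "to_complex 0 = 0"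
  using to_complex_scaleR[of 0 0] by simp

lemma to_complex_1 [simp]: "to_complex (1 :: 'k::real_or_complex) = 1"
proof -
  have "to_complex (1 :: 'k) * to_complex (1 :: 'k) = to_complex (1 :: 'k)" by (simp flip: to_complex_mult)
  moreover have "to_complex (1 :: 'k) \<noteq> 0" using norm_to_complex[of "1 :: 'k"] by auto
  ultimately show ?thesis by simp
qed

lemma to_complex_of_real [simp]: "to_complex (of_real r) = of_real r"
  using to_complex_scaleR[of r 1] by (simp add: of_real_def)

lemma to_complex_minus: "to_complex (- x) = - to_complex x"
  using to_complex_scaleR[of "-1" x] by simp

lemma to_complex_sum: "to_complex (sum f A) = (\<Sum>i\<in>A. to_complex (f i))"
  by (induction A rule: infinite_finite_induct) (auto simp: to_complex_add)

lemma to_complex_inject [simp]: "to_complex x = to_complex y \<longleftrightarrow> x = y"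
proof
  assume "to_complex x = to_complex y"
  then have "to_complex (x + - y) = 0" by (simp only: to_complex_add to_complex_minus) simp
  then show "x = y" using norm_to_complex[of "x + - y"] by simp
qed simp

text \<open>The image of \<open>to_complex\<close> contains the reals, and one element with nonzero
  imaginary part makes it the whole complex plane. The dichotomy decides whether complexification
  adds anything.\<close>

lemma to_complex_real_or_surj:
  obtains "\<And>x :: 'k::real_or_complex. cnj (to_complex x) = to_complex x" | "surj (to_complex :: 'k \<Rightarrow> complex)"
proof (cases "\<forall>x :: 'k. Im (to_complex x) = 0")
  case True then show ?thesis using that(1) by (simp add: complex_eq_iff)
next
  case False
  then obtain x :: 'k where x: "Im (to_complex x) \<noteq> 0" by blast
  have "\<exists>y :: 'k. to_complex y = z" for z
  proof -
    let ?b = "Im z / Im (to_complex x)"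
    have "to_complex (of_real (Re z - ?b * Re (to_complex x)) + ?b *\<^sub>R x)
        = of_real (Re z - ?b * Re (to_complex x)) + ?b *\<^sub>R to_complex x"
      by (simp only: to_complex_add to_complex_scaleR to_complex_of_real)
    also have "\<dots> = z" using x by (simp add: complex_eq_iff)
    finally have "to_complex (of_real (Re z - ?b * Re (to_complex x)) + ?b *\<^sub>R x) = z" .
    then show ?thesis by blast
  qed
  then show ?thesis using that(2) unfolding surj_def by metis
qed

lemma complexify_nth [simp]: "complexify x $ i = to_complex (x $ i)"
  by (simp add: complexify_def)

lemma complexify_add: "complexify (x + y) = complexify x + complexify y"
  and complexify_scale: "complexify (c *s x) = to_complex c *s complexify x"
  and complexify_0 [simp]: "complexify 0 = 0"
  and complexify_inject [simp]: "complexify x = complexify y \<longleftrightarrow> x = y"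
  and complexify_axis: "complexify (axis i 1) = axis i 1"
  by (auto simp: vec_eq_iff to_complex_add to_complex_mult axis_def)

lemma complexify_sum: "complexify (sum f A) = (\<Sum>i\<in>A. complexify (f i))"
  by (induction A rule: infinite_finite_induct) (auto simp: complexify_add)

lemma klin_complex_bracket: "klin (complex_bracket br x)" "klin (\<lambda>x. complex_bracket br x y)"
  by (auto intro!: klinI simp: complex_bracket_def distrib_left distrib_right vector_sadd_rdistrib sum.distrib
      vec.scale_sum_right mult.left_commute mult.assoc)

lemma klin_expand:
  assumes "klin h" shows "h x = (\<Sum>i\<in>UNIV. x $ i *s h (axis i 1))"
proof -
  have "h x = h (\<Sum>i\<in>UNIV. x $ i *s axis i 1)" by (simp add: basis_expansion)
  then show ?thesis by (simp add: klin_sum[OF assms] klin_scale[OF assms])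
qed

lemma klin_eq_on_axes:
  assumes "klin f" "klin g" "\<And>i. f (axis i 1) = g (axis i 1)"
  shows "f x = g x"
  using klin_expand[OF assms(1), of x] klin_expand[OF assms(2), of x] assms(3) by simp

locale lie_alg_rc = lie_alg br for br :: "('k::real_or_complex, 'n::finite) bracket"
begin

abbreviation "brC \<equiv> complex_bracket br"

lemma axis_complexify: "(axis i 1 :: complex ^ 'n) = complexify (axis i 1 :: 'k ^ 'n)"
  by (simp add: complexify_axis)

lemma complex_bracket_complexify: "brC (complexify x) (complexify y) = complexify (br x y)"
proof -
  have "br x y = (\<Sum>i\<in>UNIV. x $ i *s br (axis i 1) y)" by (rule klin_expand[OF klin_br_left])
  also have "\<dots> = (\<Sum>i\<in>UNIV. x $ i *s (\<Sum>j\<in>UNIV. y $ j *s br (axis i 1) (axis j 1)))"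
    by (subst klin_expand[OF klin_br, of _ y]) (rule refl)
  also have "complexify \<dots> = brC (complexify x) (complexify y)"
    by (simp add: complex_bracket_def complexify_sum complexify_scale vec.scale_sum_right to_complex_mult)
  finally show ?thesis by simp
qed

lemma brC_axis: "brC (axis i 1) (axis j 1) = complexify (br (axis i 1) (axis j 1))"
  by (metis complex_bracket_complexify complexify_axis)

text \<open>Multilinear identities may be checked on the coordinate vectors, where the bracket is
  the complexification of the given one. That [x, x] vanishes is not linear in x and is derived from
  antisymmetry.\<close>

lemma lie_algebra_complex_bracket: "lie_algebra brC"
proof -
  note kl = klin_complex_bracket
  have anti: "brC x y = - brC y x" for x y
  proof (rule klin_eq_on_axes[where f = "brC x", OF kl(1)])
    show "klin (\<lambda>y. - brC y x)" using klin_mult[OF kl(2), of "-1"] by simp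
    fix j
    have "klin (\<lambda>x. - brC (axis j 1) x)" using klin_mult[OF kl(1), of "-1"] by simp
    then show "brC x (axis j 1) = - brC (axis j 1) x"
    proof (rule klin_eq_on_axes[where f = "\<lambda>x. brC x (axis j 1)", OF kl(2)])
      fix i show "brC (axis i 1) (axis j 1) = - brC (axis j 1) (axis i 1)"
        unfolding brC_axis by (subst br_anti) (simp add: vec_eq_iff to_complex_minus)
    qed
  qed
  have self: "brC x x = 0" for x
  proof -
    have "brC x x + brC x x = 0" using anti[of x x] by (metis add.right_inverse)
    then show ?thesis by (simp add: vec_eq_iff) 
  qed
  have jac: "brC x (brC y z) = brC (brC x y) z + brC y (brC x z)" for x y z
  proof (rule klin_eq_on_axes[where f = "\<lambda>x. brC x (brC y z)", OF kl(2)])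
    show "klin (\<lambda>x. brC (brC x y) z + brC y (brC x z))"
      by (intro klin_plus klin_compose[OF kl(2) kl(2)] klin_compose[OF kl(1) kl(2)])
    fix i :: 'n let ?x = "axis i 1 :: complex ^ 'n"
    show "brC ?x (brC y z) = brC (brC ?x y) z + brC y (brC ?x z)"
    proof (rule klin_eq_on_axes[where f = "\<lambda>y. brC ?x (brC y z)", OF klin_compose[OF kl(1) kl(2)]])
      show "klin (\<lambda>y. brC (brC ?x y) z + brC y (brC ?x z))"
        by (intro klin_plus klin_compose[OF kl(2) kl(1)] kl(2))
      fix j :: 'n let ?y = "axis j 1 :: complex ^ 'n"
      show "brC ?x (brC ?y z) = brC (brC ?x ?y) z + brC ?y (brC ?x z)"
      proof (rule klin_eq_on_axes[where f = "\<lambda>z. brC ?x (brC ?y z)", OF klin_compose[OF kl(1) kl(1)]])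
        show "klin (\<lambda>z. brC (brC ?x ?y) z + brC ?y (brC ?x z))"
          by (intro klin_plus klin_compose[OF kl(1) kl(1)] kl(1))
        fix k :: 'n
        show "brC ?x (brC ?y (axis k 1)) = brC (brC ?x ?y) (axis k 1) + brC ?y (brC ?x (axis k 1))"
          unfolding axis_complexify complex_bracket_complexify complexify_add[symmetric]
          by (subst jacobi) (rule refl)
      qed
    qed
  qed
  have "brC x (brC y z) + brC y (brC z x) + brC z (brC x y) = 0" for x y z
    using jac[of x y z] anti[of z "brC x y"] anti[of z x] klin_minus[OF kl(1), of br y "brC x z"] by simp
  then show ?thesis unfolding lie_algebra_def klin_iff[symmetric] using kl self by blast
qed

sublocale C: lie_alg brC by (rule lie_alg.intro) (rule lie_algebra_complex_bracket)

lemma killing_complexify: "C.killing (complexify x) (complexify y) = to_complex (killing x y)"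
proof -
  have "C.ad (complexify x) $ i $ j = to_complex (ad x $ i $ j)" for x i j
    unfolding matrix_def by (simp add: axis_complexify complex_bracket_complexify)
  then show ?thesis
    by (simp add: killing_def C.killing_def trace_def matrix_matrix_mult_def to_complex_sum to_complex_mult)
qed

lemma brC_funpow: "(brC (complexify x) ^^ k) (complexify v) = complexify ((br x ^^ k) v)"
  by (induction k) (auto simp: complex_bracket_complexify)

lemma gen_eigenspace_0_complexify:
  "complexify v \<in> gen_eigenspace (brC (complexify x)) 0 \<longleftrightarrow> v \<in> gen_eigenspace (br x) 0"
proof -
  have [simp]: "klin_shift f 0 = f" for f :: "'c::field ^ 'n \<Rightarrow> 'c ^ 'n" by (simp add: klin_shift_def fun_eq_iff)
  have "complexify w = 0 \<longleftrightarrow> w = 0" for w :: "'k ^ 'n" by (metis complexify_0 complexify_inject)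
  then show ?thesis by (simp add: gen_eigenspace_def brC_funpow)
qed

subsection \<open>Cartan's criterion\<close>

text \<open>Let T have the conjugate eigenvalues of \<open>ad x\<close>. For y in the radical of the
  Killing form, tr (T ad [z, y]) = \<kappa> (T z) y = 0; by linearity tr (T ad x) = 0, so all
  eigenvalues of \<open>ad x\<close> vanish. The argument takes place over the complex numbers
  because the eigenvalues live there.\<close>

lemma killing_radical_ad_nilpotent:
  assumes x: "x \<in> vec.span {br z y | z y. \<forall>w. killing y w = 0}"
  shows "\<exists>k. (br x ^^ k) v = 0"
proof -
  let ?f = "brC (complexify x)"
  obtain T where T: "eigen_operator cnj ?f T" using ex_eigen_operator[OF C.klin_br] by blast
  then have der: "C.derivation T"
    using eigen_operator_derivation[OF lie_algebra_complex_bracket T] by simp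
  \<comment> \<open>A vector of the radical stays in the radical after complexification, since
    pairing with the coordinate vectors suffices.\<close>
  have zero: "C.killing w (complexify y) = 0" if "\<forall>w. killing y w = 0" for y w
  proof -
    have "klin (\<lambda>w. vec (C.killing w (complexify y)) :: complex ^ 1)"
      by (rule klinI) (simp_all add: C.killing_add_left C.killing_scale_left vec_eq_iff)
    then have "(vec (C.killing w (complexify y)) :: complex ^ 1) = 0"
    proof (rule klin_eq_on_axes[OF _ klin_const0])
      fix i :: 'n
      have "C.killing (axis i 1) (complexify y) = to_complex (killing (axis i 1) y)"
        by (metis complexify_axis killing_complexify)
      then show "(vec (C.killing (axis i 1) (complexify y)) :: complex ^ 1) = 0"
        using that by (simp add: killing_sym[of _ y] vec_eq_iff)
    qed
    then show ?thesis by (simp add: vec_eq_iff)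
  qed
  have "trace (matrix T ** C.ad (complexify x)) = 0"
    using x
  proof (induction rule: vec.span_induct_alt)
    case base
    have "C.ad 0 = 0" by (simp add: matrix_def vec_eq_iff)
    then show ?case unfolding complexify_0 by (simp only:) (simp add: trace_def matrix_matrix_mult_def)
  next
    case (step c u x)
    then obtain z y where u: "u = br z y" and y: "\<forall>w. killing y w = 0" by blast
    have "trace (matrix T ** C.ad (complexify u)) = 0"
      unfolding u complex_bracket_complexify[symmetric] C.trace_derivation_br[OF der] using y by (rule zero)
    moreover have "trace (matrix T ** C.ad (a *s b)) = a * trace (matrix T ** C.ad b)" for a b
      by (simp add: C.ad_scale trace_def matrix_matrix_mult_def sum_distrib_left mult.left_commute)
    ultimately show ?case using step
      by (simp add: complexify_add complexify_scale C.ad_add matrix_add_ldistrib trace_add)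
  qed
  then have "complexify v \<in> gen_eigenspace ?f 0"
    by (rule eigenvalues_zero_if_trace_zero[OF C.klin_br T])
  then have "v \<in> gen_eigenspace (br x) 0" by (simp add: gen_eigenspace_0_complexify)
  moreover have "klin_shift (br x) 0 = br x" by (simp add: klin_shift_def fun_eq_iff)
  ultimately show ?thesis by (simp add: gen_eigenspace_def)
qed

text \<open>The radical of the Killing form is an ideal by invariance. Its commutators are
  ad-nilpotent, which makes it solvable, and a semisimple algebra has no solvable ideal except
  zero.\<close>

lemma killing_nondegenerate:
  assumes ss: "semisimple_lie br" and x: "\<And>y. killing x y = 0"
  shows "x = 0"
proof -
  let ?I = "{x. \<forall>y. killing x y = 0}"
  have 0: "killing 0 y = 0" for y using killing_scale_left[of 0 0 y] by simp
  have I: "lie_ideal br ?I"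
    unfolding lie_ideal_def vec.subspace_def
    by (auto simp: 0 killing_add_left killing_scale_left) (metis br_anti br_minus killing_invariant killing_sym)
  have "solvable_lie br ?I"
  proof (rule solvable_if_commutators_ad_nilpotent[OF I])
    fix u v assume "u \<in> bracket_span br ?I ?I"
    moreover have "bracket_span br ?I ?I \<subseteq> vec.span {br z y | z y. \<forall>w. killing y w = 0}"
      unfolding bracket_span_def by (intro vec.span_mono) auto
    ultimately show "\<exists>k. (br u ^^ k) v = 0" using killing_radical_ad_nilpotent by blast
  qed
  then have "?I = {0}" using ss I by (simp add: semisimple_lie_def)
  then show ?thesis using x by blast
qed

end

section \<open>A regular functional for a Cartan subalgebra\<close>

lemma klin_shift_0 [simp]: "klin_shift f 0 = f"
  by (simp add: klin_shift_def fun_eq_iff)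

text \<open>The kernels of the powers of f increase, cannot grow strictly more often than the
  dimension allows, and stay constant from the first repetition on.\<close>

lemma funpow_kernel_bound:
  fixes f :: "'k::field ^ 'n::finite \<Rightarrow> 'k ^ 'n"
  assumes f: "klin f" and v: "(f ^^ k) v = 0"
  shows "(f ^^ CARD('n)) v = 0"
proof -
  let ?K = "\<lambda>j. {v. (f ^^ j) v = 0}"
  have sub: "vec.subspace (?K j)" for j
    unfolding vec.subspace_def
    by (auto simp: klin_0[OF klin_funpow[OF f]] klin_add[OF klin_funpow[OF f]] klin_scale[OF klin_funpow[OF f]])
  have mono: "?K i \<subseteq> ?K j" if "i \<le> j" for i j using klin_funpow_zero_mono[OF f] that by blast
  have "\<exists>j\<le>CARD('n). ?K (Suc j) = ?K j"
  proof (rule ccontr)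
    assume neg: "\<not> ?thesis"
    have "j \<le> vec.dim (?K j)" if "j \<le> Suc CARD('n)" for j
      using that
    proof (induction j)
      case (Suc j)
      then have "?K (Suc j) \<noteq> ?K j" using neg by auto
      then have "vec.dim (?K j) \<noteq> vec.dim (?K (Suc j))"
        using vec.subspace_dim_equal[OF sub[of j] sub[of "Suc j"] mono[of j "Suc j"]] by auto
      moreover have "vec.dim (?K j) \<le> vec.dim (?K (Suc j))" using mono[of j "Suc j"] by (intro vec.dim_subset) auto
      ultimately show ?case using Suc by linarith
    qed simp
    then have "Suc CARD('n) \<le> vec.dim (?K (Suc CARD('n)))" by blast
    moreover have "vec.dim (?K (Suc CARD('n))) \<le> CARD('n)"
      using vec.dim_subset[OF subset_UNIV] vec_dim_card[where ?'a = 'k and ?'n = 'n] by metis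
    ultimately show False by linarith
  qed
  then obtain j where j: "j \<le> CARD('n)" "?K (Suc j) = ?K j" by blast
  have "?K (i + j) = ?K j" for i
  proof (induction i)
    case (Suc i)
    have "v \<in> ?K (Suc i + j) \<longleftrightarrow> f v \<in> ?K (i + j)" for v by (simp add: funpow_swap1)
    moreover have "f v \<in> ?K j \<longleftrightarrow> v \<in> ?K (Suc j)" for v by (simp add: funpow_swap1)
    ultimately show ?case using Suc j(2) by blast
  qed simp
  moreover have "v \<in> ?K (k + j)" using mono[of k "k + j"] v by auto
  ultimately have "v \<in> ?K j" by blast
  then show ?thesis using mono[OF j(1)] by blast
qed

lemma gen_eigenspace_0:
  fixes f :: "'k::field ^ 'n::finite \<Rightarrow> 'k ^ 'n"
  assumes "klin f" shows "gen_eigenspace f 0 = {v. (f ^^ CARD('n)) v = 0}"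
  using funpow_kernel_bound[OF assms] by (auto simp: gen_eigenspace_def)

text \<open>Powers of a pencil, applied to a fixed vector, are polynomials in c. The top coefficient
  is singled out because it involves B alone: if the powers vanish for infinitely many c, then so
  does B^m v.\<close>

lemma funpow_affine_family:
  fixes A B :: "'k::field ^ 'n \<Rightarrow> 'k ^ 'n"
  assumes A: "klin A" and B: "klin B"
  shows "\<exists>w. (\<forall>c. ((\<lambda>v. A v + c *s B v) ^^ m) v = (\<Sum>k\<le>m. c ^ k *s w k)) \<and> w m = (B ^^ m) v"
proof (induction m)
  case 0 show ?case by (intro exI[of _ "\<lambda>_. v"]) simp
next
  case (Suc m)
  then obtain w where w: "\<And>c. ((\<lambda>v. A v + c *s B v) ^^ m) v = (\<Sum>k\<le>m. c ^ k *s w k)" "w m = (B ^^ m) v" by blast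
  define w' where "w' k = (if k \<le> m then A (w k) else 0) + (if k = 0 then 0 else B (w (k - 1)))" for k
  have "((\<lambda>v. A v + c *s B v) ^^ Suc m) v = (\<Sum>k\<le>Suc m. c ^ k *s w' k)" for c
  proof -
    have "((\<lambda>v. A v + c *s B v) ^^ Suc m) v
      = (\<Sum>k\<le>m. c ^ k *s A (w k)) + (\<Sum>k\<le>m. c ^ Suc k *s B (w k))"
      by (simp add: w klin_sum[OF A] klin_sum[OF B] klin_scale[OF A] klin_scale[OF B] vec.scale_sum_right mult.commute)
    also have "(\<Sum>k\<le>m. c ^ k *s A (w k)) = (\<Sum>k\<le>Suc m. c ^ k *s (if k \<le> m then A (w k) else 0))"
      by simp
    also have "(\<Sum>k\<le>m. c ^ Suc k *s B (w k)) = (\<Sum>k\<le>Suc m. c ^ k *s (if k = 0 then 0 else B (w (k - 1))))"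
      by (subst sum.atMost_Suc_shift) simp
    finally show ?thesis by (simp only: w'_def vec.scale_right_distrib sum.distrib)
  qed
  moreover have "w' (Suc m) = (B ^^ Suc m) v" by (simp add: w'_def w)
  ultimately show ?case by blast
qed

lemma scaleR_eq_smult: "r *\<^sub>R y = (of_real r :: 'k::real_normed_field) *s (y :: 'k ^ 'n)"
  by (simp only: vec_eq_iff vector_scaleR_component vector_smult_component) (simp add: scaleR_conv_of_real)

lemma klin_imp_linear:
  fixes f :: "'k::real_or_complex ^ 'n::finite \<Rightarrow> 'k ^ 'm::finite"
  assumes "klin f" shows "linear f"
proof (rule linearI)
  fix r :: real and x
  show "f (r *\<^sub>R x) = r *\<^sub>R f x" by (simp only: scaleR_eq_smult klin_scale[OF assms])
qed (rule klin_add[OF assms])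

lemma continuous_on_klin:
  fixes f :: "'k::real_or_complex ^ 'n::finite \<Rightarrow> 'k ^ 'm::finite"
  assumes "klin f" "continuous_on S g" shows "continuous_on S (\<lambda>x. f (g x))"
  using linear_continuous_on[OF linear_conv_bounded_linear[THEN iffD1, OF klin_imp_linear[OF assms(1)]], of "g ` S"]
    continuous_on_compose[OF assms(2)] by (simp add: o_def)

section \<open>Regular elements of a Cartan subalgebra\<close>

context lie_alg_rc
begin

text \<open>\<open>L\<close> is a subalgebra containing x and z, so the perturbed operators preserve
  it. On the quotient by \<open>L\<close> the operator \<open>ad x\<close> is invertible, and this
  persists for small t. To say so without a complement of \<open>L\<close>, \<open>R t\<close>
  composes a power of \<open>ad x\<close> with a power of the perturbed operator: it vanishes on
  \<open>L\<close> for every t, and for t = 0 its kernel is exactly \<open>L\<close>.\<close>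

lemma null_component_perturb:
  fixes x z :: "'k ^ 'n"
  defines "L \<equiv> gen_eigenspace (br x) 0"
  assumes z: "z \<in> L"
  shows "\<exists>d>0. \<forall>t::real. \<bar>t\<bar> < d \<longrightarrow> gen_eigenspace (br (x + (of_real t :: 'k) *s z)) 0 \<subseteq> L"
proof -
  let ?n = "CARD('n)"
  let ?A = "\<lambda>t::real. br (x + (of_real t :: 'k) *s z)"
  have A: "klin (?A t)" for t :: real by (rule klin_br)
  have L: "L = {v. (br x ^^ ?n) v = 0}" unfolding L_def by (rule gen_eigenspace_0[OF klin_br])
  have subL: "vec.subspace L" unfolding L_def by (rule subspace_gen_eigenspace[OF klin_br])
  have xL: "x \<in> L" unfolding L_def gen_eigenspace_def by (auto intro!: exI[of _ 1])
  have algL: "br a b \<in> L" if "a \<in> L" "b \<in> L" for a b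
    using gen_eigenspace_br[of a x 0 b 0] that by (simp add: L_def)
  have AL: "?A t v \<in> L" if "v \<in> L" for t :: real and v
    by (intro algL that vec.subspace_add[OF subL] vec.subspace_scale[OF subL] xL z)
  have ApL: "(?A t ^^ k) v \<in> L" if "v \<in> L" for t :: real and v k
    by (induction k) (auto intro: AL that)
  define R where "R t v = (br x ^^ ?n) ((?A t ^^ ?n) v)" for t :: real and v
  have kR: "klin (R t)" for t unfolding R_def by (rule klin_compose[OF klin_funpow[OF klin_br] klin_funpow[OF klin_br]])
  have RL: "R t v = 0" if "v \<in> L" for t v
    using ApL[OF that, of ?n t] unfolding R_def L by blast
  have R0: "v \<in> L" if "R 0 v = 0" for v
  proof -
    have "(br x ^^ (?n + ?n)) v = 0" using that by (simp add: R_def funpow_add)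
    then show ?thesis unfolding L_def gen_eigenspace_def by auto
  qed
  \<comment> \<open>\<open>g\<close> is a generalised inverse of \<open>R 0\<close>. Thus
    \<open>M t\<close>, which is 1 + g (R t - R 0), fixes \<open>L\<close> pointwise and equals the
    identity at t = 0; continuity of the determinant keeps it injective for small t.\<close>
  obtain g where g: "klin g" "\<And>v. R 0 (g (R 0 v)) = R 0 v"
    using vec.linear_exists_right_inverse_on[of "R 0" UNIV] kR[of 0] unfolding klin_iff by auto
  define M where "M t v = v + g (R t v) - g (R 0 v)" for t v
  have kM: "klin (M t)" for t
    unfolding M_def by (intro klin_minus_fun klin_plus klin_id klin_compose[OF g(1) kR])
  have "continuous_on UNIV (\<lambda>t. (?A t ^^ k) v)" for k v
  proof (induction k)
    case (Suc k)
    have eq: "(?A t ^^ Suc k) v = br x ((?A t ^^ k) v) + t *\<^sub>R br z ((?A t ^^ k) v)" for t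
      by (simp add: br_add_left br_scale_left scaleR_eq_smult)
    show ?case unfolding eq
      by (intro continuous_on_add continuous_on_scaleR continuous_on_klin[OF klin_br] Suc continuous_on_id)
  qed simp
  then have cM: "continuous_on UNIV (\<lambda>t. M t v)" for v
    unfolding M_def R_def
    by (intro continuous_on_diff continuous_on_add continuous_on_const continuous_on_klin[OF g(1)]
        continuous_on_klin[OF klin_funpow[OF klin_br]])
  have "continuous_on UNIV (\<lambda>t. det (matrix (M t)))"
    unfolding det_def matrix_def using cM
    by (auto intro!: continuous_intros continuous_on_component) 
  then have lim: "((\<lambda>t. det (matrix (M t))) \<longlongrightarrow> det (matrix (M 0))) (at 0)"
    unfolding continuous_on_def by auto
  have "M 0 = (\<lambda>v. v)" by (simp add: M_def fun_eq_iff)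
  then have det0: "det (matrix (M 0)) = 1" by (simp add: matrix_id_mat_1[unfolded id_def])
  then have "\<forall>\<^sub>F t in at 0. det (matrix (M t)) \<noteq> 0"
    using tendsto_imp_eventually_ne[OF lim, of 0] by simp
  then obtain d where d: "d > 0" "\<And>t. t \<noteq> 0 \<Longrightarrow> \<bar>t\<bar> < d \<Longrightarrow> det (matrix (M t)) \<noteq> 0"
    by (auto simp: eventually_at dist_real_def)
  have d0: "det (matrix (M t)) \<noteq> 0" if "\<bar>t\<bar> < d" for t
    using d(2)[of t] that det0 by (cases "t = 0") auto
  have inj: "v = w" if "\<bar>t\<bar> < d" "M t v = M t w" for t v w
    using d0[OF that(1)] that(2) klin_matrix[OF kM] inj_matrix_vector_mult[of "matrix (M t)"]
    by (simp add: invertible_det_nz inj_def)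
  \<comment> \<open>If \<open>R t v\<close> = 0, then \<open>R 0\<close> annihilates
    \<open>M t v\<close>, which therefore lies in \<open>L\<close> and is fixed by
    \<open>M t\<close>; injectivity gives v = \<open>M t v\<close>.\<close>
  have RtL: "v \<in> L" if t: "\<bar>t\<bar> < d" and v: "R t v = 0" for t v
  proof -
    have "R 0 (M t v) = 0" using g(2)[of v] v klin_0[OF g(1)] by (simp add: M_def klin_diff[OF kR])
    then have m: "M t v \<in> L" by (rule R0)
    then have "M t (M t v) = M t v" using RL by (simp add: M_def[of t "M t v"])
    then show ?thesis using inj[OF t] m by metis
  qed
  have "gen_eigenspace (?A t) 0 \<subseteq> L" if t: "\<bar>t\<bar> < d" for t :: real
  proof -
    have pull: "u \<in> L" if "?A t u \<in> L" for u
    proof (rule RtL[OF t])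
      have "(?A t ^^ (?n - 1)) (?A t u) \<in> L" using that by (rule ApL)
      moreover have "(?A t ^^ (?n - 1)) (?A t u) = (?A t ^^ ?n) u"
        by (metis Suc_pred' comp_apply funpow_Suc_right zero_less_card_finite)
      ultimately show "R t u = 0" unfolding R_def L by simp
    qed
    have it: "(?A t ^^ k) v \<in> L \<Longrightarrow> v \<in> L" for k v
      by (induction k) (auto intro: pull)
    show ?thesis
    proof
      fix v assume "v \<in> gen_eigenspace (?A t) 0"
      then obtain k where "(?A t ^^ k) v = 0" by (auto simp: gen_eigenspace_def)
      then show "v \<in> L" using it[of k v] vec.subspace_0[OF subL] by simp
    qed
  qed
  then show ?thesis using d(1) by blast
qed

lemma cartan_ad_nilpotent:
  assumes h: "cartan_subalgebra br h" and x: "x \<in> h"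
  shows "h \<subseteq> gen_eigenspace (br x) 0"
proof
  fix y assume y: "y \<in> h"
  obtain j where j: "lower_central_series br h j = {0}" using h by (auto simp: cartan_subalgebra_def nilpotent_lie_def)
  have "(br x ^^ k) y \<in> lower_central_series br h k" for k
    by (induction k) (use x y in \<open>auto simp: bracket_span_def intro!: vec.span_base\<close>)
  from this[of j] show "y \<in> gen_eigenspace (br x) 0" using j by (auto simp: gen_eigenspace_def)
qed

text \<open>Take x in h whose null space N has least dimension. Along a line x + t z in h the null
  spaces lie in N for small t, hence equal N, and polynomial dependence on t makes
  \<open>ad z\<close> nilpotent on N. If h were smaller than N, Engel's theorem on N / h would give
  an element outside h that normalises h, against self-normalisation.\<close>

lemma ex_regular_element:
  assumes h: "cartan_subalgebra br h"
  shows "\<exists>x\<in>h. gen_eigenspace (br x) 0 = h"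
proof -
  have alg: "lie_subalgebra br h" and subh: "vec.subspace h"
    and norm: "\<And>v. (\<And>y. y \<in> h \<Longrightarrow> br v y \<in> h) \<Longrightarrow> v \<in> h"
    using h by (auto simp: cartan_subalgebra_def lie_subalgebra_def)
  let ?N = "\<lambda>x. gen_eigenspace (br x) 0"
  obtain x where x: "x \<in> h" and min: "\<And>y. y \<in> h \<Longrightarrow> vec.dim (?N x) \<le> vec.dim (?N y)"
    using arg_min_nat_lemma[of "\<lambda>x. x \<in> h" "0 :: 'k ^ 'n" "\<lambda>x. vec.dim (?N x)"] vec.subspace_0[OF subh] by blast
  have hN: "h \<subseteq> ?N y" if "y \<in> h" for y by (rule cartan_ad_nilpotent[OF h that])
  have sub: "vec.subspace (?N y)" for y by (rule subspace_gen_eigenspace[OF klin_br])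
  have nil: "(br z ^^ CARD('n)) v = 0" if z: "z \<in> h" and v: "v \<in> ?N x" for z v
  proof -
    obtain d where d: "d > 0" "\<And>t::real. \<bar>t\<bar> < d \<Longrightarrow> ?N (x + (of_real t :: 'k) *s z) \<subseteq> ?N x"
      using null_component_perturb[of z x] hN[OF x] z by blast
    have zero: "(br (x + (of_real t :: 'k) *s z) ^^ CARD('n)) v = 0" if "\<bar>t\<bar> < d" for t :: real
    proof -
      have "x + (of_real t :: 'k) *s z \<in> h" using x z subh by (intro vec.subspace_add vec.subspace_scale)
      then have "?N (x + (of_real t :: 'k) *s z) = ?N x"
        using d(2)[OF that] min by (intro vec.subspace_dim_equal sub) auto
      then show ?thesis using v gen_eigenspace_0[OF klin_br] by blast
    qed
    obtain w where w: "\<And>c. ((\<lambda>v. br x v + c *s br z v) ^^ CARD('n)) v = (\<Sum>k\<le>CARD('n). c ^ k *s w k)"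
      "w CARD('n) = (br z ^^ CARD('n)) v"
      using funpow_affine_family[OF klin_br[of x] klin_br[of z], where m = "CARD('n)" and v = v] by blast
    have fam: "br (x + c *s z) = (\<lambda>v. br x v + c *s br z v)" for c
      by (simp add: fun_eq_iff br_add_left br_scale_left)
    have "w CARD('n) $ i = 0" for i
    proof -
      have "(\<Sum>k\<le>CARD('n). w k $ i * of_real t ^ k) = 0" if "\<bar>t\<bar> < d" for t :: real
        using zero[OF that] unfolding fam w(1) by (simp add: vec_eq_iff mult.commute)
      then have "of_real ` {-d<..<d} \<subseteq> {c. (\<Sum>k\<le>CARD('n). w k $ i * c ^ k) = 0}" by (auto simp: abs_less_iff)
      moreover have "infinite (of_real ` {-d<..<d} :: 'k set)"
        using d(1) by (subst finite_image_iff) (auto intro: inj_onI)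
      ultimately have "infinite {c. (\<Sum>k\<le>CARD('n). w k $ i * c ^ k) = 0}" using finite_subset by blast
      then show ?thesis using polyfun_finite_roots[of "\<lambda>k. w k $ i" "CARD('n)"] by blast
    qed
    then show ?thesis using w(2) by (simp add: vec_eq_iff)
  qed
  have "h = ?N x"
  proof (rule ccontr)
    assume "h \<noteq> ?N x"
    then have ps: "h \<subset> ?N x" using hN[OF x] by blast
    have "\<exists>v\<in>?N x - h. \<forall>y\<in>h. br y v \<in> h"
    proof (rule engel[OF alg sub subh ps])
      show "br y v \<in> ?N x" if "y \<in> h" "v \<in> ?N x" for y v
        using gen_eigenspace_br[of y x 0 v 0] hN[OF x] that by auto
      show "br y v \<in> h" if "y \<in> h" "v \<in> h" for y v using alg that by (simp add: lie_subalgebra_def)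
      show "\<exists>k. (br y ^^ k) v \<in> h" if "y \<in> h" "v \<in> ?N x" for y v
        using nil[OF that] vec.subspace_0[OF subh] by metis
      show "\<exists>k. (br y ^^ k) v = 0" if "y \<in> h" "v \<in> h" for y v
        using nil[OF that(1)] hN[OF x] that(2) by blast
    qed
    then obtain v where v: "v \<notin> h" "\<And>y. y \<in> h \<Longrightarrow> br y v \<in> h" by blast
    have "br v y \<in> h" if "y \<in> h" for y
      using vec.subspace_neg[OF subh v(2)[OF that]] by (subst br_anti)
    then show False using norm v(1) by blast
  qed
  then show ?thesis using x by blast
qed

text \<open>Over the complex numbers complexification is onto. Over the reals, coordinatewise
  conjugation commutes with \<open>ad x\<close> and so maps the generalised eigenspace of a to that
  of cnj a; hence it commutes with T, and T preserves the real vectors.\<close>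

lemma eigen_operator_real:
  fixes x v :: "'k ^ 'n"
  assumes T: "eigen_operator (\<lambda>z. z) (brC (complexify x)) T"
  shows "T (complexify v) \<in> range (complexify :: 'k ^ 'n \<Rightarrow> _)"
proof (rule to_complex_real_or_surj[where ?'k = 'k])
  assume s: "surj (to_complex :: 'k \<Rightarrow> complex)"
  have "w = complexify (\<chi> i. (inv_into UNIV to_complex (w $ i) :: 'k))" for w :: "complex ^ 'n"
    using s by (simp add: vec_eq_iff surj_f_inv_f)
  then show ?thesis by blast
next
  assume real: "\<And>x :: 'k. cnj (to_complex x) = to_complex x"
  define cv :: "complex ^ 'n \<Rightarrow> complex ^ 'n" where "cv v = (\<chi> i. cnj (v $ i))" for v
  have cv: "cv (u + v) = cv u + cv v" "cv (c *s u) = cnj c *s cv u" "cv (cv u) = u" "cv 0 = 0" "cv (u - v) = cv u - cv v"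
    for u v c by (simp_all add: cv_def vec_eq_iff)
  have cvx: "cv (complexify y) = complexify y" for y :: "'k ^ 'n" by (simp add: cv_def vec_eq_iff real)
  let ?f = "brC (complexify x)"
  have kT: "klin T" using T by (simp add: eigen_operator_def)
  have brcv: "?f (cv w) = cv (?f w)" for w
  proof -
    have "klin (\<lambda>w. cv (?f (cv w)))" by (rule klinI) (simp_all add: cv C.br_add C.br_scale)
    then have "cv (?f (cv w)) = ?f w"
    proof (rule klin_eq_on_axes[OF _ C.klin_br])
      fix i show "cv (?f (cv (axis i 1))) = ?f (axis i 1)"
        by (simp only: axis_complexify cvx complex_bracket_complexify)
    qed
    then show ?thesis by (metis cv(3))
  qed
  have sh: "(klin_shift ?f (cnj a) ^^ k) (cv w) = cv ((klin_shift ?f a ^^ k) w)" for a k w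
    by (induction k) (simp_all add: klin_shift_def cv brcv)
  have cvg: "cv w \<in> gen_eigenspace ?f (cnj a)" if w: "w \<in> gen_eigenspace ?f a" for a w
  proof -
    obtain k where "(klin_shift ?f a ^^ k) w = 0" using w unfolding gen_eigenspace_def by blast
    then have "(klin_shift ?f (cnj a) ^^ k) (cv w) = 0" unfolding sh by (simp only: cv(4))
    then show ?thesis unfolding gen_eigenspace_def by blast
  qed
  have "cv (T (cv w)) = T w" for w
  proof (rule klin_eq_on_span[where f = "\<lambda>w. cv (T (cv w))", OF _ kT _ gen_eigenspaces_span[OF C.klin_br, of w "complexify x"]])
    show "klin (\<lambda>w. cv (T (cv w)))" by (rule klinI) (simp_all add: cv klin_add[OF kT] klin_scale[OF kT])
    fix w assume "w \<in> (\<Union>a. gen_eigenspace ?f a)"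
    then obtain a where a: "w \<in> gen_eigenspace ?f a" by blast
    then have "T w = a *s w" "T (cv w) = cnj a *s cv w"
      using T cvg[OF a] unfolding eigen_operator_def by blast+
    then show "cv (T (cv w)) = T w" by (simp add: cv)
  qed
  then have "cv (T (complexify v)) = T (complexify v)" by (metis cvx)
  then have "T (complexify v) = complexify (\<chi> i. (of_real (Re (T (complexify v) $ i)) :: 'k))"
    by (auto simp: cv_def vec_eq_iff complex_eq_iff)
  then show ?thesis by blast
qed

theorem ex_regular_functional:
  assumes ss: "semisimple_lie br" and h: "cartan_subalgebra br h"
  shows "\<exists>f :: 'k ^ 'n \<Rightarrow> 'k. (\<forall>x y. f (x + y) = f x + f y) \<and> (\<forall>c x. f (c *s x) = c * f x) \<and>
    (\<forall>x. (\<forall>y. f (br x y) = 0) \<longleftrightarrow> x \<in> h)"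
proof -
  obtain x where x: "x \<in> h" "gen_eigenspace (br x) 0 = h" using ex_regular_element[OF h] by blast
  let ?f = "brC (complexify x)"
  obtain T where T: "eigen_operator (\<lambda>z. z) ?f T" using ex_eigen_operator[OF C.klin_br] by blast
  then have der: "C.derivation T" using eigen_operator_derivation[OF lie_algebra_complex_bracket T] by simp
  have kT: "klin T" using T by (simp add: eigen_operator_def)
  have "\<forall>v :: 'k ^ 'n. \<exists>w :: 'k ^ 'n. T (complexify v) = complexify w" using eigen_operator_real[OF T] by blast
  \<comment> \<open>T restricts to an operator \<open>D\<close> of the given algebra; injectivity of
    \<open>complexify\<close> carries over linearity and the Leibniz rule.\<close>
  then obtain D :: "'k ^ 'n \<Rightarrow> 'k ^ 'n" where D: "\<And>v. T (complexify v) = complexify (D v)"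
    by (auto dest!: choice)
  have "complexify (D (u + v)) = complexify (D u + D v)" "complexify (D (c *s u)) = complexify (c *s D u)"
    "complexify (D (br u v)) = complexify (br (D u) v + br u (D v))" for u v c
    using der by (simp_all add: complexify_add complexify_scale klin_add[OF kT] klin_scale[OF kT]
        C.derivation_def complex_bracket_complexify[symmetric] flip: D)
  then have D': "derivation D" unfolding derivation_def klin_def complexify_inject by blast
  have D0: "D v = 0 \<longleftrightarrow> v \<in> h" for v
  proof -
    have "D v = 0 \<longleftrightarrow> T (complexify v) = 0" unfolding D by (metis complexify_0 complexify_inject)
    then show ?thesis
      by (simp add: eigen_operator_ker[OF C.klin_br T] gen_eigenspace_0_complexify x(2))
  qed
  define f where "f v = trace (matrix D ** ad v)" for v
  have "f (u + v) = f u + f v" "f (c *s u) = c * f u" for u v c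
    by (simp_all add: f_def ad_add ad_scale matrix_add_ldistrib trace_add)
      (simp add: trace_def matrix_matrix_mult_def sum_distrib_left mult.left_commute)
  moreover have "(\<forall>v. f (br u v) = 0) \<longleftrightarrow> u \<in> h" for u
  proof -
    have "(\<forall>v. f (br u v) = 0) \<longleftrightarrow> (\<forall>v. killing (D u) v = 0)"
      by (simp add: f_def trace_derivation_br[OF D'])
    also have "\<dots> \<longleftrightarrow> D u = 0"
      using killing_nondegenerate[OF ss] killing_scale_left[of 0 0] by auto
    finally show ?thesis by (simp add: D0)
  qed
  ultimately show ?thesis by blast
qed

end

section \<open>Calculus of smooth functions\<close>

abbreviation fd :: "('a::real_normed_vector \<Rightarrow> 'b::real_normed_vector) \<Rightarrow> 'a \<Rightarrow> 'a \<Rightarrow> 'b" where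
  "fd f x \<equiv> frechet_derivative f (at x)"

lemma fd_eqI: "(f has_derivative f') (at x) \<Longrightarrow> fd f x = f'"
  using frechet_derivative_at by metis

lemma has_fd: "f differentiable (at x) \<Longrightarrow> (f has_derivative fd f x) (at x)"
  by (simp add: frechet_derivative_works)

lemma fd_cong:
  assumes "open S" "x \<in> S" "\<And>y. y \<in> S \<Longrightarrow> f y = g y" "f differentiable (at x)"
  shows "fd g x = fd f x" "g differentiable (at x)"
proof -
  have "(g has_derivative fd f x) (at x)"
    using has_derivative_transform_within_open[OF has_fd[OF assms(4)] assms(1,2,3)] .
  then show "fd g x = fd f x" "g differentiable (at x)" by (auto intro: fd_eqI simp: differentiable_def)
qed

lemma fd_comp:
  assumes "f differentiable (at x)" "g differentiable (at (f x))"
  shows "fd (\<lambda>y. g (f y)) x v = fd g (f x) (fd f x v)" "(\<lambda>y. g (f y)) differentiable (at x)"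
proof -
  have "((\<lambda>y. g (f y)) has_derivative (\<lambda>v. fd g (f x) (fd f x v))) (at x)"
    using diff_chain_at[OF has_fd[OF assms(1)] has_fd[OF assms(2)]] by (simp add: o_def)
  then show "fd (\<lambda>y. g (f y)) x v = fd g (f x) (fd f x v)" "(\<lambda>y. g (f y)) differentiable (at x)"
    by (auto simp: fd_eqI differentiable_def)
qed

lemma fd_bounded_linear: "bounded_linear L \<Longrightarrow> fd L x = L"
  by (intro fd_eqI bounded_linear_imp_has_derivative)

lemma ck_on_cong:
  assumes "open S" "\<And>x. x \<in> S \<Longrightarrow> f x = g x" "ck_on j f S"
  shows "ck_on j g S"
  using assms(2,3)
proof (induction j arbitrary: f g)
  case 0 then show ?case by (simp cong: continuous_on_cong)
next
  case (Suc j)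
  have "fd f x = fd g x" "g differentiable (at x)" if "x \<in> S" for x
    using fd_cong[OF assms(1) that, of f g] Suc.prems that by auto
  then show ?case using Suc.prems Suc.IH[of "\<lambda>x. fd f x v" "\<lambda>x. fd g x v" for v] by auto
qed

lemma ck_on_subset: "ck_on j f S \<Longrightarrow> T \<subseteq> S \<Longrightarrow> ck_on j f T"
  by (induction j arbitrary: f) (auto intro: continuous_on_subset)

lemma ck_on_SucD: "ck_on (Suc j) f S \<Longrightarrow> ck_on j f S"
proof (induction j arbitrary: f)
  case 0
  then show ?case
    by (auto intro!: continuous_at_imp_continuous_on differentiable_imp_continuous_within)
qed auto

lemma ck_on_const: "ck_on j (\<lambda>x. c) S"
  by (induction j arbitrary: c) auto

lemma ck_on_linear: "bounded_linear L \<Longrightarrow> ck_on j L S"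
  by (cases j) (auto simp: fd_bounded_linear ck_on_const bounded_linear_imp_differentiable linear_continuous_on)

lemma ck_on_linear_comp:
  assumes L: "bounded_linear L" and S: "open S" and "ck_on j f S"
  shows "ck_on j (\<lambda>x. L (f x)) S"
  using assms(3)
proof (induction j arbitrary: f)
  case 0 then show ?case using continuous_on_compose2[OF linear_continuous_on[OF L]] by simp blast
next
  case (Suc j)
  have Ld: "L differentiable (at y)" for y using L by (rule bounded_linear_imp_differentiable)
  have *: "fd (\<lambda>x. L (f x)) x v = L (fd f x v)" "(\<lambda>x. L (f x)) differentiable (at x)" if "x \<in> S" for x v
    using fd_comp(1)[of f x L v] fd_comp(2)[of f x L] Suc.prems that Ld by (auto simp: fd_bounded_linear[OF L])
  have "ck_on j (\<lambda>x. fd (\<lambda>x. L (f x)) x v) S" for v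
    by (rule ck_on_cong[OF S _ Suc.IH[of "\<lambda>x. fd f x v"]]) (use * Suc.prems in auto)
  then show ?case using * by simp
qed

lemma ck_on_add:
  assumes S: "open S" and "ck_on j f S" "ck_on j g S"
  shows "ck_on j (\<lambda>x. f x + g x) S"
  using assms(2-)
proof (induction j arbitrary: f g)
  case 0 then show ?case by (auto intro: continuous_on_add)
next
  case (Suc j)
  have *: "fd (\<lambda>x. f x + g x) x = (\<lambda>v. fd f x v + fd g x v)" if "x \<in> S" for x
    using Suc.prems that by (intro fd_eqI has_derivative_add has_fd) auto
  have "ck_on j (\<lambda>x. fd (\<lambda>x. f x + g x) x v) S" for v
    by (rule ck_on_cong[OF S _ Suc.IH[of "\<lambda>x. fd f x v" "\<lambda>x. fd g x v"]]) (use * Suc.prems in auto)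
  then show ?case using Suc.prems by simp
qed

lemma ck_on_sum:
  assumes S: "open S" and "\<And>i. i \<in> I \<Longrightarrow> ck_on j (f i) S"
  shows "ck_on j (\<lambda>x. \<Sum>i\<in>I. f i x) S"
  using assms(2) by (induction I rule: infinite_finite_induct) (auto intro: ck_on_const ck_on_add S)

lemma ck_on_bilinear:
  assumes P: "bounded_bilinear P" and S: "open S" and "ck_on j f S" "ck_on j g S"
  shows "ck_on j (\<lambda>x. P (f x) (g x)) S"
  using assms(3-)
proof (induction j arbitrary: f g)
  case 0 then show ?case using bounded_bilinear.continuous_on[OF P] by simp
next
  case (Suc j)
  have h: "((\<lambda>x. P (f x) (g x)) has_derivative (\<lambda>v. P (f x) (fd g x v) + P (fd f x v) (g x))) (at x)" if "x \<in> S" for x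
    using Suc.prems that by (intro bounded_bilinear.FDERIV[OF P] has_fd) auto
  then have *: "fd (\<lambda>x. P (f x) (g x)) x = (\<lambda>v. P (f x) (fd g x v) + P (fd f x v) (g x))" if "x \<in> S" for x
    using that by (intro fd_eqI) auto
  have "ck_on j f S" "ck_on j g S" using Suc.prems ck_on_SucD by blast+
  then have "ck_on j (\<lambda>x. P (f x) (fd g x v) + P (fd f x v) (g x)) S" for v
    using Suc.prems by (intro ck_on_add[OF S] Suc.IH) auto
  then have "ck_on j (\<lambda>x. fd (\<lambda>x. P (f x) (g x)) x v) S" for v
    by (rule ck_on_cong[OF S, rotated]) (use * in auto)
  moreover have "(\<lambda>x. P (f x) (g x)) differentiable (at x)" if "x \<in> S" for x
    using h[OF that] by (auto simp: differentiable_def)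
  ultimately show ?case by simp
qed

lemma euclidean_linear_expand:
  fixes L :: "'a::euclidean_space \<Rightarrow> 'b::real_normed_vector"
  assumes "linear L" shows "L v = (\<Sum>b\<in>Basis. (v \<bullet> b) *\<^sub>R L b)"
proof -
  have "L v = L (\<Sum>b\<in>Basis. (v \<bullet> b) *\<^sub>R b)" by (simp add: euclidean_representation)
  then show ?thesis using assms by (simp add: linear_sum linear_cmul)
qed

text \<open>In the differential of the composite, the direction handed to the differential of g
  varies with x. Expanding it in the basis leaves only fixed directions, to which the induction
  hypothesis for g applies.\<close>

lemma ck_on_comp:
  fixes f :: "'a::real_normed_vector \<Rightarrow> 'b::euclidean_space"
  assumes S: "open S" and T: "open T" and fS: "\<And>x. x \<in> S \<Longrightarrow> f x \<in> T" and "ck_on j f S" "ck_on j g T"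
  shows "ck_on j (\<lambda>x. g (f x)) S"
  using assms(4-)
proof (induction j arbitrary: g)
  case 0 then show ?case using fS by (auto intro: continuous_on_compose2)
next
  case (Suc j)
  have fj: "ck_on j f S" and gj: "ck_on j g T" using Suc.prems ck_on_SucD by blast+
  have *: "fd (\<lambda>x. g (f x)) x v = fd g (f x) (fd f x v)" "(\<lambda>x. g (f x)) differentiable (at x)" if "x \<in> S" for x v
    using fd_comp(1)[of f x g v] fd_comp(2)[of f x g] Suc.prems that fS by auto
  have exp: "fd g (f x) (fd f x v) = (\<Sum>b\<in>Basis. (fd f x v \<bullet> b) *\<^sub>R fd g (f x) b)" if "x \<in> S" for x v
    using Suc.prems(2) fS[OF that] by (intro euclidean_linear_expand linear_frechet_derivative) auto
  have 1: "ck_on j (\<lambda>x. fd f x v \<bullet> b) S" for v b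
    using Suc.prems(1) by (intro ck_on_linear_comp[OF bounded_linear_inner_left S]) auto
  have 2: "ck_on j (\<lambda>x. fd g (f x) b) S" for b
    using Suc.prems(2) by (intro Suc.IH[OF fj]) auto
  have "ck_on j (\<lambda>x. \<Sum>b\<in>Basis. (fd f x v \<bullet> b) *\<^sub>R fd g (f x) b) S" for v
    by (intro ck_on_sum[OF S] ck_on_bilinear[OF bounded_bilinear_scaleR S] 1 2)
  then have "ck_on j (\<lambda>x. fd (\<lambda>x. g (f x)) x v) S" for v
    by (rule ck_on_cong[OF S, rotated]) (simp add: * exp)
  then show ?case using * by simp
qed

lemma ck_on_inverse:
  fixes f :: "'a::real_normed_vector \<Rightarrow> 'k::real_normed_field"
  assumes S: "open S" and ne: "\<And>x. x \<in> S \<Longrightarrow> f x \<noteq> 0" and "ck_on j f S"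
  shows "ck_on j (\<lambda>x. inverse (f x)) S"
  using assms(3)
proof (induction j)
  case 0 then show ?case using ne by (auto intro: continuous_on_inverse)
next
  case (Suc j)
  have h: "((\<lambda>x. inverse (f x)) has_derivative (\<lambda>v. - (inverse (f x) * fd f x v * inverse (f x)))) (at x)" if "x \<in> S" for x
    using Suc.prems that ne by (intro Deriv.has_derivative_inverse has_fd) auto
  then have *: "fd (\<lambda>x. inverse (f x)) x = (\<lambda>v. - (inverse (f x) * fd f x v * inverse (f x)))" if "x \<in> S" for x
    using that by (intro fd_eqI) auto
  have i: "ck_on j (\<lambda>x. inverse (f x)) S" using Suc ck_on_SucD by blast
  have "ck_on j (\<lambda>x. - (inverse (f x) * fd f x v * inverse (f x))) S" for v
    using Suc.prems by (intro ck_on_linear_comp[OF bounded_linear_minus[OF bounded_linear_ident] S]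
        ck_on_bilinear[OF bounded_bilinear_mult S] i) auto
  then have "ck_on j (\<lambda>x. fd (\<lambda>x. inverse (f x)) x v) S" for v
    by (rule ck_on_cong[OF S, rotated]) (use * in auto)
  moreover have "(\<lambda>x. inverse (f x)) differentiable (at x)" if "x \<in> S" for x
    using h[OF that] by (auto simp: differentiable_def)
  ultimately show ?case by simp
qed

lemma ck_on_prod:
  fixes f :: "'i \<Rightarrow> 'a::real_normed_vector \<Rightarrow> 'k::real_normed_field"
  assumes S: "open S" and "\<And>i. i \<in> I \<Longrightarrow> ck_on j (f i) S"
  shows "ck_on j (\<lambda>x. \<Prod>i\<in>I. f i x) S"
  using assms(2)
  by (induction I rule: infinite_finite_induct) (auto intro: ck_on_const ck_on_bilinear[OF bounded_bilinear_mult S])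

lemma ck_on_local:
  assumes "\<And>x. x \<in> S \<Longrightarrow> \<exists>T. open T \<and> x \<in> T \<and> ck_on j f T"
  shows "ck_on j f S"
  using assms
proof (induction j arbitrary: f)
  case 0
  have "continuous (at x) f" if "x \<in> S" for x
    using 0[OF that] by (auto simp: continuous_on_eq_continuous_at)
  then show ?case by (simp add: continuous_at_imp_continuous_on)
next
  case (Suc j)
  have "f differentiable (at x)" if "x \<in> S" for x using Suc.prems[OF that] by auto
  moreover have "ck_on j (\<lambda>x. fd f x v) S" for v
  proof (rule Suc.IH)
    fix x assume "x \<in> S"
    then obtain T where "open T" "x \<in> T" "ck_on (Suc j) f T" using Suc.prems by blast
    then show "\<exists>T. open T \<and> x \<in> T \<and> ck_on j (\<lambda>x. fd f x v) T" by auto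
  qed
  ultimately show ?case by simp
qed

lemma bounded_linear_axis: "bounded_linear (axis k :: 'a::euclidean_space \<Rightarrow> 'a ^ 'm::finite)"
  by (intro linear_conv_bounded_linear[THEN iffD1] linearI) (auto simp: axis_def vec_eq_iff)

lemma ck_on_vec:
  fixes f :: "'a::real_normed_vector \<Rightarrow> 'k::euclidean_space ^ 'm::finite"
  assumes S: "open S" and "\<And>k. ck_on j (\<lambda>x. f x $ k) S"
  shows "ck_on j f S"
proof -
  have "ck_on j (\<lambda>x. \<Sum>k\<in>UNIV. axis k (f x $ k)) S"
    by (intro ck_on_sum[OF S] ck_on_linear_comp[OF bounded_linear_axis S] assms)
  moreover have "(\<Sum>k\<in>UNIV. axis k (f x $ k)) = f x" for x
    by (simp add: vec_eq_iff axis_def if_distrib[of "\<lambda>g. g $ _"] cong: if_cong)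
  ultimately show ?thesis by simp
qed

lemma ck_on_nth:
  "open S \<Longrightarrow> ck_on j f S \<Longrightarrow> ck_on j (\<lambda>x. f x $ k) S"
  by (rule ck_on_linear_comp[OF bounded_linear_vec_nth])

subsection \<open>Symmetry of second derivatives\<close>

text \<open>The mean value theorem is used twice: in direction u on the difference of f between two
  opposite edges of the parallelogram, and in direction v on the derivative so obtained. The point
  is that the left side is symmetric in u and v.\<close>

lemma second_difference:
  fixes f :: "'a::real_normed_vector \<Rightarrow> real"
  assumes f: "ck_on 2 f S" and t: "t > 0" and S: "\<And>s r. 0 \<le> s \<Longrightarrow> s \<le> t \<Longrightarrow> 0 \<le> r \<Longrightarrow> r \<le> t \<Longrightarrow> x + s *\<^sub>R u + r *\<^sub>R v \<in> S"
  shows "\<exists>s r. 0 \<le> s \<and> s \<le> t \<and> 0 \<le> r \<and> r \<le> t \<and>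
    f (x + t *\<^sub>R u + t *\<^sub>R v) - f (x + t *\<^sub>R u) - f (x + t *\<^sub>R v) + f x
      = t * t * fd (\<lambda>y. fd f y u) (x + s *\<^sub>R u + r *\<^sub>R v) v"
proof -
  have line: "((\<lambda>s. g (p + s *\<^sub>R w)) has_real_derivative fd g (p + s *\<^sub>R w) w) (at s)"
    if "g differentiable (at (p + s *\<^sub>R w))" for g :: "'a \<Rightarrow> real" and p w s
  proof -
    have "((\<lambda>s. p + s *\<^sub>R w) has_derivative (\<lambda>s. s *\<^sub>R w)) (at s)"
      by (auto intro!: derivative_eq_intros)
    from diff_chain_at[OF this has_fd[OF that]]
    have "((\<lambda>s. g (p + s *\<^sub>R w)) has_derivative (\<lambda>r. fd g (p + s *\<^sub>R w) (r *\<^sub>R w))) (at s)"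
      by (simp add: o_def)
    moreover have "fd g (p + s *\<^sub>R w) (r *\<^sub>R w) = fd g (p + s *\<^sub>R w) w * r" for r
      using linear_frechet_derivative[OF that] by (simp add: linear_cmul)
    ultimately show ?thesis by (simp add: has_field_derivative_def)
  qed
  have d1: "f differentiable (at y)" and d2: "(\<lambda>y. fd f y u) differentiable (at y)" if "y \<in> S" for y
    using f that by (auto simp: numeral_2_eq_2)
  define \<phi> where "\<phi> s = f (x + t *\<^sub>R v + s *\<^sub>R u) - f (x + s *\<^sub>R u)" for s
  have "\<exists>s>0. s < t \<and> \<phi> t - \<phi> 0 = (t - 0) * (fd f (x + t *\<^sub>R v + s *\<^sub>R u) u - fd f (x + s *\<^sub>R u) u)"
  proof (rule MVT2[OF t])
    fix s assume s: "0 \<le> s" "s \<le> t"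
    have "x + t *\<^sub>R v + s *\<^sub>R u \<in> S" "x + s *\<^sub>R u \<in> S"
      using S[of s t] S[of s 0] s t by (auto simp: algebra_simps)
    then show "DERIV \<phi> s :> fd f (x + t *\<^sub>R v + s *\<^sub>R u) u - fd f (x + s *\<^sub>R u) u"
      unfolding \<phi>_def by (intro DERIV_diff line d1)
  qed
  then obtain s where s: "0 < s" "s < t"
    and eq: "\<phi> t - \<phi> 0 = t * (fd f (x + t *\<^sub>R v + s *\<^sub>R u) u - fd f (x + s *\<^sub>R u) u)" by auto
  have "\<exists>r>0. r < t \<and> fd f (x + s *\<^sub>R u + t *\<^sub>R v) u - fd f (x + s *\<^sub>R u + 0 *\<^sub>R v) u
    = (t - 0) * fd (\<lambda>y. fd f y u) (x + s *\<^sub>R u + r *\<^sub>R v) v"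
  proof (rule MVT2[OF t])
    fix r assume r: "0 \<le> r" "r \<le> t"
    show "DERIV (\<lambda>r. fd f (x + s *\<^sub>R u + r *\<^sub>R v) u) r :> fd (\<lambda>y. fd f y u) (x + s *\<^sub>R u + r *\<^sub>R v) v"
      using S[of s r] s r by (intro line[of "\<lambda>y. fd f y u"] d2) auto
  qed
  then obtain r where r: "0 < r" "r < t" and eq2: "fd f (x + s *\<^sub>R u + t *\<^sub>R v) u - fd f (x + s *\<^sub>R u) u
    = t * fd (\<lambda>y. fd f y u) (x + s *\<^sub>R u + r *\<^sub>R v) v" by auto
  have "f (x + t *\<^sub>R u + t *\<^sub>R v) - f (x + t *\<^sub>R u) - f (x + t *\<^sub>R v) + f x = \<phi> t - \<phi> 0"
    by (simp add: \<phi>_def algebra_simps)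
  also have "\<dots> = t * t * fd (\<lambda>y. fd f y u) (x + s *\<^sub>R u + r *\<^sub>R v) v"
    using eq eq2 by (simp add: algebra_simps)
  finally show ?thesis using s r by (intro exI[of _ s] exI[of _ r]) auto
qed

text \<open>Both mixed derivatives, at suitable points near x, equal one and the same second
  difference quotient, so a gap between their values at x contradicts continuity.\<close>

lemma fd_symmetric_real:
  fixes f :: "'a::real_normed_vector \<Rightarrow> real"
  assumes S: "open S" and x: "x \<in> S" and f: "ck_on 2 f S"
  shows "fd (\<lambda>y. fd f y u) x v = fd (\<lambda>y. fd f y v) x u"
proof (rule ccontr)
  let ?P = "\<lambda>y. fd (\<lambda>y. fd f y u) y v" and ?Q = "\<lambda>y. fd (\<lambda>y. fd f y v) y u"
  assume ne: "?P x \<noteq> ?Q x"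
  define e where "e = \<bar>?P x - ?Q x\<bar> / 2"
  have e: "e > 0" using ne by (simp add: e_def)
  have "continuous (at x) ?P" "continuous (at x) ?Q"
    using f x S by (auto simp: numeral_2_eq_2 continuous_on_eq_continuous_at)
  then obtain d1 d2 where d: "d1 > 0" "\<And>y. dist y x < d1 \<Longrightarrow> dist (?P y) (?P x) < e"
    "d2 > 0" "\<And>y. dist y x < d2 \<Longrightarrow> dist (?Q y) (?Q x) < e"
    using e unfolding continuous_at_eps_delta by metis
  obtain d3 where d3: "d3 > 0" "ball x d3 \<subseteq> S" using S x open_contains_ball by blast
  define m where "m = min d3 (min d1 d2)"
  \<comment> \<open>This side length keeps the parallelogram spanned by t u and t v within distance
    m / 2 of x; the added 1 keeps the denominator positive when u and v vanish.\<close>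
  define t where "t = m / (2 * (norm u + norm v + 1))"
  have m: "m > 0" "m \<le> d3" "m \<le> d1" "m \<le> d2" using d d3 by (auto simp: m_def)
  have n: "norm u + norm v + 1 > 0" by (smt (verit) norm_ge_zero)
  have t: "t > 0" unfolding t_def using m n by simp
  have near: "dist (x + s *\<^sub>R a + r *\<^sub>R b) x < m" if "0 \<le> s" "s \<le> t" "0 \<le> r" "r \<le> t" "norm a + norm b = norm u + norm v" for s r a b
  proof -
    have "dist (x + s *\<^sub>R a + r *\<^sub>R b) x = norm (s *\<^sub>R a + r *\<^sub>R b)" by (simp add: dist_norm algebra_simps)
    also have "\<dots> \<le> s * norm a + r * norm b" using that by (metis abs_of_nonneg norm_scaleR norm_triangle_ineq)
    also have "\<dots> \<le> t * norm a + t * norm b" using that by (intro add_mono mult_right_mono) auto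
    also have "\<dots> = t * (norm u + norm v)" unfolding that(5)[symmetric] by (rule distrib_left[symmetric])
    also have "\<dots> \<le> t * (norm u + norm v + 1)" using t by (intro mult_left_mono) auto
    also have "\<dots> = m / 2" using n by (simp only: t_def) (metis less_irrefl nonzero_mult_divide_mult_cancel_right times_divide_eq_left)
    also have "\<dots> < m" using m by simp
    finally show ?thesis .
  qed
  have inS: "y \<in> S" if "dist y x < m" for y using that d3 m by (auto simp: dist_commute subset_eq)
  obtain s r where sr: "0 \<le> s" "s \<le> t" "0 \<le> r" "r \<le> t"
    "f (x + t *\<^sub>R u + t *\<^sub>R v) - f (x + t *\<^sub>R u) - f (x + t *\<^sub>R v) + f x = t * t * ?P (x + s *\<^sub>R u + r *\<^sub>R v)"
    using second_difference[OF f t, of x u v] inS near by metis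
  obtain s' r' where sr': "0 \<le> s'" "s' \<le> t" "0 \<le> r'" "r' \<le> t"
    "f (x + t *\<^sub>R v + t *\<^sub>R u) - f (x + t *\<^sub>R v) - f (x + t *\<^sub>R u) + f x = t * t * ?Q (x + s' *\<^sub>R v + r' *\<^sub>R u)"
    using second_difference[OF f t, of x v u] inS near[of _ _ v u] by (metis add.commute)
  have "x + t *\<^sub>R u + t *\<^sub>R v = x + t *\<^sub>R v + t *\<^sub>R u" by simp
  from arg_cong[OF this, of f] have "f (x + t *\<^sub>R u + t *\<^sub>R v) = f (x + t *\<^sub>R v + t *\<^sub>R u)" .
  then have "t * t * ?P (x + s *\<^sub>R u + r *\<^sub>R v) = t * t * ?Q (x + s' *\<^sub>R v + r' *\<^sub>R u)" using sr(5) sr'(5) by linarith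
  then have "?P (x + s *\<^sub>R u + r *\<^sub>R v) = ?Q (x + s' *\<^sub>R v + r' *\<^sub>R u)" using t by simp
  moreover have "dist (?P (x + s *\<^sub>R u + r *\<^sub>R v)) (?P x) < e"
    using near[of s r u v] sr m by (intro d) auto
  moreover have "dist (?Q (x + s' *\<^sub>R v + r' *\<^sub>R u)) (?Q x) < e"
    using near[of s' r' v u] sr' m by (intro d) auto
  ultimately have "\<bar>?P x - ?Q x\<bar> < 2 * e" by (simp add: dist_real_def)
  then show False by (simp add: e_def)
qed

lemma fd_symmetric:
  fixes f :: "'a::real_normed_vector \<Rightarrow> 'b::euclidean_space"
  assumes S: "open S" and x: "x \<in> S" and f: "\<And>j. ck_on j f S"
  shows "fd (\<lambda>y. fd f y u) x v = fd (\<lambda>y. fd f y v) x u"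
proof (rule euclidean_eqI)
  fix b :: 'b
  have f2: "ck_on (Suc (Suc 0)) f S" by (rule f)
  have b: "bounded_linear (\<lambda>w. w \<bullet> b)" by (rule bounded_linear_inner_left)
  have d1: "fd (\<lambda>y. g y \<bullet> b) y w = fd g y w \<bullet> b" if "g differentiable (at y)" for g :: "'a \<Rightarrow> 'b" and y w
    using fd_comp(1)[OF that bounded_linear_imp_differentiable[OF b]] by (simp add: fd_bounded_linear[OF b])
  have d2: "fd (\<lambda>y. fd f y w \<bullet> b) x w' = fd (\<lambda>y. fd (\<lambda>y. f y \<bullet> b) y w) x w'" for w w'
    using f2 x S bounded_linear_imp_differentiable[OF b] fd_comp(2)[of "\<lambda>y. fd f y w" x "\<lambda>w. w \<bullet> b"]
    by (intro fd_cong(1)[OF S x, THEN fun_cong, symmetric]) (auto simp: d1)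
  have "fd (\<lambda>y. fd f y u) x v \<bullet> b = fd (\<lambda>y. fd (\<lambda>y. f y \<bullet> b) y u) x v"
    using f2 x d1[of "\<lambda>y. fd f y u" x v] by (simp add: d2)
  also have "\<dots> = fd (\<lambda>y. fd (\<lambda>y. f y \<bullet> b) y v) x u"
    by (intro fd_symmetric_real[OF S x] ck_on_linear_comp[OF b S] f)
  also have "\<dots> = fd (\<lambda>y. fd f y v) x u \<bullet> b"
    using f2 x d1[of "\<lambda>y. fd f y v" x u] by (simp add: d2)
  finally show "fd (\<lambda>y. fd f y u) x v \<bullet> b = fd (\<lambda>y. fd f y v) x u \<bullet> b" .
qed

text \<open>The parameter \<open>C\<close> lists pairs of a scalar and an operation on the domain that the
  differentials intertwine: \<open>C = {}\<close> gives real smoothness on any domain, and \<open>scalars\<close> gives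
  \<open>smooth_on\<close>.\<close>

definition smo :: "('k::real_or_complex \<times> ('d \<Rightarrow> 'd)) set \<Rightarrow> ('d::real_normed_vector \<Rightarrow> 'k ^ 'l::finite) \<Rightarrow> 'd set \<Rightarrow> bool"
  where "smo C f S \<longleftrightarrow> (\<forall>j. ck_on j f S) \<and>
    (\<forall>x\<in>S. \<forall>(c, \<sigma>)\<in>C. \<forall>v. fd f x (\<sigma> v) = c *s fd f x v)"

definition scalars :: "('k::real_or_complex \<times> ('k ^ 'd::finite \<Rightarrow> 'k ^ 'd)) set" where
  "scalars = range (\<lambda>c. (c, (*s) c))"

lemma smooth_on_smo: "smooth_on S f \<longleftrightarrow> smo scalars f S"
  by (auto simp: smooth_on_def smo_def scalars_def)

lemma smo_ck: "smo C f S \<Longrightarrow> ck_on j f S"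
  by (simp add: smo_def)

lemma smo_empty: "smo {} f S \<longleftrightarrow> (\<forall>j. ck_on j f S)"
  by (simp add: smo_def)

lemma smo_real: "smo C f S \<Longrightarrow> smo {} f S"
  by (simp add: smo_def)

lemma smo_differentiable: "smo C f S \<Longrightarrow> x \<in> S \<Longrightarrow> f differentiable (at x)"
  using smo_ck[of C f S "Suc 0"] by simp

lemma smo_continuous: "smo C f S \<Longrightarrow> continuous_on S f"
  using smo_ck[of C f S 0] by simp

lemma smo_scale: "smo C f S \<Longrightarrow> x \<in> S \<Longrightarrow> (c, \<sigma>) \<in> C \<Longrightarrow> fd f x (\<sigma> v) = c *s fd f x v"
  unfolding smo_def by fast

lemma smoI:
  assumes "\<And>j. ck_on j f S" "\<And>x c \<sigma> v. x \<in> S \<Longrightarrow> (c, \<sigma>) \<in> C \<Longrightarrow> fd f x (\<sigma> v) = c *s fd f x v"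
  shows "smo C f S"
  using assms by (auto simp: smo_def)

lemma smo_subset: "smo C f S \<Longrightarrow> T \<subseteq> S \<Longrightarrow> smo C f T"
  unfolding smo_def using ck_on_subset by blast

lemma smo_cong:
  assumes S: "open S" and eq: "\<And>x. x \<in> S \<Longrightarrow> f x = g x" and f: "smo C f S"
  shows "smo C g S"
proof (rule smoI)
  show "ck_on j g S" for j using ck_on_cong[OF S eq smo_ck[OF f]] .
  fix x c \<sigma> v assume x: "x \<in> S" "(c, \<sigma>) \<in> C"
  have "fd g x = fd f x" using fd_cong(1)[OF S x(1) eq smo_differentiable[OF f x(1)]] .
  then show "fd g x (\<sigma> v) = c *s fd g x v" using smo_scale[OF f x] by simp
qed

lemma smo_local:
  assumes "\<And>x. x \<in> S \<Longrightarrow> \<exists>T. open T \<and> x \<in> T \<and> smo C f T"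
  shows "smo C f S"
proof (rule smoI)
  show "ck_on j f S" for j using assms by (intro ck_on_local) (meson smo_ck)
  show "fd f x (\<sigma> v) = c *s fd f x v" if "x \<in> S" "(c, \<sigma>) \<in> C" for x c \<sigma> v
    using assms[OF that(1)] smo_scale that(2) by blast
qed

lemma smo_const: "smo C (\<lambda>x. c) S"
  by (rule smoI) (auto simp: ck_on_const)

lemma bounded_linear_klin:
  fixes L :: "'k::real_or_complex ^ 'n::finite \<Rightarrow> 'k ^ 'm::finite"
  shows "klin L \<Longrightarrow> bounded_linear L"
  using klin_imp_linear linear_conv_bounded_linear by blast

lemma klin_fd: "smo scalars f S \<Longrightarrow> x \<in> S \<Longrightarrow> klin (fd f x)"
  unfolding klin_def
  using linear_frechet_derivative[OF smo_differentiable, of scalars f S x] smo_scale[of scalars f S x]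
  by (auto simp: linear_add scalars_def)

lemma smo_klin: "klin L \<Longrightarrow> smo scalars L S"
  using bounded_linear_klin[of L]
  by (intro smoI) (auto simp: ck_on_linear fd_bounded_linear scalars_def klin_scale)

lemma smo_klin_comp:
  assumes L: "klin L" and S: "open S" and f: "smo C f S"
  shows "smo C (\<lambda>x. L (f x)) S"
proof (rule smoI)
  show "ck_on j (\<lambda>x. L (f x)) S" for j
    by (rule ck_on_linear_comp[OF bounded_linear_klin[OF L] S smo_ck[OF f]])
  fix x c \<sigma> v assume x: "x \<in> S" "(c, \<sigma>) \<in> C"
  have "fd (\<lambda>x. L (f x)) x w = L (fd f x w)" for w
    using fd_comp(1)[OF smo_differentiable[OF f x(1)] bounded_linear_imp_differentiable[OF bounded_linear_klin[OF L]]]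
    by (simp add: fd_bounded_linear[OF bounded_linear_klin[OF L]])
  then show "fd (\<lambda>x. L (f x)) x (\<sigma> v) = c *s fd (\<lambda>x. L (f x)) x v"
    using smo_scale[OF f x] by (simp add: klin_scale[OF L])
qed

lemma fd_add: "f differentiable (at x) \<Longrightarrow> g differentiable (at x) \<Longrightarrow>
    fd (\<lambda>x. f x + g x) x v = fd f x v + fd g x v"
  using fd_eqI[OF has_derivative_add[OF has_fd has_fd], of f x g] by simp

lemma smo_add:
  assumes S: "open S" and f: "smo C f S" and g: "smo C g S"
  shows "smo C (\<lambda>x. f x + g x) S"
proof (rule smoI)
  show "ck_on j (\<lambda>x. f x + g x) S" for j by (rule ck_on_add[OF S smo_ck[OF f] smo_ck[OF g]])
  fix x c \<sigma> v assume x: "x \<in> S" "(c, \<sigma>) \<in> C"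
  then show "fd (\<lambda>x. f x + g x) x (\<sigma> v) = c *s fd (\<lambda>x. f x + g x) x v"
    using smo_scale[OF f x] smo_scale[OF g x]
    by (simp add: fd_add smo_differentiable[OF f] smo_differentiable[OF g] vec.scale_right_distrib)
qed

lemma smo_sum: "open S \<Longrightarrow> (\<And>i. i \<in> I \<Longrightarrow> smo C (f i) S) \<Longrightarrow> smo C (\<lambda>x. \<Sum>i\<in>I. f i x) S"
  by (induction I rule: infinite_finite_induct) (auto intro: smo_const smo_add)

definition kbilin :: "('k::field ^ 'a \<Rightarrow> 'k ^ 'b \<Rightarrow> 'k ^ 'c) \<Rightarrow> bool" where
  "kbilin P \<longleftrightarrow> (\<forall>x. klin (P x)) \<and> (\<forall>y. klin (\<lambda>x. P x y))"

lemma bounded_bilinear_kbilin: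
  fixes P :: "'k::real_or_complex ^ 'a::finite \<Rightarrow> 'k ^ 'b::finite \<Rightarrow> 'k ^ 'c::finite"
  shows "kbilin P \<Longrightarrow> bounded_bilinear P"
  by (simp add: bilinear_conv_bounded_bilinear[symmetric] bilinear_def kbilin_def klin_imp_linear)

lemma fd_kbilin:
  fixes P :: "'k::real_or_complex ^ 'a::finite \<Rightarrow> 'k ^ 'b::finite \<Rightarrow> 'k ^ 'c::finite"
  assumes "kbilin P" "f differentiable (at x)" "g differentiable (at x)"
  shows "fd (\<lambda>x. P (f x) (g x)) x v = P (f x) (fd g x v) + P (fd f x v) (g x)"
  using fun_cong[OF fd_eqI[OF bounded_bilinear.FDERIV[OF bounded_bilinear_kbilin[OF assms(1)]
    has_fd[OF assms(2)] has_fd[OF assms(3)]]], of v] .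

lemma smo_bilin:
  assumes P: "kbilin P" and S: "open S" and f: "smo C f S" and g: "smo C g S"
  shows "smo C (\<lambda>x. P (f x) (g x)) S"
proof (rule smoI)
  show "ck_on j (\<lambda>x. P (f x) (g x)) S" for j
    by (rule ck_on_bilinear[OF bounded_bilinear_kbilin[OF P] S smo_ck[OF f] smo_ck[OF g]])
  fix x c \<sigma> v assume x: "x \<in> S" "(c, \<sigma>) \<in> C"
  have "klin (P a)" "klin (\<lambda>a. P a b)" for a b using P by (auto simp: kbilin_def)
  then have "P a (c *s b) = c *s P a b" "P (c *s a) b = c *s P a b" for a b by (simp_all add: klin_def)
  then show "fd (\<lambda>x. P (f x) (g x)) x (\<sigma> v) = c *s fd (\<lambda>x. P (f x) (g x)) x v"
    using smo_scale[OF f x] smo_scale[OF g x]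
    by (simp add: fd_kbilin[OF P smo_differentiable[OF f x(1)] smo_differentiable[OF g x(1)]] vec.scale_right_distrib)
qed

lemma smo_comp:
  assumes S: "open S" and T: "open T" and fS: "\<And>x. x \<in> S \<Longrightarrow> f x \<in> T" and f: "smo C f S" and g: "smo scalars g T"
  shows "smo C (\<lambda>x. g (f x)) S"
proof (rule smoI)
  show "ck_on j (\<lambda>x. g (f x)) S" for j by (intro ck_on_comp[OF S T fS smo_ck[OF f] smo_ck[OF g]])
  fix x c \<sigma> v assume x: "x \<in> S" "(c, \<sigma>) \<in> C"
  have "fd (\<lambda>x. g (f x)) x w = fd g (f x) (fd f x w)" for w
    by (rule fd_comp[OF smo_differentiable[OF f x(1)] smo_differentiable[OF g fS[OF x(1)]]])
  then show "fd (\<lambda>x. g (f x)) x (\<sigma> v) = c *s fd (\<lambda>x. g (f x)) x v"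
    using smo_scale[OF f x] klin_scale[OF klin_fd[OF g fS[OF x(1)]]] by simp
qed

lemma smo_comp_real:
  fixes f :: "'a::real_normed_vector \<Rightarrow> 'b::euclidean_space"
  assumes "open S" "open T" "\<And>x. x \<in> S \<Longrightarrow> f x \<in> T" "\<And>j. ck_on j f S" "smo {} g T"
  shows "smo {} (\<lambda>x. g (f x)) S"
  unfolding smo_empty using assms by (blast intro: ck_on_comp smo_ck)

text \<open>Scalars pass through because the second derivative is symmetric: the factor c moves from
  the direction of the outer differentiation into the differential of f, which is linear over the
  ground field at every point.\<close>

lemma smo_fd:
  fixes f :: "'k::real_or_complex ^ 'd::finite \<Rightarrow> 'k ^ 'l::finite"
  assumes S: "open S" and f: "smo scalars f S"
  shows "smo scalars (\<lambda>x. fd f x w) S"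
proof (rule smoI)
  have f': "ck_on (Suc (Suc j)) f S" for j by (rule smo_ck[OF f])
  show "ck_on j (\<lambda>x. fd f x w) S" for j using smo_ck[OF f, of "Suc j"] by simp
  fix x and c :: 'k and \<sigma> v assume x: "x \<in> S" "(c, \<sigma>) \<in> (scalars :: ('k \<times> ('k ^ 'd \<Rightarrow> 'k ^ 'd)) set)"
  then have \<sigma>: "\<sigma> = (*s) c" by (auto simp: scalars_def)
  have L: "klin ((*s) c :: 'k ^ 'l \<Rightarrow> 'k ^ 'l)" using klin_mult[OF klin_id] .
  have "fd (\<lambda>x. fd f x w) x (c *s v) = fd (\<lambda>x. fd f x (c *s v)) x w"
    by (rule fd_symmetric[OF S x(1) smo_ck[OF f]])
  also have "\<dots> = fd (\<lambda>x. c *s fd f x v) x w"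
    using f'[of 0] x(1) klin_scale[OF klin_fd[OF f]]
    by (intro fun_cong[OF fd_cong(1)[OF S x(1), symmetric]]) auto
  also have "\<dots> = c *s fd (\<lambda>x. fd f x v) x w"
    using fd_comp(1)[of "\<lambda>x. fd f x v" x "(*s) c" w] f'[of 0] x(1)
      bounded_linear_imp_differentiable[OF bounded_linear_klin[OF L]] by (simp add: fd_bounded_linear[OF bounded_linear_klin[OF L]])
  also have "fd (\<lambda>x. fd f x v) x w = fd (\<lambda>x. fd f x w) x v"
    by (rule fd_symmetric[OF S x(1) smo_ck[OF f]])
  finally show "fd (\<lambda>x. fd f x w) x (\<sigma> v) = c *s fd (\<lambda>x. fd f x w) x v" by (simp add: \<sigma>)
qed

lemma kbilin_nth_smult: "kbilin (\<lambda>q z. q $ i *s z)"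
  by (auto simp: kbilin_def intro!: klinI simp: vector_sadd_rdistrib vec.scale_right_distrib mult.commute mult.left_commute)

text \<open>The varying direction is expanded along the axes, so that only differentials in fixed
  directions have to be smooth.\<close>

lemma smo_fd_apply:
  fixes F :: "'k::real_or_complex ^ 'd::finite \<Rightarrow> 'k ^ 'l::finite"
  assumes S: "open S" and F: "smo scalars F S" and W: "open W" and p: "smo C p W" and q: "smo C q W"
    and pW: "\<And>w. w \<in> W \<Longrightarrow> p w \<in> S"
  shows "smo C (\<lambda>w. fd F (p w) (q w)) W"
proof (rule smo_cong[OF W])
  show "smo C (\<lambda>w. \<Sum>i\<in>UNIV. q w $ i *s fd F (p w) (axis i 1)) W"
    by (intro smo_sum[OF W] smo_bilin[OF kbilin_nth_smult W q] smo_comp[OF W S pW p] smo_fd[OF S F])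
  show "(\<Sum>i\<in>UNIV. q w $ i *s fd F (p w) (axis i 1)) = fd F (p w) (q w)" if "w \<in> W" for w
    by (rule klin_expand[OF klin_fd[OF F pW[OF that]], symmetric])
qed

subsection \<open>Smooth local inverses\<close>

lemma ck_on_det:
  fixes M :: "'a::real_normed_vector \<Rightarrow> 'k::real_or_complex ^ 'm ^ 'm::finite"
  assumes S: "open S" and M: "\<And>i l. ck_on j (\<lambda>x. M x $ i $ l) S"
  shows "ck_on j (\<lambda>x. det (M x)) S"
  unfolding det_def
  by (intro ck_on_sum[OF S] ck_on_bilinear[OF bounded_bilinear_mult S] ck_on_const ck_on_prod[OF S] M)

text \<open>The inverse function theorem gives a differentiable inverse g whose differential is the
  inverse of that of F at g y. Cramer's rule writes it as a quotient of determinants in the entries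
  of dF at g y, so smoothness of g to one order yields the next. Linearity over the ground field is
  that of the inverse of a linear map.\<close>

lemma smooth_local_inverse:
  fixes F :: "'k::real_or_complex ^ 'm::finite \<Rightarrow> 'k ^ 'm"
  assumes S: "open S" and F: "smo scalars F S" and x0: "x0 \<in> S" and inj: "\<And>v. fd F x0 v = 0 \<Longrightarrow> v = 0"
  obtains U V g where "open U" "U \<subseteq> S" "x0 \<in> U" "open V" "F x0 \<in> V"
    "\<And>x. x \<in> U \<Longrightarrow> F x \<in> V \<and> g (F x) = x" "\<And>y. y \<in> V \<Longrightarrow> g y \<in> U \<and> F (g y) = y"
    "smo scalars g V"
proof -
  let ?F' = "\<lambda>x. Blinfun (fd F x)"
  have F': "blinfun_apply (?F' x) = fd F x" if "x \<in> S" for x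
    using bounded_linear_klin[OF klin_fd[OF F that]] by (rule bounded_linear_Blinfun_apply)
  have "continuous_on S ?F'"
  proof (rule continuous_on_blinfun_componentwise)
    fix b :: "'k ^ 'm"
    have "ck_on (Suc 0) F S" by (rule smo_ck[OF F])
    then have "continuous_on S (\<lambda>x. fd F x b)" by simp
    then show "continuous_on S (\<lambda>x. blinfun_apply (?F' x) b)" by (rule continuous_on_eq) (simp add: F')
  qed
  have k0: "klin (fd F x0)" by (rule klin_fd[OF F x0])
  have "inj (fd F x0)" using inj klin_diff[OF k0] by (intro injI) (metis eq_iff_diff_eq_0)
  then obtain invf where invf: "linear invf" "invf \<circ> fd F x0 = id"
    using linear_injective_left_inverse[OF klin_imp_linear[OF k0]] by blast
  have invb: "bounded_linear invf" using invf(1) linear_conv_bounded_linear by blast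
  have "Blinfun invf o\<^sub>L ?F' x0 = id_blinfun"
    using invf(2) by (intro blinfun_eqI) (simp add: bounded_linear_Blinfun_apply[OF invb] F'[OF x0] o_def fun_eq_iff)
  then obtain U V g g' where U: "open U" "U \<subseteq> S" "x0 \<in> U" and V: "open V" "F x0 \<in> V"
    and hom: "homeomorphism U V F g"
    and g': "\<And>y. y \<in> V \<Longrightarrow> (g has_derivative g' y) (at y)"
    "\<And>y. y \<in> V \<Longrightarrow> g' y = inv_into UNIV (blinfun_apply (?F' (g y)))"
    "\<And>y. y \<in> V \<Longrightarrow> bij (blinfun_apply (?F' (g y)))"
    using inverse_function_theorem[OF S _ \<open>continuous_on S ?F'\<close> x0, of F "Blinfun invf"] has_fd[OF smo_differentiable[OF F]] F'
    by metis
  have gV: "g y \<in> U \<and> F (g y) = y" if "y \<in> V" for y using hom that by (auto simp: homeomorphism_def)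
  have FU: "F x \<in> V \<and> g (F x) = x" if "x \<in> U" for x using hom that by (auto simp: homeomorphism_def)
  have gS: "g y \<in> S" if "y \<in> V" for y using gV[OF that] U by auto
  have fdg: "fd F (g y) (fd g y v) = v" and bij: "bij (fd F (g y))" if y: "y \<in> V" for y v
  proof -
    show b: "bij (fd F (g y))" using g'(3)[OF y] F'[OF gS[OF y]] by simp
    have "fd g y = inv_into UNIV (fd F (g y))" using g'(1,2)[OF y] F'[OF gS[OF y]] fd_eqI by metis
    then show "fd F (g y) (fd g y v) = v" using b by (simp add: bij_is_surj surj_f_inv_f)
  qed
  let ?M = "\<lambda>y. matrix (fd F (g y))"
  have kF: "klin (fd F (g y))" if "y \<in> V" for y by (rule klin_fd[OF F gS[OF that]])
  have M: "det (?M y) \<noteq> 0" if "y \<in> V" for y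
  proof -
    have "inj ((*v) (?M y))" using bij[OF that] klin_matrix[OF kF[OF that]] by (simp add: bij_def inj_def)
    then show ?thesis using inj_matrix_vector_mult matrix_left_invertible_injective invertible_left_inverse invertible_det_nz by metis
  qed
  have cram: "fd g y v = (\<chi> k. det (\<chi> i j. if j = k then v $ i else ?M y $ i $ j) / det (?M y))" if "y \<in> V" for y v
    using cramer[OF M[OF that], of "fd g y v" v] fdg[OF that] klin_matrix[OF kF[OF that]] by simp
  have "ck_on j g V" for j
  proof (induction j)
    case 0
    then show ?case using hom by (simp add: homeomorphism_def)
  next
    case (Suc j)
    have Mj: "ck_on j (\<lambda>y. ?M y $ i $ l) V" for i l
    proof -
      have "ck_on j (\<lambda>x. fd F x (axis l 1)) S" using smo_ck[OF F, of "Suc j"] by simp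
      then have "ck_on j (\<lambda>y. fd F (g y) (axis l 1)) V" using ck_on_comp[OF V(1) S gS Suc.IH] by blast
      then show ?thesis unfolding matrix_def by (simp add: ck_on_nth[OF V(1)])
    qed
    have "ck_on j (\<lambda>y. \<chi> k. det (\<chi> i l. if l = k then v $ i else ?M y $ i $ l) / det (?M y)) V" for v
    proof (rule ck_on_vec[OF V(1)])
      fix k
      have "ck_on j (\<lambda>y. det (\<chi> i l. if l = k then v $ i else ?M y $ i $ l) * inverse (det (?M y))) V"
      proof (intro ck_on_bilinear[OF bounded_bilinear_mult V(1)] ck_on_inverse[OF V(1)] ck_on_det[OF V(1)] Mj M)
        fix i l show "ck_on j (\<lambda>x. (\<chi> i l. if l = k then v $ i else ?M x $ i $ l) $ i $ l) V"
          using Mj[of i l] by (cases "l = k") (auto simp: ck_on_const)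
      qed
      then show "ck_on j (\<lambda>x. (\<chi> k. det (\<chi> i l. if l = k then v $ i else ?M x $ i $ l) / det (?M x)) $ k) V"
        by (simp add: divide_inverse)
    qed
    then have "ck_on j (\<lambda>y. fd g y v) V" for v
      by (rule ck_on_cong[OF V(1), rotated]) (simp add: cram)
    then show ?case using g'(1) by (auto simp: differentiable_def)
  qed
  moreover have "fd g y (c *s v) = c *s fd g y v" if "y \<in> V" for y c v
  proof -
    have "fd F (g y) (fd g y (c *s v)) = fd F (g y) (c *s fd g y v)"
      using fdg[OF that] by (simp add: klin_scale[OF kF[OF that]])
    then show ?thesis using bij[OF that] by (simp add: bij_def inj_def)
  qed
  ultimately have "smo scalars g V" by (intro smoI) (auto simp: scalars_def)
  then show ?thesis using that[OF U V FU gV] by blast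
qed

section \<open>Parametrised families in a manifold\<close>

text \<open>The chart conditions without compatibility, separation and countability. The atlas of
  the coset space is known to meet them long before it is known to be a manifold, and they suffice
  to describe its topology.\<close>

definition charted :: "('p, 'k::real_or_complex, 'm::finite) atlas \<Rightarrow> bool" where
  "charted M \<longleftrightarrow> (\<forall>(U, \<phi>)\<in>M. inj_on \<phi> U \<and> open (\<phi> ` U))"

lemma charted_manifold: "manifold M \<Longrightarrow> charted M"
  by (auto simp: manifold_def charted_def)

lemma chartedD:
  assumes "charted M" "(U, \<phi>) \<in> M"
  shows "inj_on \<phi> U" "open (\<phi> ` U)" "U \<subseteq> points M"
  using assms by (auto simp: charted_def points_def)

lemma pointsE:
  assumes "p \<in> points M" obtains U \<phi> where "(U, \<phi>) \<in> M" "p \<in> U"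
  using assms by (auto simp: points_def)

lemma openin_charted:
  "charted M \<Longrightarrow> openin (manifold_topology M) T \<longleftrightarrow> T \<subseteq> points M \<and> (\<forall>(U, \<phi>)\<in>M. open (\<phi> ` (U \<inter> T)))"
  by (intro openin_manifold_topology) (auto simp: charted_def)

lemma topspace_charted:
  assumes "charted M" shows "topspace (manifold_topology M) = points M"
proof
  show "topspace (manifold_topology M) \<subseteq> points M"
    using openin_topspace[of "manifold_topology M"] openin_charted[OF assms] by blast
  have "U \<inter> points M = U" if "(U, \<phi>) \<in> M" for U \<phi> using chartedD(3)[OF assms that] by blast
  then have "openin (manifold_topology M) (points M)"
    unfolding openin_charted[OF assms] using chartedD(2)[OF assms] by auto
  then show "points M \<subseteq> topspace (manifold_topology M)" by (rule openin_subset)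
qed

lemma openin_chart_domain:
  assumes "manifold M" "(U, \<phi>) \<in> M" shows "openin (manifold_topology M) U"
proof -
  have "open (\<psi> ` (V \<inter> U))" if "(V, \<psi>) \<in> M" for V \<psi>
    using assms that unfolding manifold_def by fastforce
  then show ?thesis
    using assms chartedD(3)[OF charted_manifold[OF assms(1)] assms(2)]
    unfolding openin_charted[OF charted_manifold[OF assms(1)]] by auto
qed

lemma manifold_transition:
  assumes "manifold M" "(U, \<phi>) \<in> M" "(V, \<psi>) \<in> M"
  shows "open (\<phi> ` (U \<inter> V))" "smo scalars (\<lambda>x. \<psi> (inv_into U \<phi> x)) (\<phi> ` (U \<inter> V))"
  using assms unfolding manifold_def smooth_on_smo by fastforce+

text \<open>Plots in the sense of diffeology. They put real curves, with \<open>C = {}\<close>, and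
  families smooth over the ground field, with \<open>C = scalars\<close>, under one calculus in
  which group operations apply to families without a choice of charts.\<close>

definition plot ::
    "('k::real_or_complex \<times> ('d \<Rightarrow> 'd)) set \<Rightarrow> 'd::real_normed_vector set \<Rightarrow> ('p, 'k, 'm::finite) atlas \<Rightarrow> ('d \<Rightarrow> 'p) \<Rightarrow> bool"
  where "plot C W M \<eta> \<longleftrightarrow> open W \<and> \<eta> ` W \<subseteq> points M \<and>
    (\<forall>(V, \<psi>)\<in>M. open (W \<inter> \<eta> -` V) \<and> smo C (\<lambda>x. \<psi> (\<eta> x)) (W \<inter> \<eta> -` V))"

lemma plotD:
  assumes "plot C W M \<eta>"
  shows "open W" "x \<in> W \<Longrightarrow> \<eta> x \<in> points M"
    "(V, \<psi>) \<in> M \<Longrightarrow> open (W \<inter> \<eta> -` V)" "(V, \<psi>) \<in> M \<Longrightarrow> smo C (\<lambda>x. \<psi> (\<eta> x)) (W \<inter> \<eta> -` V)"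
  using assms unfolding plot_def by fast+

lemma plotI:
  assumes "open W" "\<And>x. x \<in> W \<Longrightarrow> \<eta> x \<in> points M"
    "\<And>V \<psi>. (V, \<psi>) \<in> M \<Longrightarrow> open (W \<inter> \<eta> -` V)" "\<And>V \<psi>. (V, \<psi>) \<in> M \<Longrightarrow> smo C (\<lambda>x. \<psi> (\<eta> x)) (W \<inter> \<eta> -` V)"
  shows "plot C W M \<eta>"
  using assms unfolding plot_def by fast

lemma plot_openin:
  assumes M: "charted M" and p: "plot C W M \<eta>" and T: "openin (manifold_topology M) T"
  shows "open (W \<inter> \<eta> -` T)"
proof (rule open_subopen[THEN iffD2], rule ballI)
  fix x assume x: "x \<in> W \<inter> \<eta> -` T"
  then have "\<eta> x \<in> points M" using plotD(2)[OF p] by blast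
  then obtain V \<psi> where V: "(V, \<psi>) \<in> M" "\<eta> x \<in> V" by (rule pointsE)
  let ?O = "(W \<inter> \<eta> -` V) \<inter> (\<lambda>x. \<psi> (\<eta> x)) -` (\<psi> ` (V \<inter> T))"
  have "open (\<psi> ` (V \<inter> T))" using T V(1) unfolding openin_charted[OF M] by fast
  then have "open ?O"
    using plotD(3)[OF p V(1)] smo_continuous[OF plotD(4)[OF p V(1)]] by (intro continuous_open_preimage)
  moreover have "x \<in> ?O" using x V by auto
  moreover have "?O \<subseteq> W \<inter> \<eta> -` T" using chartedD(1)[OF M V(1)] by (auto simp: inj_on_def)
  ultimately show "\<exists>O'. open O' \<and> x \<in> O' \<and> O' \<subseteq> W \<inter> \<eta> -` T" by blast
qed

lemma plot_cong:
  assumes eq: "\<And>x. x \<in> W \<Longrightarrow> \<eta> x = \<zeta> x" and p: "plot C W M \<eta>"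
  shows "plot C W M \<zeta>"
proof (rule plotI)
  have s: "W \<inter> \<zeta> -` V = W \<inter> \<eta> -` V" for V using eq by auto
  fix V \<psi> assume V: "(V, \<psi>) \<in> M"
  show "open (W \<inter> \<zeta> -` V)" unfolding s by (rule plotD(3)[OF p V])
  show "smo C (\<lambda>x. \<psi> (\<zeta> x)) (W \<inter> \<zeta> -` V)"
    unfolding s by (rule smo_cong[OF plotD(3)[OF p V] _ plotD(4)[OF p V]]) (simp add: eq)
qed (use plotD[OF p] eq in auto)

lemma plot_subset:
  assumes p: "plot C W M \<eta>" and "open W'" "W' \<subseteq> W"
  shows "plot C W' M \<eta>"
proof (rule plotI)
  fix V \<psi> assume V: "(V, \<psi>) \<in> M"
  have "W' \<inter> \<eta> -` V = W' \<inter> (W \<inter> \<eta> -` V)" using assms by blast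
  then show "open (W' \<inter> \<eta> -` V)" using plotD(3)[OF p V] assms by auto
  show "smo C (\<lambda>x. \<psi> (\<eta> x)) (W' \<inter> \<eta> -` V)" using assms by (intro smo_subset[OF plotD(4)[OF p V]]) auto
qed (use assms plotD[OF p] in auto)

lemma plot_local:
  assumes "open W" and loc: "\<And>x. x \<in> W \<Longrightarrow> \<exists>W'. x \<in> W' \<and> plot C W' M \<eta>"
  shows "plot C W M \<eta>"
proof (rule plotI)
  fix V \<psi> assume V: "(V, \<psi>) \<in> M"
  show "open (W \<inter> \<eta> -` V)"
  proof (rule open_subopen[THEN iffD2], rule ballI)
    fix x assume x: "x \<in> W \<inter> \<eta> -` V"
    then obtain W' where W': "x \<in> W'" "plot C W' M \<eta>" using loc by blast
    have "open (W \<inter> (W' \<inter> \<eta> -` V))" using plotD(3)[OF W'(2) V] assms(1) by auto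
    then show "\<exists>O'. open O' \<and> x \<in> O' \<and> O' \<subseteq> W \<inter> \<eta> -` V"
      using x W'(1) by (intro exI[of _ "W \<inter> (W' \<inter> \<eta> -` V)"]) auto
  qed
  show "smo C (\<lambda>x. \<psi> (\<eta> x)) (W \<inter> \<eta> -` V)"
  proof (rule smo_local)
    fix x assume x: "x \<in> W \<inter> \<eta> -` V"
    then obtain W' where W': "x \<in> W'" "plot C W' M \<eta>" using loc by blast
    then show "\<exists>T. open T \<and> x \<in> T \<and> smo C (\<lambda>x. \<psi> (\<eta> x)) T"
      using plotD(3,4)[OF W'(2) V] x by (intro exI[of _ "W' \<inter> \<eta> -` V"]) auto
  qed
qed (use assms plotD(2) in blast)+

lemma plot_chart:
  assumes M: "manifold M" and U: "(U, \<phi>) \<in> M" and W: "open W" and f: "smo C f W" and fU: "\<And>x. x \<in> W \<Longrightarrow> f x \<in> \<phi> ` U"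
  shows "plot C W M (\<lambda>x. inv_into U \<phi> (f x))"
proof (rule plotI)
  show "open W" by (rule W)
  show "inv_into U \<phi> (f x) \<in> points M" if "x \<in> W" for x
    using inv_into_into[OF fU[OF that]] chartedD(3)[OF charted_manifold[OF M] U] by blast
  fix V \<psi> assume V: "(V, \<psi>) \<in> M"
  note tr = manifold_transition[OF M U V]
  have inj: "inj_on \<phi> U" using chartedD(1)[OF charted_manifold[OF M] U] .
  have eq: "W \<inter> (\<lambda>x. inv_into U \<phi> (f x)) -` V = W \<inter> f -` (\<phi> ` (U \<inter> V))"
  proof (intro Set.set_eqI iffI)
    fix x assume x: "x \<in> W \<inter> (\<lambda>x. inv_into U \<phi> (f x)) -` V"
    then have "f x = \<phi> (inv_into U \<phi> (f x))" "inv_into U \<phi> (f x) \<in> U"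
      using fU by (auto simp: f_inv_into_f inv_into_into)
    with x show "x \<in> W \<inter> f -` (\<phi> ` (U \<inter> V))" by auto
  qed (use inj in auto)
  show o: "open (W \<inter> (\<lambda>x. inv_into U \<phi> (f x)) -` V)"
    unfolding eq by (rule continuous_open_preimage[OF smo_continuous[OF f] W tr(1)])
  have "smo C f (W \<inter> f -` (\<phi> ` (U \<inter> V)))" by (rule smo_subset[OF f]) auto
  then show "smo C (\<lambda>x. \<psi> (inv_into U \<phi> (f x))) (W \<inter> (\<lambda>x. inv_into U \<phi> (f x)) -` V)"
    using smo_comp[OF o tr(1) _ _ tr(2), of f C] unfolding eq by blast
qed

lemma plot_inv_chart:
  assumes "manifold M" "(U, \<phi>) \<in> M"
  shows "plot scalars (\<phi> ` U) M (inv_into U \<phi>)"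
  using chartedD[OF charted_manifold[OF assms(1)] assms(2)]
  by (intro plot_chart[OF assms, where f = "\<lambda>x. x"] smo_klin klin_id) auto

lemma plot_via_chart:
  assumes M: "manifold M" and U: "(U, \<phi>) \<in> M" and W: "open W" and \<eta>U: "\<And>x. x \<in> W \<Longrightarrow> \<eta> x \<in> U"
    and f: "smo C (\<lambda>x. \<phi> (\<eta> x)) W"
  shows "plot C W M \<eta>"
  using chartedD[OF charted_manifold[OF M] U] \<eta>U
  by (intro plot_cong[OF _ plot_chart[OF M U W f]]) auto

lemma plot_const:
  assumes M: "manifold M" and "p \<in> points M" and W: "open W"
  shows "plot C W M (\<lambda>x. p)"
proof -
  obtain U \<phi> where U: "(U, \<phi>) \<in> M" "p \<in> U" by (rule pointsE[OF assms(2)])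
  show ?thesis by (rule plot_via_chart[OF M U(1) W]) (auto simp: U smo_const)
qed

lemma plot_chart_around:
  assumes p: "plot C W M \<eta>" and x: "x \<in> W"
  obtains U \<phi> where "(U, \<phi>) \<in> M" "\<eta> x \<in> U" "open (W \<inter> \<eta> -` U)" "x \<in> W \<inter> \<eta> -` U"
    "smo C (\<lambda>x. \<phi> (\<eta> x)) (W \<inter> \<eta> -` U)"
proof -
  obtain U \<phi> where U: "(U, \<phi>) \<in> M" "\<eta> x \<in> U" by (rule pointsE[OF plotD(2)[OF p x]])
  show ?thesis using that[OF U plotD(3)[OF p U(1)] _ plotD(4)[OF p U(1)]] x U by blast
qed

lemma plot_comp:
  assumes M: "manifold M" and p: "plot scalars W M \<eta>" and W': "open W'" and h: "smo C h W'" and hW: "\<And>x. x \<in> W' \<Longrightarrow> h x \<in> W"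
  shows "plot C W' M (\<lambda>x. \<eta> (h x))"
proof (rule plot_local[OF W'])
  fix x assume x: "x \<in> W'"
  obtain U \<phi> where V: "(U, \<phi>) \<in> M" "\<eta> (h x) \<in> U" "open (W \<inter> \<eta> -` U)" "h x \<in> W \<inter> \<eta> -` U"
    "smo scalars (\<lambda>x. \<phi> (\<eta> x)) (W \<inter> \<eta> -` U)" by (rule plot_chart_around[OF p hW[OF x]])
  note U = V(1,3,4,5)
  let ?O = "W' \<inter> h -` (W \<inter> \<eta> -` U)"
  have o: "open ?O" by (rule continuous_open_preimage[OF smo_continuous[OF h] W' U(2)])
  have "plot C ?O M (\<lambda>x. \<eta> (h x))"
  proof (rule plot_via_chart[OF M U(1) o])
    show "smo C (\<lambda>x. \<phi> (\<eta> (h x))) ?O" by (rule smo_comp[OF o U(2) _ smo_subset[OF h] U(4)]) auto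
  qed auto
  moreover have "x \<in> ?O" using x U(3) by auto
  ultimately show "\<exists>W'. x \<in> W' \<and> plot C W' M (\<lambda>x. \<eta> (h x))" by (intro exI[of _ ?O] conjI)
qed

lemma plot_comp_real:
  fixes h :: "'e::real_normed_vector \<Rightarrow> 'd::euclidean_space"
  assumes M: "manifold M" and p: "plot {} W M \<eta>" and W': "open W'" and h: "\<And>j. ck_on j h W'" and hW: "\<And>x. x \<in> W' \<Longrightarrow> h x \<in> W"
  shows "plot {} W' M (\<lambda>x. \<eta> (h x))"
proof (rule plot_local[OF W'])
  fix x assume x: "x \<in> W'"
  obtain U \<phi> where V: "(U, \<phi>) \<in> M" "\<eta> (h x) \<in> U" "open (W \<inter> \<eta> -` U)" "h x \<in> W \<inter> \<eta> -` U"
    "smo {} (\<lambda>x. \<phi> (\<eta> x)) (W \<inter> \<eta> -` U)" by (rule plot_chart_around[OF p hW[OF x]])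
  note U = V(1,3,4,5)
  let ?O = "W' \<inter> h -` (W \<inter> \<eta> -` U)"
  have "continuous_on W' h" using h[of 0] by simp
  then have o: "open ?O" by (rule continuous_open_preimage[OF _ W' U(2)])
  have "plot {} ?O M (\<lambda>x. \<eta> (h x))"
  proof (rule plot_via_chart[OF M U(1) o])
    show "smo {} (\<lambda>x. \<phi> (\<eta> (h x))) ?O" by (rule smo_comp_real[OF o U(2) _ ck_on_subset[OF h] U(4)]) auto
  qed auto
  moreover have "x \<in> ?O" using x U(3) by auto
  ultimately show "\<exists>W'. x \<in> W' \<and> plot {} W' M (\<lambda>x. \<eta> (h x))" by (intro exI[of _ ?O] conjI)
qed

lemma plot_smooth_map:
  assumes M: "charted M" and N: "manifold N" and f: "smooth_map M N f" and p: "plot C W M \<eta>"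
  shows "plot C W N (\<lambda>x. f (\<eta> x))"
proof (rule plot_local[OF plotD(1)[OF p]])
  fix x assume x: "x \<in> W"
  have cont: "continuous_map (manifold_topology M) (manifold_topology N) f" using f by (simp add: smooth_map_def)
  obtain U \<phi> where U: "(U, \<phi>) \<in> M" "\<eta> x \<in> U" "open (W \<inter> \<eta> -` U)" "x \<in> W \<inter> \<eta> -` U"
    "smo C (\<lambda>x. \<phi> (\<eta> x)) (W \<inter> \<eta> -` U)" by (rule plot_chart_around[OF p x])
  have "f (\<eta> x) \<in> points N"
    using cont plotD(2)[OF p x] continuous_map_image_subset_topspace[OF cont]
    by (auto simp: topspace_charted[OF M] topspace_charted[OF charted_manifold[OF N]])
  then obtain V \<psi> where V: "(V, \<psi>) \<in> N" "f (\<eta> x) \<in> V" by (rule pointsE)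
  have oV: "openin (manifold_topology M) {p \<in> points M. f p \<in> V}"
    using openin_continuous_map_preimage[OF cont openin_chart_domain[OF N V(1)]] by (simp add: topspace_charted[OF M])
  have oU: "open (\<phi> ` (U \<inter> f -` V))"
  proof -
    have "U \<inter> {p \<in> points M. f p \<in> V} = U \<inter> f -` V" using chartedD(3)[OF M U(1)] by auto
    then show ?thesis using oV U(1) unfolding openin_charted[OF M] by fastforce
  qed
  let ?O = "(W \<inter> \<eta> -` U) \<inter> (W \<inter> \<eta> -` {p \<in> points M. f p \<in> V})"
  have o: "open ?O" using U(3) plot_openin[OF M p oV] by blast
  have g: "smo scalars (\<lambda>x. \<psi> (f (inv_into U \<phi> x))) (\<phi> ` (U \<inter> f -` V))"
    using f U(1) V(1) unfolding smooth_map_def smooth_on_smo by fast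
  have "smo C (\<lambda>y. \<psi> (f (inv_into U \<phi> (\<phi> (\<eta> y))))) ?O"
    by (rule smo_comp[OF o oU _ smo_subset[OF U(5)] g]) auto
  then have "smo C (\<lambda>y. \<psi> (f (\<eta> y))) ?O"
    by (rule smo_cong[OF o, rotated]) (use chartedD(1)[OF M U(1)] in auto)
  then have "plot C ?O N (\<lambda>x. f (\<eta> x))" by (intro plot_via_chart[OF N V(1) o]) auto
  moreover have "x \<in> ?O" using U(4) V(2) plotD(2)[OF p x] x by auto
  ultimately show "\<exists>W'. x \<in> W' \<and> plot C W' N (\<lambda>x. f (\<eta> x))" by (intro exI[of _ ?O] conjI)
qed

lemma smooth_mapI:
  assumes M: "charted M" and N: "charted N"
    and p: "\<And>U \<phi>. (U, \<phi>) \<in> M \<Longrightarrow> plot scalars (\<phi> ` U) N (\<lambda>x. f (inv_into U \<phi> x))"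
  shows "smooth_map M N f"
  unfolding smooth_map_def
proof (rule conjI)
  have fU: "f q \<in> points N" if "(U, \<phi>) \<in> M" "q \<in> U" for U \<phi> q
    using plotD(2)[OF p[OF that(1)], of "\<phi> q"] that chartedD(1)[OF M that(1)] by auto
  have img: "\<phi> ` (U \<inter> f -` T) = \<phi> ` U \<inter> (\<lambda>x. f (inv_into U \<phi> x)) -` T" if "(U, \<phi>) \<in> M" for U \<phi> T
    using chartedD(1)[OF M that] by auto
  show "continuous_map (manifold_topology M) (manifold_topology N) f"
    unfolding continuous_map topspace_charted[OF M] topspace_charted[OF N]
  proof (intro conjI allI impI)
    show "f ` points M \<subseteq> points N" using fU by (auto elim!: pointsE)
    fix T assume T: "openin (manifold_topology N) T"
    have "open (\<phi> ` (U \<inter> {x \<in> points M. f x \<in> T}))" if U: "(U, \<phi>) \<in> M" for U \<phi>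
    proof -
      have "U \<inter> {x \<in> points M. f x \<in> T} = U \<inter> f -` T" using chartedD(3)[OF M U] by auto
      then show ?thesis using plot_openin[OF N p[OF U] T] by (simp add: img[OF U])
    qed
    then show "openin (manifold_topology M) {x \<in> points M. f x \<in> T}"
      unfolding openin_charted[OF M] by auto
  qed
  show "\<forall>(U, \<phi>)\<in>M. \<forall>(V, \<psi>)\<in>N. smooth_on (\<phi> ` (U \<inter> f -` V)) (\<lambda>x. \<psi> (f (inv_into U \<phi> x)))"
  proof clarify
    fix U \<phi> V \<psi> assume U: "(U, \<phi>) \<in> M" and V: "(V, \<psi>) \<in> N"
    show "smooth_on (\<phi> ` (U \<inter> f -` V)) (\<lambda>x. \<psi> (f (inv_into U \<phi> x)))"
      using plotD(4)[OF p[OF U] V] by (simp only: smooth_on_smo img[OF U])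
  qed
qed

lemma smooth_map_openin:
  assumes M: "charted M" and N: "charted N" and f: "smooth_map M N f" and T: "openin (manifold_topology N) T"
  shows "openin (manifold_topology M) {p \<in> points M. f p \<in> T}"
  using f openin_continuous_map_preimage[OF _ T, of "manifold_topology M" f]
  by (simp add: smooth_map_def topspace_charted[OF M])

subsection \<open>Products\<close>

definition vpair :: "'k ^ 'm::finite \<Rightarrow> 'k ^ 'l::finite \<Rightarrow> 'k ^ ('m + 'l)" where
  "vpair x y = (\<chi> i. case i of Inl a \<Rightarrow> x $ a | Inr b \<Rightarrow> y $ b)"

definition vfst :: "'k ^ ('m::finite + 'l::finite) \<Rightarrow> 'k ^ 'm" where "vfst z = (\<chi> a. z $ Inl a)"
definition vsnd :: "'k ^ ('m::finite + 'l::finite) \<Rightarrow> 'k ^ 'l" where "vsnd z = (\<chi> b. z $ Inr b)"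

lemma vpair_simps [simp]: "vfst (vpair x y) = x" "vsnd (vpair x y) = y" "vpair (vfst z) (vsnd z) = z"
  by (auto simp: vpair_def vfst_def vsnd_def vec_eq_iff split: sum.split)

lemma klin_vfst: "klin vfst" and klin_vsnd: "klin vsnd"
  and klin_vpair1: "klin (\<lambda>x. vpair x 0)" and klin_vpair2: "klin (\<lambda>y. vpair 0 y)"
  by (auto intro!: klinI simp: vpair_def vfst_def vsnd_def vec_eq_iff split: sum.split)

lemma vpair_split: "vpair x y = vpair x 0 + vpair (0 :: 'k::field ^ 'm::finite) (y :: 'k ^ 'l::finite)"
  by (auto simp: vpair_def vec_eq_iff split: sum.split)

lemma smo_vpair:
  "open W \<Longrightarrow> smo C f W \<Longrightarrow> smo C g W \<Longrightarrow> smo C (\<lambda>w. vpair (f w) (g w)) W"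
  by (subst vpair_split) (intro smo_add smo_klin_comp[OF klin_vpair1] smo_klin_comp[OF klin_vpair2])

lemma continuous_on_vfst: "continuous_on S (vfst :: 'k::real_or_complex ^ ('m::finite + 'l::finite) \<Rightarrow> _)"
  and continuous_on_vsnd: "continuous_on S (vsnd :: 'k ^ ('m + 'l) \<Rightarrow> _)"
  using linear_continuous_on bounded_linear_klin klin_vfst klin_vsnd by blast+

lemma open_vbox:
  fixes X :: "('k::real_or_complex ^ 'm::finite) set" and Y :: "('k ^ 'l::finite) set"
  assumes "open X" "open Y" shows "open {z. vfst z \<in> X \<and> vsnd z \<in> Y}"
proof -
  have "open (vfst -` X :: ('k ^ ('m + 'l)) set)" by (rule open_vimage[OF assms(1) continuous_on_vfst])
  moreover have "open (vsnd -` Y :: ('k ^ ('m + 'l)) set)" by (rule open_vimage[OF assms(2) continuous_on_vsnd])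
  ultimately have "open (vfst -` X \<inter> vsnd -` Y :: ('k ^ ('m + 'l)) set)" by (rule open_Int)
  then show ?thesis by (simp add: vimage_def Collect_conj_eq)
qed

lemma open_vbox_inside:
  fixes z :: "'k::real_or_complex ^ ('m::finite + 'l::finite)"
  assumes "open T" "z \<in> T"
  obtains X Y where "open X" "open Y" "vfst z \<in> X" "vsnd z \<in> Y" "\<And>x y. x \<in> X \<Longrightarrow> y \<in> Y \<Longrightarrow> vpair x y \<in> T"
proof -
  obtain e where e: "e > 0" "ball z e \<subseteq> T" using assms open_contains_ball by blast
  let ?X = "ball (vfst z) (e / 2)" and ?Y = "ball (vsnd z) (e / 2)"
  have n1: "norm (vpair x (0 :: 'k ^ 'l)) = norm x" for x :: "'k ^ 'm"
    unfolding norm_vec_def L2_set_def vpair_def by (simp add: UNIV_Plus_UNIV[symmetric] sum.Plus del: UNIV_Plus_UNIV)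
  have n2: "norm (vpair (0 :: 'k ^ 'm) y) = norm y" for y :: "'k ^ 'l"
    unfolding norm_vec_def L2_set_def vpair_def by (simp add: UNIV_Plus_UNIV[symmetric] sum.Plus del: UNIV_Plus_UNIV)
  have "vpair x y \<in> T" if "x \<in> ?X" "y \<in> ?Y" for x y
  proof -
    have "vpair x y - z = vpair (x - vfst z) 0 + vpair 0 (y - vsnd z)"
      by (subst vpair_split[symmetric]) (auto simp: vpair_def vfst_def vsnd_def vec_eq_iff split: sum.split)
    then have "norm (vpair x y - z) \<le> norm (x - vfst z) + norm (y - vsnd z)"
      using norm_triangle_ineq[of "vpair (x - vfst z) (0 :: 'k ^ 'l)" "vpair 0 (y - vsnd z)"] by (simp add: n1 n2)
    also have "\<dots> < e" using that by (simp add: dist_norm norm_minus_commute)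
    finally show ?thesis using e by (auto simp: dist_norm norm_minus_commute)
  qed
  then show ?thesis using e(1) by (intro that[of ?X ?Y]) auto
qed

lemma prod_atlas_vpair:
  "prod_atlas M N = {(U \<times> V, \<lambda>(p, q). vpair (\<phi> p) (\<psi> q)) | U \<phi> V \<psi>. (U, \<phi>) \<in> M \<and> (V, \<psi>) \<in> N}"
  by (simp add: prod_atlas_def vpair_def)

lemma image_vpair:
  "(\<lambda>(p, q). vpair (\<phi> p) (\<psi> q)) ` (U \<times> V) = {z. vfst z \<in> \<phi> ` U \<and> vsnd z \<in> \<psi> ` V}"
proof (intro Set.set_eqI iffI)
  fix z assume "z \<in> {z. vfst z \<in> \<phi> ` U \<and> vsnd z \<in> \<psi> ` V}"
  then obtain p q where "p \<in> U" "q \<in> V" "vfst z = \<phi> p" "vsnd z = \<psi> q" by blast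
  then show "z \<in> (\<lambda>(p, q). vpair (\<phi> p) (\<psi> q)) ` (U \<times> V)"
    by (intro image_eqI[of _ _ "(p, q)"]) (auto, metis vpair_simps(3))
qed auto

lemma inj_on_vpair:
  "inj_on \<phi> U \<Longrightarrow> inj_on \<psi> V \<Longrightarrow> inj_on (\<lambda>(p, q). vpair (\<phi> p) (\<psi> q)) (U \<times> V)"
  unfolding inj_on_def by clarify (metis vpair_simps(1,2))

lemma charted_prod_atlas: "charted M \<Longrightarrow> charted N \<Longrightarrow> charted (prod_atlas M N)"
  unfolding charted_def prod_atlas_vpair
  by (clarify, intro conjI inj_on_vpair, fast, fast, unfold image_vpair, intro open_vbox, fast+)

lemma plot_pair:
  assumes M: "plot C W M \<eta>" and N: "plot C W N \<zeta>"
  shows "plot C W (prod_atlas M N) (\<lambda>w. (\<eta> w, \<zeta> w))"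
proof (rule plotI)
  show "open W" by (rule plotD(1)[OF M])
  show "(\<eta> x, \<zeta> x) \<in> points (prod_atlas M N)" if "x \<in> W" for x
    using plotD(2)[OF M that] plotD(2)[OF N that] unfolding points_def prod_atlas_vpair by fast
  fix T \<xi> assume "(T, \<xi>) \<in> prod_atlas M N"
  then obtain U \<phi> V \<psi> where c: "(U, \<phi>) \<in> M" "(V, \<psi>) \<in> N" "T = U \<times> V" "\<xi> = (\<lambda>(p, q). vpair (\<phi> p) (\<psi> q))"
    unfolding prod_atlas_vpair by blast
  have eq: "W \<inter> (\<lambda>w. (\<eta> w, \<zeta> w)) -` T = (W \<inter> \<eta> -` U) \<inter> (W \<inter> \<zeta> -` V)" using c by auto
  show o: "open (W \<inter> (\<lambda>w. (\<eta> w, \<zeta> w)) -` T)"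
    unfolding eq using plotD(3)[OF M c(1)] plotD(3)[OF N c(2)] by blast
  show "smo C (\<lambda>x. \<xi> (\<eta> x, \<zeta> x)) (W \<inter> (\<lambda>w. (\<eta> w, \<zeta> w)) -` T)"
    using o unfolding eq c(4)
    by (simp, intro smo_vpair smo_subset[OF plotD(4)[OF M c(1)]] smo_subset[OF plotD(4)[OF N c(2)]]) auto
qed

lemma smooth_map_prodI:
  assumes M: "charted M" and N: "charted N" and K: "charted K"
    and p: "\<And>U \<phi> V \<psi>. (U, \<phi>) \<in> M \<Longrightarrow> (V, \<psi>) \<in> N \<Longrightarrow>
      plot scalars {z. vfst z \<in> \<phi> ` U \<and> vsnd z \<in> \<psi> ` V} K (\<lambda>z. f (inv_into U \<phi> (vfst z), inv_into V \<psi> (vsnd z)))"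
  shows "smooth_map (prod_atlas M N) K f"
proof (rule smooth_mapI[OF charted_prod_atlas[OF M N] K])
  fix T \<xi> assume "(T, \<xi>) \<in> prod_atlas M N"
  then obtain U \<phi> V \<psi> where c: "(U, \<phi>) \<in> M" "(V, \<psi>) \<in> N" "T = U \<times> V" "\<xi> = (\<lambda>(p, q). vpair (\<phi> p) (\<psi> q))"
    unfolding prod_atlas_vpair by blast
  have inj: "inj_on \<phi> U" "inj_on \<psi> V" using chartedD(1)[OF M c(1)] chartedD(1)[OF N c(2)] .
  show "plot scalars (\<xi> ` T) K (\<lambda>x. f (inv_into T \<xi> x))"
    unfolding c(3,4) image_vpair
  proof (rule plot_cong[OF _ p[OF c(1,2)]])
    fix z assume "z \<in> {z. vfst z \<in> \<phi> ` U \<and> vsnd z \<in> \<psi> ` V}"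
    then obtain a b where "a \<in> U" "b \<in> V" "vfst z = \<phi> a" "vsnd z = \<psi> b" by blast
    moreover have "inv_into (U \<times> V) (\<lambda>(p, q). vpair (\<phi> p) (\<psi> q)) (vpair (\<phi> a) (\<psi> b)) = (a, b)"
      using calculation inv_into_f_f[OF inj_on_vpair[OF inj], of "(a, b)"] by simp
    ultimately show "f (inv_into U \<phi> (vfst z), inv_into V \<psi> (vsnd z)) =
        f (inv_into (U \<times> V) (\<lambda>(p, q). vpair (\<phi> p) (\<psi> q)) z)"
      using inj by (metis inv_into_f_f vpair_simps(3))
  qed
qed

subsection \<open>Open and restricted atlases\<close>

lemma charted_open_atlas: "open W \<Longrightarrow> charted (open_atlas W)"
  by (simp add: charted_def open_atlas_def)

lemma smooth_map_open_atlas: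
  assumes W: "open W" and M: "manifold M"
  shows "smooth_map (open_atlas W) M \<eta> \<longleftrightarrow> plot scalars W M \<eta>"
proof
  assume "smooth_map (open_atlas W) M \<eta>"
  moreover have "plot scalars W (open_atlas W) (\<lambda>x. x)"
    using W by (intro plotI) (auto simp: open_atlas_def points_def smo_klin klin_id)
  ultimately show "plot scalars W M \<eta>"
    using plot_smooth_map[OF charted_open_atlas[OF W] M] by fast
next
  assume p: "plot scalars W M \<eta>"
  show "smooth_map (open_atlas W) M \<eta>"
  proof (rule smooth_mapI[OF charted_open_atlas[OF W] charted_manifold[OF M]])
    fix U \<phi> assume "(U, \<phi>) \<in> (open_atlas W :: ('a ^ 'b, 'a, 'b) atlas)"
    then have c: "U = W" "\<phi> = (\<lambda>x. x)" by (auto simp: open_atlas_def)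
    show "plot scalars (\<phi> ` U) M (\<lambda>x. \<eta> (inv_into U \<phi> x))"
      unfolding c by (rule plot_cong[OF _ ]) (use p in \<open>auto simp: inv_into_f_f[of "\<lambda>x. x"]\<close>)
  qed
qed

lemma smooth_map_restrict:
  assumes M: "manifold M" and S: "openin (manifold_topology M) S"
  shows "smooth_map (restrict_atlas M S) (open_atlas UNIV) q \<longleftrightarrow>
    (\<forall>(U, \<phi>)\<in>M. smo scalars (\<lambda>x. q (inv_into U \<phi> x)) (\<phi> ` (U \<inter> S)))"
proof -
  have inj: "inj_on \<phi> U" "inj_on \<phi> (U \<inter> S)" if "(U, \<phi>) \<in> M" for U \<phi>
    using chartedD(1)[OF charted_manifold[OF M] that] by (auto simp: inj_on_def)
  have oS: "open (\<phi> ` (U \<inter> S))" if "(U, \<phi>) \<in> M" for U \<phi>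
    using S that unfolding openin_charted[OF charted_manifold[OF M]] by fast
  have ch: "charted (restrict_atlas M S)"
    using inj oS by (auto simp: charted_def restrict_atlas_def)
  have inv: "inv_into (U \<inter> S) \<phi> x = inv_into U \<phi> x" if "(U, \<phi>) \<in> M" "x \<in> \<phi> ` (U \<inter> S)" for U \<phi> x
    using that inj[OF that(1)] by auto
  have eq: "smo scalars (\<lambda>x. q (inv_into U \<phi> x)) (\<phi> ` (U \<inter> S)) \<longleftrightarrow>
      plot scalars (\<phi> ` (U \<inter> S)) (open_atlas UNIV) (\<lambda>x. q (inv_into (U \<inter> S) \<phi> x))" if U: "(U, \<phi>) \<in> M" for U \<phi>
  proof -
    have "plot scalars (\<phi> ` (U \<inter> S)) (open_atlas UNIV) (\<lambda>x. q (inv_into (U \<inter> S) \<phi> x)) \<longleftrightarrow>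
      smo scalars (\<lambda>x. q (inv_into (U \<inter> S) \<phi> x)) (\<phi> ` (U \<inter> S))"
      unfolding plot_def using oS[OF U] by (simp add: open_atlas_def points_def)
    also have "\<dots> \<longleftrightarrow> smo scalars (\<lambda>x. q (inv_into U \<phi> x)) (\<phi> ` (U \<inter> S))"
      by (rule iffI; erule smo_cong[OF oS[OF U], rotated]; simp only: inv[OF U])
    finally show ?thesis by simp
  qed
  show ?thesis
  proof
    assume "smooth_map (restrict_atlas M S) (open_atlas UNIV) q"
    then have *: "smo scalars (\<lambda>x. q (inv_into (U \<inter> S) \<phi> x)) (\<phi> ` (U \<inter> S))" if "(U, \<phi>) \<in> M" for U \<phi>
      using that unfolding smooth_map_def restrict_atlas_def open_atlas_def smooth_on_smo by fastforce
    have "smo scalars (\<lambda>x. q (inv_into U \<phi> x)) (\<phi> ` (U \<inter> S))" if U: "(U, \<phi>) \<in> M" for U \<phi>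
      by (rule smo_cong[OF oS[OF U] _ *[OF U]]) (simp only: inv[OF U])
    then show "\<forall>(U, \<phi>)\<in>M. smo scalars (\<lambda>x. q (inv_into U \<phi> x)) (\<phi> ` (U \<inter> S))" by blast
  next
    assume *: "\<forall>(U, \<phi>)\<in>M. smo scalars (\<lambda>x. q (inv_into U \<phi> x)) (\<phi> ` (U \<inter> S))"
    show "smooth_map (restrict_atlas M S) (open_atlas UNIV) q"
    proof (rule smooth_mapI[OF ch charted_open_atlas[OF open_UNIV]])
      fix T \<xi> assume "(T, \<xi>) \<in> restrict_atlas M S"
      then obtain U where U: "(U, \<xi>) \<in> M" "T = U \<inter> S" by (auto simp: restrict_atlas_def)
      have "smo scalars (\<lambda>x. q (inv_into U \<xi> x)) (\<xi> ` (U \<inter> S))" using * U(1) by fast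
      then show "plot scalars (\<xi> ` T) (open_atlas UNIV) (\<lambda>x. q (inv_into T \<xi> x))"
        unfolding U(2) eq[OF U(1)] .
    qed
  qed
qed

subsection \<open>Families with vanishing derivative\<close>

text \<open>The vanishing derivative may be seen in a different chart at each time; transition maps
  carry it to a fixed chart around t, where the family is constant near t. Connectedness does the
  rest.\<close>

lemma plot_constant:
  fixes W :: "real set"
  assumes M: "manifold M" and p: "plot {} W M \<eta>" and W: "connected W"
    and 0: "\<And>t. t \<in> W \<Longrightarrow> \<exists>(U, \<phi>)\<in>M. \<eta> t \<in> U \<and> fd (\<lambda>s. \<phi> (\<eta> s)) t 1 = 0"
    and st: "s \<in> W" "t \<in> W"
  shows "\<eta> s = \<eta> t"
proof -
  have loc: "\<exists>O'. open O' \<and> t \<in> O' \<and> O' \<subseteq> W \<and> (\<forall>s\<in>O'. \<eta> s = \<eta> t)" if t: "t \<in> W" for t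
  proof -
    obtain U \<phi> where U: "(U, \<phi>) \<in> M" "\<eta> t \<in> U" "open (W \<inter> \<eta> -` U)" "t \<in> W \<inter> \<eta> -` U"
      "smo {} (\<lambda>x. \<phi> (\<eta> x)) (W \<inter> \<eta> -` U)" by (rule plot_chart_around[OF p t])
    then obtain e where e: "e > 0" "ball t e \<subseteq> W \<inter> \<eta> -` U" using open_contains_ball by blast
    have z: "fd (\<lambda>s. \<phi> (\<eta> s)) s = (\<lambda>_. 0)" if s: "s \<in> ball t e" for s
    proof -
      have sW: "s \<in> W" "\<eta> s \<in> U" using s e by auto
      obtain V \<psi> where V: "(V, \<psi>) \<in> M" "\<eta> s \<in> V" "fd (\<lambda>s. \<psi> (\<eta> s)) s 1 = 0" using 0[OF sW(1)] by fast
      note tr = manifold_transition[OF M V(1) U(1)]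
      have oV: "open (W \<inter> \<eta> -` V)" and sV: "smo {} (\<lambda>x. \<psi> (\<eta> x)) (W \<inter> \<eta> -` V)" using plotD(3,4)[OF p V(1)] .
      have d: "(\<lambda>s. \<psi> (\<eta> s)) differentiable (at s)" using smo_differentiable[OF sV] sW V by auto
      have dt: "(\<lambda>x. \<phi> (inv_into V \<psi> x)) differentiable (at (\<psi> (\<eta> s)))"
        using smo_differentiable[OF tr(2)] sW V by auto
      have inj: "inj_on \<psi> V" using chartedD(1)[OF charted_manifold[OF M] V(1)] .
      have "fd (\<lambda>s. \<phi> (\<eta> s)) s = fd (\<lambda>s. \<phi> (inv_into V \<psi> (\<psi> (\<eta> s)))) s"
        by (rule fd_cong(1)[OF oV _ _ fd_comp(2)[OF d dt]]) (use sW V inj in auto)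
      then have "fd (\<lambda>s. \<phi> (\<eta> s)) s 1 = fd (\<lambda>x. \<phi> (inv_into V \<psi> x)) (\<psi> (\<eta> s)) 0"
        using fd_comp(1)[OF d dt, of 1] V(3) by simp
      then have one: "fd (\<lambda>s. \<phi> (\<eta> s)) s 1 = 0"
        using linear_0[OF linear_frechet_derivative[OF dt]] by simp
      have "linear (fd (\<lambda>s. \<phi> (\<eta> s)) s)"
        by (rule linear_frechet_derivative[OF smo_differentiable[OF U(5)]]) (use sW in auto)
      then have "fd (\<lambda>s. \<phi> (\<eta> s)) s r = r *\<^sub>R fd (\<lambda>s. \<phi> (\<eta> s)) s 1" for r
        using linear_cmul[of _ r 1] by fastforce
      then show ?thesis using one by (auto simp: fun_eq_iff)
    qed
    have eq: "\<phi> (\<eta> s) = \<phi> (\<eta> t)" if s: "s \<in> ball t e" for s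
    proof (rule has_derivative_zero_unique[where s = "ball t e" and f = "\<lambda>s. \<phi> (\<eta> s)"])
      show "((\<lambda>s. \<phi> (\<eta> s)) has_derivative (\<lambda>h. 0)) (at x within ball t e)" if "x \<in> ball t e" for x
      proof -
        have "((\<lambda>s. \<phi> (\<eta> s)) has_derivative fd (\<lambda>s. \<phi> (\<eta> s)) x) (at x)"
          by (rule has_fd[OF smo_differentiable[OF U(5)]]) (use e that in auto)
        then show ?thesis unfolding z[OF that] by (rule has_derivative_at_withinI)
      qed
    qed (use s e in auto)
    have const: "\<eta> s = \<eta> t" if s: "s \<in> ball t e" for s
    proof (rule inj_onD[OF chartedD(1)[OF charted_manifold[OF M] U(1)] eq[OF s]])
      show "\<eta> s \<in> U" using subsetD[OF e(2) s] by simp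
      show "\<eta> t \<in> U" by (rule U(2))
    qed
    show ?thesis
    proof (intro exI[of _ "ball t e"] conjI ballI)
      show "ball t e \<subseteq> W" using e(2) by blast
      show "t \<in> ball t e" using e(1) by simp
      show "\<eta> s = \<eta> t" if "s \<in> ball t e" for s by (rule const[OF that])
    qed (rule open_ball)
  qed
  show ?thesis
  proof (rule connected_local_const[OF W st], intro ballI)
    fix t assume "t \<in> W"
    then obtain O' where o: "open O'" "t \<in> O'" "\<forall>s\<in>O'. \<eta> s = \<eta> t" using loc by blast
    show "\<forall>\<^sub>F s in at t within W. \<eta> t = \<eta> s"
      unfolding eventually_at_topological
      by (intro exI[of _ O'] conjI ballI impI o(1,2)) (rule o(3)[rule_format, symmetric])
  qed
qed

section \<open>Lie groups\<close>

lemma fd_vpair: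
  fixes f :: "'d::real_normed_vector \<Rightarrow> 'k::real_or_complex ^ 'm::finite" and g :: "'d \<Rightarrow> 'k ^ 'l::finite"
  assumes f: "f differentiable (at x)" and g: "g differentiable (at x)"
  shows "fd (\<lambda>x. vpair (f x) (g x)) x v = vpair (fd f x v) (fd g x v)" "(\<lambda>x. vpair (f x) (g x)) differentiable (at x)"
proof -
  have b: "bounded_linear (\<lambda>x :: 'k ^ 'm. vpair x (0 :: 'k ^ 'l))" "bounded_linear (\<lambda>y :: 'k ^ 'l. vpair (0 :: 'k ^ 'm) y)"
    by (rule bounded_linear_klin, rule klin_vpair1, rule bounded_linear_klin, rule klin_vpair2)
  have eq: "(\<lambda>x. vpair (f x) (g x)) = (\<lambda>x. vpair (f x) (0 :: 'k ^ 'l) + vpair (0 :: 'k ^ 'm) (g x))"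
    by (subst vpair_split) (rule refl)
  have "((\<lambda>x. vpair (f x) (0 :: 'k ^ 'l) + vpair (0 :: 'k ^ 'm) (g x)) has_derivative
      (\<lambda>v. vpair (fd f x v) (0 :: 'k ^ 'l) + vpair (0 :: 'k ^ 'm) (fd g x v))) (at x)"
    by (intro has_derivative_add bounded_linear.has_derivative[OF b(1)] bounded_linear.has_derivative[OF b(2)] has_fd f g)
  then have h: "((\<lambda>x. vpair (f x) (g x)) has_derivative (\<lambda>v. vpair (fd f x v) (fd g x v))) (at x)"
    unfolding eq by (subst (2) vpair_split)
  show "fd (\<lambda>x. vpair (f x) (g x)) x v = vpair (fd f x v) (fd g x v)" using fd_eqI[OF h] by simp
  show "(\<lambda>x. vpair (f x) (g x)) differentiable (at x)" using h by (auto simp: differentiable_def)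
qed

locale lie_grp =
  fixes G :: "'g monoid" (structure) and A :: "('g, 'k::real_or_complex, 'n::finite) atlas"
    and U0 :: "'g set" and \<phi>0 :: "'g \<Rightarrow> 'k ^ 'n"
  assumes lie: "lie_group G A" and chart0: "(U0, \<phi>0) \<in> A" and one_U0: "\<one> \<in> U0"
begin

lemma is_group: "group G" using lie by (simp add: lie_group_def)

sublocale group G by (rule is_group)

lemma manifold_A: "manifold A" and points_A: "points A = carrier G"
  using lie by (auto simp: lie_group_def)

lemma charted_A: "charted A" by (rule charted_manifold[OF manifold_A])

lemma plot_carrier: "plot C W A a \<Longrightarrow> w \<in> W \<Longrightarrow> a w \<in> carrier G"
  using plotD(2)[of C W A a w] by (simp add: points_A)

lemma plot_mult:
  assumes a: "plot C W A a" and b: "plot C W A b" shows "plot C W A (\<lambda>w. a w \<otimes> b w)"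
proof -
  have "smooth_map (prod_atlas A A) A (\<lambda>(x, y). x \<otimes> y)" using lie by (simp add: lie_group_def)
  from plot_smooth_map[OF charted_prod_atlas[OF charted_A charted_A] manifold_A this plot_pair[OF a b]]
  show ?thesis by simp
qed

lemma plot_inverse:
  assumes a: "plot C W A a" shows "plot C W A (\<lambda>w. inv (a w))"
proof -
  have "smooth_map A A (\<lambda>x. inv x)" using lie by (simp add: lie_group_def)
  from plot_smooth_map[OF charted_A manifold_A this a] show ?thesis .
qed

lemma plot_const_carrier: "g \<in> carrier G \<Longrightarrow> open W \<Longrightarrow> plot C W A (\<lambda>w. g)"
  by (rule plot_const[OF manifold_A]) (simp add: points_A)

lemma plot_lmult: "g \<in> carrier G \<Longrightarrow> plot C W A a \<Longrightarrow> plot C W A (\<lambda>w. g \<otimes> a w)"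
  using plot_mult[OF plot_const_carrier] plotD(1) by blast

lemma plot_rmult: "g \<in> carrier G \<Longrightarrow> plot C W A a \<Longrightarrow> plot C W A (\<lambda>w. a w \<otimes> g)"
  using plot_mult[OF _ plot_const_carrier] plotD(1) by blast

abbreviation "\<psi>0 \<equiv> inv_into U0 \<phi>0"
abbreviation "e0 \<equiv> \<phi>0 \<one>"
abbreviation "T0 \<equiv> \<phi>0 ` U0"

lemma inj_\<phi>0: "inj_on \<phi>0 U0" and open_T0: "open T0" and U0_carrier: "U0 \<subseteq> carrier G"
  using chartedD[OF charted_A chart0] by (auto simp: points_A)

lemma e0_T0: "e0 \<in> T0" using one_U0 by blast

lemma \<psi>0_e0 [simp]: "\<psi>0 e0 = \<one>" using inj_\<phi>0 one_U0 by simp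

lemma \<psi>0_in: "y \<in> T0 \<Longrightarrow> \<psi>0 y \<in> U0" "y \<in> T0 \<Longrightarrow> \<psi>0 y \<in> carrier G" "y \<in> T0 \<Longrightarrow> \<phi>0 (\<psi>0 y) = y"
  using U0_carrier by (auto simp: inv_into_into f_inv_into_f)

lemma \<psi>0_\<phi>0: "g \<in> U0 \<Longrightarrow> \<psi>0 (\<phi>0 g) = g" using inj_\<phi>0 by simp

lemma plot_\<psi>0: "plot scalars T0 A \<psi>0" by (rule plot_inv_chart[OF manifold_A chart0])

lemma plot_chart0:
  assumes "plot C W A a"
  shows "open (W \<inter> a -` U0)" "smo C (\<lambda>x. \<phi>0 (a x)) (W \<inter> a -` U0)"
    "w \<in> W \<Longrightarrow> a w \<in> U0 \<Longrightarrow> (\<lambda>x. \<phi>0 (a x)) differentiable (at w)"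
  using plotD(3,4)[OF assms chart0] smo_differentiable[OF plotD(4)[OF assms chart0]] by auto

text \<open>A map f on the group is differentiated along a family at a parameter where the family
  passes through the identity; the single chart \<open>\<phi>0\<close> suffices there. Other
  parameters are reduced to this case by translation, as in \<open>fd_chart_ld\<close>.\<close>

lemma chain_at_one:
  assumes a: "plot C W A a" and w: "w \<in> W" "a w = \<one>"
    and f: "plot scalars T0 N (\<lambda>y. f (\<psi>0 y))" and V: "(V, \<psi>) \<in> N" "f \<one> \<in> V"
  shows "fd (\<lambda>x. \<psi> (f (a x))) w v = fd (\<lambda>y. \<psi> (f (\<psi>0 y))) e0 (fd (\<lambda>x. \<phi>0 (a x)) w v)"
    "(\<lambda>x. \<psi> (f (a x))) differentiable (at w)"
proof -
  let ?O = "W \<inter> a -` U0"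
  have o: "open ?O" "w \<in> ?O" using plot_chart0(1)[OF a] w one_U0 by auto
  have da: "(\<lambda>x. \<phi>0 (a x)) differentiable (at w)" using plot_chart0(3)[OF a w(1)] w one_U0 by simp
  have df: "(\<lambda>y. \<psi> (f (\<psi>0 y))) differentiable (at (\<phi>0 (a w)))"
    using smo_differentiable[OF plotD(4)[OF f V(1)], of e0] V(2) e0_T0 w by simp
  have eq: "\<psi> (f (\<psi>0 (\<phi>0 (a x)))) = \<psi> (f (a x))" if "x \<in> ?O" for x using that by (simp add: \<psi>0_\<phi>0)
  show "fd (\<lambda>x. \<psi> (f (a x))) w v = fd (\<lambda>y. \<psi> (f (\<psi>0 y))) e0 (fd (\<lambda>x. \<phi>0 (a x)) w v)"
    using fd_cong(1)[OF o eq fd_comp(2)[OF da df]] fd_comp(1)[OF da df, of v] w(2) by simp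
  show "(\<lambda>x. \<psi> (f (a x))) differentiable (at w)" by (rule fd_cong(2)[OF o eq fd_comp(2)[OF da df]])
qed

subsection \<open>Multiplication in the chart at the identity\<close>

definition \<mu> :: "'k ^ ('n + 'n) \<Rightarrow> 'k ^ 'n" where
  "\<mu> z = \<phi>0 (\<psi>0 (vfst z) \<otimes> \<psi>0 (vsnd z))"

definition M2 :: "('k ^ ('n + 'n)) set" where
  "M2 = {z. vfst z \<in> T0 \<and> vsnd z \<in> T0} \<inter> (\<lambda>z. \<psi>0 (vfst z) \<otimes> \<psi>0 (vsnd z)) -` U0"

lemma plot_\<mu>: "plot scalars {z. vfst z \<in> T0 \<and> vsnd z \<in> T0} A (\<lambda>z. \<psi>0 (vfst z) \<otimes> \<psi>0 (vsnd z))"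
proof (rule plot_mult)
  have o: "open {z :: 'k ^ ('n + 'n). vfst z \<in> T0 \<and> vsnd z \<in> T0}" by (rule open_vbox[OF open_T0 open_T0])
  show "plot scalars {z :: 'k ^ ('n + 'n). vfst z \<in> T0 \<and> vsnd z \<in> T0} A (\<lambda>z. \<psi>0 (vfst z))"
    by (rule plot_chart[OF manifold_A chart0 o smo_klin[OF klin_vfst]]) simp
  show "plot scalars {z :: 'k ^ ('n + 'n). vfst z \<in> T0 \<and> vsnd z \<in> T0} A (\<lambda>z. \<psi>0 (vsnd z))"
    by (rule plot_chart[OF manifold_A chart0 o smo_klin[OF klin_vsnd]]) simp
qed

lemma open_M2: "open M2" and smo_\<mu>: "smo scalars \<mu> M2"
  using plot_chart0[OF plot_\<mu>] by (simp_all add: M2_def \<mu>_def[abs_def])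

lemma M2_left: "x \<in> T0 \<Longrightarrow> vpair x e0 \<in> M2" and M2_right: "x \<in> T0 \<Longrightarrow> vpair e0 x \<in> M2"
  using \<psi>0_in e0_T0 by (simp_all add: M2_def)

lemma \<mu>_left: "x \<in> T0 \<Longrightarrow> \<mu> (vpair x e0) = x" and \<mu>_right: "x \<in> T0 \<Longrightarrow> \<mu> (vpair e0 x) = x"
  using \<psi>0_in by (simp_all add: \<mu>_def)

lemma fd_vpair_const:
  fixes x :: "'k ^ 'n" and y :: "'k ^ 'n"
  shows "fd (\<lambda>x. vpair x y) x v = vpair v 0" "(\<lambda>x. vpair x y) differentiable (at x)"
    "fd (\<lambda>y. vpair x y) y v = vpair 0 v" "(\<lambda>y. vpair x y) differentiable (at y)"
  using fd_vpair[of "\<lambda>x. x" x "\<lambda>x. y"] fd_vpair[of "\<lambda>y. x" y "\<lambda>y. y"] by simp_all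

text \<open>Multiplication by the identity on either side changes nothing, so both partial
  differentials of \<open>\<mu>\<close> at the identity are identities.\<close>

lemma fd_\<mu>_e0: "fd \<mu> (vpair e0 e0) (vpair u v) = u + v"
proof -
  have d: "\<mu> differentiable (at (vpair e0 e0))" by (rule smo_differentiable[OF smo_\<mu> M2_left[OF e0_T0]])
  have "fd (\<lambda>x. x) e0 = fd (\<lambda>x. \<mu> (vpair x e0)) e0"
    by (rule fd_cong(1)[OF open_T0 e0_T0 _ fd_comp(2)]) (use d \<mu>_left fd_vpair_const in auto)
  then have "u = fd \<mu> (vpair e0 e0) (vpair u 0)"
    using fd_comp(1)[of "\<lambda>x. vpair x e0" e0 \<mu> u] d fd_vpair_const by (simp add: fun_eq_iff)
  moreover have "fd (\<lambda>x. x) e0 = fd (\<lambda>x. \<mu> (vpair e0 x)) e0"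
    by (rule fd_cong(1)[OF open_T0 e0_T0 _ fd_comp(2)]) (use d \<mu>_right fd_vpair_const in auto)
  then have "v = fd \<mu> (vpair e0 e0) (vpair 0 v)"
    using fd_comp(1)[of "\<lambda>x. vpair e0 x" e0 \<mu> v] d fd_vpair_const by (simp add: fun_eq_iff)
  moreover have "fd \<mu> (vpair e0 e0) (vpair u 0 + vpair 0 v) = fd \<mu> (vpair e0 e0) (vpair u 0) + fd \<mu> (vpair e0 e0) (vpair 0 v)"
    by (rule klin_add[OF klin_fd[OF smo_\<mu> M2_left[OF e0_T0]]])
  ultimately show ?thesis by (simp flip: vpair_split)
qed

lemma fd_mult_at_one:
  assumes a: "plot C W A a" and b: "plot C W A b" and w: "w \<in> W" "a w = \<one>" "b w = \<one>"
  shows "fd (\<lambda>x. \<phi>0 (a x \<otimes> b x)) w v = fd (\<lambda>x. \<phi>0 (a x)) w v + fd (\<lambda>x. \<phi>0 (b x)) w v"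
proof -
  let ?O = "(W \<inter> a -` U0) \<inter> (W \<inter> b -` U0)"
  have o: "open ?O" "w \<in> ?O" using plot_chart0(1)[OF a] plot_chart0(1)[OF b] w one_U0 by auto
  have da: "(\<lambda>x. \<phi>0 (a x)) differentiable (at w)" using plot_chart0(3)[OF a w(1)] w one_U0 by simp
  have db: "(\<lambda>x. \<phi>0 (b x)) differentiable (at w)" using plot_chart0(3)[OF b w(1)] w one_U0 by simp
  note p = fd_vpair[OF da db]
  have dm: "\<mu> differentiable (at (vpair (\<phi>0 (a w)) (\<phi>0 (b w))))"
    using smo_differentiable[OF smo_\<mu> M2_left[OF e0_T0]] w by simp
  have eq: "\<mu> (vpair (\<phi>0 (a x)) (\<phi>0 (b x))) = \<phi>0 (a x \<otimes> b x)" if "x \<in> ?O" for x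
    using that by (simp add: \<mu>_def \<psi>0_\<phi>0)
  have "fd (\<lambda>x. \<phi>0 (a x \<otimes> b x)) w v = fd (\<lambda>x. \<mu> (vpair (\<phi>0 (a x)) (\<phi>0 (b x)))) w v"
    using fd_cong(1)[OF o eq fd_comp(2)[OF p(2) dm]] by simp
  also have "\<dots> = fd \<mu> (vpair e0 e0) (vpair (fd (\<lambda>x. \<phi>0 (a x)) w v) (fd (\<lambda>x. \<phi>0 (b x)) w v))"
    using fd_comp(1)[OF p(2) dm, of v] w by (simp add: p(1))
  finally show ?thesis by (simp add: fd_\<mu>_e0)
qed

subsection \<open>The adjoint representation\<close>

definition Ad :: "'g \<Rightarrow> 'k ^ 'n \<Rightarrow> 'k ^ 'n" where
  "Ad g v = fd (\<lambda>y. \<phi>0 (g \<otimes> \<psi>0 y \<otimes> inv g)) e0 v"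

lemma plot_conj: "g \<in> carrier G \<Longrightarrow> plot C W A a \<Longrightarrow> plot C W A (\<lambda>w. g \<otimes> a w \<otimes> inv g)"
  by (intro plot_rmult plot_lmult inv_closed)

lemma fd_conj:
  assumes a: "plot C W A a" and w: "w \<in> W" "a w = \<one>" and g: "g \<in> carrier G"
  shows "fd (\<lambda>x. \<phi>0 (g \<otimes> a x \<otimes> inv g)) w v = Ad g (fd (\<lambda>x. \<phi>0 (a x)) w v)"
  unfolding Ad_def
  by (rule chain_at_one(1)[OF a w plot_conj[OF g plot_\<psi>0] chart0]) (simp add: g one_U0)

lemma klin_Ad:
  assumes g: "g \<in> carrier G" shows "klin (Ad g)"
proof -
  have "plot scalars T0 A (\<lambda>y. g \<otimes> \<psi>0 y \<otimes> inv g)" by (rule plot_conj[OF g plot_\<psi>0])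
  from klin_fd[OF plot_chart0(2)[OF this], of e0] show ?thesis
    using e0_T0 one_U0 g unfolding Ad_def[abs_def] by simp
qed

lemma fd_\<phi>0_\<psi>0: "fd (\<lambda>y. \<phi>0 (\<psi>0 y)) e0 v = v"
  using fd_cong(1)[OF open_T0 e0_T0, of "\<lambda>x. x" "\<lambda>y. \<phi>0 (\<psi>0 y)"] \<psi>0_in(3) by simp

lemma Ad_mult:
  assumes g: "g \<in> carrier G" and h: "h \<in> carrier G"
  shows "Ad (g \<otimes> h) v = Ad g (Ad h v)"
proof -
  have "Ad (g \<otimes> h) v = fd (\<lambda>y. \<phi>0 (g \<otimes> (h \<otimes> \<psi>0 y \<otimes> inv h) \<otimes> inv g)) e0 v"
  proof -
    have d: "(\<lambda>y. \<phi>0 (g \<otimes> (h \<otimes> \<psi>0 y \<otimes> inv h) \<otimes> inv g)) differentiable (at e0)"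
      by (rule plot_chart0(3)[OF plot_conj[OF g plot_conj[OF h plot_\<psi>0]] e0_T0]) (simp add: g h one_U0)
    show ?thesis unfolding Ad_def
      by (rule fun_cong[OF fd_cong(1)[OF open_T0 e0_T0 _ d]]) (simp add: g h \<psi>0_in inv_mult_group m_assoc)
  qed
  also have "\<dots> = Ad g (Ad h v)"
    using fd_conj[OF plot_conj[OF h plot_\<psi>0] e0_T0 _ g, of v] by (simp add: h Ad_def)
  finally show ?thesis .
qed

lemma Ad_one: "Ad \<one> v = v"
proof -
  have d: "(\<lambda>y. \<phi>0 (\<psi>0 y)) differentiable (at e0)"
    by (rule plot_chart0(3)[OF plot_\<psi>0 e0_T0]) (simp add: one_U0)
  have "fd (\<lambda>y. \<phi>0 (\<one> \<otimes> \<psi>0 y \<otimes> inv \<one>)) e0 = fd (\<lambda>y. \<phi>0 (\<psi>0 y)) e0"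
    by (rule fd_cong(1)[OF open_T0 e0_T0 _ d]) (simp add: \<psi>0_in)
  then show ?thesis by (simp add: Ad_def fd_\<phi>0_\<psi>0)
qed

lemma Ad_inv: "g \<in> carrier G \<Longrightarrow> Ad g (Ad (inv g) v) = v" "g \<in> carrier G \<Longrightarrow> Ad (inv g) (Ad g v) = v"
  by (simp_all add: Ad_mult[symmetric] Ad_one)

subsection \<open>Left logarithmic derivatives\<close>

text \<open>\<open>ld a\<close> is the pullback of the Maurer-Cartan form along \<open>a\<close>, in the coordinates of the chart
  at the identity.\<close>

definition ld :: "('d::real_normed_vector \<Rightarrow> 'g) \<Rightarrow> 'd \<Rightarrow> 'd \<Rightarrow> 'k ^ 'n" where
  "ld a w v = fd (\<lambda>x. \<phi>0 (inv (a w) \<otimes> a x)) w v"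

lemma ld_cong:
  assumes W: "open W" "w \<in> W" and eq: "\<And>x. x \<in> W \<Longrightarrow> a x = b x" and a: "plot C W A a"
  shows "ld b w = ld a w"
proof -
  have d: "(\<lambda>x. \<phi>0 (inv (a w) \<otimes> a x)) differentiable (at w)"
    by (rule plot_chart0(3)[OF plot_lmult[OF _ a] W(2)]) (simp_all add: plot_carrier[OF a W(2)] one_U0)
  have "fd (\<lambda>x. \<phi>0 (inv (b w) \<otimes> b x)) w = fd (\<lambda>x. \<phi>0 (inv (a w) \<otimes> a x)) w"
    by (rule fd_cong(1)[OF W _ d]) (simp add: eq W)
  then show ?thesis by (simp add: ld_def fun_eq_iff)
qed

lemma ld_at_one:
  assumes a: "plot C W A a" and w: "w \<in> W" "a w = \<one>"
  shows "ld a w v = fd (\<lambda>x. \<phi>0 (a x)) w v"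
proof -
  have d: "(\<lambda>x. \<phi>0 (a x)) differentiable (at w)" by (rule plot_chart0(3)[OF a w(1)]) (simp add: w one_U0)
  have "fd (\<lambda>x. \<phi>0 (inv (a w) \<otimes> a x)) w = fd (\<lambda>x. \<phi>0 (a x)) w"
    by (rule fd_cong(1)[OF plotD(1)[OF a] w(1) _ d]) (simp add: w plot_carrier[OF a])
  then show ?thesis by (simp add: ld_def)
qed

lemma ld_lmult:
  assumes a: "plot C W A a" and w: "w \<in> W" and g: "g \<in> carrier G"
  shows "ld (\<lambda>x. g \<otimes> a x) w v = ld a w v"
proof -
  have c: "a x \<in> carrier G" if "x \<in> W" for x by (rule plot_carrier[OF a that])
  have d: "(\<lambda>x. \<phi>0 (inv (a w) \<otimes> a x)) differentiable (at w)"
    by (rule plot_chart0(3)[OF plot_lmult[OF _ a] w]) (simp_all add: c w one_U0)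
  have e: "inv (g \<otimes> a w) \<otimes> (g \<otimes> a x) = inv (a w) \<otimes> a x" if "x \<in> W" for x
    using c[OF that] c[OF w] g by (simp add: inv_mult_group m_assoc) (metis inv_closed l_inv l_one m_assoc)
  have "fd (\<lambda>x. \<phi>0 (inv (g \<otimes> a w) \<otimes> (g \<otimes> a x))) w = fd (\<lambda>x. \<phi>0 (inv (a w) \<otimes> a x)) w"
    by (rule fd_cong(1)[OF plotD(1)[OF a] w _ d]) (simp only: e)
  then show ?thesis by (simp add: ld_def)
qed

lemma ld_const:
  assumes "g \<in> carrier G" shows "ld (\<lambda>x. g) w v = 0"
  using assms by (simp add: ld_def)

text \<open>The quotient of a x b x by a w b w is the conjugate of (a w)^-1 (a x) by (b w)^-1,
  multiplied by (b w)^-1 (b x). All factors pass through the identity at w, where products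
  differentiate to sums.\<close>

lemma ld_mult:
  assumes a: "plot C W A a" and b: "plot C W A b" and w: "w \<in> W"
  shows "ld (\<lambda>x. a x \<otimes> b x) w v = Ad (inv (b w)) (ld a w v) + ld b w v"
proof -
  have ca: "a x \<in> carrier G" and cb: "b x \<in> carrier G" if "x \<in> W" for x
    using plot_carrier[OF a that] plot_carrier[OF b that] .
  let ?g = "inv (b w)"
  let ?a = "\<lambda>x. inv (a w) \<otimes> a x" and ?b = "\<lambda>x. inv (b w) \<otimes> b x"
  have pa: "plot C W A ?a" and pb: "plot C W A ?b"
    using plot_lmult[OF _ a] plot_lmult[OF _ b] ca[OF w] cb[OF w] by simp_all
  have g: "?g \<in> carrier G" using cb[OF w] by simp
  have pc: "plot C W A (\<lambda>x. ?g \<otimes> ?a x \<otimes> inv ?g)" by (rule plot_conj[OF g pa])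
  have one: "?a w = \<one>" "?b w = \<one>" "?g \<otimes> ?a w \<otimes> inv ?g = \<one>" using ca[OF w] cb[OF w] by simp_all
  have e: "inv (a w \<otimes> b w) \<otimes> (a x \<otimes> b x) = (?g \<otimes> ?a x \<otimes> inv ?g) \<otimes> ?b x" if x: "x \<in> W" for x
  proof -
    have c: "a x \<in> carrier G" "b x \<in> carrier G" "a w \<in> carrier G" "b w \<in> carrier G" using ca cb x w by auto
    have "b w \<otimes> (inv (b w) \<otimes> b x) = b x" using c by (simp add: m_assoc[symmetric])
    then show ?thesis using c by (simp add: inv_mult_group m_assoc)
  qed
  have d: "(\<lambda>x. \<phi>0 ((?g \<otimes> ?a x \<otimes> inv ?g) \<otimes> ?b x)) differentiable (at w)"
    by (rule plot_chart0(3)[OF plot_mult[OF pc pb] w]) (use one in \<open>simp add: one_U0\<close>)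
  have "ld (\<lambda>x. a x \<otimes> b x) w v = fd (\<lambda>x. \<phi>0 ((?g \<otimes> ?a x \<otimes> inv ?g) \<otimes> ?b x)) w v"
    unfolding ld_def by (rule fun_cong[OF fd_cong(1)[OF plotD(1)[OF a] w _ d]]) (simp only: e)
  also have "\<dots> = fd (\<lambda>x. \<phi>0 (?g \<otimes> ?a x \<otimes> inv ?g)) w v + fd (\<lambda>x. \<phi>0 (?b x)) w v"
    by (rule fd_mult_at_one[OF pc pb w one(3,2)])
  also have "fd (\<lambda>x. \<phi>0 (?g \<otimes> ?a x \<otimes> inv ?g)) w v = Ad ?g (fd (\<lambda>x. \<phi>0 (?a x)) w v)"
    by (rule fd_conj[OF pa w one(1) g])
  finally show ?thesis by (simp add: ld_def)
qed

text \<open>The product rule for the constant family b b^-1.\<close>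

lemma ld_inverse:
  assumes b: "plot C W A b" and w: "w \<in> W"
  shows "ld (\<lambda>x. inv (b x)) w v = - Ad (b w) (ld b w v)"
proof -
  have c: "b x \<in> carrier G" if "x \<in> W" for x by (rule plot_carrier[OF b that])
  have "ld (\<lambda>x. b x \<otimes> inv (b x)) w v = Ad (inv (inv (b w))) (ld b w v) + ld (\<lambda>x. inv (b x)) w v"
    by (rule ld_mult[OF b plot_inverse[OF b] w])
  moreover have "ld (\<lambda>x. b x \<otimes> inv (b x)) w = ld (\<lambda>x. \<one>) w"
    by (rule ld_cong[OF plotD(1)[OF b] w _ plot_const_carrier[OF one_closed plotD(1)[OF b], of C]]) (simp add: c)
  ultimately show ?thesis using c[OF w] by (simp add: ld_const eq_neg_iff_add_eq_0 add.commute)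
qed

text \<open>Write a x as a w times (a w)^-1 (a x), where the second factor passes through the
  identity at w. So derivatives of maps along a depend on a w and the logarithmic derivative
  alone.\<close>

lemma fd_chart_ld:
  assumes a: "plot C W A a" and w: "w \<in> W" and f: "\<And>g. g \<in> carrier G \<Longrightarrow> plot scalars T0 N (\<lambda>y. f (g \<otimes> \<psi>0 y))"
    and V: "(V, \<psi>) \<in> N" "f (a w) \<in> V"
  shows "fd (\<lambda>x. \<psi> (f (a x))) w v = fd (\<lambda>y. \<psi> (f (a w \<otimes> \<psi>0 y))) e0 (ld a w v)"
proof -
  have c: "a x \<in> carrier G" if "x \<in> W" for x by (rule plot_carrier[OF a that])
  have pa: "plot C W A (\<lambda>x. inv (a w) \<otimes> a x)" using plot_lmult[OF _ a] c[OF w] by simp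
  note ch = chain_at_one[OF pa w _ f[OF c[OF w]] V(1), simplified c[OF w] l_inv r_one V(2)]
  have eq: "\<psi> (f (a w \<otimes> (inv (a w) \<otimes> a x))) = \<psi> (f (a x))" if "x \<in> W" for x
    using c[OF that] c[OF w] by (simp add: m_assoc[symmetric])
  have one: "inv (a w) \<otimes> a w = \<one>" and V': "f (a w \<otimes> \<one>) \<in> V" using c[OF w] V(2) by simp_all
  note ch = chain_at_one[where f = "\<lambda>g. f (a w \<otimes> g)", OF pa w one f[OF c[OF w]] V(1) V']
  have "fd (\<lambda>x. \<psi> (f (a x))) w v = fd (\<lambda>x. \<psi> (f (a w \<otimes> (inv (a w) \<otimes> a x)))) w v"
    using fd_cong(1)[OF plotD(1)[OF a] w eq ch(2)] by simp
  then show ?thesis unfolding ch(1) ld_def .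
qed

lemma klin_ld:
  assumes a: "plot scalars W A a" and w: "w \<in> W" shows "klin (ld a w)"
proof -
  have c: "a w \<in> carrier G" by (rule plot_carrier[OF a w])
  have pa: "plot scalars W A (\<lambda>x. inv (a w) \<otimes> a x)" using plot_lmult[OF _ a] c by simp
  from klin_fd[OF plot_chart0(2)[OF this], of w] show ?thesis
    using w one_U0 c unfolding ld_def[abs_def] by simp
qed

lemma ld_zero_constant:
  fixes W :: "real set"
  assumes a: "plot {} W A a" and W: "connected W" and 0: "\<And>t. t \<in> W \<Longrightarrow> ld a t 1 = 0" and st: "s \<in> W" "t \<in> W"
  shows "a s = a t"
proof (rule plot_constant[OF manifold_A a W _ st])
  fix t assume t: "t \<in> W"
  obtain U \<phi> where U: "(U, \<phi>) \<in> A" "a t \<in> U" by (rule pointsE[OF plotD(2)[OF a t]])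
  have c: "a t \<in> carrier G" by (rule plot_carrier[OF a t])
  have p: "plot scalars T0 A (\<lambda>y. g \<otimes> \<psi>0 y)" if "g \<in> carrier G" for g by (rule plot_lmult[OF that plot_\<psi>0])
  have "fd (\<lambda>x. \<phi> (a x)) t 1 = fd (\<lambda>y. \<phi> (a t \<otimes> \<psi>0 y)) e0 (ld a t 1)"
    by (rule fd_chart_ld[OF a t p U])
  moreover have "klin (fd (\<lambda>y. \<phi> (a t \<otimes> \<psi>0 y)) e0)"
    using klin_fd[OF plotD(4)[OF p[OF c] U(1)], of e0] e0_T0 c U(2) by simp
  ultimately have "fd (\<lambda>x. \<phi> (a x)) t 1 = 0" using 0[OF t] by (simp add: klin_0)
  then show "\<exists>(U, \<phi>)\<in>A. a t \<in> U \<and> fd (\<lambda>s. \<phi> (a s)) t 1 = 0" using U by blast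
qed

text \<open>The quotient a b^-1 has logarithmic derivative Ad b (ld a - ld b) = 0. It takes the
  place of a uniqueness theorem for differential equations on the group.\<close>

lemma ld_equal_constant:
  fixes W :: "real set"
  assumes a: "plot {} W A a" and b: "plot {} W A b" and W: "connected W" 
    and eq: "\<And>t. t \<in> W \<Longrightarrow> ld a t 1 = ld b t 1" and st: "s \<in> W" "t \<in> W"
  shows "a s \<otimes> inv (b s) = a t \<otimes> inv (b t)"
proof (rule ld_zero_constant[OF plot_mult[OF a plot_inverse[OF b]] W _ st])
  fix t assume t: "t \<in> W"
  show "ld (\<lambda>w. a w \<otimes> inv (b w)) t 1 = 0"
    using plot_carrier[OF b t] by (simp add: ld_mult[OF a plot_inverse[OF b] t] ld_inverse[OF b t] eq[OF t])
qed

end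

section \<open>One-parameter subgroups\<close>

lemma c1_lipschitz_cball:
  fixes f :: "'a::euclidean_space \<Rightarrow> 'b::real_normed_vector"
  assumes "open S" and f: "ck_on (Suc 0) f S" and r: "cball x0 r \<subseteq> S"
  shows "\<exists>L\<ge>0. \<forall>x\<in>cball x0 r. \<forall>y\<in>cball x0 r. norm (f x - f y) \<le> L * norm (x - y)"
proof -
  have "\<exists>B. \<forall>x\<in>cball x0 r. norm (fd f x b) \<le> B" for b
  proof -
    have "continuous_on (cball x0 r) (\<lambda>x. fd f x b)" using f r by (auto intro: continuous_on_subset)
    then have "bounded ((\<lambda>x. fd f x b) ` cball x0 r)" by (intro compact_imp_bounded compact_continuous_image compact_cball)
    then show ?thesis unfolding bounded_iff by auto
  qed
  then obtain B where B: "\<And>b x. x \<in> cball x0 r \<Longrightarrow> norm (fd f x b) \<le> B b" by metis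
  define L where "L = (\<Sum>b\<in>Basis. \<bar>B b\<bar>)"
  have L: "L \<ge> 0" by (simp add: L_def sum_nonneg)
  have d: "f differentiable (at x)" if "x \<in> cball x0 r" for x using f r that by auto
  have on: "onorm (fd f x) \<le> L" if x: "x \<in> cball x0 r" for x
  proof (rule onorm_le)
    fix v
    have "fd f x v = (\<Sum>b\<in>Basis. (v \<bullet> b) *\<^sub>R fd f x b)"
      by (rule euclidean_linear_expand[OF linear_frechet_derivative[OF d[OF x]]])
    also have "norm \<dots> \<le> (\<Sum>b\<in>Basis. norm ((v \<bullet> b) *\<^sub>R fd f x b))" by (rule norm_sum)
    also have "\<dots> \<le> (\<Sum>b\<in>Basis. norm v * \<bar>B b\<bar>)"
    proof (rule sum_mono)
      fix b :: 'a assume b: "b \<in> Basis"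
      have "norm (fd f x b) \<le> \<bar>B b\<bar>" using B[OF x, of b] by linarith
      then show "norm ((v \<bullet> b) *\<^sub>R fd f x b) \<le> norm v * \<bar>B b\<bar>"
        using Basis_le_norm[OF b, of v] by (auto intro!: mult_mono)
    qed
    finally show "norm (fd f x v) \<le> L * norm v" by (simp add: L_def sum_distrib_left mult.commute)
  qed
  have "norm (f x - f y) \<le> L * norm (x - y)" if "x \<in> cball x0 r" "y \<in> cball x0 r" for x y
    by (rule differentiable_bound[OF convex_cball _ on that]) (rule has_derivative_at_withinI[OF has_fd[OF d]])
  then show ?thesis using L by blast
qed

text \<open>Banach's fixed point theorem for the Picard operator on bounded continuous functions on
  the whole line. Composition with the nearest point map \<open>p\<close> of the ball makes the
  right-hand side globally Lipschitz, and clamping time by \<open>cl\<close> makes the operator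
  bounded; the fixed point stays in the ball, where \<open>p\<close> is the identity.\<close>

lemma picard:
  fixes f :: "'a::euclidean_space \<Rightarrow> 'a"
  assumes S: "open S" "x0 \<in> S" and f: "ck_on (Suc 0) f S"
  shows "\<exists>\<delta>>0. \<exists>x. x 0 = x0 \<and> (\<forall>t. \<bar>t\<bar> < \<delta> \<longrightarrow> x t \<in> S \<and> (x has_vector_derivative f (x t)) (at t))"
proof -
  obtain r where r: "r > 0" "cball x0 r \<subseteq> S" using S open_contains_cball by blast
  obtain L where L: "L \<ge> 0" "\<And>x y. x \<in> cball x0 r \<Longrightarrow> y \<in> cball x0 r \<Longrightarrow> norm (f x - f y) \<le> L * norm (x - y)"
    using c1_lipschitz_cball[OF S(1) f r(2)] by blast
  define M where "M = norm (f x0) + L * r"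
  have M0: "M \<ge> 0" using L r by (simp add: M_def)
  define p where "p = closest_point (cball x0 r)"
  have p: "p y \<in> cball x0 r" for y unfolding p_def using r by (intro closest_point_in_set) auto
  have p_id: "p y = y" if "y \<in> cball x0 r" for y unfolding p_def using that by (rule closest_point_self)
  have p_lip: "norm (p y - p z) \<le> norm (y - z)" for y z
    using closest_point_lipschitz[of "cball x0 r" y z] r by (simp add: p_def dist_norm)
  define F where "F y = f (p y)" for y
  have F_lip: "norm (F y - F z) \<le> L * norm (y - z)" for y z
    unfolding F_def using L(2)[OF p p] mult_left_mono[OF p_lip L(1)] by (rule order_trans)
  have F_bd: "norm (F y) \<le> M" for y
  proof -
    have "norm (F y - f x0) \<le> L * norm (p y - x0)" unfolding F_def using L(2)[OF p, of x0 y] r by simp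
    also have "\<dots> \<le> L * r" using p[of y] L by (intro mult_left_mono) (auto simp: dist_norm norm_minus_commute)
    finally show ?thesis unfolding M_def using norm_triangle_sub[of "F y" "f x0"] by linarith
  qed
  have F_cont: "continuous_on UNIV F"
  proof -
    have "L-lipschitz_on UNIV F" using F_lip L by (intro lipschitz_onI) (auto simp: dist_norm)
    then show ?thesis by (rule lipschitz_on_continuous_on)
  qed
  \<comment> \<open>The integral up to \<open>cl t\<close> contributes at most 2 \<delta> times the
    bound of the integrand and the one up to 0 at most \<delta> times it. The two terms of the
    minimum make 3 \<delta> M at most r, so that the ball is not left, and 3 \<delta> L at most 1/2,
    which is the contraction factor.\<close>
  define \<delta> where "\<delta> = min (r / (3 * (M + 1))) (1 / (6 * (L + 1)))"
  have \<delta>: "\<delta> > 0" using r M0 L by (simp add: \<delta>_def)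
  have \<delta>M: "3 * \<delta> * M \<le> r"
  proof -
    have "3 * \<delta> * M \<le> 3 * (r / (3 * (M + 1))) * (M + 1)"
      using \<delta> M0 r by (intro mult_mono) (auto simp: \<delta>_def)
    also have "\<dots> = r" using M0 by (simp add: field_simps)
    finally show ?thesis .
  qed
  have \<delta>L: "3 * \<delta> * L \<le> 1 / 2"
  proof -
    have "3 * \<delta> * L \<le> 3 * (1 / (6 * (L + 1))) * (L + 1)"
      using \<delta> L by (intro mult_mono) (auto simp: \<delta>_def)
    also have "\<dots> = 1 / 2" using L by (simp add: field_simps)
    finally show ?thesis .
  qed
  define cl where "cl t = max (- \<delta>) (min \<delta> t)" for t
  have cl: "cl t \<in> {- \<delta>..\<delta>}" for t using \<delta> by (auto simp: cl_def)
  \<comment> \<open>Both integrals begin at the left end, so that negative times require no oriented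
    integral.\<close>
  define I where "I g t = x0 + integral {- \<delta>..cl t} (\<lambda>s. F (g s)) - integral {- \<delta>..0} (\<lambda>s. F (g s))" for g t
  have cg: "continuous_on X (\<lambda>s. F (g s))" if "continuous_on UNIV g" for g :: "real \<Rightarrow> 'a" and X
    using continuous_on_compose2[OF F_cont that] by (auto intro: continuous_on_subset)
  have bd: "norm (integral {- \<delta>..cl t} h - integral {- \<delta>..0} h) \<le> 3 * \<delta> * B"
    if h: "continuous_on UNIV h" and B: "\<And>s. norm (h s) \<le> B" "B \<ge> 0" for h :: "real \<Rightarrow> 'a" and B t
  proof -
    have "norm (integral {- \<delta>..cl t} h) \<le> B * (cl t - (- \<delta>))"
      using cl[of t] h B by (intro integral_bound) (auto intro: continuous_on_subset)
    also have "\<dots> \<le> B * (2 * \<delta>)" using cl[of t] B by (intro mult_left_mono) auto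
    finally have 1: "norm (integral {- \<delta>..cl t} h) \<le> B * (2 * \<delta>)" .
    have "norm (integral {- \<delta>..0} h) \<le> B * (0 - (- \<delta>))"
      using \<delta> h B by (intro integral_bound) (auto intro: continuous_on_subset)
    with 1 show ?thesis using norm_triangle_ineq4[of "integral {- \<delta>..cl t} h" "integral {- \<delta>..0} h"] by (simp add: algebra_simps)
  qed
  have I_near: "norm (I g t - x0) \<le> r" if "continuous_on UNIV g" for g t
    using bd[OF cg[OF that] F_bd M0, of t] \<delta>M by (simp add: I_def)
  have I_cont: "continuous_on UNIV (I g)" if "continuous_on UNIV g" for g
  proof -
    have c1: "continuous_on {- \<delta>..\<delta>} (\<lambda>t. integral {- \<delta>..t} (\<lambda>s. F (g s)))"
      by (intro indefinite_integral_continuous_1 integrable_continuous_interval cg that)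
    have c2: "continuous_on UNIV cl" unfolding cl_def by (intro continuous_intros)
    have "cl ` UNIV \<subseteq> {- \<delta>..\<delta>}" using cl by blast
    from continuous_on_compose2[OF c1 c2 this]
    have "continuous_on UNIV (\<lambda>t. integral {- \<delta>..cl t} (\<lambda>s. F (g s)))" .
    then show ?thesis unfolding I_def by (intro continuous_intros)
  qed
  define J where "J g = Bcontfun (I (apply_bcontfun g))" for g
  have ac: "continuous_on UNIV (apply_bcontfun g)" for g :: "real \<Rightarrow>\<^sub>C 'a" by (intro continuous_on_apply_bcontfun continuous_on_id)
  have J: "apply_bcontfun (J g) = I (apply_bcontfun g)" for g
  proof -
    have "norm (I (apply_bcontfun g) t) \<le> norm x0 + r" for t
      using I_near[OF ac, of g t] norm_triangle_sub[of "I (apply_bcontfun g) t" x0] by linarith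
    then show ?thesis unfolding J_def
      by (intro Bcontfun_inverse bcontfun_normI[where b = "norm x0 + r"] I_cont ac)
  qed
  have "dist (J g) (J h) \<le> 1 / 2 * dist g h" for g h
  proof (rule dist_bound)
    fix t
    have fi: "(\<lambda>s. F (apply_bcontfun k s)) integrable_on {a..b}" for k :: "real \<Rightarrow>\<^sub>C 'a" and a b
      by (intro integrable_continuous_interval cg ac)
    let ?h = "\<lambda>s. F (apply_bcontfun g s) - F (apply_bcontfun h s)"
    have "norm (?h s) \<le> L * dist g h" for s
      using F_lip[of "apply_bcontfun g s" "apply_bcontfun h s"] mult_left_mono[OF dist_bounded[of g s h] L(1)]
      by (simp add: dist_norm)
    then have "norm (integral {- \<delta>..cl t} ?h - integral {- \<delta>..0} ?h) \<le> 3 * \<delta> * (L * dist g h)"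
      using L by (intro bd continuous_on_diff cg ac) auto
    also have "\<dots> \<le> 1 / 2 * dist g h" using mult_right_mono[OF \<delta>L, of "dist g h"] by (simp add: mult.assoc)
    finally show "dist (apply_bcontfun (J g) t) (apply_bcontfun (J h) t) \<le> 1 / 2 * dist g h"
      unfolding J I_def dist_norm using fi by (simp add: integral_diff algebra_simps)
  qed
  then have "\<exists>!g. J g = g" by (intro banach_fix_type[where c = "1 / 2"]) auto
  then obtain g where g: "J g = g" by blast
  let ?x = "apply_bcontfun g"
  have x: "?x t = I ?x t" for t using J[of g] g by simp
  have in_ball: "?x t \<in> cball x0 r" for t using I_near[OF ac, of g t] x[of t] by (simp add: dist_norm norm_minus_commute)
  have "(?x has_vector_derivative f (?x t)) (at t)" if t: "\<bar>t\<bar> < \<delta>" for t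
  proof -
    have t': "t \<in> {- \<delta><..<\<delta>}" "t \<in> {- \<delta>..\<delta>}" using t by auto
    have "((\<lambda>u. integral {- \<delta>..u} (\<lambda>s. F (?x s))) has_vector_derivative F (?x t)) (at t within {- \<delta>..\<delta>})"
      by (rule integral_has_vector_derivative[OF cg[OF ac] t'(2)])
    moreover have "at t within {- \<delta>..\<delta>} = at t" using t' by (intro at_within_interior) (auto simp: interior_atLeastAtMost_real)
    ultimately have "((\<lambda>u. x0 + integral {- \<delta>..u} (\<lambda>s. F (?x s)) - integral {- \<delta>..0} (\<lambda>s. F (?x s))) has_vector_derivative F (?x t)) (at t)"
      by (auto intro!: derivative_eq_intros)
    then have "(?x has_vector_derivative F (?x t)) (at t)"
    proof (rule has_vector_derivative_transform_within_open[OF _ open_greaterThanLessThan t'(1)])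
      fix u assume "u \<in> {- \<delta><..<\<delta>}"
      then have "cl u = u" by (auto simp: cl_def)
      then show "x0 + integral {- \<delta>..u} (\<lambda>s. F (?x s)) - integral {- \<delta>..0} (\<lambda>s. F (?x s)) = ?x u"
        unfolding x[of u] I_def by simp
    qed
    then show ?thesis by (simp add: F_def p_id[OF in_ball])
  qed
  moreover have "?x 0 = x0" using x[of 0] \<delta> by (simp add: I_def cl_def)
  ultimately show ?thesis using \<delta> in_ball r(2) by blast
qed

text \<open>The derivative of a solution is f along the solution, hence as often differentiable as
  the solution itself; each round gains one order.\<close>

lemma ck_on_ode:
  fixes f :: "'a::euclidean_space \<Rightarrow> 'a" and x :: "real \<Rightarrow> 'a"
  assumes S: "open S" and T: "open T" and f: "\<And>j. ck_on j f S" and x: "\<And>t. t \<in> T \<Longrightarrow> x t \<in> S"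
    and d: "\<And>t. t \<in> T \<Longrightarrow> (x has_vector_derivative f (x t)) (at t)"
  shows "ck_on j x T"
proof (induction j)
  case 0
  show ?case using d by (auto intro!: continuous_at_imp_continuous_on has_vector_derivative_continuous)
next
  case (Suc j)
  have fd: "fd x t v = v *\<^sub>R f (x t)" if "t \<in> T" for t v
    using fd_eqI[OF d[OF that, unfolded has_vector_derivative_def]] by simp
  have A: "ck_on j (\<lambda>t. v *\<^sub>R f (x t)) T" for v
    by (rule ck_on_linear_comp[OF bounded_linear_scaleR_right T ck_on_comp[OF T S x Suc f]])
  have "ck_on j (\<lambda>t. fd x t v) T" for v by (rule ck_on_cong[OF T _ A[of v]]) (simp add: fd)
  moreover have "x differentiable (at t)" if "t \<in> T" for t
    using d[OF that] by (auto simp: has_vector_derivative_def differentiable_def)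
  ultimately show ?case by simp
qed

section \<open>Exponential curves of the group\<close>

context lie_grp
begin

definition lfield :: "'k ^ 'n \<Rightarrow> 'k ^ 'n \<Rightarrow> 'k ^ 'n" where
  "lfield u x = fd (\<lambda>y. \<phi>0 (\<psi>0 x \<otimes> \<psi>0 y)) e0 u"

lemma lfield_\<mu>: "x \<in> T0 \<Longrightarrow> lfield u x = fd \<mu> (vpair x e0) (vpair 0 u)"
proof -
  assume x: "x \<in> T0"
  have d: "\<mu> differentiable (at (vpair x e0))" by (rule smo_differentiable[OF smo_\<mu> M2_left[OF x]])
  have "lfield u x = fd (\<lambda>y. \<mu> (vpair x y)) e0 u" unfolding lfield_def \<mu>_def by simp
  also have "\<dots> = fd \<mu> (vpair x e0) (vpair 0 u)"
    using fd_comp(1)[of "\<lambda>y. vpair x y" e0 \<mu> u] d fd_vpair_const by simp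
  finally show ?thesis .
qed

lemma smo_lfield: "smo scalars (lfield u) T0"
proof (rule smo_cong[OF open_T0])
  show "smo scalars (\<lambda>x. fd \<mu> (vpair x e0) (vpair 0 u)) T0"
    by (rule smo_fd_apply[OF open_M2 smo_\<mu> open_T0 smo_vpair[OF open_T0 smo_klin[OF klin_id] smo_const] smo_const M2_left])
qed (simp add: lfield_\<mu>)

text \<open>The curve is the integral curve, through the identity, of the left invariant field of u.
  Translating back by the inverse of a t undoes the left translation that defines
  \<open>lfield\<close> at a t, so the logarithmic derivative is constantly u.\<close>

lemma ex_local_one_parameter:
  "\<exists>(\<delta>::real) a. \<delta> > 0 \<and> plot {} {- \<delta><..<\<delta>} A a \<and> a 0 = \<one> \<and> (\<forall>t. \<bar>t\<bar> < \<delta> \<longrightarrow> ld a t 1 = u)"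
proof -
  obtain \<delta> x where \<delta>: "\<delta> > 0" and x0: "x 0 = e0"
    and sol: "\<forall>t. \<bar>t\<bar> < \<delta> \<longrightarrow> x t \<in> T0 \<and> (x has_vector_derivative lfield u (x t)) (at t)"
    using picard[OF open_T0 e0_T0 smo_ck[OF smo_lfield[of u]]] by blast
  have x: "x t \<in> T0" "(x has_vector_derivative lfield u (x t)) (at t)" if "\<bar>t\<bar> < \<delta>" for t
    using sol that by blast+
  let ?W = "{- \<delta><..<\<delta>}"
  define a where "a t = \<psi>0 (x t)" for t
  have W: "open ?W" by simp
  have "ck_on j x ?W" for j
    by (rule ck_on_ode[OF open_T0 W smo_ck[OF smo_lfield[of u]]]) (use x in auto)
  then have p: "plot {} ?W A a"
    unfolding a_def by (intro plot_chart[OF manifold_A chart0 W]) (use x in \<open>auto simp: smo_empty\<close>)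
  have "ld a t 1 = u" if t: "\<bar>t\<bar> < \<delta>" for t
  proof -
    have tW: "t \<in> ?W" using t by auto
    have aU: "a t \<in> U0" and ac: "a t \<in> carrier G" using x(1)[OF t] \<psi>0_in by (auto simp: a_def)
    have xt: "\<phi>0 (a t) = x t" using x(1)[OF t] \<psi>0_in by (simp add: a_def)
    have \<psi>x: "\<psi>0 (x t) = a t" by (simp add: a_def)
    let ?R = "\<lambda>y. \<phi>0 (inv (a t) \<otimes> \<psi>0 y)" and ?L = "\<lambda>y. \<phi>0 (a t \<otimes> \<psi>0 y)"
    have pR: "plot scalars T0 A (\<lambda>y. inv (a t) \<otimes> \<psi>0 y)" using plot_lmult[OF _ plot_\<psi>0] ac by simp
    have pL: "plot scalars T0 A (\<lambda>y. a t \<otimes> \<psi>0 y)" by (rule plot_lmult[OF ac plot_\<psi>0])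
    have dR: "?R differentiable (at (x t))"
      by (rule plot_chart0(3)[OF pR x(1)[OF t]]) (simp add: \<psi>x ac one_U0)
    have dL: "?L differentiable (at e0)" by (rule plot_chart0(3)[OF pL e0_T0]) (simp add: ac aU)
    have Le: "?L e0 = x t" using ac xt by simp
    have dx: "x differentiable (at t)" and fdx: "fd x t 1 = lfield u (x t)"
      using x(2)[OF t] fd_eqI[OF x(2)[OF t, unfolded has_vector_derivative_def]]
      by (auto simp: has_vector_derivative_def differentiable_def)
    have "ld a t 1 = fd (\<lambda>s. ?R (x s)) t 1" by (simp add: ld_def a_def)
    also have "\<dots> = fd ?R (x t) (fd ?L e0 u)"
      using fd_comp(1)[OF dx dR, of 1] by (simp add: fdx lfield_def \<psi>x)
    also have "\<dots> = fd (\<lambda>y. ?R (?L y)) e0 u"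
      using fd_comp(1)[OF dL, of ?R u] dR Le by simp
    also have "fd (\<lambda>y. ?R (?L y)) e0 = fd (\<lambda>y. y) e0"
    proof (rule fd_cong(1))
      show "open (T0 \<inter> (\<lambda>y. a t \<otimes> \<psi>0 y) -` U0)" by (rule plot_chart0(1)[OF pL])
      show "e0 \<in> T0 \<inter> (\<lambda>y. a t \<otimes> \<psi>0 y) -` U0" using e0_T0 ac aU by simp
      show "y = ?R (?L y)" if "y \<in> T0 \<inter> (\<lambda>y. a t \<otimes> \<psi>0 y) -` U0" for y
        using that ac \<psi>0_in by (simp add: \<psi>0_\<phi>0 m_assoc[symmetric])
    qed simp
    finally show ?thesis by simp
  qed
  moreover have "a 0 = \<one>" by (simp add: a_def x0)
  ultimately show ?thesis using \<delta> p by blast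
qed

lemma ld_shift:
  assumes a: "plot {} W A a" and W: "s + t \<in> W"
  shows "ld (\<lambda>t. a (s + t)) t 1 = ld a (s + t :: real) 1"
proof -
  have pa: "plot {} W A (\<lambda>x. inv (a (s + t)) \<otimes> a x)" using plot_lmult[OF _ a] plot_carrier[OF a W] by simp
  have d: "(\<lambda>x. \<phi>0 (inv (a (s + t)) \<otimes> a x)) differentiable (at (s + t))"
    by (rule plot_chart0(3)[OF pa W]) (simp add: plot_carrier[OF a W] one_U0)
  have sh: "((\<lambda>x. s + x) has_derivative (\<lambda>x. x)) (at t)" by (auto intro!: derivative_eq_intros)
  then have "(\<lambda>x. s + x) differentiable (at t)" by (auto simp: differentiable_def)
  from fd_comp(1)[OF this d, of 1] show ?thesis by (simp add: ld_def fd_eqI[OF sh])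
qed

lemma ck_on_affine: "ck_on j (\<lambda>t::real. s + t) W"
  by (cases j) (auto intro!: ck_on_cong[OF _ _ ck_on_const] continuous_intros derivative_intros ck_on_add ck_on_linear bounded_linear_ident simp: fd_add ck_on_const)

text \<open>Both t \<mapsto> a (s + t) and a have logarithmic derivative u, so their quotient is
  constant on the interval where both are defined; at time 0 it equals a s.\<close>

lemma local_one_parameter_add:
  fixes \<delta> s t :: real
  assumes p: "plot {} {- \<delta><..<\<delta>} A a" and a0: "a 0 = \<one>" and ld: "\<And>t. \<bar>t\<bar> < \<delta> \<Longrightarrow> ld a t 1 = u"
    and st: "\<bar>s\<bar> < \<delta>" "\<bar>t\<bar> < \<delta>" "\<bar>s + t\<bar> < \<delta>"
  shows "a (s + t) = a s \<otimes> a t"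
proof -
  let ?I = "{- \<delta><..<\<delta>}" and ?W = "{max (- \<delta>) (- \<delta> - s)<..<min \<delta> (\<delta> - s)}"
  have W: "open ?W" "connected ?W" by (rule open_greaterThanLessThan) (intro convex_connected convex_real_interval)
  have pW: "plot {} ?W A a" by (rule plot_subset[OF p W(1)]) auto
  have ps: "plot {} ?W A (\<lambda>t. a (s + t))"
    by (rule plot_comp_real[OF manifold_A p W(1) ck_on_affine]) auto
  have inW: "0 \<in> ?W" "t \<in> ?W" using st by (auto simp: max_def min_def)
  have "a (s + 0) \<otimes> inv (a 0) = a (s + t) \<otimes> inv (a t)"
  proof (rule ld_equal_constant[OF ps pW W(2) _ inW])
    fix t assume t: "t \<in> ?W"
    then have "ld (\<lambda>t. a (s + t)) t 1 = ld a (s + t) 1" by (intro ld_shift[OF p]) auto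
    also have "\<dots> = u" using t by (intro ld) auto
    also have "\<dots> = ld a t 1" using t by (intro ld[symmetric]) auto
    finally show "ld (\<lambda>t. a (s + t)) t 1 = ld a t 1" .
  qed
  moreover have c: "a x \<in> carrier G" if "\<bar>x\<bar> < \<delta>" for x by (rule plot_carrier[OF p]) (use that in auto)
  ultimately have "a s = a (s + t) \<otimes> inv (a t)" using c[OF st(1)] by (simp add: a0)
  then show ?thesis using c st by (simp add: m_assoc)
qed

lemma one_parameter_subgroup_plot:
  "one_parameter_subgroup G A \<gamma> \<longleftrightarrow> plot {} UNIV A \<gamma> \<and> (\<forall>s t. \<gamma> (s + t) = \<gamma> s \<otimes> \<gamma> t)"
proof
  assume g: "one_parameter_subgroup G A \<gamma>"
  have "plot {} UNIV A \<gamma>"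
  proof (rule plotI)
    show "\<gamma> x \<in> points A" for x using g by (simp add: one_parameter_subgroup_def points_A)
    fix V \<psi> assume V: "(V, \<psi>) \<in> A"
    have "continuous_map euclideanreal (manifold_topology A) \<gamma>" using g by (simp add: one_parameter_subgroup_def)
    from openin_continuous_map_preimage[OF this openin_chart_domain[OF manifold_A V]]
    show "open (UNIV \<inter> \<gamma> -` V)" by (simp add: vimage_def)
    show "smo {} (\<lambda>x. \<psi> (\<gamma> x)) (UNIV \<inter> \<gamma> -` V)"
      using g V unfolding one_parameter_subgroup_def smo_empty by (auto dest!: bspec)
  qed simp
  then show "plot {} UNIV A \<gamma> \<and> (\<forall>s t. \<gamma> (s + t) = \<gamma> s \<otimes> \<gamma> t)" using g by (simp add: one_parameter_subgroup_def)
next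
  assume p: "plot {} UNIV A \<gamma> \<and> (\<forall>s t. \<gamma> (s + t) = \<gamma> s \<otimes> \<gamma> t)"
  have c: "\<gamma> t \<in> carrier G" for t using plot_carrier[of "{}" UNIV \<gamma> t] p by simp
  have "continuous_map euclideanreal (manifold_topology A) \<gamma>"
    unfolding continuous_map topspace_charted[OF charted_A]
  proof (intro conjI allI impI)
    fix T assume "openin (manifold_topology A) T"
    with p have "open (UNIV \<inter> \<gamma> -` T)" using plot_openin[OF charted_A] by blast
    then show "openin euclideanreal {x \<in> topspace euclideanreal. \<gamma> x \<in> T}" by (simp add: vimage_def)
  qed (use c in \<open>auto simp: points_A\<close>)
  moreover have "ck_on j (\<lambda>t. \<phi> (\<gamma> t)) (\<gamma> -` U)" if "(U, \<phi>) \<in> A" for U \<phi> j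
    using plotD(4)[of "{}" UNIV A \<gamma> U \<phi>] p that smo_ck by fastforce
  ultimately show "one_parameter_subgroup G A \<gamma>" using c p unfolding one_parameter_subgroup_def by blast
qed

text \<open>The local curve is extended by setting \<open>\<gamma> t\<close> to the N-th power of a
  (t / N), with N so large that t / N lies in its domain. Comparison with the common refinement M K
  shows independence of N, and additivity can then be checked with one exponent for all the times
  involved.\<close>

lemma ex_one_parameter:
  "\<exists>\<gamma>. one_parameter_subgroup G A \<gamma> \<and> fd (\<lambda>t. \<phi>0 (\<gamma> t)) 0 1 = u"
proof -
  obtain \<delta> :: real and a where \<delta>: "\<delta> > 0" and p: "plot {} {- \<delta><..<\<delta>} A a" and a0: "a 0 = \<one>"
    and ld: "\<And>t. \<bar>t\<bar> < \<delta> \<Longrightarrow> ld a t 1 = u" using ex_local_one_parameter[of u] by blast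
  have add: "a (s + t) = a s \<otimes> a t" if "\<bar>s\<bar> < \<delta>" "\<bar>t\<bar> < \<delta>" "\<bar>s + t\<bar> < \<delta>" for s t
    by (rule local_one_parameter_add[OF p a0 ld that])
  have c: "a x \<in> carrier G" if "\<bar>x\<bar> < \<delta>" for x by (rule plot_carrier[OF p]) (use that in auto)
  have pow: "a x [^] k = a (real k * x)" if "\<bar>real k * x\<bar> < \<delta>" for k :: nat and x
    using that
  proof (induction k)
    case (Suc k)
    have "\<bar>real k * x\<bar> \<le> \<bar>real (Suc k) * x\<bar>" "\<bar>x\<bar> \<le> \<bar>real (Suc k) * x\<bar>"
      by (auto simp: abs_mult intro!: mult_right_mono simp del: of_nat_Suc) (auto simp: algebra_simps)
    then have "\<bar>real k * x\<bar> < \<delta>" "\<bar>x\<bar> < \<delta>" using Suc.prems by linarith+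
    then show ?case using Suc add[of "real k * x" x] by (simp add: algebra_simps)
  qed (simp add: a0)
  \<comment> \<open>The added 1 makes t / N strictly smaller than \<delta> in absolute value and N
    positive at t = 0.\<close>
  define N where "N t = nat \<lceil>\<bar>t\<bar> / \<delta>\<rceil> + 1" for t
  define \<gamma> where "\<gamma> t = a (t / real (N t)) [^] N t" for t
  have indep: "a (t / real M) [^] M = a (t / real K) [^] K"
    if "M > 0" "K > 0" "\<bar>t / real M\<bar> < \<delta>" "\<bar>t / real K\<bar> < \<delta>" for t M K
  proof -
    have one: "a (t / real M) [^] M = a (t / real (M * K)) [^] (K * M)" if MK: "M > 0" "K > 0" "\<bar>t / real M\<bar> < \<delta>" for M K
    proof -
      have eq: "t / real M = real K * (t / real (M * K))" using MK by (simp add: field_simps)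
      have "\<bar>real K * (t / real (M * K))\<bar> < \<delta>" unfolding eq[symmetric] by (rule MK(3))
      from pow[OF this] have "a (t / real M) = a (t / real (M * K)) [^] K" unfolding eq[symmetric] by (rule sym)
      moreover have "\<bar>t / real (M * K)\<bar> \<le> \<bar>t / real M\<bar>"
        using MK by (simp add: abs_divide divide_left_mono frac_le)
      then have "a (t / real (M * K)) \<in> carrier G" using MK(3) by (intro c) linarith
      ultimately show ?thesis by (simp add: nat_pow_pow)
    qed
    show ?thesis using one[OF that(1,2,3)] one[OF that(2,1,4)] by (simp add: mult.commute)
  qed
  have N: "N t > 0" "\<bar>t / real (N t)\<bar> < \<delta>" for t
  proof -
    show "N t > 0" by (simp add: N_def)
    have "\<bar>t\<bar> / \<delta> < real (N t)" unfolding N_def using \<delta> by (simp add: ceiling_correct) linarith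
    then show "\<bar>t / real (N t)\<bar> < \<delta>" using \<delta> \<open>N t > 0\<close> by (simp add: abs_divide field_simps)
  qed
  have \<gamma>: "\<gamma> t = a (t / real K) [^] K" if "K > 0" "\<bar>t / real K\<bar> < \<delta>" for t K
    unfolding \<gamma>_def by (rule indep[OF N(1) that(1) N(2) that(2)])
  have \<gamma>a: "\<gamma> t = a t" if "\<bar>t\<bar> < \<delta>" for t using \<gamma>[of 1 t] that c[OF that] by simp
  have hom: "\<gamma> (s + t) = \<gamma> s \<otimes> \<gamma> t" for s t
  proof -
    define K where "K = N (\<bar>s\<bar> + \<bar>t\<bar>)"
    have K: "K > 0" "(\<bar>s\<bar> + \<bar>t\<bar>) / real K < \<delta>" using N[of "\<bar>s\<bar> + \<bar>t\<bar>"] by (auto simp: K_def)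
    have le: "\<bar>x / real K\<bar> < \<delta>" if "\<bar>x\<bar> \<le> \<bar>s\<bar> + \<bar>t\<bar>" for x
    proof -
      have "\<bar>x / real K\<bar> \<le> (\<bar>s\<bar> + \<bar>t\<bar>) / real K" using that by (simp add: abs_divide divide_right_mono)
      then show ?thesis using K by linarith
    qed
    have b: "\<bar>s / real K\<bar> < \<delta>" "\<bar>t / real K\<bar> < \<delta>" "\<bar>(s + t) / real K\<bar> < \<delta>"
      by (rule le, simp add: abs_triangle_ineq)+
    have b3: "\<bar>s / real K + t / real K\<bar> < \<delta>" "\<bar>t / real K + s / real K\<bar> < \<delta>"
      using b(3) by (simp_all only: add_divide_distrib add.commute)
    \<comment> \<open>The power of a product is the product of the powers only because the two small
      values commute; they do, since either product is the value of a at the sum of the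
      times.\<close>
    note ab = add[OF b(1,2) b3(1)] and ba = add[OF b(2,1) b3(2)]
    have "t / real K + s / real K = s / real K + t / real K" by (rule add.commute)
    from ab ba[unfolded this] have "a (s / real K + t / real K) = a (s / real K) \<otimes> a (t / real K)"
      "a (s / real K) \<otimes> a (t / real K) = a (t / real K) \<otimes> a (s / real K)" by simp_all
    then have e: "a ((s + t) / real K) = a (s / real K) \<otimes> a (t / real K)"
      "a (s / real K) \<otimes> a (t / real K) = a (t / real K) \<otimes> a (s / real K)"
      by (simp_all only: add_divide_distrib)
    show ?thesis
      unfolding \<gamma>[OF K(1) b(1)] \<gamma>[OF K(1) b(2)] \<gamma>[OF K(1) b(3)] e(1) by (rule pow_mult_distrib[OF e(2) c[OF b(1)] c[OF b(2)]])
  qed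
  have c\<gamma>: "\<gamma> t \<in> carrier G" for t unfolding \<gamma>_def using c[OF N(2)] by simp
  have "plot {} UNIV A \<gamma>"
  proof (rule plot_local[OF open_UNIV])
    fix t
    let ?W = "{t - \<delta><..<t + \<delta>}"
    have "plot {} ?W A (\<lambda>s. \<gamma> t \<otimes> a (- t + s))"
      by (rule plot_lmult[OF c\<gamma> plot_comp_real[OF manifold_A p _ ck_on_affine]]) auto
    then have "plot {} ?W A \<gamma>"
    proof (rule plot_cong[rotated])
      fix s assume "s \<in> ?W"
      then show "\<gamma> t \<otimes> a (- t + s) = \<gamma> s" using hom[of t "- t + s"] \<gamma>a[of "- t + s"] by auto
    qed
    then show "\<exists>W'. t \<in> W' \<and> plot {} W' A \<gamma>" using \<delta> by (intro exI[of _ ?W]) auto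
  qed
  then have op: "one_parameter_subgroup G A \<gamma>" using hom by (simp add: one_parameter_subgroup_plot)
  have 0: "0 \<in> {- \<delta><..<\<delta>}" using \<delta> by auto
  have d: "(\<lambda>t. \<phi>0 (a t)) differentiable (at 0)" by (rule plot_chart0(3)[OF p 0]) (simp add: a0 one_U0)
  have "fd (\<lambda>t. \<phi>0 (\<gamma> t)) 0 1 = fd (\<lambda>t. \<phi>0 (a t)) 0 1"
    by (rule fun_cong[OF fd_cong(1)[OF _ 0 _ d]]) (auto simp: \<gamma>a abs_less_iff)
  also have "\<dots> = ld a 0 1" by (rule ld_at_one[OF p 0 a0, symmetric])
  finally have "fd (\<lambda>t. \<phi>0 (\<gamma> t)) 0 1 = u" using ld[of 0] \<delta> by simp
  then show ?thesis using op by blast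
qed

lemma one_parameter_0: "one_parameter_subgroup G A \<gamma> \<Longrightarrow> \<gamma> 0 = \<one>"
proof -
  assume g: "one_parameter_subgroup G A \<gamma>"
  then have "\<gamma> 0 \<in> carrier G" "\<gamma> (0 + 0) = \<gamma> 0 \<otimes> \<gamma> 0" unfolding one_parameter_subgroup_def by blast+
  then show ?thesis using l_cancel_one by auto
qed

lemma one_parameter_neg: "one_parameter_subgroup G A \<gamma> \<Longrightarrow> inv (\<gamma> t) = \<gamma> (- t)"
proof -
  assume g: "one_parameter_subgroup G A \<gamma>"
  then have c: "\<gamma> s \<in> carrier G" for s unfolding one_parameter_subgroup_def by blast
  have "\<gamma> (- t + t) = \<gamma> (- t) \<otimes> \<gamma> t" using g unfolding one_parameter_subgroup_def by blast
  then have "\<gamma> (- t) \<otimes> \<gamma> t = \<one>" using one_parameter_0[OF g] by simp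
  then show ?thesis using c by (simp add: inv_equality)
qed

lemma ld_one_parameter:
  assumes g: "one_parameter_subgroup G A \<gamma>"
  shows "ld \<gamma> t 1 = fd (\<lambda>t. \<phi>0 (\<gamma> t)) 0 1"
proof -
  have p: "plot {} UNIV A \<gamma>" and hom: "\<And>s t. \<gamma> (s + t) = \<gamma> s \<otimes> \<gamma> t" using g by (auto simp: one_parameter_subgroup_plot)
  have c: "\<gamma> s \<in> carrier G" for s by (rule plot_carrier[OF p]) simp
  have "ld \<gamma> (t + 0) 1 = ld (\<lambda>s. \<gamma> (t + s)) 0 1" by (rule ld_shift[OF p, symmetric]) simp
  also have "\<dots> = ld (\<lambda>s. \<gamma> t \<otimes> \<gamma> s) 0 1" by (simp add: hom)
  also have "\<dots> = ld \<gamma> 0 1" by (rule ld_lmult[OF p UNIV_I c])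
  also have "\<dots> = fd (\<lambda>t. \<phi>0 (\<gamma> t)) 0 1" by (rule ld_at_one[OF p UNIV_I one_parameter_0[OF g]])
  finally show ?thesis by simp
qed

lemma one_parameter_unique:
  assumes g: "one_parameter_subgroup G A \<gamma>" "one_parameter_subgroup G A \<gamma>'"
    and eq: "fd (\<lambda>t. \<phi>0 (\<gamma> t)) 0 1 = fd (\<lambda>t. \<phi>0 (\<gamma>' t)) 0 1"
  shows "\<gamma> t = \<gamma>' t"
proof -
  have p: "plot {} UNIV A \<gamma>" "plot {} UNIV A \<gamma>'" using g by (auto simp: one_parameter_subgroup_plot)
  have c: "\<gamma> t \<in> carrier G" "\<gamma>' t \<in> carrier G" using plot_carrier[OF p(1), of t] plot_carrier[OF p(2), of t] by auto
  have "\<gamma> t \<otimes> inv (\<gamma>' t) = \<gamma> 0 \<otimes> inv (\<gamma>' 0)"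
    by (rule ld_equal_constant[OF p connected_UNIV]) (simp_all add: ld_one_parameter[OF g(1)] ld_one_parameter[OF g(2)] eq)
  then have "\<gamma> t \<otimes> inv (\<gamma>' t) = \<one>" by (simp add: one_parameter_0 g)
  then show ?thesis using c by (metis inv_closed inv_equality inv_inv)
qed

text \<open>\<open>ops u t\<close> is exp (t u) for a tangent vector u in the coordinates of
  \<open>\<phi>0\<close>. The parameter is real also over the complex numbers; later arguments use
  finitely many fixed u, so smooth dependence on u does not come up.\<close>

definition ops :: "'k ^ 'n \<Rightarrow> real \<Rightarrow> 'g" where
  "ops u = (SOME \<gamma>. one_parameter_subgroup G A \<gamma> \<and> fd (\<lambda>t. \<phi>0 (\<gamma> t)) 0 1 = u)"

lemma ops: "one_parameter_subgroup G A (ops u)" "fd (\<lambda>t. \<phi>0 (ops u t)) 0 1 = u"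
  using someI_ex[OF ex_one_parameter[of u]] by (simp_all add: ops_def)

lemma plot_ops: "plot {} UNIV A (ops u)" and ops_add: "ops u (s + t) = ops u s \<otimes> ops u t"
  using ops(1)[of u] by (auto simp: one_parameter_subgroup_plot)

lemma ops_carrier: "ops u t \<in> carrier G" by (rule plot_carrier[OF plot_ops]) simp

lemma ops_0: "ops u 0 = \<one>" by (rule one_parameter_0[OF ops(1)])

lemma ld_ops: "ld (ops u) t 1 = u"
  using ld_one_parameter[OF ops(1)] ops(2) by simp

lemma lie_exp_ops: "lie_exp G A (U0, \<phi>0) \<theta> X = ops (\<theta> X) 1"
  unfolding lie_exp_def
proof (rule the_equality)
  have conv: "((\<lambda>t. \<phi>0 (\<gamma> t)) has_vector_derivative v) (at 0) \<longleftrightarrow> fd (\<lambda>t. \<phi>0 (\<gamma> t)) 0 1 = v"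
    if g: "one_parameter_subgroup G A \<gamma>" for \<gamma> v
  proof
    assume "((\<lambda>t. \<phi>0 (\<gamma> t)) has_vector_derivative v) (at 0)"
    then show "fd (\<lambda>t. \<phi>0 (\<gamma> t)) 0 1 = v" using fd_eqI unfolding has_vector_derivative_def by fastforce
  next
    assume v: "fd (\<lambda>t. \<phi>0 (\<gamma> t)) 0 1 = v"
    have "plot {} UNIV A \<gamma>" using g by (simp add: one_parameter_subgroup_plot)
    then have d: "(\<lambda>t. \<phi>0 (\<gamma> t)) differentiable (at 0)" 
      by (rule plot_chart0(3)) (simp_all add: one_parameter_0[OF g] one_U0)
    have "fd (\<lambda>t. \<phi>0 (\<gamma> t)) 0 = (\<lambda>r. r *\<^sub>R v)"
    proof
      fix r show "fd (\<lambda>t. \<phi>0 (\<gamma> t)) 0 r = r *\<^sub>R v"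
        using linear_cmul[OF linear_frechet_derivative[OF d], of r 1] v by simp
    qed
    then show "((\<lambda>t. \<phi>0 (\<gamma> t)) has_vector_derivative v) (at 0)"
      using has_fd[OF d] by (simp only: has_vector_derivative_def)
  qed
  show "\<exists>\<gamma>. one_parameter_subgroup G A \<gamma> \<and> ((\<lambda>t. snd (U0, \<phi>0) (\<gamma> t)) has_vector_derivative \<theta> X) (at 0) \<and> ops (\<theta> X) 1 = \<gamma> 1"
    using ops[of "\<theta> X"] conv[OF ops(1)] by (intro exI[of _ "ops (\<theta> X)"]) simp
  fix g assume "\<exists>\<gamma>. one_parameter_subgroup G A \<gamma> \<and> ((\<lambda>t. snd (U0, \<phi>0) (\<gamma> t)) has_vector_derivative \<theta> X) (at 0) \<and> g = \<gamma> 1"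
  then obtain \<gamma> where \<gamma>: "one_parameter_subgroup G A \<gamma>" "fd (\<lambda>t. \<phi>0 (\<gamma> t)) 0 1 = \<theta> X" "g = \<gamma> 1"
    using conv by auto
  show "g = ops (\<theta> X) 1"
    unfolding \<gamma>(3) by (rule one_parameter_unique[OF \<gamma>(1) ops(1)]) (simp only: \<gamma>(2) ops(2))
qed

lemma ops_scale: "ops (r *\<^sub>R u) t = ops u (r * t)"
proof (rule one_parameter_unique[OF ops(1)])
  have b: "bounded_linear (\<lambda>t. r * t)" by (rule bounded_linear_mult_right)
  have "plot {} UNIV A (\<lambda>t. ops u (r * t))"
    by (rule plot_comp_real[OF manifold_A plot_ops open_UNIV ck_on_linear[OF b]]) auto
  then show "one_parameter_subgroup G A (\<lambda>t. ops u (r * t))"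
    by (simp add: one_parameter_subgroup_plot distrib_left ops_add)
  have d: "(\<lambda>t. \<phi>0 (ops u t)) differentiable (at (r * 0))"
    by (rule plot_chart0(3)[OF plot_ops]) (simp_all add: ops_0 one_U0)
  have "fd (\<lambda>t. \<phi>0 (ops u (r * t))) 0 1 = fd (\<lambda>t. \<phi>0 (ops u t)) (r * 0) (r * 1)"
    using fd_comp(1)[OF bounded_linear_imp_differentiable[OF b] d, of 1] by (simp add: fd_bounded_linear[OF b])
  also have "\<dots> = r *\<^sub>R u"
    using linear_cmul[OF linear_frechet_derivative[OF d], of r 1] ops(2) by simp
  finally show "fd (\<lambda>t. \<phi>0 (ops (r *\<^sub>R u) t)) 0 1 = fd (\<lambda>t. \<phi>0 (ops u (r * t))) 0 1" by (simp add: ops(2))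
qed

end

section \<open>The differential of the adjoint representation\<close>

text \<open>Expanding the moving direction in coordinates turns the expression into a finite sum of
  products, to which the product rule applies.\<close>

lemma fd_fd_apply:
  fixes F :: "'k::real_or_complex ^ 'd::finite \<Rightarrow> 'k ^ 'l::finite"
  assumes S: "open S" and F: "smo scalars F S" and p: "p differentiable (at w)" and q: "q differentiable (at w)"
    and W: "open W" "w \<in> W" and pW: "\<And>w. w \<in> W \<Longrightarrow> p w \<in> S"
  shows "fd (\<lambda>w. fd F (p w) (q w)) w \<xi> = fd (\<lambda>z. fd F z (q w)) (p w) (fd p w \<xi>) + fd F (p w) (fd q w \<xi>)"
proof -
  let ?E = "\<lambda>i z. fd F z (axis i 1)"
  have pw: "p w \<in> S" by (rule pW[OF W(2)])
  have dE: "?E i differentiable (at (p w))" for i by (rule smo_differentiable[OF smo_fd[OF S F] pw])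
  have dc: "(\<lambda>w. ?E i (p w)) differentiable (at w)" for i by (rule fd_comp(2)[OF p dE])
  have h: "((\<lambda>w. q w $ i *s ?E i (p w)) has_derivative (\<lambda>\<xi>. q w $ i *s fd (\<lambda>w. ?E i (p w)) w \<xi> + fd q w \<xi> $ i *s ?E i (p w))) (at w)" for i
    by (rule bounded_bilinear.FDERIV[OF bounded_bilinear_kbilin[OF kbilin_nth_smult] has_fd[OF q] has_fd[OF dc]])
  have hs: "((\<lambda>w. \<Sum>i\<in>UNIV. q w $ i *s ?E i (p w)) has_derivative
      (\<lambda>\<xi>. \<Sum>i\<in>UNIV. q w $ i *s fd (\<lambda>w. ?E i (p w)) w \<xi> + fd q w \<xi> $ i *s ?E i (p w))) (at w)"
    by (rule has_derivative_sum) (rule h)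
  have ex: "fd F z v = (\<Sum>i\<in>UNIV. v $ i *s ?E i z)" if "z \<in> S" for z v
    by (rule klin_expand[OF klin_fd[OF F that]])
  have "fd (\<lambda>w. fd F (p w) (q w)) w = fd (\<lambda>w. \<Sum>i\<in>UNIV. q w $ i *s ?E i (p w)) w"
  proof (rule fd_cong(1)[OF W])
    show "(\<lambda>w. \<Sum>i\<in>UNIV. q w $ i *s ?E i (p w)) differentiable (at w)" using hs by (auto simp: differentiable_def)
    show "(\<Sum>i\<in>UNIV. q w $ i *s ?E i (p w)) = fd F (p w) (q w)" if "w \<in> W" for w by (rule ex[OF pW[OF that], symmetric])
  qed
  also have "\<dots> = (\<lambda>\<xi>. \<Sum>i\<in>UNIV. q w $ i *s fd (\<lambda>w. ?E i (p w)) w \<xi> + fd q w \<xi> $ i *s ?E i (p w))"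
    by (rule fd_eqI[OF hs])
  finally have e1: "fd (\<lambda>w. fd F (p w) (q w)) w \<xi>
      = (\<Sum>i\<in>UNIV. q w $ i *s fd (\<lambda>w. ?E i (p w)) w \<xi> + fd q w \<xi> $ i *s ?E i (p w))" by simp
  have e2: "(\<Sum>i\<in>UNIV. fd q w \<xi> $ i *s ?E i (p w)) = fd F (p w) (fd q w \<xi>)" by (rule ex[OF pw, symmetric])
  have "fd (\<lambda>w. fd F (p w) (q w)) w \<xi>
      = (\<Sum>i\<in>UNIV. q w $ i *s fd (?E i) (p w) (fd p w \<xi>)) + fd F (p w) (fd q w \<xi>)"
    by (simp only: e1 sum.distrib e2 fd_comp(1)[OF p dE])
  moreover have "fd (\<lambda>z. fd F z (q w)) (p w) (fd p w \<xi>) = (\<Sum>i\<in>UNIV. q w $ i *s fd (?E i) (p w) (fd p w \<xi>))"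
  proof -
    have b: "bounded_linear ((*s) c :: 'k ^ 'l \<Rightarrow> _)" for c by (rule bounded_linear_klin[OF klin_mult[OF klin_id]])
    have h: "((\<lambda>z. \<Sum>i\<in>UNIV. q w $ i *s ?E i z) has_derivative (\<lambda>\<eta>. \<Sum>i\<in>UNIV. q w $ i *s fd (?E i) (p w) \<eta>)) (at (p w))"
      by (rule has_derivative_sum) (rule bounded_linear.has_derivative[OF b has_fd[OF dE]])
    have "fd (\<lambda>z. fd F z (q w)) (p w) = fd (\<lambda>z. \<Sum>i\<in>UNIV. q w $ i *s ?E i z) (p w)"
    proof (rule fd_cong(1)[OF S pw])
      show "(\<lambda>z. \<Sum>i\<in>UNIV. q w $ i *s ?E i z) differentiable (at (p w))" using h by (auto simp: differentiable_def)
    qed (rule ex[symmetric])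
    then show ?thesis by (simp add: fd_eqI[OF h])
  qed
  ultimately show ?thesis by simp
qed

context lie_grp
begin

lemma smo_on_plot:
  assumes q: "\<And>U \<phi>. (U, \<phi>) \<in> A \<Longrightarrow> smo scalars (\<lambda>x. q (inv_into U \<phi> x)) (\<phi> ` U)"
    and a: "plot C W A a"
  shows "smo C (\<lambda>w. q (a w)) W"
proof (rule smo_local)
  fix w assume w: "w \<in> W"
  obtain U \<phi> where U: "(U, \<phi>) \<in> A" "a w \<in> U" "open (W \<inter> a -` U)" "w \<in> W \<inter> a -` U"
    "smo C (\<lambda>x. \<phi> (a x)) (W \<inter> a -` U)" by (rule plot_chart_around[OF a w])
  have "smo C (\<lambda>x. q (inv_into U \<phi> (\<phi> (a x)))) (W \<inter> a -` U)"
    by (rule smo_comp[OF U(3) chartedD(2)[OF charted_A U(1)] _ U(5) q[OF U(1)]]) auto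
  then have "smo C (\<lambda>x. q (a x)) (W \<inter> a -` U)"
    by (rule smo_cong[OF U(3), rotated]) (use chartedD(1)[OF charted_A U(1)] in auto)
  then show "\<exists>T. open T \<and> w \<in> T \<and> smo C (\<lambda>w. q (a w)) T" using U(3,4) by blast
qed

text \<open>In charts, \<open>Ad g v\<close> is the partial differential, in the second variable at
  the identity, of the conjugation map of two variables, and so depends smoothly on g.\<close>

lemma smo_Ad_chart:
  assumes U: "(U, \<phi>) \<in> A"
  shows "smo scalars (\<lambda>x. Ad (inv_into U \<phi> x) v) (\<phi> ` U)"
proof -
  let ?B = "{z :: 'k ^ ('n + 'n). vfst z \<in> \<phi> ` U \<and> vsnd z \<in> T0}"
  let ?i = "inv_into U \<phi>"
  let ?c = "\<lambda>z :: 'k ^ ('n + 'n). ?i (vfst z) \<otimes> \<psi>0 (vsnd z) \<otimes> inv (?i (vfst z))"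
  let ?F = "\<lambda>z. \<phi>0 (?c z)"
  have oU: "open (\<phi> ` U)" and UG: "U \<subseteq> carrier G" using chartedD[OF charted_A U] by (auto simp: points_A)
  have oB: "open ?B" by (rule open_vbox[OF oU open_T0])
  have p1: "plot scalars ?B A (\<lambda>z. ?i (vfst z))"
    by (rule plot_chart[OF manifold_A U oB smo_klin[OF klin_vfst]]) simp
  have p2: "plot scalars ?B A (\<lambda>z. \<psi>0 (vsnd z))"
    by (rule plot_chart[OF manifold_A chart0 oB smo_klin[OF klin_vsnd]]) simp
  have pc: "plot scalars ?B A ?c" by (rule plot_mult[OF plot_mult[OF p1 p2] plot_inverse[OF p1]])
  let ?O = "?B \<inter> ?c -` U0"
  have oO: "open ?O" and sF: "smo scalars ?F ?O" using plot_chart0(1,2)[OF pc] .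
  have ic: "?i x \<in> carrier G" if "x \<in> \<phi> ` U" for x using inv_into_into[OF that] UG by blast
  have inO: "vpair x e0 \<in> ?O" if "x \<in> \<phi> ` U" for x using ic[OF that] that e0_T0 by (simp add: one_U0)
  have eq: "Ad (?i x) v = fd ?F (vpair x e0) (vpair 0 v)" if x: "x \<in> \<phi> ` U" for x
  proof -
    have d: "?F differentiable (at (vpair x e0))" by (rule smo_differentiable[OF sF inO[OF x]])
    have "Ad (?i x) v = fd (\<lambda>y. ?F (vpair x y)) e0 v" by (simp add: Ad_def)
    also have "\<dots> = fd ?F (vpair x e0) (vpair 0 v)"
      using fd_comp(1)[of "\<lambda>y. vpair x y" e0 ?F v] d fd_vpair_const by simp
    finally show ?thesis .
  qed
  show ?thesis
  proof (rule smo_cong[OF oU])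
    show "smo scalars (\<lambda>x. fd ?F (vpair x e0) (vpair 0 v)) (\<phi> ` U)"
      by (rule smo_fd_apply[OF oO sF oU smo_vpair[OF oU smo_klin[OF klin_id] smo_const] smo_const inO])
  qed (simp add: eq)
qed

lemma smo_Ad: "plot C W A a \<Longrightarrow> smo C (\<lambda>w. Ad (a w) v) W"
  by (rule smo_on_plot[where q = "\<lambda>g. Ad g v"]) (rule smo_Ad_chart)

definition tb :: "'k ^ 'n \<Rightarrow> 'k ^ 'n \<Rightarrow> 'k ^ 'n" where
  "tb u v = fd (lfield v) e0 u - fd (lfield u) e0 v"

lemma lfield_e0: "lfield u e0 = u"
  by (simp add: lfield_\<mu>[OF e0_T0] fd_\<mu>_e0)

lemma tangent_bracket_tb: "tangent_bracket G (U0, \<phi>0) u v = tb u v"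
proof -
  have "left_field G (U0, \<phi>0) w = lfield w" for w
    by (simp add: left_field_def lfield_def fun_eq_iff)
  then show ?thesis by (simp add: tangent_bracket_def tb_def Let_def lfield_e0)
qed

text \<open>Since x y = (x y x^-1) x, the left invariant field of v at x is the right invariant
  field of \<open>Ad x v\<close>. Differentiating this equality will produce the bracket.\<close>

lemma lfield_Ad:
  assumes x: "x \<in> T0"
  shows "lfield v x = fd \<mu> (vpair e0 x) (vpair (Ad (\<psi>0 x) v) 0)"
proof -
  have xc: "\<psi>0 x \<in> carrier G" "\<psi>0 x \<in> U0" using \<psi>0_in[OF x] by auto
  have pc: "plot scalars T0 A (\<lambda>y. \<psi>0 x \<otimes> \<psi>0 y \<otimes> inv (\<psi>0 x))" by (rule plot_conj[OF xc(1) plot_\<psi>0])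
  let ?c = "\<lambda>y. \<phi>0 (\<psi>0 x \<otimes> \<psi>0 y \<otimes> inv (\<psi>0 x))"
  let ?O = "T0 \<inter> (\<lambda>y. \<psi>0 x \<otimes> \<psi>0 y \<otimes> inv (\<psi>0 x)) -` U0"
  have o: "open ?O" "e0 \<in> ?O" using plot_chart0(1)[OF pc] e0_T0 xc by (auto simp: one_U0)
  have dc: "?c differentiable (at e0)" by (rule plot_chart0(3)[OF pc e0_T0]) (simp add: xc one_U0)
  have ce: "?c e0 = e0" using xc by simp
  have dm: "\<mu> differentiable (at (vpair (?c e0) x))" unfolding ce by (rule smo_differentiable[OF smo_\<mu> M2_right[OF x]])
  note dv = fd_vpair[OF dc, of "\<lambda>y. x", simplified]
  have eq: "\<mu> (vpair (?c y) x) = \<phi>0 (\<psi>0 x \<otimes> \<psi>0 y)" if "y \<in> ?O" for y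
  proof -
    have "\<psi>0 (?c y) = \<psi>0 x \<otimes> \<psi>0 y \<otimes> inv (\<psi>0 x)" using that by (intro \<psi>0_\<phi>0) simp
    moreover have "\<psi>0 y \<in> carrier G" using that \<psi>0_in by simp
    ultimately show ?thesis using xc unfolding \<mu>_def vpair_simps by (simp add: m_assoc)
  qed
  have "lfield v x = fd (\<lambda>y. \<mu> (vpair (?c y) x)) e0 v"
    unfolding lfield_def using fd_cong(1)[OF o eq fd_comp(2)[OF dv(2) dm]] by simp
  also have "\<dots> = fd \<mu> (vpair e0 x) (vpair (Ad (\<psi>0 x) v) 0)"
    using fd_comp(1)[OF dv(2) dm, of v] xc by (simp add: dv(1) Ad_def)
  finally show ?thesis .
qed

text \<open>The identity \<open>lfield_Ad\<close> is differentiated at the identity of the group.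
  One summand on the right is the derivative of \<open>Ad\<close>; the other is a mixed second
  derivative of \<open>\<mu>\<close>, which by symmetry is the derivative of \<open>lfield u\<close>
  in direction v. So the derivative of \<open>Ad\<close> is what the commutator leaves over.\<close>

lemma fd_Ad_e0: "fd (\<lambda>x. Ad (\<psi>0 x) v) e0 u = tb u v"
proof -
  let ?ee = "vpair e0 e0" and ?D = "fd (\<lambda>x. Ad (\<psi>0 x) v) e0 u"
  have dA: "(\<lambda>x. Ad (\<psi>0 x) v) differentiable (at e0)" by (rule smo_differentiable[OF smo_Ad[OF plot_\<psi>0] e0_T0])
  have dp: "(\<lambda>x. vpair e0 x) differentiable (at e0)" by (rule fd_vpair_const(4))
  have dq: "(\<lambda>x. vpair (Ad (\<psi>0 x) v) (0 :: 'k ^ 'n)) differentiable (at e0)"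
    and fq: "fd (\<lambda>x. vpair (Ad (\<psi>0 x) v) (0 :: 'k ^ 'n)) e0 u = vpair ?D 0"
    using fd_vpair[OF dA, of "\<lambda>y. 0 :: 'k ^ 'n"] by simp_all
  have inM: "?ee \<in> M2" by (rule M2_left[OF e0_T0])
  have "fd (lfield v) e0 = fd (\<lambda>x. fd \<mu> (vpair e0 x) (vpair (Ad (\<psi>0 x) v) 0)) e0"
    by (rule fd_cong(1)[OF open_T0 e0_T0 _ smo_differentiable[OF smo_lfield e0_T0], symmetric]) (simp add: lfield_Ad)
  then have "fd (lfield v) e0 u = fd (\<lambda>z. fd \<mu> z (vpair v 0)) ?ee (vpair 0 u) + fd \<mu> ?ee (vpair ?D 0)"
    using fd_fd_apply[OF open_M2 smo_\<mu> dp dq open_T0 e0_T0 M2_right, of u] fq fd_vpair_const(3) by (simp add: Ad_one)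
  also have "fd \<mu> ?ee (vpair ?D 0) = ?D" by (simp add: fd_\<mu>_e0)
  also have "fd (\<lambda>z. fd \<mu> z (vpair v 0)) ?ee (vpair 0 u) = fd (\<lambda>z. fd \<mu> z (vpair 0 u)) ?ee (vpair v 0)"
    by (rule fd_symmetric[OF open_M2 inM smo_ck[OF smo_\<mu>]])
  also have "\<dots> = fd (\<lambda>x. fd \<mu> (vpair x e0) (vpair 0 u)) e0 v"
    using fd_comp(1)[OF fd_vpair_const(2) smo_differentiable[OF smo_fd[OF open_M2 smo_\<mu>] inM], where v = v] fd_vpair_const(1) by simp
  also have "fd (\<lambda>x. fd \<mu> (vpair x e0) (vpair 0 u)) e0 = fd (lfield u) e0"
    by (rule fd_cong(1)[OF open_T0 e0_T0 _ smo_differentiable[OF smo_lfield e0_T0]]) (simp add: lfield_\<mu>)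
  finally show ?thesis by (simp add: tb_def)
qed

lemma fd_Ad:
  assumes a: "plot C W A a" and w: "w \<in> W"
  shows "fd (\<lambda>x. Ad (a x) v) w \<xi> = Ad (a w) (tb (ld a w \<xi>) v)"
proof -
  have c: "a x \<in> carrier G" if "x \<in> W" for x by (rule plot_carrier[OF a that])
  let ?a = "\<lambda>x. inv (a w) \<otimes> a x"
  have pa: "plot C W A ?a" using plot_lmult[OF _ a] c[OF w] by simp
  have one: "?a w = \<one>" using c[OF w] by simp
  let ?O = "W \<inter> ?a -` U0"
  have o: "open ?O" "w \<in> ?O" using plot_chart0(1)[OF pa] w one one_U0 by auto
  have da: "(\<lambda>x. \<phi>0 (?a x)) differentiable (at w)" by (rule plot_chart0(3)[OF pa w]) (simp add: c[OF w] one_U0)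
  have dA: "(\<lambda>x. Ad (\<psi>0 x) v) differentiable (at (\<phi>0 (?a w)))"
    unfolding one by (rule smo_differentiable[OF smo_Ad[OF plot_\<psi>0] e0_T0])
  have bA: "bounded_linear (Ad (a w))" by (rule bounded_linear_klin[OF klin_Ad[OF c[OF w]]])
  note d1 = fd_comp(2)[OF da dA]
  have eq: "Ad (a w) (Ad (\<psi>0 (\<phi>0 (?a x))) v) = Ad (a x) v" if x: "x \<in> ?O" for x
  proof -
    have "a w \<otimes> (inv (a w) \<otimes> a x) = a x" using c w x by (simp add: m_assoc[symmetric])
    moreover have "\<psi>0 (\<phi>0 (?a x)) = ?a x" using x by (simp add: \<psi>0_\<phi>0)
    ultimately show ?thesis using c w x by (simp add: Ad_mult[symmetric])
  qed
  have "fd (\<lambda>x. Ad (a x) v) w \<xi> = fd (\<lambda>x. Ad (a w) (Ad (\<psi>0 (\<phi>0 (?a x))) v)) w \<xi>"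
    using fd_cong(1)[OF o eq fd_comp(2)[OF d1 bounded_linear_imp_differentiable[OF bA]]] by simp
  also have "\<dots> = Ad (a w) (fd (\<lambda>x. Ad (\<psi>0 (\<phi>0 (?a x))) v) w \<xi>)"
    using fd_comp(1)[OF d1 bounded_linear_imp_differentiable[OF bA]] by (simp add: fd_bounded_linear[OF bA])
  also have "fd (\<lambda>x. Ad (\<psi>0 (\<phi>0 (?a x))) v) w \<xi> = tb (ld a w \<xi>) v"
    using fd_comp(1)[OF da dA] unfolding one by (simp add: fd_Ad_e0 ld_def)
  finally show ?thesis .
qed

lemma tb_self: "tb u u = 0" by (simp add: tb_def)
lemma tb_anti: "tb u v = - tb v u" by (simp add: tb_def)

text \<open>Differentiate Ad (g exp (t u) g^-1) (Ad g v) = Ad g (Ad (exp (t u)) v) at t = 0.\<close>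

lemma Ad_tb:
  assumes g: "g \<in> carrier G"
  shows "Ad g (tb u v) = tb (Ad g u) (Ad g v)"
proof -
  have p: "plot {} UNIV A (\<lambda>t. g \<otimes> ops u t \<otimes> inv g)" by (rule plot_conj[OF g plot_ops])
  have l: "ld (\<lambda>t. g \<otimes> ops u t \<otimes> inv g) 0 1 = Ad g u"
    using ld_at_one[OF p UNIV_I] fd_conj[OF plot_ops UNIV_I ops_0 g, of u 1] ops(2)[of u] g by (simp add: ops_0)
  have bA: "bounded_linear (Ad g)" by (rule bounded_linear_klin[OF klin_Ad[OF g]])
  have dO: "(\<lambda>t. Ad (ops u t) v) differentiable (at 0)" by (rule smo_differentiable[OF smo_Ad[OF plot_ops] UNIV_I])
  have eq: "Ad (g \<otimes> ops u t \<otimes> inv g) (Ad g v) = Ad g (Ad (ops u t) v)" for t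
    using g ops_carrier[of u t] by (simp add: Ad_mult Ad_inv)
  have "tb (Ad g u) (Ad g v) = fd (\<lambda>t. Ad (g \<otimes> ops u t \<otimes> inv g) (Ad g v)) 0 1"
    using fd_Ad[OF p UNIV_I, of "Ad g v" 0 1] g by (simp add: l ops_0 Ad_one)
  also have "\<dots> = fd (\<lambda>t. Ad g (Ad (ops u t) v)) 0 1" by (simp only: eq)
  also have "\<dots> = Ad g (fd (\<lambda>t. Ad (ops u t) v) 0 1)"
    using fd_comp(1)[OF dO bounded_linear_imp_differentiable[OF bA]] by (simp add: fd_bounded_linear[OF bA])
  also have "fd (\<lambda>t. Ad (ops u t) v) 0 1 = tb u v"
    using fd_Ad[OF plot_ops UNIV_I, of u v 0 1] by (simp add: ld_ops ops_0 Ad_one)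
  finally show ?thesis by simp
qed

lemma Ad_ops_self: "Ad (ops u t) u = u"
proof -
  have eq: "ops u t \<otimes> ops u s \<otimes> inv (ops u t) = ops u s" for s
    by (simp add: one_parameter_neg[OF ops(1)] ops_add[symmetric])
  show ?thesis using fd_conj[OF plot_ops UNIV_I ops_0 ops_carrier, of u t u 1] ops(2)[of u] by (simp add: eq)
qed

end

section \<open>The coadjoint orbit of a regular functional\<close>

text \<open>From here on the Lie algebra enters only through one fact: \<open>hh\<close> is the
  radical of the alternating form f (tb u v) on the tangent space. Bilinearity of \<open>tb\<close>
  is an assumption because it will be carried over from the abstract bracket by the isomorphism
  \<theta>.\<close>

locale lie_grp_f = lie_grp G A U0 \<phi>0
  for G :: "'g monoid" (structure) and A :: "('g, 'k::real_or_complex, 'n::finite) atlas" and U0 \<phi>0 +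
  fixes f :: "'k ^ 'n \<Rightarrow> 'k" and hh :: "('k ^ 'n) set"
  assumes f_add: "f (u + v) = f u + f v" and f_scale: "f (c *s u) = c * f u"
    and f_tb: "(\<forall>v. f (tb u v) = 0) \<longleftrightarrow> u \<in> hh"
    and kbilin_tb: "kbilin tb"
begin

lemma klin_tb1: "klin (tb u)" and klin_tb2: "klin (\<lambda>u. tb u v)"
  using kbilin_tb by (auto simp: kbilin_def)

lemma f_0 [simp]: "f 0 = 0" using f_scale[of 0 0] by simp
lemma f_minus: "f (- u) = - f u" using f_scale[of "-1" u] by simp
lemma f_diff: "f (u - v) = f u - f v" using f_add[of u "- v"] by (simp add: f_minus)
lemma f_sum: "f (sum g S) = (\<Sum>i\<in>S. f (g i))"
  by (induction S rule: infinite_finite_induct) (auto simp: f_add)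

lemma klin_f_axis: "klin (\<lambda>u. axis i (f u) :: 'k ^ 'l::finite)"
  by (rule klinI) (auto simp: f_add f_scale vec_eq_iff axis_def)

lemma bounded_linear_f: "bounded_linear f"
proof -
  have "bounded_linear (\<lambda>u. (axis undefined (f u) :: 'k ^ 'n) $ undefined)"
    using bounded_linear_compose[OF bounded_linear_vec_nth bounded_linear_klin[OF klin_f_axis]] .
  then show ?thesis by simp
qed

lemma f_tb_eq_0: "u \<in> hh \<Longrightarrow> f (tb u v) = 0" using f_tb by blast

lemma subspace_hh: "vec.subspace hh"
proof -
  have 1: "f (tb (u + u') v) = f (tb u v) + f (tb u' v)" "f (tb (c *s u) v) = c * f (tb u v)" "f (tb 0 v) = 0" for u u' v c
    by (simp_all add: klin_add[OF klin_tb2] klin_scale[OF klin_tb2] klin_0[OF klin_tb2] f_add f_scale)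
  have mem: "u \<in> hh" if "\<And>v. f (tb u v) = 0" for u using f_tb that by blast
  show ?thesis unfolding vec.subspace_def by (auto intro!: mem simp: 1 f_tb_eq_0)
qed

section \<open>The isotropy group of \<open>f\<close> and the subgroup generated by
  exponentials\<close>

definition stab :: "'g set" where
  "stab = {g \<in> carrier G. \<forall>v. f (Ad g v) = f v}"

definition HH :: "'g set" where
  "HH = generate G ((\<lambda>u. ops u 1) ` hh)"

lemma subgroup_stab: "subgroup stab G"
proof (rule subgroupI)
  show "stab \<noteq> {}" by (auto simp: stab_def Ad_one intro!: exI[of _ \<one>])
next
  fix a assume a: "a \<in> stab"
  then have "f (Ad (inv a) v) = f v" for v unfolding stab_def using Ad_inv(1)[of a v] by (auto, metis)
  then show "inv a \<in> stab" using a by (simp add: stab_def)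
qed (auto simp: stab_def Ad_mult)

lemma fd_f: "q differentiable (at x) \<Longrightarrow> fd (\<lambda>x. f (q x)) x v = f (fd q x v)"
  "q differentiable (at x) \<Longrightarrow> (\<lambda>x. f (q x)) differentiable (at x)"
  using fd_comp[OF _ bounded_linear_imp_differentiable[OF bounded_linear_f]]
  by (simp_all add: fd_bounded_linear[OF bounded_linear_f])

text \<open>The derivative of f (Ad (exp (t u)) v) in t is f [u, Ad (exp (t u)) v], because u is
  fixed by its own exponentials; it vanishes because u lies in the radical.\<close>

lemma ops_stab:
  assumes u: "u \<in> hh" shows "ops u t \<in> stab"
proof -
  have "f (Ad (ops u t) v) = f v" for v
  proof -
    have d: "(\<lambda>t. Ad (ops u t) v) differentiable (at t)" for t by (rule smo_differentiable[OF smo_Ad[OF plot_ops] UNIV_I])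
    have z: "fd (\<lambda>t. f (Ad (ops u t) v)) t 1 = 0" for t
    proof -
      have "fd (\<lambda>t. f (Ad (ops u t) v)) t 1 = f (Ad (ops u t) (tb u v))"
        by (simp add: fd_f(1)[OF d] fd_Ad[OF plot_ops UNIV_I] ld_ops)
      also have "\<dots> = f (tb u (Ad (ops u t) v))" by (simp add: Ad_tb[OF ops_carrier] Ad_ops_self)
      finally show ?thesis by (simp add: f_tb_eq_0[OF u])
    qed
    have fdz: "fd (\<lambda>t. f (Ad (ops u t) v)) t = (\<lambda>_. 0)" for t
    proof
      fix r show "fd (\<lambda>t. f (Ad (ops u t) v)) t r = 0"
        using linear_cmul[OF linear_frechet_derivative[OF fd_f(2)[OF d[of t]]], of r 1] z[of t] by simp
    qed
    have "((\<lambda>t. f (Ad (ops u t) v)) has_derivative (\<lambda>_. 0)) (at t)" for t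
      using has_fd[OF fd_f(2)[OF d, of t]] unfolding fdz .
    then have "f (Ad (ops u t) v) = f (Ad (ops u 0) v)"
      using has_derivative_zero_unique[of UNIV "\<lambda>t. f (Ad (ops u t) v)" t 0] by simp
    then show ?thesis by (simp add: ops_0 Ad_one)
  qed
  then show ?thesis by (simp add: stab_def ops_carrier)
qed

lemma HH_stab: "HH \<subseteq> stab"
  unfolding HH_def by (rule generate_subgroup_incl[OF _ subgroup_stab]) (auto intro: ops_stab)

lemma subgroup_HH: "subgroup HH G"
  unfolding HH_def by (rule generate_is_subgroup) (auto intro: ops_carrier)

lemma HH_carrier: "HH \<subseteq> carrier G" using subgroup_HH by (rule subgroup.subset)

lemma HH_one: "\<one> \<in> HH" and HH_mult: "\<eta> \<in> HH \<Longrightarrow> \<eta>' \<in> HH \<Longrightarrow> \<eta> \<otimes> \<eta>' \<in> HH" and HH_inv: "\<eta> \<in> HH \<Longrightarrow> inv \<eta> \<in> HH"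
  using subgroup.one_closed[OF subgroup_HH] subgroup.m_closed[OF subgroup_HH] subgroup.m_inv_closed[OF subgroup_HH] by auto

lemma ops_HH: "u \<in> hh \<Longrightarrow> ops u t \<in> HH"
proof -
  assume u: "u \<in> hh"
  have "t *\<^sub>R u \<in> hh" unfolding scaleR_eq_smult by (rule vec.subspace_scale[OF subspace_hh u])
  then have "ops (t *\<^sub>R u) 1 \<in> HH" unfolding HH_def by (intro generate.incl) auto
  then show ?thesis by (simp add: ops_scale)
qed

text \<open>An infinitesimal converse of \<open>ops_stab\<close>: differentiating the constant f (Ad
  (a x) v) puts the logarithmic derivative into the radical. It holds for the full isotropy group,
  so families in \<open>HH\<close> are covered without a manifold structure on
  \<open>HH\<close>.\<close>

lemma ld_in_hh:
  assumes a: "plot C W A a" and w: "w \<in> W" and st: "\<And>x. x \<in> W \<Longrightarrow> a x \<in> stab"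
  shows "ld a w \<xi> \<in> hh"
proof -
  have d: "(\<lambda>x. Ad (a x) v) differentiable (at w)" for v by (rule smo_differentiable[OF smo_Ad[OF a] w])
  have aw: "a w \<in> carrier G" "\<And>v. f (Ad (a w) v) = f v" using st[OF w] by (auto simp: stab_def)
  have "f (tb (ld a w \<xi>) v) = 0" for v
  proof -
    have "f (tb (ld a w \<xi>) v) = f (Ad (a w) (tb (ld a w \<xi>) v))" by (simp add: aw)
    also have "\<dots> = fd (\<lambda>x. f (Ad (a x) v)) w \<xi>" by (simp add: fd_f(1)[OF d] fd_Ad[OF a w])
    also have "fd (\<lambda>x. f (Ad (a x) v)) w = fd (\<lambda>x. f v) w"
      by (rule fd_cong(1)[OF plotD(1)[OF a] w]) (use st in \<open>auto simp: stab_def\<close>)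
    finally show ?thesis by simp
  qed
  then show ?thesis using f_tb by blast
qed

text \<open>The coordinates of the coadjoint transform of f by g, read off on the standard axes. The
  inverse makes this a left action, so that the map is constant on left cosets of
  \<open>stab\<close>.\<close>

definition coad :: "'g \<Rightarrow> 'k ^ 'n" where
  "coad g = (\<chi> i. f (Ad (inv g) (axis i 1)))"

lemma coad_stab: "g \<in> carrier G \<Longrightarrow> \<eta> \<in> stab \<Longrightarrow> coad (g \<otimes> \<eta>) = coad g"
proof -
  assume g: "g \<in> carrier G" and e: "\<eta> \<in> stab"
  have "inv \<eta> \<in> stab" using subgroup.m_inv_closed[OF subgroup_stab e] .
  then show ?thesis using g e by (simp add: coad_def inv_mult_group Ad_mult stab_def)
qed

lemma smo_coad:
  assumes a: "plot C W A a" shows "smo C (\<lambda>w. coad (a w)) W"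
proof -
  have "smo C (\<lambda>w. \<Sum>i\<in>UNIV. axis i (f (Ad (inv (a w)) (axis i 1)))) W"
    by (intro smo_sum plotD(1)[OF a] smo_klin_comp[OF klin_f_axis plotD(1)[OF a]] smo_Ad[OF plot_inverse[OF a]])
  moreover have "(\<Sum>i\<in>UNIV. axis i (f (Ad (inv (a w)) (axis i 1)))) = coad (a w)" for w
    by (simp add: coad_def vec_eq_iff axis_def if_distrib[of "\<lambda>g. g $ _"] cong: if_cong)
  ultimately show ?thesis by simp
qed

lemma fd_coad:
  assumes a: "plot C W A a" and w: "w \<in> W" "a w = \<one>"
  shows "fd (\<lambda>x. coad (a x)) w \<xi> = (\<chi> i. - f (tb (ld a w \<xi>) (axis i 1)))"
proof -
  have dc: "(\<lambda>x. coad (a x)) differentiable (at w)" by (rule smo_differentiable[OF smo_coad[OF a] w(1)])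
  have "fd (\<lambda>x. coad (a x)) w \<xi> $ i = - f (tb (ld a w \<xi>) (axis i 1))" for i
  proof -
    have d: "(\<lambda>x. Ad (inv (a x)) (axis i 1)) differentiable (at w)"
      by (rule smo_differentiable[OF smo_Ad[OF plot_inverse[OF a]] w(1)])
    have b: "bounded_linear (\<lambda>x :: 'k ^ 'n. x $ i)" by (rule bounded_linear_vec_nth)
    have "fd (\<lambda>x. coad (a x)) w \<xi> $ i = fd (\<lambda>x. coad (a x) $ i) w \<xi>"
      using fd_comp(1)[OF dc bounded_linear_imp_differentiable[OF b]] by (simp add: fd_bounded_linear[OF b])
    also have "\<dots> = f (fd (\<lambda>x. Ad (inv (a x)) (axis i 1)) w \<xi>)"
      by (simp add: coad_def fd_f(1)[OF d])
    also have "\<dots> = f (tb (- ld a w \<xi>) (axis i 1))"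
      using fd_Ad[OF plot_inverse[OF a] w(1)] ld_inverse[OF a w(1)] w(2) by (simp add: Ad_one)
    finally show ?thesis by (simp add: klin_minus[OF klin_tb2] f_minus)
  qed
  then show ?thesis by (simp add: vec_eq_iff)
qed

lemma coad_differential_ker:
  "(\<chi> i. - f (tb u (axis i 1))) = (0 :: 'k ^ 'n) \<longleftrightarrow> u \<in> hh"
proof -
  have ex: "f (tb u v) = (\<Sum>i\<in>UNIV. v $ i * f (tb u (axis i 1)))" for v
    by (subst klin_expand[OF klin_tb1]) (simp add: f_sum f_scale)
  have "f (tb u v) = 0" if "\<And>i. f (tb u (axis i 1)) = 0" for v
    by (subst ex) (simp add: that)
  then have "(\<forall>i. f (tb u (axis i 1)) = 0) \<longleftrightarrow> (\<forall>v. f (tb u v) = 0)" by blast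
  then show ?thesis using f_tb by (simp add: vec_eq_iff)
qed

end

section \<open>Local sections of the projection to the coset space\<close>

text \<open>A basis of V is completed to one of the whole space; \<iota> parametrises the span of
  the added vectors and \<pi> reads off their coordinates. The cardinality of the index type turns
  the complement into exactly m coordinates.\<close>

lemma ex_complement:
  fixes V :: "('k::field ^ 'n::finite) set"
  assumes V: "vec.subspace V" and card: "CARD('m::finite) = CARD('n) - vec.dim V"
  shows "\<exists>(\<iota> :: 'k ^ 'm \<Rightarrow> 'k ^ 'n) \<pi>. klin \<iota> \<and> klin \<pi> \<and> (\<forall>z. \<pi> (\<iota> z) = z) \<and> (\<forall>y. y - \<iota> (\<pi> y) \<in> V) \<and> (\<forall>y\<in>V. \<pi> y = 0)"
proof -
  obtain B where B: "B \<subseteq> V" "\<not> vec.dependent B" "V \<subseteq> vec.span B" "card B = vec.dim V" using vec.basis_exists by blast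
  have spB: "vec.span B = V" using B V by (metis vec.span_minimal subset_antisym)
  obtain C where C0: "B \<subseteq> C" "C \<subseteq> UNIV" "\<not> vec.dependent C" "UNIV \<subseteq> vec.span C"
    by (rule vec.maximal_independent_subset_extend[OF subset_UNIV B(2)])
  note C = C0(1,3,4)
  have spC: "vec.span C = UNIV" using C by auto
  have fC: "finite C" by (rule vec.finiteI_independent[OF C(2)])
  have fB: "finite B" by (rule vec.finiteI_independent[OF B(2)])
  have "card C = CARD('n)"
    using vec.dim_eq_card_independent[OF C(2)] vec.dim_span[of C] spC vec_dim_card[where ?'a = 'k and ?'n = 'n] by metis
  then have "card (C - B) = CARD('m)" using card B(4) C(1) fB by (simp add: card_Diff_subset)
  then obtain g :: "'m \<Rightarrow> 'k ^ 'n" where g: "bij_betw g UNIV (C - B)"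
    using finite_same_card_bij[of "UNIV :: 'm set" "C - B"] fC by auto
  have gC: "g j \<in> C" "g j \<notin> B" for j using g by (auto simp: bij_betw_def)
  have ginj: "g j = g k \<longleftrightarrow> j = k" for j k using g by (auto simp: bij_betw_def inj_def)
  let ?r = "vec.representation C"
  define \<iota> where "\<iota> z = (\<Sum>j\<in>UNIV. z $ j *s g j)" for z
  define \<pi> :: "'k ^ 'n \<Rightarrow> 'k ^ 'm" where "\<pi> y = (\<chi> j. ?r y (g j))" for y
  have inC: "y \<in> vec.span C" for y by (simp add: spC)
  have "klin \<iota>"
    by (rule klinI) (simp_all add: \<iota>_def vector_sadd_rdistrib sum.distrib vec.scale_sum_right)
  moreover have "klin \<pi>"
    by (rule klinI) (simp_all add: \<pi>_def vec_eq_iff vec.representation_add[OF C(2) inC inC] vec.representation_scale[OF C(2) inC])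
  moreover have "\<pi> (\<iota> z) = z" for z
  proof -
    have "?r (\<iota> z) (g k) = (\<Sum>j\<in>UNIV. z $ j * ?r (g j) (g k))" for k
      unfolding \<iota>_def by (simp add: vec.representation_sum[OF C(2)] inC vec.representation_scale[OF C(2) inC])
    also have "\<dots> k = (\<Sum>j\<in>UNIV. if j = k then z $ j else 0)" for k
      by (intro sum.cong) (auto simp: vec.representation_basis[OF C(2) gC(1)] ginj)
    finally show ?thesis by (simp add: \<pi>_def vec_eq_iff)
  qed
  moreover have "y - \<iota> (\<pi> y) \<in> V" for y
  proof -
    have "y = (\<Sum>b\<in>C. ?r y b *s b)" using vec.sum_representation_eq[OF C(2) inC fC] by simp
    also have "\<dots> = (\<Sum>b\<in>C - B. ?r y b *s b) + (\<Sum>b\<in>B. ?r y b *s b)" by (rule sum.subset_diff[OF C(1) fC])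
    also have "(\<Sum>b\<in>C - B. ?r y b *s b) = \<iota> (\<pi> y)"
      unfolding \<iota>_def \<pi>_def using sum.reindex_bij_betw[OF g, of "\<lambda>b. ?r y b *s b"] by simp
    finally have "y - \<iota> (\<pi> y) = (\<Sum>b\<in>B. ?r y b *s b)" by (simp add: algebra_simps)
    then show ?thesis using B(1) by (auto intro!: vec.subspace_sum[OF V] vec.subspace_scale[OF V])
  qed
  moreover have "\<pi> y = 0" if "y \<in> V" for y
  proof -
    have "y \<in> vec.span B" using that spB by simp
    then have "?r y = vec.representation B y" by (intro vec.representation_extend[OF C(2)] C(1))
    then have "?r y (g j) = 0" for j using vec.representation_ne_zero[of B y "g j"] gC(2) by auto
    then show ?thesis by (simp add: \<pi>_def vec_eq_iff)
  qed
  ultimately show ?thesis by blast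
qed

lemma openin_chart_preimage:
  assumes M: "manifold M" and U: "(U, \<phi>) \<in> M" and X: "open X"
  shows "openin (manifold_topology M) {p \<in> U. \<phi> p \<in> X}"
  unfolding openin_charted[OF charted_manifold[OF M]]
proof (intro conjI ballI, goal_cases)
  case 1 then show ?case using chartedD(3)[OF charted_manifold[OF M] U] by blast
next
  case (2 c)
  obtain V \<psi> where c: "c = (V, \<psi>)" by fastforce
  have V: "(V, \<psi>) \<in> M" using 2 c by simp
  have inj: "inj_on \<psi> V" by (rule chartedD(1)[OF charted_manifold[OF M] V])
  note tr = manifold_transition[OF M V U]
  have "\<psi> ` (V \<inter> {p \<in> U. \<phi> p \<in> X}) = \<psi> ` (V \<inter> U) \<inter> (\<lambda>x. \<phi> (inv_into V \<psi> x)) -` X"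
    using inj by auto
  moreover have "open (\<psi> ` (V \<inter> U) \<inter> (\<lambda>x. \<phi> (inv_into V \<psi> x)) -` X)"
    by (rule continuous_open_preimage[OF smo_continuous[OF tr(2)] tr(1) X])
  ultimately show ?case by (simp add: c)
qed

context lie_grp_f
begin

lemma fd_ops_linear:
  assumes b: "bounded_linear l"
  shows "plot {} UNIV A (\<lambda>y. ops u (l y))" "fd (\<lambda>y. \<phi>0 (ops u (l y))) 0 v = l v *\<^sub>R u"
proof -
  have "plot {} UNIV A (\<lambda>y. ops u (l y))"
    by (rule plot_comp_real[OF manifold_A plot_ops open_UNIV ck_on_linear[OF b]]) auto
  then show "plot {} UNIV A (\<lambda>y. ops u (l y))" .
  have l0: "l 0 = 0" using linear_0[OF bounded_linear.linear[OF b]] .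
  have d: "(\<lambda>t. \<phi>0 (ops u t)) differentiable (at (l 0))"
    by (rule plot_chart0(3)[OF plot_ops]) (simp_all add: l0 ops_0 one_U0)
  have "fd (\<lambda>y. \<phi>0 (ops u (l y))) 0 v = fd (\<lambda>t. \<phi>0 (ops u t)) (l 0) (l v)"
    using fd_comp(1)[OF bounded_linear_imp_differentiable[OF b] d] by (simp add: fd_bounded_linear[OF b])
  also have "\<dots> = l v *\<^sub>R u"
    using linear_cmul[OF linear_frechet_derivative[OF d], of "l v" 1] ops(2)[of u] by (simp add: l0)
  finally show "fd (\<lambda>y. \<phi>0 (ops u (l y))) 0 v = l v *\<^sub>R u" .
qed

text \<open>Coordinates of the second kind: a product of exponentials of fixed vectors. It lies in
  \<open>HH\<close> by construction, and its smoothness in y follows from that of the single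
  curves.\<close>

primrec ops_prod :: "('k ^ 'n \<Rightarrow> 'd \<Rightarrow> real) \<Rightarrow> ('k ^ 'n) list \<Rightarrow> 'd \<Rightarrow> 'g" where
  "ops_prod l [] y = \<one>"
| "ops_prod l (b # bs) y = ops b (l b y) \<otimes> ops_prod l bs y"

lemma ops_prod:
  fixes l :: "'k ^ 'n \<Rightarrow> 'd::euclidean_space \<Rightarrow> real"
  assumes l: "\<And>b. bounded_linear (l b)" and bs: "set bs \<subseteq> hh"
  shows "plot {} UNIV A (ops_prod l bs) \<and> (\<forall>y. ops_prod l bs y \<in> HH) \<and> ops_prod l bs 0 = \<one> \<and>
    (\<forall>v. fd (\<lambda>y. \<phi>0 (ops_prod l bs y)) 0 v = (\<Sum>b\<leftarrow>bs. l b v *\<^sub>R b))"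
  using bs
proof (induction bs)
  case Nil
  have "plot {} UNIV A (\<lambda>y. \<one>)" by (rule plot_const_carrier) simp_all
  moreover have "ops_prod l [] = (\<lambda>y. \<one>)" by (simp add: fun_eq_iff)
  ultimately show ?case by (simp add: HH_one)
next
  case (Cons b bs)
  then have IH: "plot {} UNIV A (ops_prod l bs)" "\<And>y. ops_prod l bs y \<in> HH" "ops_prod l bs 0 = \<one>"
    "\<And>v. fd (\<lambda>y. \<phi>0 (ops_prod l bs y)) 0 v = (\<Sum>b\<leftarrow>bs. l b v *\<^sub>R b)" and b: "b \<in> hh" by auto
  note o = fd_ops_linear[OF l[of b], of b]
  have l0: "l b 0 = 0" using linear_0[OF bounded_linear.linear[OF l]] .
  have eq: "ops_prod l (b # bs) = (\<lambda>y. ops b (l b y) \<otimes> ops_prod l bs y)" by (simp add: fun_eq_iff)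
  have "fd (\<lambda>y. \<phi>0 (ops b (l b y) \<otimes> ops_prod l bs y)) 0 v
      = fd (\<lambda>y. \<phi>0 (ops b (l b y))) 0 v + fd (\<lambda>y. \<phi>0 (ops_prod l bs y)) 0 v" for v
    by (rule fd_mult_at_one[OF o(1) IH(1) UNIV_I]) (simp_all add: IH(3) l0 ops_0)
  then show ?case unfolding eq
    using plot_mult[OF o(1) IH(1)] IH HH_mult[OF ops_HH[OF b]] o(2) by (simp add: l0 ops_0)
qed

lemma ex_slice:
  assumes \<iota>: "klin (\<iota> :: 'k ^ 'm::finite \<Rightarrow> 'k ^ 'n)"
  shows "\<exists>S s. plot scalars S A s \<and> 0 \<in> S \<and> s 0 = \<one> \<and> (\<forall>\<zeta>. fd (\<lambda>z. \<phi>0 (s z)) 0 \<zeta> = \<iota> \<zeta>)"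
proof -
  have sa: "smo scalars (\<lambda>z. e0 + \<iota> z) UNIV" by (rule smo_add[OF open_UNIV smo_const smo_klin[OF \<iota>]])
  define S0 where "S0 = {z. e0 + \<iota> z \<in> T0}"
  have oS0: "open S0"
    using continuous_open_preimage[OF smo_continuous[OF sa] open_UNIV open_T0] by (simp add: S0_def vimage_def)
  have S00: "0 \<in> S0" by (simp add: S0_def klin_0[OF \<iota>] e0_T0)
  define s where "s z = \<psi>0 (e0 + \<iota> z)" for z
  have ps: "plot scalars S0 A s"
    unfolding s_def by (rule plot_chart[OF manifold_A chart0 oS0 smo_subset[OF sa]]) (auto simp: S0_def)
  have s0: "s 0 = \<one>" by (simp add: s_def klin_0[OF \<iota>])
  have ha: "((\<lambda>z. e0 + \<iota> z) has_derivative \<iota>) (at z)" for z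
    using has_derivative_add[OF has_derivative_const bounded_linear_imp_has_derivative[OF bounded_linear_klin[OF \<iota>]]] by simp
  have "fd (\<lambda>z. \<phi>0 (s z)) 0 \<zeta> = \<iota> \<zeta>" for \<zeta>
  proof -
    have "fd (\<lambda>z. \<phi>0 (s z)) 0 = fd (\<lambda>z. e0 + \<iota> z) 0"
      by (rule fd_cong(1)[OF oS0 S00]) (use ha[of 0] in \<open>auto simp: s_def S0_def \<psi>0_in differentiable_def\<close>)
    then show ?thesis using fd_eqI[OF ha] by simp
  qed
  then show ?thesis using ps S00 s0 by blast
qed

text \<open>A slice transverse to \<open>hh\<close> is reparametrised so that
  \<open>P \<circ> coad\<close> reads off its parameter; this normalisation later makes chart values
  independent of representatives. That the slice times \<open>HH\<close> contains a neighbourhood of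
  the identity follows from an auxiliary map whose differential at one point is the
  identity.\<close>

theorem ex_local_section:
  assumes card: "CARD('m::finite) = CARD('n) - vec.dim hh"
  shows "\<exists>(W :: ('k ^ 'm) set) \<sigma> P N. plot scalars W A \<sigma> \<and> klin P \<and> (\<forall>x\<in>W. P (coad (\<sigma> x)) = x) \<and>
    openin (manifold_topology A) N \<and> \<one> \<in> N \<and> (\<forall>g\<in>N. \<exists>x\<in>W. \<exists>\<eta>\<in>HH. g = \<sigma> x \<otimes> \<eta>)"
proof -
  obtain \<iota> :: "'k ^ 'm \<Rightarrow> 'k ^ 'n" and \<pi> where \<iota>: "klin \<iota>" and \<pi>: "klin \<pi>" and \<pi>\<iota>: "\<And>z. \<pi> (\<iota> z) = z"
    and comp: "\<And>y. y - \<iota> (\<pi> y) \<in> hh" and \<pi>h: "\<And>y. y \<in> hh \<Longrightarrow> \<pi> y = 0"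
    using ex_complement[OF subspace_hh card] by blast
  note b\<pi> = bounded_linear_klin[OF \<pi>]
  obtain S0 s where ps: "plot scalars S0 A s" and S00: "0 \<in> S0" and s0: "s 0 = \<one>"
    and fds: "\<And>\<zeta>. fd (\<lambda>z. \<phi>0 (s z)) 0 \<zeta> = \<iota> \<zeta>"
    using ex_slice[OF \<iota>] by blast
  note oS0 = plotD(1)[OF ps]
  have lds: "ld s 0 \<zeta> = \<iota> \<zeta>" for \<zeta> using ld_at_one[OF ps S00 s0] fds by simp
  define \<Lambda> :: "'k ^ 'n \<Rightarrow> 'k ^ 'n" where "\<Lambda> u = (\<chi> i. - f (tb u (axis i 1)))" for u
  have \<Lambda>: "klin \<Lambda>"
    by (rule klinI) (simp_all add: \<Lambda>_def vec_eq_iff klin_add[OF klin_tb2] klin_scale[OF klin_tb2] f_add f_scale)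
  have \<Lambda>0: "\<Lambda> u = 0 \<longleftrightarrow> u \<in> hh" for u unfolding \<Lambda>_def by (rule coad_differential_ker)
  have k\<Lambda>: "klin (\<lambda>\<zeta>. \<Lambda> (\<iota> \<zeta>))" by (rule klin_compose[OF \<Lambda> \<iota>])
  have "inj (\<lambda>\<zeta>. \<Lambda> (\<iota> \<zeta>))"
  proof (rule injI)
    fix x y assume "\<Lambda> (\<iota> x) = \<Lambda> (\<iota> y)"
    then have "\<Lambda> (\<iota> (x - y)) = 0" by (simp add: klin_diff[OF k\<Lambda>])
    then have "\<pi> (\<iota> (x - y)) = 0" by (intro \<pi>h) (simp add: \<Lambda>0)
    then show "x = y" by (simp add: \<pi>\<iota>)
  qed
  \<comment> \<open>\<Lambda> is the differential of \<open>coad\<close> at the identity. Its kernel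
    is \<open>hh\<close>, so it is injective on the complement, and P is a left inverse there that
    reduces the n coordinates of \<open>coad\<close> to m.\<close>
  then obtain P where P: "klin P" "\<And>\<zeta>. P (\<Lambda> (\<iota> \<zeta>)) = \<zeta>"
    using vec.linear_injective_left_inverse[OF k\<Lambda>[unfolded klin_iff]] unfolding klin_iff[symmetric] by (auto simp: fun_eq_iff)
  note bP = bounded_linear_klin[OF P(1)]
  define Q where "Q z = P (coad (s z))" for z
  have sc: "smo scalars (\<lambda>z. coad (s z)) S0" by (rule smo_coad[OF ps])
  have sQ: "smo scalars Q S0" unfolding Q_def by (rule smo_klin_comp[OF P(1) oS0 sc])
  have fdQ: "fd Q 0 \<zeta> = \<zeta>" for \<zeta>
  proof -
    have "fd Q 0 \<zeta> = P (fd (\<lambda>z. coad (s z)) 0 \<zeta>)"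
      unfolding Q_def using fd_comp(1)[OF smo_differentiable[OF sc S00] bounded_linear_imp_differentiable[OF bP]]
      by (simp add: fd_bounded_linear[OF bP])
    then show ?thesis using fd_coad[OF ps S00 s0, of \<zeta>] P(2) by (simp add: lds \<Lambda>_def)
  qed
  have inj0: "v = 0" if "fd Q 0 v = 0" for v using that fdQ by simp
  obtain U1 V1 g where U1: "open U1" "U1 \<subseteq> S0" "0 \<in> U1" and V1: "open V1" "Q 0 \<in> V1"
    and QU: "\<And>x. x \<in> U1 \<Longrightarrow> Q x \<in> V1 \<and> g (Q x) = x" and gV: "\<And>y. y \<in> V1 \<Longrightarrow> g y \<in> U1 \<and> Q (g y) = y"
    and sg: "smo scalars g V1"
    using smooth_local_inverse[OF oS0 sQ S00 inj0] by blast
  define \<sigma> where "\<sigma> x = s (g x)" for x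
  have p\<sigma>: "plot scalars V1 A \<sigma>"
    unfolding \<sigma>_def using gV U1(2) by (intro plot_comp[OF manifold_A ps V1(1) sg]) auto
  have P\<sigma>: "P (coad (\<sigma> x)) = x" if "x \<in> V1" for x using gV[OF that] by (simp add: \<sigma>_def Q_def)
  have s\<sigma>: "s z = \<sigma> (Q z)" "Q z \<in> V1" if "z \<in> U1" for z using QU[OF that] by (simp_all add: \<sigma>_def)
  \<comment> \<open>Exponentials are real curves, so \<open>hh\<close> is now treated as a real
    vector space with a real basis, also over the complex numbers.\<close>
  have rsub: "subspace hh"
    using subspace_hh unfolding vec.subspace_def subspace_def by (auto simp: scaleR_eq_smult)
  obtain B where B: "B \<subseteq> hh" "independent B" "hh \<subseteq> span B" "card B = dim hh" by (rule basis_exists[of hh])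
  have fB: "finite B" using B(2) by (rule independent_imp_finite)
  obtain bs where bs: "set bs = B" "distinct bs" using finite_distinct_list[OF fB] by blast
  \<comment> \<open>The real coordinates of the component of y in \<open>hh\<close>. They give the
    product of exponentials the differential v - \<iota> (\<pi> v) at 0, which complements that of
    the slice.\<close>
  define l where "l b y = representation B (y - \<iota> (\<pi> y)) b" for b y
  have inB: "y - \<iota> (\<pi> y) \<in> span B" for y using comp B(3) by blast
  have lin: "bounded_linear (l b)" for b
  proof (intro linear_conv_bounded_linear[THEN iffD1] linearI)
    fix x y :: "'k ^ 'n" and r :: real
    have e1: "(x + y) - \<iota> (\<pi> (x + y)) = (x - \<iota> (\<pi> x)) + (y - \<iota> (\<pi> y))" by (simp add: klin_add[OF \<pi>] klin_add[OF \<iota>])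
    show "l b (x + y) = l b x + l b y" unfolding l_def e1 by (simp add: representation_add[OF B(2) inB inB])
    have "linear (\<lambda>y. y - \<iota> (\<pi> y))"
      by (intro linear_compose_sub linear_id[unfolded id_def] klin_imp_linear klin_compose[OF \<iota> \<pi>])
    from linear_cmul[OF this] have e2: "r *\<^sub>R x - \<iota> (\<pi> (r *\<^sub>R x)) = r *\<^sub>R (x - \<iota> (\<pi> x))" .
    show "l b (r *\<^sub>R x) = r *\<^sub>R l b x" unfolding l_def e2 by (simp add: representation_scale[OF B(2) inB])
  qed
  have lsum: "(\<Sum>b\<leftarrow>bs. l b y *\<^sub>R b) = y - \<iota> (\<pi> y)" for y
    using sum_representation_eq[OF B(2) inB fB subset_refl, of y] bs by (simp add: l_def sum_list_distinct_conv_sum_set)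
  have bshh: "set bs \<subseteq> hh" using bs B by simp
  note op = ops_prod[of l, OF lin bshh]
  let ?E = "ops_prod l bs"
  have pE: "plot {} UNIV A ?E" and E0: "?E 0 = \<one>" and EH: "\<And>y. ?E y \<in> HH"
    and fE: "\<And>v. fd (\<lambda>y. \<phi>0 (?E y)) 0 v = v - \<iota> (\<pi> v)" using op lsum by auto
  let ?D = "\<pi> -` U1"
  have oD: "open ?D" by (rule open_vimage[OF U1(1) linear_continuous_on[OF b\<pi>]])
  have D0: "0 \<in> ?D" using U1(3) by (simp add: klin_0[OF \<pi>])
  have psp: "plot {} ?D A (\<lambda>y. s (\<pi> y))"
    by (rule plot_comp[OF manifold_A ps oD smo_real[OF smo_klin[OF \<pi>]]]) (use U1(2) in auto)
  have pE': "plot {} ?D A ?E" by (rule plot_subset[OF pE oD]) simp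
  let ?c = "\<lambda>y. s (\<pi> y) \<otimes> ?E y"
  have pc: "plot {} ?D A ?c" by (rule plot_mult[OF psp pE'])
  let ?\<Psi> = "\<lambda>y. \<phi>0 (?c y)" and ?S = "?D \<inter> ?c -` U0"
  have \<pi>0: "\<pi> 0 = 0" by (rule klin_0[OF \<pi>])
  have c0: "?c 0 = \<one>" by (simp add: \<pi>0 s0 E0)
  have oS: "open ?S" and cont: "continuous_on ?S ?\<Psi>" and S0: "0 \<in> ?S"
    using plot_chart0(1)[OF pc] smo_continuous[OF plot_chart0(2)[OF pc]] D0 c0 one_U0 by auto
  have ds: "(\<lambda>z. \<phi>0 (s z)) differentiable (at (\<pi> 0))"
    by (rule plot_chart0(3)[OF ps]) (simp_all add: \<pi>0 S00 s0 one_U0)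
  have "fd ?\<Psi> 0 v = v" for v
  proof -
    have "fd ?\<Psi> 0 v = fd (\<lambda>y. \<phi>0 (s (\<pi> y))) 0 v + fd (\<lambda>y. \<phi>0 (?E y)) 0 v"
      by (rule fd_mult_at_one[OF psp pE' D0]) (simp_all add: \<pi>0 s0 E0)
    also have "fd (\<lambda>y. \<phi>0 (s (\<pi> y))) 0 v = \<iota> (\<pi> v)"
      using fd_comp(1)[OF bounded_linear_imp_differentiable[OF b\<pi>] ds] by (simp add: fd_bounded_linear[OF b\<pi>] \<pi>0 fds)
    finally show ?thesis by (simp add: fE)
  qed
  then have fid: "fd ?\<Psi> 0 = (\<lambda>v. v)" by (simp add: fun_eq_iff)
  have "?\<Psi> differentiable (at 0)" by (rule plot_chart0(3)[OF pc D0]) (simp only: c0 one_U0)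
  from has_fd[OF this] have der: "(?\<Psi> has_derivative (\<lambda>v. v)) (at 0)" unfolding fid .
  \<comment> \<open>\<open>?\<Psi>\<close> is merely real smooth. Its identity differential at the
    single point 0 already makes the image of any neighbourhood of 0 a neighbourhood of
    \<open>?\<Psi> 0\<close>; neither an inverse nor a smooth choice of factors is asked
    for.\<close>
  have int: "?\<Psi> 0 \<in> interior (?\<Psi> ` ?S)"
  proof (rule sussmann_open_mapping[OF oS cont S0 der bounded_linear_ident _ subset_refl])
    show "0 \<in> interior ?S" unfolding interior_open[OF oS] by (rule S0)
  qed (simp add: fun_eq_iff)
  define N where "N = {g \<in> U0. \<phi>0 g \<in> interior (?\<Psi> ` ?S)}"
  have oN: "openin (manifold_topology A) N"
    unfolding N_def by (rule openin_chart_preimage[OF manifold_A chart0 open_interior])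
  have oneN: "\<one> \<in> N" using int c0 one_U0 by (simp add: N_def)
  have "\<exists>x\<in>V1. \<exists>\<eta>\<in>HH. g = \<sigma> x \<otimes> \<eta>" if g: "g \<in> N" for g
  proof -
    have "\<phi>0 g \<in> ?\<Psi> ` ?S" using g interior_subset unfolding N_def by blast
    then obtain y where y: "y \<in> ?S" "\<phi>0 g = ?\<Psi> y" by blast
    then have "g = ?c y" using g inj_\<phi>0 unfolding N_def inj_on_def by auto
    then have "g = \<sigma> (Q (\<pi> y)) \<otimes> ?E y" using s\<sigma>(1)[of "\<pi> y"] y(1) by simp
    moreover have "Q (\<pi> y) \<in> V1" using s\<sigma>(2)[of "\<pi> y"] y(1) by simp
    ultimately show ?thesis using EH by blast
  qed
  then show ?thesis using p\<sigma> P(1) P\<sigma> oN oneN by blast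
qed

end

section \<open>The manifold of cosets\<close>

context lie_grp
begin

lemma smo_on_plot_open:
  assumes S: "openin (manifold_topology A) S"
    and q: "\<And>U \<phi>. (U, \<phi>) \<in> A \<Longrightarrow> smo scalars (\<lambda>x. q (inv_into U \<phi> x)) (\<phi> ` (U \<inter> S))"
    and a: "plot C W A a"
  shows "smo C (\<lambda>w. q (a w)) (W \<inter> a -` S)"
proof (rule smo_local)
  fix w assume w: "w \<in> W \<inter> a -` S"
  then have wW: "w \<in> W" by simp
  obtain U \<phi> where U: "(U, \<phi>) \<in> A" "a w \<in> U" "open (W \<inter> a -` U)" "w \<in> W \<inter> a -` U"
    "smo C (\<lambda>x. \<phi> (a x)) (W \<inter> a -` U)" by (rule plot_chart_around[OF a wW])
  let ?O = "(W \<inter> a -` U) \<inter> (W \<inter> a -` S)"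
  have o: "open ?O" using U(3) plot_openin[OF charted_A a S] by blast
  have oU: "open (\<phi> ` (U \<inter> S))" using S U(1) unfolding openin_charted[OF charted_A] by fast
  have "smo C (\<lambda>x. q (inv_into U \<phi> (\<phi> (a x)))) ?O"
    by (rule smo_comp[OF o oU _ smo_subset[OF U(5)] q[OF U(1)]]) auto
  then have "smo C (\<lambda>x. q (a x)) ?O"
    by (rule smo_cong[OF o, rotated]) (use chartedD(1)[OF charted_A U(1)] in auto)
  then show "\<exists>T. open T \<and> w \<in> T \<and> smo C (\<lambda>w. q (a w)) T" using o w U(4) by (intro exI[of _ ?O]) auto
qed

lemma openin_preimage:
  assumes F: "\<And>U \<phi>. (U, \<phi>) \<in> A \<Longrightarrow> plot scalars (\<phi> ` U) A (\<lambda>x. F (inv_into U \<phi> x))"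
    and T: "openin (manifold_topology A) T"
  shows "openin (manifold_topology A) {g \<in> carrier G. F g \<in> T}"
  using smooth_map_openin[OF charted_A charted_A smooth_mapI[OF charted_A charted_A F] T] by (simp add: points_A)

lemma openin_translate:
  assumes g: "g \<in> carrier G" "h \<in> carrier G" and T: "openin (manifold_topology A) T"
  shows "openin (manifold_topology A) {x \<in> carrier G. g \<otimes> x \<otimes> h \<in> T}"
  by (rule openin_preimage[OF plot_rmult[OF g(2) plot_lmult[OF g(1) plot_inv_chart[OF manifold_A]]] T])

lemma openin_carrier_subset: "openin (manifold_topology A) T \<Longrightarrow> T \<subseteq> carrier G"
  using openin_subset[of "manifold_topology A" T] by (simp add: topspace_charted[OF charted_A] points_A)

end

context lie_grp_f
begin

abbreviation \<pi> :: "'g \<Rightarrow> 'g set" where "\<pi> g \<equiv> g <# HH"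

lemma coset_eq:
  assumes g: "g \<in> carrier G" "g' \<in> carrier G"
  shows "\<pi> g = \<pi> g' \<longleftrightarrow> inv g \<otimes> g' \<in> HH"
proof
  assume eq: "\<pi> g = \<pi> g'"
  have "g' \<otimes> \<one> \<in> \<pi> g'" unfolding l_coset_def using HH_one by blast
  then have "g' \<otimes> \<one> \<in> \<pi> g" using eq by simp
  then obtain \<eta> where e: "\<eta> \<in> HH" "g' = g \<otimes> \<eta>" unfolding l_coset_def using g by auto
  have "\<eta> \<in> carrier G" using e HH_carrier by blast
  then have "inv g \<otimes> g' = \<eta>" using e g by (simp add: m_assoc[symmetric])
  then show "inv g \<otimes> g' \<in> HH" using e by simp
next
  assume h: "inv g \<otimes> g' \<in> HH"
  have one: "\<pi> (g1 \<otimes> \<eta>) \<subseteq> \<pi> g1" if "g1 \<in> carrier G" "\<eta> \<in> HH" for g1 \<eta>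
  proof
    fix x assume "x \<in> \<pi> (g1 \<otimes> \<eta>)"
    then obtain \<eta>' where e: "\<eta>' \<in> HH" "x = g1 \<otimes> \<eta> \<otimes> \<eta>'" unfolding l_coset_def by blast
    then have "x = g1 \<otimes> (\<eta> \<otimes> \<eta>')" using that HH_carrier by (simp add: m_assoc subset_iff)
    then show "x \<in> \<pi> g1" unfolding l_coset_def using HH_mult[OF that(2) e(1)] by blast
  qed
  have g': "g' = g \<otimes> (inv g \<otimes> g')" using g by (simp add: m_assoc[symmetric])
  have gg: "g = g' \<otimes> inv (inv g \<otimes> g')" using g by (simp add: inv_mult_group m_assoc[symmetric])
  have "\<pi> g' \<subseteq> \<pi> g" using one[OF g(1) h] g' by simp
  moreover have "\<pi> g \<subseteq> \<pi> g'" using one[OF g(2) HH_inv[OF h]] gg by simp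
  ultimately show "\<pi> g = \<pi> g'" by blast
qed

lemma coset_mult_HH: "g \<in> carrier G \<Longrightarrow> \<eta> \<in> HH \<Longrightarrow> \<pi> (g \<otimes> \<eta>) = \<pi> g"
  using coset_eq[of g "g \<otimes> \<eta>"] HH_carrier by (auto simp: m_assoc[symmetric] subset_iff)

lemma coset_mem: "g \<in> carrier G \<Longrightarrow> g \<in> \<pi> g"
  unfolding l_coset_def using HH_one by (auto intro!: bexI[of _ \<one>])

lemma coset_elem: "g \<in> carrier G \<Longrightarrow> x \<in> \<pi> g \<Longrightarrow> \<exists>\<eta>\<in>HH. x = g \<otimes> \<eta>"
  unfolding l_coset_def by blast

lemma left_cosets_eq: "left_cosets G HH = \<pi> ` carrier G"
  by (simp add: left_cosets_def)

section \<open>Charts of the coset space and their compatibility\<close>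

lemma quotient_atlas_iff:
  "(U, \<phi>) \<in> (quotient_atlas G A HH :: ('g set, 'k, 'm::finite) atlas) \<longleftrightarrow>
    U \<subseteq> \<pi> ` carrier G \<and> inj_on \<phi> U \<and> open (\<phi> ` U) \<and>
    openin (manifold_topology A) {g \<in> carrier G. \<pi> g \<in> U} \<and>
    (\<forall>(V, \<psi>)\<in>A. smo scalars (\<lambda>x. \<phi> (\<pi> (inv_into V \<psi> x))) (\<psi> ` (V \<inter> {g \<in> carrier G. \<pi> g \<in> U}))) \<and>
    (\<forall>y\<in>\<phi> ` U. \<exists>W \<sigma>. y \<in> W \<and> W \<subseteq> \<phi> ` U \<and> plot scalars W A \<sigma> \<and> (\<forall>x\<in>W. \<pi> (\<sigma> x) = inv_into U \<phi> x))"
proof -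
  let ?S = "{g \<in> carrier G. \<pi> g \<in> U}"
  have 1: "openin (manifold_topology A) ?S \<and> smooth_map (restrict_atlas A ?S) (open_atlas UNIV) (\<lambda>g. \<phi> (\<pi> g)) \<longleftrightarrow>
    openin (manifold_topology A) ?S \<and> (\<forall>(V, \<psi>)\<in>A. smo scalars (\<lambda>x. \<phi> (\<pi> (inv_into V \<psi> x))) (\<psi> ` (V \<inter> ?S)))"
    using smooth_map_restrict[OF manifold_A, of ?S "\<lambda>g. \<phi> (\<pi> g)"] by blast
  have 2: "open W \<and> y \<in> W \<and> W \<subseteq> \<phi> ` U \<and> smooth_map (open_atlas W) A \<sigma> \<and> (\<forall>x\<in>W. \<pi> (\<sigma> x) = inv_into U \<phi> x) \<longleftrightarrow>
    y \<in> W \<and> W \<subseteq> \<phi> ` U \<and> plot scalars W A \<sigma> \<and> (\<forall>x\<in>W. \<pi> (\<sigma> x) = inv_into U \<phi> x)" for y W \<sigma>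
    using smooth_map_open_atlas[OF _ manifold_A, of W \<sigma>] plotD(1)[of scalars W A \<sigma>] by blast
  show ?thesis
    unfolding quotient_atlas_def mem_Collect_eq prod.case Let_def left_cosets_eq 2 using 1 by blast
qed

lemma quotient_atlasD:
  assumes "(U, \<phi>) \<in> (quotient_atlas G A HH :: ('g set, 'k, 'm::finite) atlas)"
  shows "U \<subseteq> \<pi> ` carrier G" "inj_on \<phi> U" "open (\<phi> ` U)" "openin (manifold_topology A) {g \<in> carrier G. \<pi> g \<in> U}"
    "(V, \<psi>) \<in> A \<Longrightarrow> smo scalars (\<lambda>x. \<phi> (\<pi> (inv_into V \<psi> x))) (\<psi> ` (V \<inter> {g \<in> carrier G. \<pi> g \<in> U}))"
    "y \<in> \<phi> ` U \<Longrightarrow> \<exists>W \<sigma>. y \<in> W \<and> W \<subseteq> \<phi> ` U \<and> plot scalars W A \<sigma> \<and> (\<forall>x\<in>W. \<pi> (\<sigma> x) = inv_into U \<phi> x)"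
proof -
  note q = assms[unfolded quotient_atlas_iff]
  show "U \<subseteq> \<pi> ` carrier G" by (rule q[THEN conjunct1])
  show "inj_on \<phi> U" by (rule q[THEN conjunct2, THEN conjunct1])
  show "open (\<phi> ` U)" by (rule q[THEN conjunct2, THEN conjunct2, THEN conjunct1])
  show "openin (manifold_topology A) {g \<in> carrier G. \<pi> g \<in> U}"
    by (rule q[THEN conjunct2, THEN conjunct2, THEN conjunct2, THEN conjunct1])
  note q5 = q[THEN conjunct2, THEN conjunct2, THEN conjunct2, THEN conjunct2]
  show "smo scalars (\<lambda>x. \<phi> (\<pi> (inv_into V \<psi> x))) (\<psi> ` (V \<inter> {g \<in> carrier G. \<pi> g \<in> U}))" if "(V, \<psi>) \<in> A"
    using bspec[OF q5[THEN conjunct1] that] by (simp only: prod.case)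
  show "\<exists>W \<sigma>. y \<in> W \<and> W \<subseteq> \<phi> ` U \<and> plot scalars W A \<sigma> \<and> (\<forall>x\<in>W. \<pi> (\<sigma> x) = inv_into U \<phi> x)" if "y \<in> \<phi> ` U"
    by (rule bspec[OF q5[THEN conjunct2] that])
qed

lemma quotient_atlas_section:
  assumes U: "(U, \<phi>) \<in> (quotient_atlas G A HH :: ('g set, 'k, 'm::finite) atlas)" and y: "y \<in> \<phi> ` U"
  obtains W \<sigma> where "y \<in> W" "W \<subseteq> \<phi> ` U" "plot scalars W A \<sigma>" "\<forall>x\<in>W. \<pi> (\<sigma> x) = inv_into U \<phi> x"
  using quotient_atlasD(6)[OF U y] that by (elim exE conjE)

lemma charted_quotient: "charted (quotient_atlas G A HH :: ('g set, 'k, 'm::finite) atlas)"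
  unfolding charted_def using quotient_atlasD(2,3) by fast

lemma plot_\<pi>_chart:
  assumes U: "(U, \<phi>) \<in> (quotient_atlas G A HH :: ('g set, 'k, 'm::finite) atlas)" and a: "plot C W A a"
  shows "open (W \<inter> (\<lambda>w. \<pi> (a w)) -` U)" "smo C (\<lambda>w. \<phi> (\<pi> (a w))) (W \<inter> (\<lambda>w. \<pi> (a w)) -` U)"
proof -
  have eq: "W \<inter> (\<lambda>w. \<pi> (a w)) -` U = W \<inter> a -` {g \<in> carrier G. \<pi> g \<in> U}"
    using plot_carrier[OF a] by auto
  show "open (W \<inter> (\<lambda>w. \<pi> (a w)) -` U)" unfolding eq by (rule plot_openin[OF charted_A a quotient_atlasD(4)[OF U]])
  show "smo C (\<lambda>w. \<phi> (\<pi> (a w))) (W \<inter> (\<lambda>w. \<pi> (a w)) -` U)"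
    unfolding eq by (rule smo_on_plot_open[OF quotient_atlasD(4)[OF U] quotient_atlasD(5)[OF U] a])
qed

text \<open>A local section identifies the points near y that belong to T with the parameters whose
  section values lie in the open preimage of T. Openness of the projection will be deduced from
  this.\<close>

lemma quotient_chart_open:
  assumes U: "(U, \<phi>) \<in> (quotient_atlas G A HH :: ('g set, 'k, 'm::finite) atlas)"
    and T: "openin (manifold_topology A) {g \<in> carrier G. \<pi> g \<in> T}"
  shows "open (\<phi> ` (U \<inter> T))"
proof (rule open_subopen[THEN iffD2], rule ballI)
  fix y assume y: "y \<in> \<phi> ` (U \<inter> T)"
  then have "y \<in> \<phi> ` U" by blast
  then obtain W \<sigma> where W: "y \<in> W" "W \<subseteq> \<phi> ` U" "plot scalars W A \<sigma>" "\<forall>x\<in>W. \<pi> (\<sigma> x) = inv_into U \<phi> x"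
    by (rule quotient_atlas_section[OF U])
  let ?O = "W \<inter> \<sigma> -` {g \<in> carrier G. \<pi> g \<in> T}"
  have "open ?O" by (rule plot_openin[OF charted_A W(3) T])
  moreover have "y \<in> ?O"
  proof -
    obtain C where C: "C \<in> U" "C \<in> T" "y = \<phi> C" using y by blast
    then have "\<pi> (\<sigma> y) = C" using W(1,4) quotient_atlasD(2)[OF U] by simp
    then show ?thesis using C W(1) plot_carrier[OF W(3,1)] by simp
  qed
  moreover have "?O \<subseteq> \<phi> ` (U \<inter> T)"
  proof
    fix x assume x: "x \<in> ?O"
    then have xU: "x \<in> \<phi> ` U" "\<pi> (\<sigma> x) = inv_into U \<phi> x" "\<pi> (\<sigma> x) \<in> T" using W(2,4) by auto
    then have "inv_into U \<phi> x \<in> U \<inter> T" "\<phi> (inv_into U \<phi> x) = x" by (auto simp: inv_into_into f_inv_into_f)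
    then show "x \<in> \<phi> ` (U \<inter> T)" by force
  qed
  ultimately show "\<exists>O'. open O' \<and> y \<in> O' \<and> O' \<subseteq> \<phi> ` (U \<inter> T)" by blast
qed

lemma quotient_transition:
  assumes U: "(U, \<phi>) \<in> (quotient_atlas G A HH :: ('g set, 'k, 'm::finite) atlas)"
    and V: "(V, \<psi>) \<in> (quotient_atlas G A HH :: ('g set, 'k, 'm) atlas)"
  shows "smo scalars (\<lambda>x. \<psi> (inv_into U \<phi> x)) (\<phi> ` (U \<inter> V))"
proof (rule smo_local)
  fix y assume y: "y \<in> \<phi> ` (U \<inter> V)"
  then have "y \<in> \<phi> ` U" by blast
  then obtain W \<sigma> where W: "y \<in> W" "W \<subseteq> \<phi> ` U" "plot scalars W A \<sigma>" "\<forall>x\<in>W. \<pi> (\<sigma> x) = inv_into U \<phi> x"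
    by (rule quotient_atlas_section[OF U])
  let ?O = "W \<inter> (\<lambda>w. \<pi> (\<sigma> w)) -` V"
  have o: "open ?O" by (rule plot_\<pi>_chart(1)[OF V W(3)])
  have "smo scalars (\<lambda>x. \<psi> (inv_into U \<phi> x)) ?O"
    by (rule smo_cong[OF o _ plot_\<pi>_chart(2)[OF V W(3)]]) (simp add: W(4))
  moreover have "y \<in> ?O"
  proof -
    obtain C where C: "C \<in> U" "C \<in> V" "y = \<phi> C" using y by blast
    then have "\<pi> (\<sigma> y) = C" using W(1,4) quotient_atlasD(2)[OF U] by simp
    then show ?thesis using C W(1) by simp
  qed
  ultimately show "\<exists>T. open T \<and> y \<in> T \<and> smo scalars (\<lambda>x. \<psi> (inv_into U \<phi> x)) T" using o by blast
qed

text \<open>The chart at the coset of a is the one at the identity, translated: the coset of g gets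
  the coordinate P (coad (a^-1 g)), well defined because \<open>HH\<close> fixes f. \<open>N\<close>
  is enlarged to the right \<open>HH\<close>-stable set \<open>ND\<close>, so that membership in the
  domain depends on the coset alone.\<close>

lemma quotient_chart_at:
  fixes W :: "('k ^ 'm::finite) set" and P :: "'k ^ 'n \<Rightarrow> 'k ^ 'm"
  assumes \<sigma>: "plot scalars W A \<sigma>" and P: "klin P" and P\<sigma>: "\<And>x. x \<in> W \<Longrightarrow> P (coad (\<sigma> x)) = x"
    and N: "openin (manifold_topology A) N" "\<one> \<in> N" "\<And>g. g \<in> N \<Longrightarrow> \<exists>x\<in>W. \<exists>\<eta>\<in>HH. g = \<sigma> x \<otimes> \<eta>"
    and a: "a \<in> carrier G"
  shows "\<exists>(U, \<phi>) \<in> (quotient_atlas G A HH :: ('g set, 'k, 'm) atlas). \<pi> a \<in> U"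
proof -
  have NG: "N \<subseteq> carrier G" by (rule openin_carrier_subset[OF N(1)])
  have \<sigma>c: "\<sigma> x \<in> carrier G" if "x \<in> W" for x by (rule plot_carrier[OF \<sigma> that])
  have HG: "\<eta> \<in> carrier G" if "\<eta> \<in> HH" for \<eta> using that HH_carrier by blast
  define ND where "ND = (\<Union>\<eta>\<in>HH. {g \<in> carrier G. g \<otimes> \<eta> \<in> N})"
  have ND_G: "g \<in> carrier G" if "g \<in> ND" for g using that by (auto simp: ND_def)
  have ND_HH: "g \<otimes> \<eta> \<in> ND" if g: "g \<in> ND" and that: "\<eta> \<in> HH" for g \<eta>
  proof -
    obtain \<eta>' where e: "\<eta>' \<in> HH" "g \<in> carrier G" "g \<otimes> \<eta>' \<in> N" using g unfolding ND_def by blast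
    have "(g \<otimes> \<eta>) \<otimes> (inv \<eta> \<otimes> \<eta>') = g \<otimes> \<eta>'" using e that HG by (simp add: m_assoc[symmetric]) (simp add: m_assoc)
    then show ?thesis unfolding ND_def using e that HG HH_mult[OF HH_inv[OF that] e(1)]
      by (intro UN_I[of "inv \<eta> \<otimes> \<eta>'"]) auto
  qed
  have ND_\<sigma>: "\<exists>x\<in>W. \<exists>\<eta>\<in>HH. g = \<sigma> x \<otimes> \<eta>" if g: "g \<in> ND" for g
  proof -
    obtain \<eta>' where e: "\<eta>' \<in> HH" "g \<in> carrier G" "g \<otimes> \<eta>' \<in> N" using g unfolding ND_def by blast
    obtain x \<eta> where x: "x \<in> W" "\<eta> \<in> HH" "g \<otimes> \<eta>' = \<sigma> x \<otimes> \<eta>" using N(3)[OF e(3)] by blast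
    have "g = (g \<otimes> \<eta>') \<otimes> inv \<eta>'" using e HG by (simp add: m_assoc)
    also have "\<dots> = \<sigma> x \<otimes> (\<eta> \<otimes> inv \<eta>')" using e x HG \<sigma>c by (simp add: m_assoc)
    finally show ?thesis using x(1) HH_mult[OF x(2) HH_inv[OF e(1)]] by blast
  qed
  have oND: "openin (manifold_topology A) ND"
    unfolding ND_def
  proof (rule openin_Union, clarify)
    fix \<eta> assume "\<eta> \<in> HH"
    then have "openin (manifold_topology A) {x \<in> carrier G. \<one> \<otimes> x \<otimes> \<eta> \<in> N}" by (intro openin_translate N HG one_closed)
    then show "openin (manifold_topology A) {g \<in> carrier G. g \<otimes> \<eta> \<in> N}" by (simp cong: conj_cong)
  qed
  have oneND: "\<one> \<in> ND" unfolding ND_def using HH_one N(2) by (intro UN_I[of \<one>]) auto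
  define U where "U = {\<pi> g | g. g \<in> carrier G \<and> inv a \<otimes> g \<in> ND}"
  define \<phi> where "\<phi> C = P (coad (inv a \<otimes> (SOME g. g \<in> C)))" for C
  have ia: "inv a \<in> carrier G" using a by simp
  have \<phi>: "\<phi> (\<pi> g) = P (coad (inv a \<otimes> g))" if g: "g \<in> carrier G" for g
  proof -
    have "(SOME x. x \<in> \<pi> g) \<in> \<pi> g" using coset_mem[OF g] by (rule someI)
    then obtain \<eta> where e: "\<eta> \<in> HH" "(SOME x. x \<in> \<pi> g) = g \<otimes> \<eta>" using coset_elem[OF g] by blast
    have "inv a \<otimes> (g \<otimes> \<eta>) = inv a \<otimes> g \<otimes> \<eta>" using g a e HG by (simp add: m_assoc)
    then show ?thesis unfolding \<phi>_def e(2) using coad_stab[of "inv a \<otimes> g" \<eta>] e(1) g a HH_stab by auto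
  qed
  have inU: "\<pi> g \<in> U \<longleftrightarrow> inv a \<otimes> g \<in> ND" if g: "g \<in> carrier G" for g
  proof
    assume "\<pi> g \<in> U"
    then obtain g' where g': "\<pi> g = \<pi> g'" "g' \<in> carrier G" "inv a \<otimes> g' \<in> ND" unfolding U_def by blast
    then have h: "inv g' \<otimes> g \<in> HH" using coset_eq[OF g'(2) g] by simp
    have "(inv a \<otimes> g') \<otimes> (inv g' \<otimes> g) = inv a \<otimes> g"
    proof -
      have "g' \<otimes> (inv g' \<otimes> g) = g" using g g' by (simp add: m_assoc[symmetric])
      then show ?thesis using g g' a by (simp add: m_assoc)
    qed
    then show "inv a \<otimes> g \<in> ND" using ND_HH[OF g'(3) h] by simp
  qed (use g in \<open>auto simp: U_def\<close>)
  \<comment> \<open>The factorisation of a^-1 g recovers its own parameter through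
    \<open>P \<circ> coad\<close>. Image, injectivity and section of the chart all rest on
    this.\<close>
  have dec: "\<exists>x\<in>W. \<exists>\<eta>\<in>HH. inv a \<otimes> g = \<sigma> x \<otimes> \<eta> \<and> \<phi> (\<pi> g) = x \<and> \<sigma> x \<in> ND \<and> \<pi> g = \<pi> (a \<otimes> \<sigma> x)"
    if g: "g \<in> carrier G" "inv a \<otimes> g \<in> ND" for g
  proof -
    obtain x \<eta> where x: "x \<in> W" "\<eta> \<in> HH" "inv a \<otimes> g = \<sigma> x \<otimes> \<eta>" using ND_\<sigma>[OF g(2)] by blast
    have "\<phi> (\<pi> g) = P (coad (\<sigma> x \<otimes> \<eta>))" by (simp add: \<phi>[OF g(1)] x(3))
    also have "\<dots> = x" using coad_stab[OF \<sigma>c[OF x(1)], of \<eta>] x(2) HH_stab P\<sigma>[OF x(1)] by auto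
    finally have 1: "\<phi> (\<pi> g) = x" .
    have "\<sigma> x = (inv a \<otimes> g) \<otimes> inv \<eta>" using x HG \<sigma>c by (simp add: m_assoc)
    then have 2: "\<sigma> x \<in> ND" using ND_HH[OF g(2) HH_inv[OF x(2)]] by simp
    have "g = a \<otimes> (inv a \<otimes> g)" using g a by (simp add: m_assoc[symmetric])
    also have "\<dots> = (a \<otimes> \<sigma> x) \<otimes> \<eta>" using x a \<sigma>c HG by (simp add: m_assoc)
    finally have "\<pi> g = \<pi> ((a \<otimes> \<sigma> x) \<otimes> \<eta>)" by simp
    also have "\<dots> = \<pi> (a \<otimes> \<sigma> x)" using x a \<sigma>c by (intro coset_mult_HH) auto
    finally show ?thesis using x 1 2 by blast
  qed
  have rev: "\<pi> (a \<otimes> \<sigma> x) \<in> U" "\<phi> (\<pi> (a \<otimes> \<sigma> x)) = x" if "x \<in> W" "\<sigma> x \<in> ND" for x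
  proof -
    have c: "a \<otimes> \<sigma> x \<in> carrier G" "inv a \<otimes> (a \<otimes> \<sigma> x) = \<sigma> x" using a \<sigma>c[OF that(1)] by (simp_all add: m_assoc[symmetric])
    show "\<pi> (a \<otimes> \<sigma> x) \<in> U" using inU[OF c(1)] c(2) that(2) by simp
    show "\<phi> (\<pi> (a \<otimes> \<sigma> x)) = x" using \<phi>[OF c(1)] c(2) P\<sigma>[OF that(1)] by simp
  qed
  have Ux: "\<exists>x\<in>W. \<sigma> x \<in> ND \<and> C = \<pi> (a \<otimes> \<sigma> x) \<and> \<phi> C = x" if "C \<in> U" for C
  proof -
    obtain g where g: "g \<in> carrier G" "inv a \<otimes> g \<in> ND" "C = \<pi> g" using \<open>C \<in> U\<close> unfolding U_def by blast
    then show ?thesis using dec[OF g(1,2)] by auto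
  qed
  have img: "\<phi> ` U = W \<inter> \<sigma> -` ND"
  proof (intro Set.set_eqI iffI)
    fix x assume "x \<in> \<phi> ` U" then show "x \<in> W \<inter> \<sigma> -` ND" using Ux by auto
  next
    fix x assume "x \<in> W \<inter> \<sigma> -` ND"
    then show "x \<in> \<phi> ` U" using rev[of x] by (intro image_eqI[of _ _ "\<pi> (a \<otimes> \<sigma> x)"]) auto
  qed
  have inj: "inj_on \<phi> U"
  proof (rule inj_onI)
    fix C D assume CD: "C \<in> U" "D \<in> U" "\<phi> C = \<phi> D"
    obtain x where x: "C = \<pi> (a \<otimes> \<sigma> x)" "\<phi> C = x" using Ux[OF CD(1)] by blast
    obtain y where y: "D = \<pi> (a \<otimes> \<sigma> y)" "\<phi> D = y" using Ux[OF CD(2)] by blast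
    show "C = D" using x y CD(3) by simp
  qed
  have oimg: "open (\<phi> ` U)" unfolding img by (rule plot_openin[OF charted_A \<sigma> oND])
  have S: "{g \<in> carrier G. \<pi> g \<in> U} = {g \<in> carrier G. inv a \<otimes> g \<otimes> \<one> \<in> ND}" using inU a by auto
  have oS: "openin (manifold_topology A) {g \<in> carrier G. \<pi> g \<in> U}"
    unfolding S by (rule openin_translate[OF ia one_closed oND])
  have "smo scalars (\<lambda>x. \<phi> (\<pi> (inv_into V \<psi> x))) (\<psi> ` (V \<inter> {g \<in> carrier G. \<pi> g \<in> U}))" if V: "(V, \<psi>) \<in> A" for V \<psi>
  proof -
    have oV: "open (\<psi> ` V)" and VG: "V \<subseteq> carrier G" using chartedD[OF charted_A V] by (auto simp: points_A)
    have p: "plot scalars (\<psi> ` V) A (\<lambda>x. inv a \<otimes> inv_into V \<psi> x)"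
      by (rule plot_lmult[OF ia plot_inv_chart[OF manifold_A V]])
    have sm: "smo scalars (\<lambda>x. P (coad (inv a \<otimes> inv_into V \<psi> x))) (\<psi> ` V)"
      by (rule smo_klin_comp[OF P oV smo_coad[OF p]])
    have eq: "P (coad (inv a \<otimes> inv_into V \<psi> x)) = \<phi> (\<pi> (inv_into V \<psi> x))" if x: "x \<in> \<psi> ` V" for x
    proof -
      have "inv_into V \<psi> x \<in> carrier G" by (rule subsetD[OF VG inv_into_into[OF x]])
      then show ?thesis by (rule \<phi>[symmetric])
    qed
    have "smo scalars (\<lambda>x. \<phi> (\<pi> (inv_into V \<psi> x))) (\<psi> ` V)" by (rule smo_cong[OF oV eq sm])
    then show ?thesis by (rule smo_subset) blast
  qed
  moreover have "\<exists>W' \<sigma>'. y \<in> W' \<and> W' \<subseteq> \<phi> ` U \<and> plot scalars W' A \<sigma>' \<and> (\<forall>x\<in>W'. \<pi> (\<sigma>' x) = inv_into U \<phi> x)" if "y \<in> \<phi> ` U" for y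
  proof (intro exI[of _ "\<phi> ` U"] exI[of _ "\<lambda>x. a \<otimes> \<sigma> x"] conjI ballI)
    show "plot scalars (\<phi> ` U) A (\<lambda>x. a \<otimes> \<sigma> x)"
      by (rule plot_lmult[OF a plot_subset[OF \<sigma> oimg]]) (auto simp: img)
    fix x assume "x \<in> \<phi> ` U"
    then have "x \<in> W" "\<sigma> x \<in> ND" by (auto simp: img)
    then show "\<pi> (a \<otimes> \<sigma> x) = inv_into U \<phi> x" using inv_into_f_f[OF inj rev(1)] rev(2) by metis
  qed (use that in auto)
  ultimately have "(U, \<phi>) \<in> (quotient_atlas G A HH :: ('g set, 'k, 'm) atlas)"
    unfolding quotient_atlas_iff using inj oimg oS by (auto simp: U_def)
  moreover have "\<pi> a \<in> U" using inU[OF a] a oneND by simp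
  ultimately show ?thesis by blast
qed

lemma ex_quotient_chart:
  assumes card: "CARD('m::finite) = CARD('n) - vec.dim hh" and a: "a \<in> carrier G"
  shows "\<exists>(U, \<phi>) \<in> (quotient_atlas G A HH :: ('g set, 'k, 'm) atlas). \<pi> a \<in> U"
proof -
  obtain W :: "('k ^ 'm) set" and \<sigma> P N where 1: "plot scalars W A \<sigma>" "klin P" "\<forall>x\<in>W. P (coad (\<sigma> x)) = x"
    "openin (manifold_topology A) N" "\<one> \<in> N" "\<forall>g\<in>N. \<exists>x\<in>W. \<exists>\<eta>\<in>HH. g = \<sigma> x \<otimes> \<eta>"
    using ex_local_section[OF card] by (elim exE conjE)
  show ?thesis by (rule quotient_chart_at[OF 1(1,2) _ 1(4,5) _ a]) (use 1(3,6) in blast)+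
qed

section \<open>The projection to the coset space and the quotient topology\<close>

lemma points_quotient:
  assumes card: "CARD('m::finite) = CARD('n) - vec.dim hh"
  shows "points (quotient_atlas G A HH :: ('g set, 'k, 'm) atlas) = \<pi> ` carrier G"
proof
  show "points (quotient_atlas G A HH :: ('g set, 'k, 'm) atlas) \<subseteq> \<pi> ` carrier G"
    unfolding points_def using quotient_atlasD(1) by blast
  show "\<pi> ` carrier G \<subseteq> points (quotient_atlas G A HH :: ('g set, 'k, 'm) atlas)"
    unfolding points_def using ex_quotient_chart[OF card] by fast
qed

lemma plot_\<pi>:
  assumes card: "CARD('m::finite) = CARD('n) - vec.dim hh" and a: "plot C W A a"
  shows "plot C W (quotient_atlas G A HH :: ('g set, 'k, 'm) atlas) (\<lambda>w. \<pi> (a w))"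
proof (rule plotI[OF plotD(1)[OF a]])
  show "\<pi> (a x) \<in> points (quotient_atlas G A HH :: ('g set, 'k, 'm) atlas)" if "x \<in> W" for x
    unfolding points_quotient[OF card] using plot_carrier[OF a that] by blast
qed (rule plot_\<pi>_chart[OF _ a], assumption)+

lemma smooth_map_\<pi>:
  assumes card: "CARD('m::finite) = CARD('n) - vec.dim hh"
  shows "smooth_map A (quotient_atlas G A HH :: ('g set, 'k, 'm) atlas) \<pi>"
  by (rule smooth_mapI[OF charted_A charted_quotient plot_\<pi>[OF card plot_inv_chart[OF manifold_A]]])

text \<open>The saturation of X is the union of its right translates by elements of
  \<open>HH\<close>, each of which is open.\<close>

lemma openin_quotient_image:
  assumes card: "CARD('m::finite) = CARD('n) - vec.dim hh" and X: "openin (manifold_topology A) X"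
  shows "openin (manifold_topology (quotient_atlas G A HH :: ('g set, 'k, 'm) atlas)) (\<pi> ` X)"
proof -
  have XG: "X \<subseteq> carrier G" by (rule openin_carrier_subset[OF X])
  have HG: "\<eta> \<in> carrier G" if "\<eta> \<in> HH" for \<eta> using that HH_carrier by blast
  have "{g \<in> carrier G. \<pi> g \<in> \<pi> ` X} = (\<Union>\<eta>\<in>HH. {g \<in> carrier G. \<one> \<otimes> g \<otimes> \<eta> \<in> X})"
  proof (intro Set.set_eqI iffI)
    fix g assume "g \<in> {g \<in> carrier G. \<pi> g \<in> \<pi> ` X}"
    then obtain x where x: "g \<in> carrier G" "x \<in> X" "\<pi> g = \<pi> x" by blast
    then have xc: "x \<in> carrier G" using XG by blast
    then have "inv g \<otimes> x \<in> HH" using coset_eq[OF x(1) xc] x(3) by simp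
    moreover have "\<one> \<otimes> g \<otimes> (inv g \<otimes> x) = x" using x(1) xc by (simp add: m_assoc[symmetric])
    ultimately show "g \<in> (\<Union>\<eta>\<in>HH. {g \<in> carrier G. \<one> \<otimes> g \<otimes> \<eta> \<in> X})" using x by force
  next
    fix g assume "g \<in> (\<Union>\<eta>\<in>HH. {g \<in> carrier G. \<one> \<otimes> g \<otimes> \<eta> \<in> X})"
    then obtain \<eta> where e: "\<eta> \<in> HH" "g \<in> carrier G" "g \<otimes> \<eta> \<in> X" by auto
    then show "g \<in> {g \<in> carrier G. \<pi> g \<in> \<pi> ` X}" using coset_mult_HH[OF e(2,1)] by (metis (mono_tags) image_eqI mem_Collect_eq)
  qed
  moreover have "openin (manifold_topology A) (\<Union>\<eta>\<in>HH. {g \<in> carrier G. \<one> \<otimes> g \<otimes> \<eta> \<in> X})"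
  proof (rule openin_Union, clarify)
    fix \<eta> assume "\<eta> \<in> HH"
    then show "openin (manifold_topology A) {g \<in> carrier G. \<one> \<otimes> g \<otimes> \<eta> \<in> X}"
      by (intro openin_translate X HG one_closed)
  qed
  ultimately have o: "openin (manifold_topology A) {g \<in> carrier G. \<pi> g \<in> \<pi> ` X}" by simp
  show ?thesis
    unfolding openin_charted[OF charted_quotient] points_quotient[OF card]
    using quotient_chart_open[OF _ o] XG by blast
qed

lemma openin_smo_preimage:
  assumes q: "\<And>U \<phi>. (U, \<phi>) \<in> A \<Longrightarrow> smo scalars (\<lambda>x. q (inv_into U \<phi> x)) (\<phi> ` U)" and X: "open X"
  shows "openin (manifold_topology A) {g \<in> carrier G. q g \<in> X}"
  unfolding openin_charted[OF charted_A]
proof (intro conjI ballI, goal_cases)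
  case 1 then show ?case by (auto simp: points_A)
next
  case (2 c)
  obtain U \<phi> where c: "c = (U, \<phi>)" by fastforce
  have U: "(U, \<phi>) \<in> A" using 2 c by simp
  note ch = chartedD[OF charted_A U]
  have "\<phi> ` (U \<inter> {g \<in> carrier G. q g \<in> X}) = \<phi> ` U \<inter> (\<lambda>x. q (inv_into U \<phi> x)) -` X"
    using ch(1,3) by (auto simp: points_A)
  moreover have "open (\<phi> ` U \<inter> (\<lambda>x. q (inv_into U \<phi> x)) -` X)"
    by (rule continuous_open_preimage[OF smo_continuous[OF q[OF U]] ch(2) X])
  ultimately show ?case by (simp add: c)
qed

text \<open>Near the identity \<open>HH\<close> is a level set of \<open>P \<circ> coad\<close>, hence closed.\<close>

lemma openin_compl_HH:
  assumes card: "CARD('m::finite) = CARD('n) - vec.dim hh"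
  shows "openin (manifold_topology A) (carrier G - HH)"
proof -
  obtain W :: "('k ^ 'm) set" and \<sigma> P N where 1: "plot scalars W A \<sigma>" "klin P" "\<forall>x\<in>W. P (coad (\<sigma> x)) = x"
    "openin (manifold_topology A) N" "\<one> \<in> N" "\<forall>g\<in>N. \<exists>x\<in>W. \<exists>\<eta>\<in>HH. g = \<sigma> x \<otimes> \<eta>"
    using ex_local_section[OF card] by (elim exE conjE)
  have \<sigma>c: "\<sigma> x \<in> carrier G" if "x \<in> W" for x by (rule plot_carrier[OF 1(1) that])
  have HG: "\<eta> \<in> carrier G" if "\<eta> \<in> HH" for \<eta> using that HH_carrier by blast
  have coadH: "coad (g \<otimes> \<eta>) = coad g" if "g \<in> carrier G" "\<eta> \<in> HH" for g \<eta>
    using coad_stab[OF that(1), of \<eta>] that(2) HH_stab by blast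
  define x1 where "x1 = P (coad \<one>)"
  obtain y \<eta>1 where y: "y \<in> W" "\<eta>1 \<in> HH" "\<one> = \<sigma> y \<otimes> \<eta>1" using 1(5,6) by blast
  have "P (coad \<one>) = y" unfolding y(3) using coadH[OF \<sigma>c[OF y(1)] y(2)] 1(3) y(1) by simp
  then have y1: "y = x1" by (simp add: x1_def)
  have "\<sigma> y = \<one> \<otimes> inv \<eta>1" unfolding y(3) using \<sigma>c[OF y(1)] HG[OF y(2)] by (simp add: m_assoc)
  then have sH: "\<sigma> x1 \<in> HH" using HH_inv[OF y(2)] HG[OF y(2)] y1 by simp
  \<comment> \<open>For g in \<open>N\<close> the parameter of its factorisation is P (coad g), and
    the section value at the parameter \<open>x1\<close> of the identity lies in \<open>HH\<close>;
    so g lies in \<open>HH\<close> exactly when its parameter is \<open>x1\<close>.\<close>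
  have lev: "g \<in> HH \<longleftrightarrow> P (coad g) = x1" if g: "g \<in> N" for g
  proof
    assume "g \<in> HH"
    then have "coad (\<one> \<otimes> g) = coad \<one>" by (intro coadH) auto
    then show "P (coad g) = x1" using HG[OF \<open>g \<in> HH\<close>] by (simp add: x1_def)
  next
    assume P: "P (coad g) = x1"
    obtain x \<eta> where x: "x \<in> W" "\<eta> \<in> HH" "g = \<sigma> x \<otimes> \<eta>" using 1(6) g by blast
    have "P (coad g) = x" unfolding x(3) using coadH[OF \<sigma>c[OF x(1)] x(2)] 1(3) x(1) by simp
    then show "g \<in> HH" using P sH x HH_mult by simp
  qed
  show ?thesis
  proof (rule openin_subopen[THEN iffD2], rule ballI)
    fix g assume g: "g \<in> carrier G - HH"
    show "\<exists>T. openin (manifold_topology A) T \<and> g \<in> T \<and> T \<subseteq> carrier G - HH"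
    \<comment> \<open>If g is close to some h in \<open>HH\<close>, the level set near h separates
      it from \<open>HH\<close>; otherwise every y with y^-1 g in \<open>N\<close> lies outside
      \<open>HH\<close>.\<close>
    proof (cases "\<exists>h\<in>HH. inv h \<otimes> g \<in> N")
      case True
      then obtain h where h: "h \<in> HH" "inv h \<otimes> g \<in> N" by blast
      have hc: "inv h \<in> carrier G" using HG[OF h(1)] by simp
      let ?T = "{y \<in> carrier G. inv h \<otimes> y \<otimes> \<one> \<in> N} \<inter> {y \<in> carrier G. P (coad (inv h \<otimes> y)) \<in> - {x1}}"
      have "smo scalars (\<lambda>x. P (coad (inv h \<otimes> inv_into U \<phi> x))) (\<phi> ` U)" if U: "(U, \<phi>) \<in> A" for U \<phi>
        by (rule smo_klin_comp[OF 1(2) chartedD(2)[OF charted_A U] smo_coad[OF plot_lmult[OF hc plot_inv_chart[OF manifold_A U]]]])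
      then have "openin (manifold_topology A) {y \<in> carrier G. P (coad (inv h \<otimes> y)) \<in> - {x1}}"
        by (rule openin_smo_preimage) auto
      then have "openin (manifold_topology A) ?T"
        using openin_translate[OF hc one_closed 1(4)] by (rule openin_Int[rotated])
      moreover have "g \<in> ?T"
      proof -
        have "inv h \<otimes> g \<notin> HH"
        proof
          assume "inv h \<otimes> g \<in> HH"
          then have "h \<otimes> (inv h \<otimes> g) \<in> HH" using h(1) HH_mult by blast
          then show False using g HG[OF h(1)] by (simp add: m_assoc[symmetric])
        qed
        then show ?thesis using lev[OF h(2)] h(2) g hc by simp
      qed
      moreover have "?T \<subseteq> carrier G - HH"
      proof
        fix y assume y: "y \<in> ?T"
        then have "inv h \<otimes> y \<in> N" "P (coad (inv h \<otimes> y)) \<noteq> x1" using hc by auto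
        then have "inv h \<otimes> y \<notin> HH" using lev by blast
        then show "y \<in> carrier G - HH" using y HH_mult[OF HH_inv[OF h(1)]] by auto
      qed
      ultimately show ?thesis by blast
    next
      case False
      let ?T = "{y \<in> carrier G. inv y \<otimes> g \<in> N}"
      have gc: "g \<in> carrier G" using g by simp
      have "openin (manifold_topology A) ?T"
        by (rule openin_preimage[OF plot_rmult[OF gc plot_inverse[OF plot_inv_chart[OF manifold_A]]] 1(4)])
      moreover have "g \<in> ?T" using gc 1(5) by simp
      moreover have "?T \<subseteq> carrier G - HH" using False by blast
      ultimately show ?thesis by blast
    qed
  qed
qed

text \<open>The complement of \<open>HH\<close> is open, so p^-1 q avoids \<open>HH\<close> for all
  (p, q) in a box around (a, b). The open projection sends the two sides of the box to disjoint
  neighbourhoods.\<close>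

lemma Hausdorff_quotient:
  assumes card: "CARD('m::finite) = CARD('n) - vec.dim hh"
  shows "Hausdorff_space (manifold_topology (quotient_atlas G A HH :: ('g set, 'k, 'm) atlas))"
  unfolding Hausdorff_space_def topspace_charted[OF charted_quotient] points_quotient[OF card]
proof (intro allI impI, elim conjE imageE)
  fix x y a b assume ab: "a \<in> carrier G" "b \<in> carrier G" "x = \<pi> a" "y = \<pi> b" and ne: "x \<noteq> y"
  have nH: "inv a \<otimes> b \<in> carrier G - HH" using coset_eq[OF ab(1,2)] ne ab by simp
  obtain U \<phi> where U: "(U, \<phi>) \<in> A" "a \<in> U" using pointsE[of a A] ab(1) points_A by blast
  obtain V \<psi> where V: "(V, \<psi>) \<in> A" "b \<in> V" using pointsE[of b A] ab(2) points_A by blast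
  have oU: "open (\<phi> ` U)" and oV: "open (\<psi> ` V)" and injU: "inj_on \<phi> U" and injV: "inj_on \<psi> V"
    using chartedD[OF charted_A U(1)] chartedD[OF charted_A V(1)] by auto
  let ?B = "{z :: 'k ^ ('n + 'n). vfst z \<in> \<phi> ` U \<and> vsnd z \<in> \<psi> ` V}"
  have oB: "open ?B" by (rule open_vbox[OF oU oV])
  let ?F = "\<lambda>z :: 'k ^ ('n + 'n). inv (inv_into U \<phi> (vfst z)) \<otimes> inv_into V \<psi> (vsnd z)"
  have p1: "plot scalars ?B A (\<lambda>z. inv_into U \<phi> (vfst z))"
    by (rule plot_chart[OF manifold_A U(1) oB smo_klin[OF klin_vfst]]) simp
  have p2: "plot scalars ?B A (\<lambda>z. inv_into V \<psi> (vsnd z))"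
    by (rule plot_chart[OF manifold_A V(1) oB smo_klin[OF klin_vsnd]]) simp
  have pF: "plot scalars ?B A ?F" by (rule plot_mult[OF plot_inverse[OF p1] p2])
  let ?T = "?B \<inter> ?F -` (carrier G - HH)"
  have oT: "open ?T" by (rule plot_openin[OF charted_A pF openin_compl_HH[OF card]])
  have zT: "vpair (\<phi> a) (\<psi> b) \<in> ?T" using U V nH injU injV by simp
  obtain X Y where XY': "open X" "open Y" "vfst (vpair (\<phi> a) (\<psi> b)) \<in> X" "vsnd (vpair (\<phi> a) (\<psi> b)) \<in> Y"
    "\<And>x y. x \<in> X \<Longrightarrow> y \<in> Y \<Longrightarrow> vpair x y \<in> ?T"
    by (rule open_vbox_inside[OF oT zT], rule that)
  note XY = XY'(1,2) XY'(3,4)[unfolded vpair_simps] XY'(5)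
  let ?Oa = "{p \<in> U. \<phi> p \<in> X}" and ?Ob = "{p \<in> V. \<psi> p \<in> Y}"
  have oa: "openin (manifold_topology A) ?Oa" by (rule openin_chart_preimage[OF manifold_A U(1) XY(1)])
  have ob: "openin (manifold_topology A) ?Ob" by (rule openin_chart_preimage[OF manifold_A V(1) XY(2)])
  have "disjnt (\<pi> ` ?Oa) (\<pi> ` ?Ob)"
    unfolding disjnt_iff
  proof (intro allI notI, elim conjE imageE)
    fix c p q assume p: "p \<in> ?Oa" and q: "q \<in> ?Ob" and c: "c = \<pi> p" "c = \<pi> q"
    have pq: "p \<in> carrier G" "q \<in> carrier G" using p q openin_carrier_subset[OF oa] openin_carrier_subset[OF ob] by blast+
    have "vpair (\<phi> p) (\<psi> q) \<in> ?T" using XY(5) p q by blast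
    then have "inv p \<otimes> q \<notin> HH" using p q injU injV by simp
    then show False using coset_eq[OF pq] c by simp
  qed
  moreover have "x \<in> \<pi> ` ?Oa" "y \<in> \<pi> ` ?Ob" using ab U V XY by auto
  ultimately show "\<exists>U V. openin (manifold_topology (quotient_atlas G A HH :: ('g set, 'k, 'm) atlas)) U \<and>
      openin (manifold_topology (quotient_atlas G A HH :: ('g set, 'k, 'm) atlas)) V \<and> x \<in> U \<and> y \<in> V \<and> disjnt U V"
    using openin_quotient_image[OF card oa] openin_quotient_image[OF card ob] by blast
qed

lemma manifold_quotient:
  assumes card: "CARD('m::finite) = CARD('n) - vec.dim hh"
  shows "manifold (quotient_atlas G A HH :: ('g set, 'k, 'm) atlas)"
proof -
  let ?M = "quotient_atlas G A HH :: ('g set, 'k, 'm) atlas"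
  have cont: "continuous_map (manifold_topology A) (manifold_topology ?M) \<pi>"
    using smooth_map_\<pi>[OF card] by (simp add: smooth_map_def)
  have "second_countable (manifold_topology ?M)"
  proof (rule second_countable_open_map_image[OF cont])
    show "open_map (manifold_topology A) (manifold_topology ?M) \<pi>"
      unfolding open_map_def using openin_quotient_image[OF card] by blast
    show "\<pi> ` topspace (manifold_topology A) = topspace (manifold_topology ?M)"
      by (simp add: topspace_charted[OF charted_A] topspace_charted[OF charted_quotient] points_quotient[OF card] points_A)
    show "second_countable (manifold_topology A)" using manifold_A by (simp add: manifold_def)
  qed
  moreover have "open (\<phi> ` (U \<inter> V)) \<and> smooth_on (\<phi> ` (U \<inter> V)) (\<lambda>x. \<psi> (inv_into U \<phi> x))"
    if "(U, \<phi>) \<in> ?M" "(V, \<psi>) \<in> ?M" for U \<phi> V \<psi>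
    using quotient_chart_open[OF that(1) quotient_atlasD(4)[OF that(2)]] quotient_transition[OF that]
    by (simp add: smooth_on_smo)
  ultimately show ?thesis
    unfolding manifold_def using Hausdorff_quotient[OF card] quotient_atlasD(2,3)[where ?'m = 'm] by fast
qed

subsection \<open>Models of the coset space\<close>

text \<open>Both \<open>G/H\<close> and \<open>\<Gamma>\<close> arise from a submersion on \<open>G\<close> whose fibres are the cosets.\<close>

definition coset_model :: "('p, 'k, 'm::finite) atlas \<Rightarrow> ('g \<Rightarrow> 'p) \<Rightarrow> bool" where
  "coset_model M q \<longleftrightarrow> manifold M \<and> smooth_map A M q \<and> q ` carrier G = points M \<and>
    (\<forall>g\<in>carrier G. \<forall>g'\<in>carrier G. q g = q g' \<longleftrightarrow> inv g \<otimes> g' \<in> HH) \<and>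
    (\<forall>V \<psi> y. (V, \<psi>) \<in> M \<longrightarrow> y \<in> \<psi> ` V \<longrightarrow>
      (\<exists>W \<sigma>. y \<in> W \<and> W \<subseteq> \<psi> ` V \<and> plot scalars W A \<sigma> \<and> (\<forall>x\<in>W. q (\<sigma> x) = inv_into V \<psi> x)))"

lemma coset_modelD:
  assumes "coset_model M q"
  shows "manifold M" "smooth_map A M q" "q ` carrier G = points M"
    "g \<in> carrier G \<Longrightarrow> g' \<in> carrier G \<Longrightarrow> q g = q g' \<longleftrightarrow> inv g \<otimes> g' \<in> HH"
  using assms by (simp_all add: coset_model_def)

lemma coset_model_section:
  assumes "coset_model M q" "(V, \<psi>) \<in> M" "y \<in> \<psi> ` V"
  obtains W \<sigma> where "y \<in> W" "W \<subseteq> \<psi> ` V" "plot scalars W A \<sigma>" "\<forall>x\<in>W. q (\<sigma> x) = inv_into V \<psi> x"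
proof -
  have "\<exists>W \<sigma>. y \<in> W \<and> W \<subseteq> \<psi> ` V \<and> plot scalars W A \<sigma> \<and> (\<forall>x\<in>W. q (\<sigma> x) = inv_into V \<psi> x)"
    using assms by (simp add: coset_model_def)
  then show ?thesis using that by (elim exE conjE)
qed

lemma coset_model_quotient:
  assumes card: "CARD('m::finite) = CARD('n) - vec.dim hh"
  shows "coset_model (quotient_atlas G A HH :: ('g set, 'k, 'm) atlas) \<pi>"
  unfolding coset_model_def
proof (intro conjI allI impI)
  show "manifold (quotient_atlas G A HH :: ('g set, 'k, 'm) atlas)" by (rule manifold_quotient[OF card])
  show "smooth_map A (quotient_atlas G A HH :: ('g set, 'k, 'm) atlas) \<pi>" by (rule smooth_map_\<pi>[OF card])
  show "\<pi> ` carrier G = points (quotient_atlas G A HH :: ('g set, 'k, 'm) atlas)" by (rule points_quotient[OF card, symmetric])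
  show "\<forall>g\<in>carrier G. \<forall>g'\<in>carrier G. \<pi> g = \<pi> g' \<longleftrightarrow> inv g \<otimes> g' \<in> HH" using coset_eq by blast
qed (rule quotient_atlasD(6))

text \<open>Along a local section \<sigma> of q, the map F is q' after \<sigma>, so smoothness
  descends from the group.\<close>

lemma coset_model_smooth_map:
  assumes M: "coset_model M q" and N: "manifold N" and f: "smooth_map A N q'"
    and F: "\<And>g. g \<in> carrier G \<Longrightarrow> F (q g) = q' g"
  shows "smooth_map M N F"
proof (rule smooth_mapI[OF charted_manifold[OF coset_modelD(1)[OF M]] charted_manifold[OF N]])
  fix V \<psi> assume V: "(V, \<psi>) \<in> M"
  show "plot scalars (\<psi> ` V) N (\<lambda>x. F (inv_into V \<psi> x))"
  proof (rule plot_local[OF chartedD(2)[OF charted_manifold[OF coset_modelD(1)[OF M]] V]])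
    fix y assume "y \<in> \<psi> ` V"
    then obtain W \<sigma> where W: "y \<in> W" "W \<subseteq> \<psi> ` V" "plot scalars W A \<sigma>" "\<forall>x\<in>W. q (\<sigma> x) = inv_into V \<psi> x"
      by (rule coset_model_section[OF M V])
    have "plot scalars W N (\<lambda>x. F (inv_into V \<psi> x))"
    proof (rule plot_cong[OF _ plot_smooth_map[OF charted_A N f W(3)]])
      fix x assume x: "x \<in> W"
      then show "q' (\<sigma> x) = F (inv_into V \<psi> x)" using F[OF plot_carrier[OF W(3) x]] W(4) by simp
    qed
    then show "\<exists>W'. y \<in> W' \<and> plot scalars W' N (\<lambda>x. F (inv_into V \<psi> x))" using W(1) by blast
  qed
qed

lemma coset_model_diffeomorphism:
  assumes M: "coset_model M q" and N: "coset_model N q'"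
  shows "\<exists>F. diffeomorphism M N F \<and> (\<forall>g\<in>carrier G. F (q g) = q' g)"
proof -
  define F where "F p = q' (SOME g. g \<in> carrier G \<and> q g = p)" for p
  have F: "F (q g) = q' g" if g: "g \<in> carrier G" for g
  proof -
    let ?g = "SOME g'. g' \<in> carrier G \<and> q g' = q g"
    have s: "?g \<in> carrier G \<and> q ?g = q g" by (rule someI[of _ g]) (simp add: g)
    then have "inv ?g \<otimes> g \<in> HH" using coset_modelD(4)[OF M, of ?g g] g by simp
    then show ?thesis unfolding F_def using coset_modelD(4)[OF N, of ?g g] s g by simp
  qed
  have inj: "inj_on F (points M)"
  proof (rule inj_onI)
    fix x y assume xy: "x \<in> points M" "y \<in> points M" "F x = F y"
    obtain g where g: "g \<in> carrier G" "x = q g" using xy(1) coset_modelD(3)[OF M] by blast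
    obtain g' where g': "g' \<in> carrier G" "y = q g'" using xy(2) coset_modelD(3)[OF M] by blast
    have "q' g = q' g'" using xy(3) F g g' by simp
    then show "x = y" using coset_modelD(4)[OF M g(1) g'(1)] coset_modelD(4)[OF N g(1) g'(1)] g g' by simp
  qed
  have "F ` points M = F ` (q ` carrier G)" by (simp add: coset_modelD(3)[OF M])
  also have "\<dots> = q' ` carrier G" using F by force
  finally have im: "F ` points M = points N" by (simp add: coset_modelD(3)[OF N])
  have s1: "smooth_map M N F" by (rule coset_model_smooth_map[OF M coset_modelD(1,2)[OF N] F])
  have "smooth_map N M (inv_into (points M) F)"
  proof (rule coset_model_smooth_map[OF N coset_modelD(1,2)[OF M]])
    fix g assume g: "g \<in> carrier G"
    then have "q g \<in> points M" using coset_modelD(3)[OF M] by blast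
    then show "inv_into (points M) F (q' g) = q g" using inv_into_f_f[OF inj] F[OF g] by metis
  qed
  then have "diffeomorphism M N F" using s1 inj im by (simp add: diffeomorphism_def bij_betw_def)
  then show ?thesis using F by blast
qed

subsection \<open>The action on the coset space\<close>

lemma coset_action_\<pi>:
  "g \<in> carrier G \<Longrightarrow> g' \<in> carrier G \<Longrightarrow> coset_action G HH g (\<pi> g') = \<pi> (g \<otimes> g')"
  using lcos_m_assoc[OF HH_carrier, of g g'] by (auto simp: coset_action_def left_cosets_eq)

lemma transitive_coset_action: "transitive_action G (\<pi> ` carrier G) (coset_action G HH)"
proof -
  let ?E = "\<pi> ` carrier G" and ?\<alpha> = "coset_action G HH"
  have ext: "?\<alpha> g \<in> extensional ?E" for g by (simp add: coset_action_def left_cosets_eq)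
  have inE: "?\<alpha> g x \<in> ?E" if "g \<in> carrier G" "x \<in> ?E" for g x
    using that coset_action_\<pi> by auto
  have comp: "?\<alpha> (g \<otimes> g') x = ?\<alpha> g (?\<alpha> g' x)" if "g \<in> carrier G" "g' \<in> carrier G" "x \<in> ?E" for g g' x
    using that by (auto simp: coset_action_\<pi> m_assoc)
  have one: "?\<alpha> \<one> x = x" if "x \<in> ?E" for x using that by (auto simp: coset_action_\<pi>)
  have Bij: "?\<alpha> g \<in> Bij ?E" if g: "g \<in> carrier G" for g
  proof -
    have "bij_betw (?\<alpha> g) ?E ?E"
    proof (rule bij_betw_byWitness[where f' = "?\<alpha> (inv g)"])
      show "\<forall>a\<in>?E. ?\<alpha> (inv g) (?\<alpha> g a) = a" using comp[of "inv g" g] g one by simp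
      show "\<forall>a'\<in>?E. ?\<alpha> g (?\<alpha> (inv g) a') = a'" using comp[of g "inv g"] g one by simp
    qed (use inE g in blast)+
    then show ?thesis using ext by (simp add: Bij_def)
  qed
  have "?\<alpha> \<in> hom G (BijGroup ?E)"
  proof (rule homI)
    show "?\<alpha> g \<in> carrier (BijGroup ?E)" if "g \<in> carrier G" for g using Bij[OF that] by (simp add: BijGroup_def)
    fix g g' assume g: "g \<in> carrier G" "g' \<in> carrier G"
    have "?\<alpha> (g \<otimes> g') = compose ?E (?\<alpha> g) (?\<alpha> g')"
    proof (rule extensionalityI[OF ext compose_extensional])
      fix x assume "x \<in> ?E" then show "?\<alpha> (g \<otimes> g') x = compose ?E (?\<alpha> g) (?\<alpha> g') x"
        by (simp add: compose_eq comp g)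
    qed
    then show "?\<alpha> (g \<otimes> g') = ?\<alpha> g \<otimes>\<^bsub>BijGroup ?E\<^esub> ?\<alpha> g'" using Bij g by (simp add: BijGroup_def)
  qed
  then have "group_hom G (BijGroup ?E) ?\<alpha>"
    by (intro group_hom.intro group_hom_axioms.intro is_group group_BijGroup)
  then have "group_action G ?E ?\<alpha>" by (rule group_action.intro)
  moreover have "transitive_action_axioms G ?E ?\<alpha>"
  proof
    fix x y assume "x \<in> ?E" "y \<in> ?E"
    then obtain a b where ab: "a \<in> carrier G" "b \<in> carrier G" "x = \<pi> a" "y = \<pi> b" by blast
    then have "?\<alpha> (b \<otimes> inv a) x = y" by (simp add: coset_action_\<pi> m_assoc)
    then show "\<exists>g\<in>carrier G. ?\<alpha> g x = y" using ab by (intro bexI[of _ "b \<otimes> inv a"]) auto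
  qed
  ultimately show ?thesis by (rule transitive_action.intro)
qed

text \<open>With a local section in the second variable, the action becomes multiplication in the
  group followed by the projection.\<close>

lemma homogeneous_quotient:
  assumes card: "CARD('m::finite) = CARD('n) - vec.dim hh"
  shows "homogeneous_manifold G A (quotient_atlas G A HH :: ('g set, 'k, 'm) atlas) (coset_action G HH)"
proof -
  let ?M = "quotient_atlas G A HH :: ('g set, 'k, 'm) atlas"
  have "smooth_map (prod_atlas A ?M) ?M (\<lambda>(g, p). coset_action G HH g p)"
  proof (rule smooth_map_prodI[OF charted_A charted_quotient charted_quotient])
    fix U \<phi> V \<psi> assume U: "(U, \<phi>) \<in> A" and V: "(V, \<psi>) \<in> ?M"
    let ?B = "{z :: 'k ^ ('n + 'm). vfst z \<in> \<phi> ` U \<and> vsnd z \<in> \<psi> ` V}"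
    have oB: "open ?B" by (rule open_vbox[OF chartedD(2)[OF charted_A U] quotient_atlasD(3)[OF V]])
    have "plot scalars ?B ?M (\<lambda>z. coset_action G HH (inv_into U \<phi> (vfst z)) (inv_into V \<psi> (vsnd z)))"
    proof (rule plot_local[OF oB])
      fix z assume z: "z \<in> ?B"
      then have "vsnd z \<in> \<psi> ` V" by simp
      then obtain W \<sigma> where W: "vsnd z \<in> W" "W \<subseteq> \<psi> ` V" "plot scalars W A \<sigma>" "\<forall>x\<in>W. \<pi> (\<sigma> x) = inv_into V \<psi> x"
        by (rule quotient_atlas_section[OF V])
      let ?B' = "{z :: 'k ^ ('n + 'm). vfst z \<in> \<phi> ` U \<and> vsnd z \<in> W}"
      have oB': "open ?B'" by (rule open_vbox[OF chartedD(2)[OF charted_A U] plotD(1)[OF W(3)]])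
      have p1: "plot scalars ?B' A (\<lambda>z. inv_into U \<phi> (vfst z))"
        by (rule plot_chart[OF manifold_A U oB' smo_klin[OF klin_vfst]]) simp
      have p2: "plot scalars ?B' A (\<lambda>z. \<sigma> (vsnd z))"
        by (rule plot_comp[OF manifold_A W(3) oB' smo_klin[OF klin_vsnd]]) simp
      have "plot scalars ?B' ?M (\<lambda>z. coset_action G HH (inv_into U \<phi> (vfst z)) (inv_into V \<psi> (vsnd z)))"
      proof (rule plot_cong[OF _ plot_\<pi>[OF card plot_mult[OF p1 p2]]])
        fix x assume x: "x \<in> ?B'"
        show "\<pi> (inv_into U \<phi> (vfst x) \<otimes> \<sigma> (vsnd x)) = coset_action G HH (inv_into U \<phi> (vfst x)) (inv_into V \<psi> (vsnd x))"
          using coset_action_\<pi>[OF plot_carrier[OF p1 x] plot_carrier[OF p2 x]] W(4) x by simp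
      qed
      moreover have "z \<in> ?B'" using z W(1) by simp
      ultimately show "\<exists>W'. z \<in> W' \<and> plot scalars W' ?M (\<lambda>z. coset_action G HH (inv_into U \<phi> (vfst z)) (inv_into V \<psi> (vsnd z)))"
        by (intro exI[of _ ?B'] conjI)
    qed
    then show "plot scalars ?B ?M (\<lambda>z. case (inv_into U \<phi> (vfst z), inv_into V \<psi> (vsnd z)) of (g, p) \<Rightarrow> coset_action G HH g p)"
      by simp
  qed
  then show ?thesis
    using manifold_quotient[OF card] transitive_coset_action unfolding homogeneous_manifold_def points_quotient[OF card] by blast
qed

end

section \<open>Orbits with stabiliser \<open>HH\<close>\<close>

lemma fd_chart_map:
  assumes p: "plot C W M \<eta>" and w: "w \<in> W" and U: "(U, \<phi>) \<in> M" "\<eta> w \<in> U" and M: "charted M"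
    and F: "plot scalars (\<phi> ` U) N (\<lambda>x. F (inv_into U \<phi> x))" and V: "(V, \<psi>) \<in> N" "F (\<eta> w) \<in> V"
  shows "fd (\<lambda>x. \<psi> (F (\<eta> x))) w v = fd (\<lambda>y. \<psi> (F (inv_into U \<phi> y))) (\<phi> (\<eta> w)) (fd (\<lambda>x. \<phi> (\<eta> x)) w v)"
proof -
  have inj: "inj_on \<phi> U" by (rule chartedD(1)[OF M U(1)])
  have o: "open (W \<inter> \<eta> -` U)" "w \<in> W \<inter> \<eta> -` U" using plotD(3)[OF p U(1)] w U by auto
  have d: "(\<lambda>x. \<phi> (\<eta> x)) differentiable (at w)" by (rule smo_differentiable[OF plotD(4)[OF p U(1)] o(2)])
  have dF: "(\<lambda>y. \<psi> (F (inv_into U \<phi> y))) differentiable (at (\<phi> (\<eta> w)))"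
    by (rule smo_differentiable[OF plotD(4)[OF F V(1)]]) (use U V inj in simp)
  have eq: "\<psi> (F (inv_into U \<phi> (\<phi> (\<eta> x)))) = \<psi> (F (\<eta> x))" if "x \<in> W \<inter> \<eta> -` U" for x using that inj by simp
  show ?thesis using fd_cong(1)[OF o eq fd_comp(2)[OF d dF]] fd_comp(1)[OF d dF, of v] by simp
qed

locale orbit_model = lie_grp_f G A U0 \<phi>0 f hh
  for G :: "'g monoid" (structure) and A :: "('g, 'k::real_or_complex, 'n::finite) atlas" and U0 \<phi>0 f hh +
  fixes M :: "('p, 'k, 'm::finite) atlas" and act :: "'g \<Rightarrow> 'p \<Rightarrow> 'p" and p :: 'p
  assumes homogeneous: "homogeneous_manifold G A M act" and p: "p \<in> points M"
    and stabilizer: "stabilizer G act p = HH" and card_m: "CARD('m) = CARD('n) - vec.dim hh"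
begin

lemma manifold_M: "manifold M" using homogeneous by (simp add: homogeneous_manifold_def)
lemma charted_M: "charted M" by (rule charted_manifold[OF manifold_M])

sublocale transitive_action G "points M" act using homogeneous by (simp add: homogeneous_manifold_def)

lemma plot_act:
  assumes a: "plot C W A a" and b: "plot C W M b"
  shows "plot C W M (\<lambda>w. act (a w) (b w))"
  using plot_smooth_map[OF charted_prod_atlas[OF charted_A charted_M] manifold_M _ plot_pair[OF a b], of "\<lambda>(g, p). act g p"]
    homogeneous by (simp add: homogeneous_manifold_def)

lemma plot_orbit: "plot C W A a \<Longrightarrow> plot C W M (\<lambda>w. act (a w) p)"
  using plot_act[OF _ plot_const[OF manifold_M p plotD(1)]] by blast

lemma act_points: "g \<in> carrier G \<Longrightarrow> x \<in> points M \<Longrightarrow> act g x \<in> points M"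
  using element_image by blast

text \<open>Translation by \<open>g0 \<otimes> ops u t \<otimes> inv g0\<close> carries time 0 to time \<open>t\<close>, so a vanishing
  derivative at 0 makes the curve \<open>act (g0 \<otimes> ops u t) p\<close> constant.\<close>

lemma orbit_differential_ker:
  assumes g0: "g0 \<in> carrier G" and V: "(V, \<psi>) \<in> M" "act g0 p \<in> V"
    and 0: "fd (\<lambda>y. \<psi> (act (g0 \<otimes> \<psi>0 y) p)) e0 u = 0"
  shows "u \<in> hh"
proof -
  note oc = ops_carrier[of u]
  let ?c = "\<lambda>t. act (g0 \<otimes> ops u t) p"
  have pc: "plot {} UNIV M ?c" by (rule plot_orbit[OF plot_lmult[OF g0 plot_ops]])
  have const: "?c t = ?c 0" for t
  proof (rule plot_constant[OF manifold_M pc connected_UNIV _ UNIV_I UNIV_I])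
    fix t :: real
    let ?k = "g0 \<otimes> ops u t \<otimes> inv g0" and ?a = "\<lambda>s. ops u (s - t)"
    let ?b = "\<lambda>s. act (g0 \<otimes> ?a s) p"
    have k: "?k \<in> carrier G" using g0 oc by simp
    have ceq: "?c s = act ?k (?b s)" for s
    proof -
      have "?k \<otimes> (g0 \<otimes> ?a s) = g0 \<otimes> (ops u t \<otimes> (inv g0 \<otimes> (g0 \<otimes> ?a s)))" using g0 oc by (simp add: m_assoc)
      also have "inv g0 \<otimes> (g0 \<otimes> ?a s) = ?a s" using g0 oc by (simp add: m_assoc[symmetric])
      also have "ops u t \<otimes> ?a s = ops u s" using ops_add[of u t "s - t"] by simp
      finally show ?thesis using composition_rule[OF p k m_closed[OF g0 oc], of "s - t"] by simp
    qed
    have pa: "plot {} UNIV A ?a" by (rule plot_comp_real[OF manifold_A plot_ops open_UNIV]) (use ck_on_affine[of _ "- t"] in simp_all)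
    have "ld ?a t 1 = u" using ld_shift[OF plot_ops UNIV_I, of u "- t" t] ld_ops by simp
    then have fa: "fd (\<lambda>s. \<phi>0 (?a s)) t 1 = u" using ld_at_one[OF pa UNIV_I, of t 1] by (simp add: ops_0)
    have pf: "plot scalars T0 M (\<lambda>y. act (g0 \<otimes> \<psi>0 y) p)" by (rule plot_orbit[OF plot_lmult[OF g0 plot_\<psi>0]])
    have fb: "fd (\<lambda>s. \<psi> (?b s)) t 1 = 0"
      using chain_at_one(1)[where f = "\<lambda>g. act (g0 \<otimes> g) p", OF pa UNIV_I _ pf V(1), of t 1] fa 0 V(2) g0 by (simp add: ops_0)
    have bt: "?b t = act g0 p" using g0 by (simp add: ops_0)
    have "act ?k (?b t) \<in> points M" unfolding bt by (rule act_points[OF k act_points[OF g0 p]])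
    then obtain V' \<psi>' where V': "(V', \<psi>') \<in> M" "act ?k (?b t) \<in> V'" by (rule pointsE)
    have pb: "plot {} UNIV M ?b" by (rule plot_orbit[OF plot_lmult[OF g0 pa]])
    have pF: "plot scalars (\<psi> ` V) M (\<lambda>x. act ?k (inv_into V \<psi> x))"
      by (rule plot_act[OF plot_const_carrier[OF k chartedD(2)[OF charted_M V(1)]] plot_inv_chart[OF manifold_M V(1)]])
    have dF: "(\<lambda>y. \<psi>' (act ?k (inv_into V \<psi> y))) differentiable (at (\<psi> (?b t)))"
      by (rule smo_differentiable[OF plotD(4)[OF pF V'(1)]]) (use V'(2) bt V(2) chartedD(1)[OF charted_M V(1)] in simp)
    have btV: "?b t \<in> V" using bt V(2) by simp
    have z: "fd (\<lambda>s. \<psi>' (act ?k (?b s))) t 1 = 0"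
      using fd_chart_map[where F = "\<lambda>x. act ?k x", OF pb UNIV_I V(1) btV charted_M pF V', of 1] fb
        linear_0[OF linear_frechet_derivative[OF dF]] by simp
    show "\<exists>(U, \<phi>)\<in>M. ?c t \<in> U \<and> fd (\<lambda>s. \<phi> (?c s)) t 1 = 0"
    proof -
      have E: "(\<lambda>s. \<psi>' (act ?k (?b s))) = (\<lambda>s. \<psi>' (?c s))" by (rule ext) (rule arg_cong[OF ceq[symmetric]])
      have "?c t \<in> V'" by (rule subst[OF ceq[of t, symmetric], of "\<lambda>x. x \<in> V'"]) (rule V'(2))
      moreover have "fd (\<lambda>s. \<psi>' (?c s)) t 1 = 0" using z unfolding E .
      ultimately show ?thesis using V'(1) by fast
    qed
  qed
  \<comment> \<open>Constancy of the curve puts exp (t u) into the stabiliser of p, which is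
    \<open>HH\<close> and therefore fixes f; then u lies in the radical.\<close>
  have st: "ops u t \<in> stab" for t
  proof -
    have q: "act (ops u t) p \<in> points M" by (rule act_points[OF oc p])
    have "act g0 (act (ops u t) p) = act g0 p"
      using const[of t] composition_rule[OF p g0 oc, of t] g0 by (simp add: ops_0)
    then have "act (ops u t) p = p" using inj_onD[OF inj_prop[OF g0] _ q p] by blast
    then have "ops u t \<in> stabilizer G act p" using oc by (simp add: stabilizer_def)
    then show ?thesis using stabilizer HH_stab by blast
  qed
  show ?thesis using ld_in_hh[OF plot_ops UNIV_I st, of 0 1] by (simp add: ld_ops)
qed

text \<open>The translate by g0 of a slice complementary to \<open>hh\<close> is mapped to M with
  injective differential, by \<open>orbit_differential_ker\<close>. Slice and chart both have m
  coordinates, so the map is locally invertible, and the inverse put back into the slice is the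
  section.\<close>

lemma ex_orbit_section:
  assumes V: "(V, \<psi>) \<in> M" and y: "y \<in> \<psi> ` V"
  shows "\<exists>W \<sigma>. y \<in> W \<and> W \<subseteq> \<psi> ` V \<and> plot scalars W A \<sigma> \<and> (\<forall>x\<in>W. act (\<sigma> x) p = inv_into V \<psi> x)"
proof -
  have inj: "inj_on \<psi> V" by (rule chartedD(1)[OF charted_M V])
  have xV: "inv_into V \<psi> y \<in> V" by (rule inv_into_into[OF y])
  then have "inv_into V \<psi> y \<in> points M" using chartedD(3)[OF charted_M V] by blast
  then obtain g0 where g0: "g0 \<in> carrier G" "act g0 p = inv_into V \<psi> y" using unique_orbit[OF p] by blast
  obtain \<iota> :: "'k ^ 'm \<Rightarrow> 'k ^ 'n" and \<pi>' where \<iota>: "klin \<iota>" and \<pi>\<iota>: "\<And>z. \<pi>' (\<iota> z) = z"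
    and \<pi>h: "\<And>y. y \<in> hh \<Longrightarrow> \<pi>' y = 0"
    using ex_complement[OF subspace_hh card_m] by blast
  obtain S s where s: "plot scalars S A s" "0 \<in> S" "s 0 = \<one>" "\<forall>\<zeta>. fd (\<lambda>z. \<phi>0 (s z)) 0 \<zeta> = \<iota> \<zeta>"
    using ex_slice[OF \<iota>] by (elim exE conjE)
  let ?o = "\<lambda>z. act (g0 \<otimes> s z) p"
  have po: "plot scalars S M ?o" by (rule plot_orbit[OF plot_lmult[OF g0(1) s(1)]])
  define S1 where "S1 = S \<inter> ?o -` V"
  have S1: "open S1" "smo scalars (\<lambda>z. \<psi> (?o z)) S1" unfolding S1_def by (rule plotD(3,4)[OF po V])+
  have o0: "?o 0 = inv_into V \<psi> y" using s(3) g0 by simp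
  have S10: "0 \<in> S1" unfolding S1_def using s(2) o0 xV by simp
  have aV: "act g0 p \<in> V" using g0(2) xV by simp
  have inj0: "\<zeta> = 0" if z: "fd (\<lambda>z. \<psi> (?o z)) 0 \<zeta> = 0" for \<zeta>
  proof -
    have pf: "plot scalars T0 M (\<lambda>y. act (g0 \<otimes> \<psi>0 y) p)" by (rule plot_orbit[OF plot_lmult[OF g0(1) plot_\<psi>0]])
    have aV': "act (g0 \<otimes> \<one>) p \<in> V" using aV g0(1) by simp
    have "fd (\<lambda>y. \<psi> (act (g0 \<otimes> \<psi>0 y) p)) e0 (\<iota> \<zeta>) = 0"
      using chain_at_one(1)[where f = "\<lambda>g. act (g0 \<otimes> g) p", OF s(1,2,3) pf V aV', of \<zeta>] z s(4) by simp
    then have "\<iota> \<zeta> \<in> hh" by (rule orbit_differential_ker[OF g0(1) V aV])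
    then show ?thesis using \<pi>h \<pi>\<iota> by metis
  qed
  obtain U' V' g where U': "open U'" "U' \<subseteq> S1" "0 \<in> U'" "open V'" "\<psi> (?o 0) \<in> V'"
    "\<And>x. x \<in> U' \<Longrightarrow> \<psi> (?o x) \<in> V' \<and> g (\<psi> (?o x)) = x" "\<And>y. y \<in> V' \<Longrightarrow> g y \<in> U' \<and> \<psi> (?o (g y)) = y" "smo scalars g V'"
    by (rule smooth_local_inverse[OF S1 S10 inj0], assumption, rule that)
  have gS: "g x \<in> S" "?o (g x) \<in> V" "\<psi> (?o (g x)) = x" if "x \<in> V'" for x using U'(7)[OF that] U'(2) by (auto simp: S1_def)
  have "plot scalars V' A (\<lambda>x. g0 \<otimes> s (g x))"
    by (rule plot_lmult[OF g0(1) plot_comp[OF manifold_A s(1) U'(4,8) gS(1)]])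
  moreover have "\<psi> (?o 0) = y" using o0 y by (simp add: f_inv_into_f)
  moreover have "V' \<subseteq> \<psi> ` V" using gS(2,3) by (metis image_eqI subsetI)
  moreover have "?o (g x) = inv_into V \<psi> x" if "x \<in> V'" for x using gS(2,3)[OF that] inj inv_into_f_f by metis
  ultimately show ?thesis using U'(5) by (intro exI[of _ V'] exI[of _ "\<lambda>x. g0 \<otimes> s (g x)"]) simp
qed

lemma coset_model_orbit: "coset_model M (\<lambda>g. act g p)"
  unfolding coset_model_def
proof (intro conjI allI impI ballI)
  show "smooth_map A M (\<lambda>g. act g p)"
    by (rule smooth_mapI[OF charted_A charted_M plot_orbit[OF plot_inv_chart[OF manifold_A]]])
  show "(\<lambda>g. act g p) ` carrier G = points M" using unique_orbit[OF p] act_points[OF _ p] by blast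
next
  fix g g' assume g: "g \<in> carrier G" "g' \<in> carrier G"
  have q: "act g' p \<in> points M" by (rule act_points[OF g(2) p])
  have e: "act (inv g \<otimes> g') p = act (inv g) (act g' p)" by (rule composition_rule[OF p inv_closed[OF g(1)] g(2)])
  have i: "act g (act (inv g) (act g' p)) = act g' p"
    using composition_rule[OF q g(1) inv_closed[OF g(1)]] g composition_rule[OF p one_closed g(2)] by simp
  have "act g p = act g' p \<longleftrightarrow> act (inv g) (act g' p) = p"
    using orbit_sym_aux[OF g(1) p] i by metis
  also have "\<dots> \<longleftrightarrow> inv g \<otimes> g' \<in> stabilizer G act p" using g e by (simp add: stabilizer_def)
  finally show "act g p = act g' p \<longleftrightarrow> inv g \<otimes> g' \<in> HH" by (simp add: stabilizer)
qed (rule manifold_M ex_orbit_section; assumption?)+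

end

section \<open>The Maurer-Cartan equation\<close>

context lie_grp
begin

text \<open>\<open>ld \<sigma> x u\<close> is the partial differential in y, on the diagonal, of (x,
  y) \<mapsto> (\<sigma> x)^-1 (\<sigma> y). This accounts for the translation, which itself moves
  with x.\<close>

lemma smo_ld:
  fixes \<sigma> :: "'k ^ 'd::finite \<Rightarrow> 'g"
  assumes \<sigma>: "plot scalars W A \<sigma>"
  shows "smo scalars (\<lambda>x. ld \<sigma> x u) W"
proof -
  have oW: "open W" by (rule plotD(1)[OF \<sigma>])
  have c: "\<sigma> x \<in> carrier G" if "x \<in> W" for x by (rule plot_carrier[OF \<sigma> that])
  let ?B = "{z :: 'k ^ ('d + 'd). vfst z \<in> W \<and> vsnd z \<in> W}"
  let ?N = "\<lambda>z. inv (\<sigma> (vfst z)) \<otimes> \<sigma> (vsnd z)"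
  let ?n = "\<lambda>z. \<phi>0 (?N z)"
  have oB: "open ?B" by (rule open_vbox[OF oW oW])
  have p1: "plot scalars ?B A (\<lambda>z. \<sigma> (vfst z))" by (rule plot_comp[OF manifold_A \<sigma> oB smo_klin[OF klin_vfst]]) simp
  have p2: "plot scalars ?B A (\<lambda>z. \<sigma> (vsnd z))" by (rule plot_comp[OF manifold_A \<sigma> oB smo_klin[OF klin_vsnd]]) simp
  have pN: "plot scalars ?B A ?N" by (rule plot_mult[OF plot_inverse[OF p1] p2])
  let ?D = "?B \<inter> ?N -` U0"
  have oD: "open ?D" and sn: "smo scalars ?n ?D" by (rule plot_chart0[OF pN])+
  have diag: "vpair x x \<in> ?D" if "x \<in> W" for x using that c one_U0 by simp
  have sd: "smo scalars (\<lambda>x. vpair x x) W" by (rule smo_vpair[OF oW smo_klin[OF klin_id] smo_klin[OF klin_id]])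
  have "smo scalars (\<lambda>x. fd ?n (vpair x x) (vpair 0 u)) W"
    by (rule smo_comp[OF oW oD diag sd smo_fd[OF oD sn]])
  moreover have "fd ?n (vpair x x) (vpair 0 u) = ld \<sigma> x u" if x: "x \<in> W" for x
  proof -
    have i: "(\<lambda>y. y) differentiable (at x)" "fd (\<lambda>y. y) x u = u" by simp_all
    note v = fd_vpair[OF differentiable_const i(1), of x]
    have "fd (\<lambda>y. ?n (vpair x y)) x u = fd ?n (vpair x x) (fd (\<lambda>y. vpair x y) x u)"
      by (rule fd_comp(1)[OF v(2) smo_differentiable[OF sn diag[OF x]]])
    then show ?thesis by (simp add: ld_def v(1))
  qed
  ultimately show ?thesis by (rule smo_cong[OF oW, rotated])
qed

lemma ld_comp:
  assumes a: "plot C W A a" and h: "h differentiable (at x)" and x: "h x \<in> W"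
  shows "ld (\<lambda>y. a (h y)) x v = ld a (h x) (fd h x v)"
proof -
  have pa: "plot C W A (\<lambda>y. inv (a (h x)) \<otimes> a y)" using plot_lmult[OF _ a] plot_carrier[OF a x] by simp
  have "(\<lambda>y. \<phi>0 (inv (a (h x)) \<otimes> a y)) differentiable (at (h x))"
    by (rule plot_chart0(3)[OF pa x]) (simp add: plot_carrier[OF a x] one_U0)
  from fd_comp(1)[OF h this] show ?thesis by (simp add: ld_def)
qed

lemma fd_\<phi>0_lfield:
  assumes a: "plot C W A a" and w: "w \<in> W" "a w \<in> U0"
  shows "fd (\<lambda>x. \<phi>0 (a x)) w v = lfield (ld a w v) (\<phi>0 (a w))"
  using fd_chart_ld[where f = "\<lambda>g. g", OF a w(1) plot_lmult[OF _ plot_\<psi>0] chart0 w(2), of v] w(2)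
  by (simp add: lfield_def \<psi>0_\<phi>0)

text \<open>The structure equation, with the sign that belongs to left invariant fields. In the
  chart, the differential of p in direction w is the left invariant field of
  \<open>ld \<sigma> y w\<close> at p y; differentiating once more and using symmetry of the second
  derivative of p leaves the commutator \<open>tb\<close>.\<close>

theorem maurer_cartan:
  fixes \<sigma> :: "'k ^ 'd::finite \<Rightarrow> 'g"
  assumes \<sigma>: "plot scalars W A \<sigma>" and x: "x \<in> W"
  shows "fd (\<lambda>y. ld \<sigma> y v) x u - fd (\<lambda>y. ld \<sigma> y u) x v = - tb (ld \<sigma> x u) (ld \<sigma> x v)"
proof -
  have oW: "open W" by (rule plotD(1)[OF \<sigma>])
  have xc: "\<sigma> x \<in> carrier G" by (rule plot_carrier[OF \<sigma> x])
  let ?a = "\<lambda>y. inv (\<sigma> x) \<otimes> \<sigma> y"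
  have pa: "plot scalars W A ?a" using plot_lmult[OF _ \<sigma>] xc by simp
  have one: "?a x = \<one>" using xc by simp
  have lda: "ld ?a y = ld \<sigma> y" if "y \<in> W" for y
    by (rule ext) (rule ld_lmult[OF \<sigma> that inv_closed[OF xc]])
  define O' where "O' = W \<inter> ?a -` U0"
  have o: "open O'" "x \<in> O'" using plot_chart0(1)[OF pa] x one one_U0 by (auto simp: O'_def)
  define p where "p y = \<phi>0 (?a y)" for y
  have sp: "smo scalars p O'" unfolding p_def[abs_def] O'_def by (rule plot_chart0(2)[OF pa])
  have pT: "p y \<in> T0" if "y \<in> O'" for y using that by (simp add: p_def O'_def)
  have px: "p x = e0" by (simp only: p_def one)
  have dp: "p differentiable (at x)" by (rule smo_differentiable[OF sp o(2)])
  have fpx: "fd p x w = ld \<sigma> x w" for w using ld_at_one[OF pa x one, of w] lda[OF x] by (simp add: p_def[abs_def])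
  let ?v0 = "\<lambda>y. vpair (p y) e0"
  note v1 = fd_vpair[OF dp differentiable_const, of e0]
  have dL: "(\<lambda>y. ld \<sigma> y w) differentiable (at x)" for w by (rule smo_differentiable[OF smo_ld[OF \<sigma>] x])
  note v2 = fd_vpair[OF differentiable_const[of "0 :: 'k ^ 'n"] dL]
  have inM: "vpair e0 e0 \<in> M2" by (rule M2_left[OF e0_T0])
  have E: "fd (\<lambda>y. fd p y w) x z = fd (lfield (ld \<sigma> x w)) e0 (ld \<sigma> x z) + fd (\<lambda>y. ld \<sigma> y w) x z" for w z
  proof -
    let ?X = "ld \<sigma> x w"
    let ?F = "\<lambda>y. fd \<mu> (vpair (p y) e0) (vpair 0 (ld \<sigma> y w))"
    have eq: "fd p y w = ?F y" if y: "y \<in> O'" for y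
    proof -
      have "fd p y w = lfield (ld ?a y w) (p y)"
        unfolding p_def[abs_def] by (rule fd_\<phi>0_lfield[OF pa]) (use y in \<open>auto simp: O'_def\<close>)
      then show ?thesis using lda[of y] y lfield_\<mu>[OF pT[OF y]] by (simp add: O'_def)
    qed
    have "fd (\<lambda>y. fd p y w) x = fd ?F x"
      by (rule fd_cong(1)[OF o eq smo_differentiable[OF smo_fd[OF o(1) sp] o(2)], symmetric])
    then have "fd (\<lambda>y. fd p y w) x z = fd ?F x z" by (rule fun_cong)
    also have "fd ?F x z = fd (\<lambda>m. fd \<mu> m (vpair 0 ?X)) (vpair (p x) e0) (fd ?v0 x z)
        + fd \<mu> (vpair (p x) e0) (fd (\<lambda>y. vpair 0 (ld \<sigma> y w)) x z)"
      by (rule fd_fd_apply[OF open_M2 smo_\<mu> v1(2) v2(2) o M2_left[OF pT]])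
    also have "fd ?v0 x z = vpair (ld \<sigma> x z) 0" by (simp add: v1(1) fpx)
    also have "fd (\<lambda>y. vpair 0 (ld \<sigma> y w)) x z = vpair (0 :: 'k ^ 'n) (fd (\<lambda>y. ld \<sigma> y w) x z)" by (simp add: v2(1))
    also have "fd (\<lambda>m. fd \<mu> m (vpair 0 ?X)) (vpair (p x) e0) (vpair (ld \<sigma> x z) 0)
        = fd (\<lambda>y. fd \<mu> (vpair y e0) (vpair 0 ?X)) e0 (ld \<sigma> x z)"
      using fd_comp(1)[OF fd_vpair_const(2) smo_differentiable[OF smo_fd[OF open_M2 smo_\<mu>] inM], where v = "ld \<sigma> x z"]
        fd_vpair_const(1) by (simp add: px)
    also have "fd (\<lambda>y. fd \<mu> (vpair y e0) (vpair 0 ?X)) e0 = fd (lfield ?X) e0"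
      by (rule fd_cong(1)[OF open_T0 e0_T0 _ smo_differentiable[OF smo_lfield e0_T0]]) (simp add: lfield_\<mu>)
    finally show ?thesis by (simp add: px fd_\<mu>_e0)
  qed
  have "fd (\<lambda>y. fd p y v) x u = fd (\<lambda>y. fd p y u) x v"
    by (rule fd_symmetric[OF o smo_ck[OF sp]])
  then show ?thesis unfolding E tb_def by (simp add: algebra_simps)
qed

end

section \<open>The symplectic form\<close>

lemma linear_scalarI:
  fixes g :: "'k::field ^ 'm \<Rightarrow> 'k"
  assumes "\<And>x y. g (x + y) = g x + g y" "\<And>c x. g (c *s x) = c * g x"
  shows "Vector_Spaces.linear (*s) (*) g"
  by unfold_locales (simp_all add: assms algebra_simps vector_add_ldistrib vector_sadd_rdistrib)

context lie_grp_f
begin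

text \<open>The pullback along \<open>\<sigma>\<close> of the Kirillov-Kostant form of the coadjoint orbit of \<open>f\<close>.\<close>

definition area :: "('d::real_normed_vector \<Rightarrow> 'g) \<Rightarrow> 'd \<Rightarrow> 'd \<Rightarrow> 'd \<Rightarrow> 'k" where
  "area \<sigma> x u v = f (tb (ld \<sigma> x u) (ld \<sigma> x v))"

lemma f_tb_add_hh: "X \<in> hh \<Longrightarrow> Y \<in> hh \<Longrightarrow> f (tb (x + X) (y + Y)) = f (tb x y)"
  using f_tb_eq_0[of X] f_tb_eq_0[of Y] tb_anti[of x Y]
  by (simp add: klin_add[OF klin_tb1] klin_add[OF klin_tb2] f_add f_minus f_diff)

lemma f_tb_stab: "a \<in> stab \<Longrightarrow> f (tb (Ad a x) (Ad a y)) = f (tb x y)"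
  by (simp add: stab_def Ad_tb[symmetric])

text \<open>With \<tau> = \<sigma> \<eta> and \<eta> in \<open>HH\<close>, the logarithmic
  derivative of \<sigma> is transformed by Ad \<eta>^-1, which preserves the form because \<eta>
  fixes f, and a term in the radical \<open>hh\<close> is added to it.\<close>

lemma area_cong:
  assumes \<sigma>: "plot C W A \<sigma>" and \<tau>: "plot C W A \<tau>" and x: "x \<in> W"
    and eq: "\<And>y. y \<in> W \<Longrightarrow> inv (\<sigma> y) \<otimes> \<tau> y \<in> HH"
  shows "area \<tau> x = area \<sigma> x"
proof (intro ext)
  fix u v
  let ?\<eta> = "\<lambda>y. inv (\<sigma> y) \<otimes> \<tau> y"
  have c: "\<sigma> y \<in> carrier G" "\<tau> y \<in> carrier G" if "y \<in> W" for y
    using plot_carrier[OF \<sigma> that] plot_carrier[OF \<tau> that] .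
  have p: "plot C W A ?\<eta>" by (rule plot_mult[OF plot_inverse[OF \<sigma>] \<tau>])
  have st: "?\<eta> y \<in> stab" if "y \<in> W" for y using eq[OF that] HH_stab by blast
  have "inv (?\<eta> x) \<in> stab" using HH_inv[OF eq[OF x]] HH_stab by blast
  note a = f_tb_stab[OF this]
  have ld: "ld \<tau> x w = Ad (inv (?\<eta> x)) (ld \<sigma> x w) + ld ?\<eta> x w" for w
  proof -
    have "ld (\<lambda>y. \<sigma> y \<otimes> ?\<eta> y) x = ld \<tau> x"
      by (rule ld_cong[OF plotD(1)[OF \<sigma>] x _ \<tau>]) (simp add: c m_assoc[symmetric])
    then show ?thesis using ld_mult[OF \<sigma> p x, of w] by simp
  qed
  show "area \<tau> x u v = area \<sigma> x u v"
    unfolding area_def ld by (rule trans[OF f_tb_add_hh[OF ld_in_hh[OF p x st] ld_in_hh[OF p x st]] a])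
qed

lemma area_comp:
  assumes "plot C W A \<sigma>" "h differentiable (at x)" "h x \<in> W"
  shows "area (\<lambda>y. \<sigma> (h y)) x u v = area \<sigma> (h x) (fd h x u) (fd h x v)"
  unfolding area_def ld_comp[OF assms] ..

lemma area_bilinear:
  assumes "plot scalars W A \<sigma>" "x \<in> W"
  shows "Vector_Spaces.linear (*s) (*) (\<lambda>v. area \<sigma> x u v)" "Vector_Spaces.linear (*s) (*) (\<lambda>u. area \<sigma> x u v)"
  unfolding area_def
  by (rule linear_scalarI; simp add: klin_add[OF klin_ld[OF assms]] klin_scale[OF klin_ld[OF assms]]
      klin_add[OF klin_tb1] klin_add[OF klin_tb2] klin_scale[OF klin_tb1] klin_scale[OF klin_tb2] f_add f_scale)+

lemma klin_vec_f: "klin (\<lambda>x. vec (f x) :: 'k ^ 1)"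
  by (rule klinI) (simp_all add: f_add f_scale vec_eq_iff)

lemma smo_area:
  assumes \<sigma>: "plot scalars W A (\<sigma> :: 'k ^ 'd::finite \<Rightarrow> 'g)"
  shows "smo scalars (\<lambda>x. vec (area \<sigma> x u v) :: 'k ^ 1) W"
  unfolding area_def
  by (rule smo_klin_comp[OF klin_vec_f plotD(1)[OF \<sigma>] smo_bilin[OF kbilin_tb plotD(1)[OF \<sigma>] smo_ld[OF \<sigma>] smo_ld[OF \<sigma>]]])

lemma differentiable_area:
  assumes "plot scalars W A (\<sigma> :: 'k ^ 'd::finite \<Rightarrow> 'g)" "x \<in> W"
  shows "(\<lambda>y. area \<sigma> y u v) differentiable (at x)"
  unfolding area_def
  by (rule fd_f(2)[OF smo_differentiable[OF smo_bilin[OF kbilin_tb plotD(1)[OF assms(1)] smo_ld[OF assms(1)] smo_ld[OF assms(1)]] assms(2)]])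

text \<open>By the Maurer-Cartan equation the form is minus the exterior derivative of the scalar
  1-form f \<circ> \<Theta>, hence locally exact. The cyclic sum then consists of second derivatives
  that cancel in pairs.\<close>

lemma area_closed:
  assumes \<sigma>: "plot scalars W A (\<sigma> :: 'k ^ 'd::finite \<Rightarrow> 'g)" and x: "x \<in> W"
  shows "fd (\<lambda>y. area \<sigma> y v w) x u + fd (\<lambda>y. area \<sigma> y w u) x v + fd (\<lambda>y. area \<sigma> y u v) x w = 0"
proof -
  have oW: "open W" by (rule plotD(1)[OF \<sigma>])
  let ?B = "\<lambda>u y. ld \<sigma> y u"
  let ?S = "\<lambda>a b c. fd (\<lambda>y. fd (?B a) y b) x c"
  have dB: "(\<lambda>y. fd (?B a) y b) differentiable (at x)" for a b
    by (rule smo_differentiable[OF smo_fd[OF oW smo_ld[OF \<sigma>]] x])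
  have d: "fd (\<lambda>y. area \<sigma> y a b) x c = f (?S a b c) - f (?S b a c)" for a b c
  proof -
    have eq: "f (fd (?B a) y b - fd (?B b) y a) = area \<sigma> y a b" if y: "y \<in> W" for y
    proof -
      have "fd (?B a) y b - fd (?B b) y a = tb (ld \<sigma> y a) (ld \<sigma> y b)"
        using maurer_cartan[OF \<sigma> y, of a b] tb_anti[of "ld \<sigma> y b" "ld \<sigma> y a"] by simp
      then show ?thesis by (simp add: area_def)
    qed
    have h: "((\<lambda>y. fd (?B a) y b - fd (?B b) y a) has_derivative (\<lambda>c. ?S a b c - ?S b a c)) (at x)"
      by (rule has_derivative_diff[OF has_fd[OF dB] has_fd[OF dB]])
    then have dd: "(\<lambda>y. fd (?B a) y b - fd (?B b) y a) differentiable (at x)" by (auto simp: differentiable_def)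
    have "fd (\<lambda>y. area \<sigma> y a b) x = fd (\<lambda>y. f (fd (?B a) y b - fd (?B b) y a)) x"
      by (rule fd_cong(1)[OF oW x eq fd_f(2)[OF dd]])
    then show ?thesis using fd_f(1)[OF dd, of c] fd_eqI[OF h] by (simp add: f_diff)
  qed
  have s: "?S a b c = ?S a c b" for a b c by (rule fd_symmetric[OF oW x smo_ck[OF smo_ld[OF \<sigma>]]])
  show ?thesis unfolding d s[of v w u] s[of w u v] s[of u v w] by simp
qed

end

section \<open>The symplectic form of a coset model\<close>

locale coset_space = lie_grp_f G A U0 \<phi>0 f hh
  for G :: "'g monoid" (structure) and A :: "('g, 'k::real_or_complex, 'n::finite) atlas" and U0 \<phi>0 f hh +
  fixes M :: "('p, 'k, 'm::finite) atlas" and q :: "'g \<Rightarrow> 'p"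
  assumes model: "coset_model M q" and card_m: "CARD('m) = CARD('n) - vec.dim hh"
begin

lemma manifold_M: "manifold M" by (rule coset_modelD(1)[OF model])
lemma charted_M: "charted M" by (rule charted_manifold[OF manifold_M])

lemma plot_q: "plot C W A a \<Longrightarrow> plot C W M (\<lambda>w. q (a w))"
  by (rule plot_smooth_map[OF charted_A manifold_M coset_modelD(2)[OF model]])

lemma q_mult_HH: "g \<in> carrier G \<Longrightarrow> \<eta> \<in> HH \<Longrightarrow> q (g \<otimes> \<eta>) = q g"
  using coset_modelD(4)[OF model, of g "g \<otimes> \<eta>"] HH_carrier by (auto simp: m_assoc[symmetric] subset_iff)

definition local_section :: "'p set \<Rightarrow> ('p \<Rightarrow> 'k ^ 'm) \<Rightarrow> ('k ^ 'm) set \<Rightarrow> ('k ^ 'm \<Rightarrow> 'g) \<Rightarrow> bool" where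
  "local_section V \<psi> W \<sigma> \<longleftrightarrow> W \<subseteq> \<psi> ` V \<and> plot scalars W A \<sigma> \<and> (\<forall>x\<in>W. q (\<sigma> x) = inv_into V \<psi> x)"

lemma local_sectionD:
  assumes "local_section V \<psi> W \<sigma>"
  shows "W \<subseteq> \<psi> ` V" "plot scalars W A \<sigma>" "x \<in> W \<Longrightarrow> q (\<sigma> x) = inv_into V \<psi> x" "open W"
  using assms plotD(1)[of scalars W A \<sigma>] by (auto simp: local_section_def)

lemma ex_local_section_at:
  assumes "(V, \<psi>) \<in> M" "x \<in> \<psi> ` V"
  obtains W \<sigma> where "x \<in> W" "local_section V \<psi> W \<sigma>"
proof -
  obtain W \<sigma> where "x \<in> W" "W \<subseteq> \<psi> ` V" "plot scalars W A \<sigma>" "\<forall>x\<in>W. q (\<sigma> x) = inv_into V \<psi> x"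
    by (rule coset_model_section[OF model assms])
  then show ?thesis by (intro that[of W \<sigma>]) (auto simp: local_section_def)
qed

lemma area_local_section:
  assumes \<sigma>: "local_section V \<psi> W \<sigma>" and \<tau>: "local_section V \<psi> W' \<tau>" and x: "x \<in> W" "x \<in> W'"
  shows "area \<tau> x = area \<sigma> x"
proof (rule area_cong)
  note s = local_sectionD[OF \<sigma>] and t = local_sectionD[OF \<tau>]
  have o: "open (W \<inter> W')" using s(4) t(4) by (rule open_Int)
  show "plot scalars (W \<inter> W') A \<sigma>" "plot scalars (W \<inter> W') A \<tau>"
    by (rule plot_subset[OF s(2) o], simp, rule plot_subset[OF t(2) o], simp)
  show "x \<in> W \<inter> W'" using x by simp
  fix y assume y: "y \<in> W \<inter> W'"
  then have "q (\<sigma> y) = q (\<tau> y)" using s(3) t(3) by simp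
  then show "inv (\<sigma> y) \<otimes> \<tau> y \<in> HH"
    using coset_modelD(4)[OF model plot_carrier[OF s(2)] plot_carrier[OF t(2)]] y by simp
qed

text \<open>If X = \<open>ld \<sigma> x u\<close> lies in \<open>hh\<close>, then \<sigma> and the
  curve \<sigma> x exp (t X) give q the same derivative; but q is constant on that curve, which
  stays in one coset. In the chart, q after \<sigma> is the identity, so u = 0.\<close>

lemma ld_section_hh:
  assumes V: "(V, \<psi>) \<in> M" and \<sigma>: "local_section V \<psi> W \<sigma>" and x: "x \<in> W" and hh: "ld \<sigma> x u \<in> hh"
  shows "u = 0"
proof -
  note s = local_sectionD[OF \<sigma>]
  have c: "\<sigma> x \<in> carrier G" by (rule plot_carrier[OF s(2) x])
  let ?X = "ld \<sigma> x u"
  have xV: "x \<in> \<psi> ` V" using s(1) x by blast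
  have qV: "q (\<sigma> x) \<in> V" using s(3)[OF x] inv_into_into[OF xV] by simp
  have pg: "plot scalars T0 M (\<lambda>y. q (g \<otimes> \<psi>0 y))" if "g \<in> carrier G" for g
    by (rule plot_q[OF plot_lmult[OF that plot_\<psi>0]])
  have "fd (\<lambda>y. \<psi> (q (\<sigma> y))) x u = fd (\<lambda>y. \<psi> (q (\<sigma> x \<otimes> \<psi>0 y))) e0 ?X"
    by (rule fd_chart_ld[OF s(2) x pg V qV])
  also have "\<dots> = fd (\<lambda>t. \<psi> (q (\<sigma> x \<otimes> ops ?X t))) 0 1"
  proof -
    have "q (\<sigma> x \<otimes> \<one>) \<in> V" using qV c by simp
    from chain_at_one(1)[where f = "\<lambda>g. q (\<sigma> x \<otimes> g)", OF plot_ops UNIV_I ops_0 pg[OF c] V this, of ?X 1]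
    show ?thesis by (simp add: ops(2))
  qed
  also have "(\<lambda>t. \<psi> (q (\<sigma> x \<otimes> ops ?X t))) = (\<lambda>t. \<psi> (q (\<sigma> x)))"
    using q_mult_HH[OF c ops_HH[OF hh]] by simp
  finally have 0: "fd (\<lambda>y. \<psi> (q (\<sigma> y))) x u = 0" by simp
  have "fd (\<lambda>y. \<psi> (q (\<sigma> y))) x = fd (\<lambda>y. y) x"
    by (rule fd_cong(1)[OF s(4) x]) (use s(1,3) in \<open>auto simp: f_inv_into_f subset_iff\<close>)
  then show ?thesis using 0 by simp
qed

text \<open>By dimension, the values of \<open>ld \<sigma> x\<close> together with \<open>hh\<close>
  fill the tangent space. A value orthogonal to all values is thus orthogonal to everything and lies
  in \<open>hh\<close>, which \<open>ld_section_hh\<close> excludes for u other than 0.\<close>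

lemma area_nondegenerate:
  assumes V: "(V, \<psi>) \<in> M" and \<sigma>: "local_section V \<psi> W \<sigma>" and x: "x \<in> W" and 0: "\<And>v. area \<sigma> x u v = 0"
  shows "u = 0"
proof (rule ld_section_hh[OF V \<sigma> x])
  obtain \<iota> :: "'k ^ 'm \<Rightarrow> 'k ^ 'n" and \<pi>' where \<pi>': "klin \<pi>'" "\<And>y. y - \<iota> (\<pi>' y) \<in> hh" "klin \<iota>"
    using ex_complement[OF subspace_hh card_m] by blast
  have kl: "klin (ld \<sigma> x)" by (rule klin_ld[OF local_sectionD(2)[OF \<sigma>] x])
  have k: "klin (\<lambda>v. \<pi>' (ld \<sigma> x v))" by (rule klin_compose[OF \<pi>'(1) kl])
  have hh: "y \<in> hh" if "\<pi>' y = 0" for y using \<pi>'(2)[of y] that by (simp add: klin_0[OF \<pi>'(3)])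
  have "inj (\<lambda>v. \<pi>' (ld \<sigma> x v))"
  proof (rule injI)
    fix a b assume "\<pi>' (ld \<sigma> x a) = \<pi>' (ld \<sigma> x b)"
    then have "\<pi>' (ld \<sigma> x (a - b)) = 0" by (simp add: klin_diff[OF k])
    then have "a - b = 0" using ld_section_hh[OF V \<sigma> x] hh by blast
    then show "a = b" by simp
  qed
  then have surj: "surj (\<lambda>v. \<pi>' (ld \<sigma> x v))" by (rule vec.linear_injective_imp_surjective[OF k[unfolded klin_iff]]) simp
  have "f (tb (ld \<sigma> x u) y) = 0" for y
  proof -
    obtain v where v: "\<pi>' y = \<pi>' (ld \<sigma> x v)" using surjD[OF surj, of "\<pi>' y"] by blast
    then have Y: "y - ld \<sigma> x v \<in> hh" by (intro hh) (simp add: klin_diff[OF \<pi>'(1)])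
    have "f (tb (ld \<sigma> x u + 0) (ld \<sigma> x v + (y - ld \<sigma> x v))) = f (tb (ld \<sigma> x u) (ld \<sigma> x v))"
      by (rule f_tb_add_hh[OF vec.subspace_0[OF subspace_hh] Y])
    then show ?thesis using 0[of v] by (simp add: area_def)
  qed
  then show "ld \<sigma> x u \<in> hh" using f_tb by blast
qed

text \<open>A section is chosen anew at each point. All sections give the same value, so near any
  point the form is the \<open>area\<close> of one fixed section and inherits its smoothness and
  closedness.\<close>

definition \<omega> :: "('p, 'k, 'm) chart \<Rightarrow> 'k ^ 'm \<Rightarrow> 'k ^ 'm \<Rightarrow> 'k ^ 'm \<Rightarrow> 'k" where
  "\<omega> c x = area (SOME \<sigma>. \<exists>W. x \<in> W \<and> local_section (fst c) (snd c) W \<sigma>) x"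

lemma \<omega>_eq:
  assumes \<sigma>: "local_section V \<psi> W \<sigma>" and x: "x \<in> W"
  shows "\<omega> (V, \<psi>) x = area \<sigma> x"
proof -
  let ?\<tau> = "SOME \<sigma>. \<exists>W. x \<in> W \<and> local_section V \<psi> W \<sigma>"
  have "\<exists>\<sigma> W. x \<in> W \<and> local_section V \<psi> W \<sigma>" using \<sigma> x by (intro exI conjI)
  from someI_ex[OF this] obtain W' where W': "x \<in> W'" "local_section V \<psi> W' ?\<tau>" by (elim exE conjE)
  show ?thesis unfolding \<omega>_def fst_conv snd_conv by (rule area_local_section[OF \<sigma> W'(2) x W'(1)])
qed

text \<open>A section over V composed with the change of charts is a section over U, and
  \<open>area\<close> is natural under composition.\<close>

lemma \<omega>_transition:
  assumes U: "(U, \<phi>) \<in> M" and V: "(V, \<psi>) \<in> M" and x: "x \<in> \<phi> ` (U \<inter> V)"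
  defines "\<tau> \<equiv> \<lambda>y. \<psi> (inv_into U \<phi> y)"
  shows "\<omega> (U, \<phi>) x u v = \<omega> (V, \<psi>) (\<tau> x) (fd \<tau> x u) (fd \<tau> x v)"
proof -
  have injU: "inj_on \<phi> U" by (rule chartedD(1)[OF charted_M U])
  have injV: "inj_on \<psi> V" by (rule chartedD(1)[OF charted_M V])
  have o: "open (\<phi> ` (U \<inter> V))" and st: "smo scalars \<tau> (\<phi> ` (U \<inter> V))"
    unfolding \<tau>_def by (rule manifold_transition[OF manifold_M U V])+
  have "\<tau> x \<in> \<psi> ` V" using x injU by (auto simp: \<tau>_def)
  then obtain W \<sigma> where W: "\<tau> x \<in> W" and \<sigma>: "local_section V \<psi> W \<sigma>" by (rule ex_local_section_at[OF V])
  note s = local_sectionD[OF \<sigma>]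
  let ?W = "\<phi> ` (U \<inter> V) \<inter> \<tau> -` W"
  have oW: "open ?W" by (rule continuous_open_preimage[OF smo_continuous[OF st] o s(4)])
  have xW: "x \<in> ?W" using x W by simp
  have "local_section U \<phi> ?W (\<lambda>y. \<sigma> (\<tau> y))"
    unfolding local_section_def
  proof (intro conjI ballI)
    show "?W \<subseteq> \<phi> ` U" by blast
    show "plot scalars ?W A (\<lambda>y. \<sigma> (\<tau> y))" by (rule plot_comp[OF manifold_A s(2) oW smo_subset[OF st]]) auto
    fix y assume y: "y \<in> ?W"
    then obtain a where a: "a \<in> U" "a \<in> V" "y = \<phi> a" by blast
    then show "q (\<sigma> (\<tau> y)) = inv_into U \<phi> y" using s(3)[of "\<tau> y"] y injU injV by (simp add: \<tau>_def)
  qed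
  from \<omega>_eq[OF this xW] area_comp[OF s(2) smo_differentiable[OF st x] W] show ?thesis by (simp add: \<omega>_eq[OF \<sigma> W])
qed

theorem symplectic_M: "symplectic M"
  unfolding symplectic_def symplectic_form_def
proof (intro exI[of _ \<omega>] conjI)
  show "\<forall>(U, \<phi>)\<in>M. \<forall>(V, \<psi>)\<in>M. \<forall>x\<in>\<phi> ` (U \<inter> V). \<forall>u v.
       (let \<tau> = (\<lambda>y. \<psi> (inv_into U \<phi> y)); d\<tau> = fd \<tau> x
        in \<omega> (U, \<phi>) x u v = \<omega> (V, \<psi>) (\<tau> x) (d\<tau> u) (d\<tau> v))"
    unfolding Let_def
  proof (intro ballI, clarify)
    fix U \<phi> V \<psi> and x :: 'p and u v
    assume "(U, \<phi>) \<in> M" "(V, \<psi>) \<in> M" "x \<in> U" "x \<in> V"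
    then show "\<omega> (U, \<phi>) (\<phi> x) u v = \<omega> (V, \<psi>) (\<psi> (inv_into U \<phi> (\<phi> x)))
        (fd (\<lambda>y. \<psi> (inv_into U \<phi> y)) (\<phi> x) u) (fd (\<lambda>y. \<psi> (inv_into U \<phi> y)) (\<phi> x) v)"
      by (intro \<omega>_transition) auto
  qed
next
  have loc: "\<exists>W \<sigma>. x \<in> W \<and> local_section V \<psi> W \<sigma> \<and> (\<forall>y\<in>W. \<omega> (V, \<psi>) y = area \<sigma> y)"
    if V: "(V, \<psi>) \<in> M" "x \<in> \<psi> ` V" for V \<psi> x
  proof -
    obtain W \<sigma> where "x \<in> W" "local_section V \<psi> W \<sigma>" by (rule ex_local_section_at[OF V])
    then show ?thesis using \<omega>_eq by blast
  qed
  show "\<forall>(U, \<phi>)\<in>M.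
       (\<forall>x\<in>\<phi> ` U.
          (\<forall>u. Vector_Spaces.linear (*s) (*) (\<lambda>v. \<omega> (U, \<phi>) x u v)) \<and>
          (\<forall>v. Vector_Spaces.linear (*s) (*) (\<lambda>u. \<omega> (U, \<phi>) x u v)) \<and>
          (\<forall>u. \<omega> (U, \<phi>) x u u = 0) \<and>
          (\<forall>u. (\<forall>v. \<omega> (U, \<phi>) x u v = 0) \<longrightarrow> u = 0) \<and>
          (\<forall>u v w. fd (\<lambda>y. \<omega> (U, \<phi>) y v w) x u + fd (\<lambda>y. \<omega> (U, \<phi>) y w u) x v +
             fd (\<lambda>y. \<omega> (U, \<phi>) y u v) x w = 0)) \<and>
       (\<forall>u v. smooth_on (\<phi> ` U) (\<lambda>x. vec (\<omega> (U, \<phi>) x u v) :: 'k ^ 1))"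
  proof (rule ballI, rule case_prodI2, goal_cases)
    case (1 c V \<psi>)
    then have V: "(V, \<psi>) \<in> M" by simp
    show ?case
    proof (intro conjI ballI allI)
      fix x assume "x \<in> \<psi> ` V"
      then obtain W \<sigma> where x: "x \<in> W" and \<sigma>: "local_section V \<psi> W \<sigma>" and eq: "\<forall>y\<in>W. \<omega> (V, \<psi>) y = area \<sigma> y"
        using loc[OF V] by blast
      note s = local_sectionD[OF \<sigma>]
      have e: "\<omega> (V, \<psi>) x = area \<sigma> x" using eq x by blast
      show "Vector_Spaces.linear (*s) (*) (\<lambda>v. \<omega> (V, \<psi>) x u v)" for u unfolding e by (rule area_bilinear[OF s(2) x])
      show "Vector_Spaces.linear (*s) (*) (\<lambda>u. \<omega> (V, \<psi>) x u v)" for v unfolding e by (rule area_bilinear[OF s(2) x])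
      show "\<omega> (V, \<psi>) x u u = 0" for u unfolding e by (simp add: area_def tb_self)
      show "(\<forall>v. \<omega> (V, \<psi>) x u v = 0) \<longrightarrow> u = 0" for u unfolding e using area_nondegenerate[OF V \<sigma> x] by blast
      fix u v w
      have d: "fd (\<lambda>y. \<omega> (V, \<psi>) y a b) x = fd (\<lambda>y. area \<sigma> y a b) x" for a b
        by (rule fd_cong(1)[OF s(4) x _ differentiable_area[OF s(2) x]]) (simp add: eq)
      show "fd (\<lambda>y. \<omega> (V, \<psi>) y v w) x u + fd (\<lambda>y. \<omega> (V, \<psi>) y w u) x v + fd (\<lambda>y. \<omega> (V, \<psi>) y u v) x w = 0"
        unfolding d by (rule area_closed[OF s(2) x])
    next
      fix u v
      show "smooth_on (\<psi> ` V) (\<lambda>x. vec (\<omega> (V, \<psi>) x u v) :: 'k ^ 1)"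
        unfolding smooth_on_smo
      proof (rule smo_local)
        fix x assume "x \<in> \<psi> ` V"
        then obtain W \<sigma> where x: "x \<in> W" and \<sigma>: "local_section V \<psi> W \<sigma>" and eq: "\<forall>y\<in>W. \<omega> (V, \<psi>) y = area \<sigma> y"
          using loc[OF V] by blast
        note s = local_sectionD[OF \<sigma>]
        have "smo scalars (\<lambda>x. vec (\<omega> (V, \<psi>) x u v) :: 'k ^ 1) W"
          by (rule smo_cong[OF s(4) _ smo_area[OF s(2)]]) (simp add: eq)
        then show "\<exists>T. open T \<and> x \<in> T \<and> smo scalars (\<lambda>x. vec (\<omega> (V, \<psi>) x u v) :: 'k ^ 1) T"
          using s(4) x by blast
      qed
    qed
  qed
qed

end

section \<open>Transport along the isomorphism with the given Lie algebra, and conclusion\<close>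

lemma ex_regular_functional_on_tangent_space:
  fixes br :: "('k::real_or_complex, 'n::finite) bracket"
  assumes br: "lie_algebra br" "semisimple_lie br" "cartan_subalgebra br h"
    and G: "lie_group G A" and iso: "lie_algebra_iso G A br (U0, \<phi>0) \<theta>"
  shows "\<exists>f. lie_grp_f G A U0 \<phi>0 f (\<theta> ` h)"
proof -
  have c: "(U0, \<phi>0) \<in> A" "\<one>\<^bsub>G\<^esub> \<in> U0" and bij: "bij \<theta>" and k: "klin \<theta>"
    and hom: "\<And>x y. \<theta> (br x y) = tangent_bracket G (U0, \<phi>0) (\<theta> x) (\<theta> y)"
    using iso by (auto simp: lie_algebra_iso_def klin_iff)
  interpret lie_grp G A U0 \<phi>0 by unfold_locales (rule G c)+
  interpret L: lie_alg_rc br by unfold_locales (rule br(1))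
  obtain f :: "'k ^ 'n \<Rightarrow> 'k" where f: "\<forall>x y. f (x + y) = f x + f y" "\<forall>c x. f (c *s x) = c * f x"
    "\<forall>x. (\<forall>y. f (br x y) = 0) \<longleftrightarrow> x \<in> h"
    using L.ex_regular_functional[OF br(2,3)] by (elim exE conjE)
  define \<theta>' where "\<theta>' = inv_into UNIV \<theta>"
  have i: "\<theta> (\<theta>' x) = x" "\<theta>' (\<theta> x) = x" for x
    using bij by (simp_all add: \<theta>'_def bij_is_surj surj_f_inv_f bij_is_inj)
  have k': "klin \<theta>'"
  proof (rule klinI)
    show "\<theta>' (x + y) = \<theta>' x + \<theta>' y" for x y using klin_add[OF k, of "\<theta>' x" "\<theta>' y"] i by metis
    show "\<theta>' (a *s x) = a *s \<theta>' x" for a x using klin_scale[OF k, of a "\<theta>' x"] i by metis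
  qed
  have tb: "tb u v = \<theta> (br (\<theta>' u) (\<theta>' v))" for u v
    using hom[of "\<theta>' u" "\<theta>' v"] by (simp add: tangent_bracket_tb i)
  have "lie_grp_f G A U0 \<phi>0 (\<lambda>u. f (\<theta>' u)) (\<theta> ` h)"
  proof unfold_locales
    show "f (\<theta>' (u + v)) = f (\<theta>' u) + f (\<theta>' v)" for u v using f(1) by (simp add: klin_add[OF k'])
    show "f (\<theta>' (a *s u)) = a * f (\<theta>' u)" for a u using f(2) by (simp add: klin_scale[OF k'])
    show "(\<forall>v. f (\<theta>' (tb u v)) = 0) \<longleftrightarrow> u \<in> \<theta> ` h" for u
    proof -
      have "(\<forall>v. f (\<theta>' (tb u v)) = 0) \<longleftrightarrow> (\<forall>y. f (br (\<theta>' u) y) = 0)" unfolding tb i(2) using i(2) by metis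
      also have "\<dots> \<longleftrightarrow> \<theta>' u \<in> h" using f(3) by blast
      also have "\<dots> \<longleftrightarrow> u \<in> \<theta> ` h" using i by (metis image_iff)
      finally show ?thesis .
    qed
    show "kbilin tb"
      unfolding kbilin_def tb
      by (intro conjI allI klin_compose[OF k] klin_compose[OF L.klin_br k'] klin_compose[OF L.klin_br_left k'])
  qed
  then show ?thesis by blast
qed

theorem proposition5:
  fixes br :: "('k::real_or_complex, 'n::finite) bracket"
    and h :: "('k ^ 'n) set"
    and G :: "'g monoid"
    and A :: "('g, 'k, 'n) atlas"
    and c :: "('g, 'k, 'n) chart"
    and \<theta> :: "'k ^ 'n \<Rightarrow> 'k ^ 'n"
  assumes "lie_algebra br"
    and "semisimple_lie br"
    and "cartan_subalgebra br h"
    and "smallest_connected_lie_group br G A"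
    and "lie_algebra_iso G A br c \<theta>"
    and "CARD('m::finite) = CARD('n) - vec.dim h"
  shows
    "let H = connected_lie_subgroup G A c \<theta> h;
         GH = (quotient_atlas G A H :: ('g set, 'k, 'm) atlas)
     in points GH = left_cosets G H \<and>
        homogeneous_manifold G A GH (coset_action G H) \<and>
        symplectic GH \<and>
        (\<forall>(\<Gamma> :: ('p, 'k, 'm) atlas) act p.
           classical_phase_space br h G A c \<theta> \<Gamma> act p \<longrightarrow>
             (\<exists>F. diffeomorphism \<Gamma> GH F \<and>
                  (\<forall>g\<in>carrier G. \<forall>x\<in>points \<Gamma>. F (act g x) = coset_action G H g (F x))) \<and>
             symplectic \<Gamma>)"
proof -
  obtain U0 \<phi>0 where c: "c = (U0, \<phi>0)" by fastforce
  have G: "lie_group G A" using assms(4) by (simp add: smallest_connected_lie_group_def connected_lie_group_of_def)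
  obtain f where "lie_grp_f G A U0 \<phi>0 f (\<theta> ` h)"
    using ex_regular_functional_on_tangent_space[OF assms(1-3) G assms(5)[unfolded c]] by blast
  then interpret lie_grp_f G A U0 \<phi>0 f "\<theta> ` h" .
  have lin: "Vector_Spaces.linear (*s) (*s) \<theta>" and inj: "inj \<theta>"
    using assms(5) by (auto simp: lie_algebra_iso_def bij_is_inj)
  have "vec.dim (\<theta> ` h) = vec.dim h" by (rule vec.dim_image_eq[OF lin inj_on_subset[OF inj subset_UNIV]])
  then have card: "CARD('m) = CARD('n) - vec.dim (\<theta> ` h)" using assms(6) by simp
  \<comment> \<open>Exponentials in the sense of \<open>lie_exp\<close> are the values at time 1 of
    \<open>ops\<close> on the transported vectors, so both subgroups have the same
    generators.\<close>
  have H: "connected_lie_subgroup G A c \<theta> h = HH"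
    by (simp add: connected_lie_subgroup_def HH_def c lie_exp_ops image_image)
  let ?GH = "quotient_atlas G A HH :: ('g set, 'k, 'm) atlas"
  note mq = coset_model_quotient[OF card]
  interpret Q: coset_space G A U0 \<phi>0 f "\<theta> ` h" ?GH \<pi> by unfold_locales (rule mq card)+
  have "(\<exists>F. diffeomorphism \<Gamma> ?GH F \<and> (\<forall>g\<in>carrier G. \<forall>x\<in>points \<Gamma>. F (act g x) = coset_action G HH g (F x))) \<and> symplectic \<Gamma>"
    if \<Gamma>: "classical_phase_space br h G A c \<theta> \<Gamma> act p" for \<Gamma> :: "('p, 'k, 'm) atlas" and act p
  proof -
    interpret O: orbit_model G A U0 \<phi>0 f "\<theta> ` h" \<Gamma> act p
      by unfold_locales (use \<Gamma> card H in \<open>simp_all add: classical_phase_space_def\<close>)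
    note mo = O.coset_model_orbit
    interpret R: coset_space G A U0 \<phi>0 f "\<theta> ` h" \<Gamma> "\<lambda>g. act g p" by unfold_locales (rule mo card)+
    \<comment> \<open>\<open>F\<close> sends the translate of p by g to the coset of g. Equivariance
      follows by writing a point x as the translate of p by some g' and composing the two
      translations.\<close>
    obtain F where F: "diffeomorphism \<Gamma> ?GH F" "\<forall>g\<in>carrier G. F (act g p) = \<pi> g"
      using coset_model_diffeomorphism[OF mo mq] by blast
    have "F (act g x) = coset_action G HH g (F x)" if g: "g \<in> carrier G" and x: "x \<in> points \<Gamma>" for g x
    proof -
      obtain g' where g': "g' \<in> carrier G" "x = act g' p" using coset_modelD(3)[OF mo] x by blast
      have "F (act g x) = F (act (g \<otimes>\<^bsub>G\<^esub> g') p)" using O.composition_rule[OF O.p g g'(1)] g'(2) by simp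
      then show ?thesis using F(2) g g' coset_action_\<pi>[OF g g'(1)] by simp
    qed
    then show ?thesis using F(1) R.symplectic_M by blast
  qed
  then show ?thesis
    unfolding Let_def H left_cosets_eq using points_quotient[OF card] homogeneous_quotient[OF card] Q.symplectic_M by blast
qed

end
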